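(* Let $\Gamma$ be a decay function on $\mathbb{Z}^m$, let $U\subset\ell^\infty(\mathbb{R}^n)$ be an open set with $0\in U$, and let $F\in C^r_\Gamma(U,\ell^\infty(\mathbb{R}^n))$ with $F(0)=0$. Let $A=DF(0)$, $\alpha_\Gamma=\inf\{|\lambda|:\lambda\in\operatorname{Spec}_\Gamma(A)\}$, $\beta_\Gamma=\sup\{|\lambda|:\lambda\in\operatorname{Spec}_\Gamma(A)\}$, $\nu=\frac{\log\alpha_\Gamma}{\log\beta_\Gamma}$ and $r_0=[\nu]+1$, where $[\cdot]$ denotes the integer part. Assume (H1) $0\notin\operatorname{Spec}_\Gamma(A)$ and $\operatorname{Spec}_\Gamma(A)\subset\mathbb{D}(0,1)$, the open unit disc of $\mathbb{C}$; (H2) $\operatorname{Spec}_\Gamma(A)\cap(\operatorname{Spec}_\Gamma(A))^j=\emptyset$ for $2\le j\le r_0$. If $r\ge r_0$, then there exists $R\in C^r_\Gamma(\ell^\infty(\mathbb{R}^n),\ell^\infty(\mathbb{R}^n))$ such that $R(0)=0$, $DR(0)=\operatorname{Id}$ and $$R\circ F=AR$$ in a neighborhood $U_1\subset U$ of $0$.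
   Context: Fix integers $n,m\ge1$ and a norm $\|\cdot\|$ on $\mathbb{R}^n$. $\ell^\infty(\mathbb{R}^n)$ is the Banach space of bounded families $x=(x_i)_{i\in\mathbb{Z}^m}$, $x_i\in\mathbb{R}^n$, with norm $\|x\|_\infty=\sup_i\|x_i\|$; $\ell^\infty(\mathbb{C}^n)$ is defined analogously and is the complexification of $\ell^\infty(\mathbb{R}^n)$. Decay function: $\Gamma:\mathbb{Z}^m\to\mathbb{R}^+=(0,\infty)$ with $\sum_{k}\Gamma(k)\le1$ and $\sum_k\Gamma(i-k)\Gamma(k-j)\le\Gamma(i-j)$ for all $i,j\in\mathbb{Z}^m$. Linear maps with decay: for a bounded linear map $A$ of $\ell^\infty(\mathbb{R}^n)$ (or $\ell^\infty(\mathbb{C}^n)$) let $\|A\|$ be the operator norm, $\gamma(A)=\sup_{i,k\in\mathbb{Z}^m}\sup\{\|(Au)_i\|\,\Gamma(i-k)^{-1}: \|u\|_\infty\le1,\ u_j=0 \text{ for } j\ne k\}$ and $\|A\|_\Gamma=\max\{\|A\|,\gamma(A)\}$; $L_\Gamma$ is the set of $A$ with $\|A\|_\Gamma<\infty$. Multilinear maps with decay: $L^k_\Gamma$ is the space of bounded $k$-linear maps $A:\ell^\infty(\mathbb{R}^n)^k\to\ell^\infty(\mathbb{R}^n)$ with $\|A\|_\Gamma=\max\{\|A\|,\gamma(A)\}<\infty$, where $\gamma(A)=\max_{1\le p\le k}\sup_{i,l\in\mathbb{Z}^m}\sup\|A(v_1,\ldots,v_{p-1},w,v_p,\ldots,v_{k-1})_i\|\,\Gamma(i-l)^{-1}$,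 the inner supremum being over $w$ with $\|w\|_\infty\le1$, $w_j=0$ for $j\neq l$, and $v_q$ with $\|v_q\|_\infty\le1$. For $V\subset\ell^\infty(\mathbb{R}^n)$ open and an integer $r\ge1$, $C^r_\Gamma(V,\ell^\infty(\mathbb{R}^n))$ is the space of maps $F\in C^r(V,\ell^\infty(\mathbb{R}^n))$ (Fréchet sense) with $\sup_{x\in V}\|F(x)\|_\infty<\infty$, $D^jF(x)\in L^j_\Gamma$ for all $x\in V$ and $\sup_{x\in V}\|D^jF(x)\|_\Gamma<\infty$ for $1\le j\le r$; its norm is the maximum of these suprema. $\Gamma$-spectrum: for $A\in L_\Gamma$, extended complex-linearly to $\ell^\infty(\mathbb{C}^n)$, $\operatorname{Spec}_\Gamma(A)$ is the complement in $\mathbb{C}$ of the set of $\lambda$ such that $A-\lambda\operatorname{Id}$ is invertible and $(A-\lambda\operatorname{Id})^{-1}\in L_\Gamma$. For $X\subset\mathbb{C}$, $X^j=\{x_1x_2\cdots x_j: x_1,\ldots,x_j\in X\}$. *)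

theory Defs
  imports "HOL-Analysis.Analysis"
begin

section \<open>Norms and bounded families\<close>

definition is_norm :: "('a::real_vector \<Rightarrow> real) \<Rightarrow> bool" where
  "is_norm N \<longleftrightarrow>
     (\<forall>x. 0 \<le> N x) \<and> (\<forall>x. N x = 0 \<longleftrightarrow> x = 0) \<and>
     (\<forall>x y. N (x + y) \<le> N x + N y) \<and> (\<forall>c x. N (c *\<^sub>R x) = \<bar>c\<bar> * N x)"

definition is_complex_norm :: "(complex ^ 'n \<Rightarrow> real) \<Rightarrow> bool" where
  "is_complex_norm N \<longleftrightarrow> is_norm N \<and> (\<forall>c x. N (c *s x) = cmod c * N x)"

text \<open>
  Families indexed by \<open>int ^ 'm\<close> are bounded continuous functions on that type, whose topology
  is discrete; so they are exactly the bounded families (\<open>bcontfun_eq_bounded\<close>). The topology of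
  this type comes from the standard norm on \<open>real ^ 'n\<close>, whereas the norm of interest is the
  supremum norm built from an arbitrary norm \<open>N\<close>. The two are equivalent
  (\<open>linf_norm_equivalent\<close>), so open sets and Frechet derivatives do not depend on the choice.
\<close>

type_synonym ('m, 'e) linf = "(int ^ 'm) \<Rightarrow>\<^sub>C 'e"

definition linf_norm :: "('e \<Rightarrow> real) \<Rightarrow> ('m::finite, 'e::metric_space) linf \<Rightarrow> real" where
  "linf_norm N x = (SUP i. N (apply_bcontfun x i))"

lemma open_int_vec: "open (S :: (int ^ 'm::finite) set)"
proof -
  have "open {a}" for a :: "int ^ 'm"
  proof -
    have "{a} = {x. \<forall>i. x $ i \<in> {a $ i}}"
      by (auto simp: vec_eq_iff)
    moreover have "open {x :: int ^ 'm. \<forall>i. x $ i \<in> {a $ i}}"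
      by (intro open_vector_box allI open_discrete)
    ultimately show ?thesis by simp
  qed
  then have "open (\<Union>a\<in>S. {a})" by blast
  then show ?thesis by simp
qed

lemma bcontfun_eq_bounded:
  "(bcontfun :: (int ^ 'm::finite \<Rightarrow> 'e::metric_space) set) = {f. bounded (range f)}"
  by (auto simp: bcontfun_def continuous_on_open_vimage open_int_vec)

lemma is_norm_equivalent:
  fixes N :: "'e::euclidean_space \<Rightarrow> real"
  assumes "is_norm N"
  shows "\<exists>c C. 0 < c \<and> 0 < C \<and> (\<forall>v. c * norm v \<le> N v \<and> N v \<le> C * norm v)"
proof -
  have N0: "0 \<le> N x" and Nz: "N x = 0 \<longleftrightarrow> x = 0" and Nt: "N (x + y) \<le> N x + N y"
    and Ns: "N (c *\<^sub>R x) = \<bar>c\<bar> * N x" for x y c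
    using assms by (auto simp: is_norm_def)
  define C where "C = (\<Sum>b\<in>Basis. N b) + 1"
  have C: "C > 0" unfolding C_def by (intro add_nonneg_pos sum_nonneg N0) simp
  have Nsum: "N (\<Sum>b\<in>B. f b) \<le> (\<Sum>b\<in>B. N (f b))" if "finite B" for B :: "'e set" and f :: "'e \<Rightarrow> 'e"
    using that
  proof (induction B)
    case empty
    show ?case using Nz[of 0] by simp
  next
    case (insert b B)
    then show ?case using Nt[of "f b" "\<Sum>b\<in>B. f b"] by simp
  qed
  have upper: "N v \<le> C * norm v" for v
  proof -
    have "N v = N (\<Sum>b\<in>Basis. (v \<bullet> b) *\<^sub>R b)" by (simp add: euclidean_representation)
    also have "\<dots> \<le> (\<Sum>b\<in>Basis. N ((v \<bullet> b) *\<^sub>R b))" by (intro Nsum) simp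
    also have "\<dots> \<le> (\<Sum>b\<in>Basis. norm v * N b)"
      by (intro sum_mono) (simp add: Ns N0 mult_right_mono Basis_le_norm)
    also have "\<dots> \<le> C * norm v"
      by (simp add: C_def sum_distrib_right distrib_right mult.commute[of "norm v"])
    finally show ?thesis .
  qed
  have diff: "\<bar>N x - N y\<bar> \<le> C * norm (x - y)" for x y
  proof -
    have "N x \<le> N y + N (x - y)" using Nt[of y "x - y"] by simp
    moreover have "N y \<le> N x + N (y - x)" using Nt[of x "y - x"] by simp
    ultimately show ?thesis
      using upper[of "x - y"] upper[of "y - x"] by (simp add: norm_minus_commute)
  qed
  have cont: "continuous_on (sphere 0 1) N"
  proof (rule continuous_onI)
    fix x :: 'e and e :: real
    assume "0 < e"
    show "\<exists>d>0. \<forall>x'\<in>sphere 0 1. dist x' x < d \<longrightarrow> dist (N x') (N x) \<le> e"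
    proof (intro exI[of _ "e / C"] conjI ballI impI)
      show "0 < e / C" using \<open>0 < e\<close> C by simp
      fix x' assume "dist x' x < e / C"
      then have "C * norm (x' - x) \<le> e" using C by (simp add: dist_norm field_simps)
      then show "dist (N x') (N x) \<le> e" using diff[of x' x] by (simp add: dist_real_def)
    qed
  qed
  have "(sphere 0 1 :: 'e set) \<noteq> {}"
    using SOME_Basis norm_Basis by fastforce
  then obtain s where s: "s \<in> sphere 0 1" "\<And>x. x \<in> sphere 0 1 \<Longrightarrow> N s \<le> N x"
    using continuous_attains_inf[OF compact_sphere _ cont] by blast
  have c: "N s > 0" using s(1) N0[of s] Nz[of s] by fastforce
  have lower: "N s * norm v \<le> N v" for v
  proof (cases "v = 0")
    case True
    then show ?thesis using Nz[of 0] by simp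
  next
    case False
    have "N s \<le> N (inverse (norm v) *\<^sub>R v)" using False by (intro s(2)) simp
    then show ?thesis using False by (simp add: Ns field_simps)
  qed
  show ?thesis using c C upper lower by blast
qed

lemma linf_norm_equivalent:
  fixes N :: "'e::euclidean_space \<Rightarrow> real"
  assumes "is_norm N"
  shows "\<exists>c C. 0 < c \<and> 0 < C \<and>
    (\<forall>x :: ('m::finite, 'e) linf. c * norm x \<le> linf_norm N x \<and> linf_norm N x \<le> C * norm x)"
proof -
  obtain c C where cC: "0 < c" "0 < C" "\<And>v. c * norm v \<le> N v" "\<And>v. N v \<le> C * norm v"
    using is_norm_equivalent[OF assms] by blast
  have le: "N (apply_bcontfun x i) \<le> C * norm x" for x :: "('m, 'e) linf" and i
    using cC(4)[of "apply_bcontfun x i"] norm_bounded[of x i] cC(2)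
    by (meson mult_left_mono less_imp_le order_trans)
  have upper: "linf_norm N x \<le> C * norm x" for x :: "('m, 'e) linf"
    unfolding linf_norm_def by (intro cSUP_least le) simp
  have lower: "c * norm x \<le> linf_norm N x" for x :: "('m, 'e) linf"
  proof -
    have "bdd_above (range (\<lambda>i. N (apply_bcontfun x i)))" using le by (intro bdd_aboveI2)
    then have "N (apply_bcontfun x i) \<le> linf_norm N x" for i
      unfolding linf_norm_def by (intro cSUP_upper) auto
    then have "c * norm (apply_bcontfun x i) \<le> linf_norm N x" for i
      using cC(3) order_trans by blast
    then have "norm x \<le> linf_norm N x / c"
      using cC(1) by (intro norm_bound) (simp add: field_simps)
    then show ?thesis using cC(1) by (simp add: field_simps)
  qed
  show ?thesis using cC(1,2) upper lower by blast
qed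


section \<open>Decay functions and linear maps with decay\<close>

definition decay_function :: "(int ^ 'm::finite \<Rightarrow> real) \<Rightarrow> bool" where
  "decay_function \<Gamma> \<longleftrightarrow>
     (\<forall>k. 0 < \<Gamma> k) \<and>
     \<Gamma> summable_on UNIV \<and> (\<Sum>\<^sub>\<infinity>k. \<Gamma> k) \<le> 1 \<and>
     (\<forall>i j. (\<lambda>k. \<Gamma> (i - k) * \<Gamma> (k - j)) summable_on UNIV \<and>
            (\<Sum>\<^sub>\<infinity>k. \<Gamma> (i - k) * \<Gamma> (k - j)) \<le> \<Gamma> (i - j))"

text \<open>Norms of operators take values in \<open>ennreal\<close>, so that an infinite supremum is \<open>\<infinity>\<close>.\<close>

definition op_norm ::
  "('e \<Rightarrow> real) \<Rightarrow> (('m::finite, 'e::real_normed_vector) linf \<Rightarrow> ('m, 'e) linf) \<Rightarrow> ennreal" where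
  "op_norm N A = (SUP u\<in>{u. linf_norm N u \<le> 1}. ennreal (linf_norm N (A u)))"

definition decay_coeff ::
  "('e \<Rightarrow> real) \<Rightarrow> (int ^ 'm \<Rightarrow> real) \<Rightarrow>
    (('m::finite, 'e::real_normed_vector) linf \<Rightarrow> ('m, 'e) linf) \<Rightarrow> ennreal" where
  "decay_coeff N \<Gamma> A =
     (SUP i. SUP k. SUP u\<in>{u. linf_norm N u \<le> 1 \<and> (\<forall>j. j \<noteq> k \<longrightarrow> apply_bcontfun u j = 0)}.
        ennreal (N (apply_bcontfun (A u) i) / \<Gamma> (i - k)))"

definition decay_norm ::
  "('e \<Rightarrow> real) \<Rightarrow> (int ^ 'm \<Rightarrow> real) \<Rightarrow>
    (('m::finite, 'e::real_normed_vector) linf \<Rightarrow> ('m, 'e) linf) \<Rightarrow> ennreal" where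
  "decay_norm N \<Gamma> A = max (op_norm N A) (decay_coeff N \<Gamma> A)"


section \<open>Multilinear maps with decay\<close>

text \<open>A \<open>k\<close>-linear map is a function on lists, only its values on lists of length \<open>k\<close> matter.\<close>

definition multilinear_map :: "nat \<Rightarrow> ('a::real_vector list \<Rightarrow> 'b::real_vector) \<Rightarrow> bool" where
  "multilinear_map k A \<longleftrightarrow>
     (\<forall>vs p. length vs = k \<longrightarrow> p < k \<longrightarrow> linear (\<lambda>w. A (vs[p := w])))"

definition mult_norm ::
  "('e \<Rightarrow> real) \<Rightarrow> nat \<Rightarrow>
    (('m::finite, 'e::real_normed_vector) linf list \<Rightarrow> ('m, 'e) linf) \<Rightarrow> ennreal" where
  "mult_norm N k A =
     (SUP vs\<in>{vs. length vs = k \<and> (\<forall>v\<in>set vs. linf_norm N v \<le> 1)}. ennreal (linf_norm N (A vs)))"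

definition mult_decay_coeff ::
  "('e \<Rightarrow> real) \<Rightarrow> (int ^ 'm \<Rightarrow> real) \<Rightarrow> nat \<Rightarrow>
    (('m::finite, 'e::real_normed_vector) linf list \<Rightarrow> ('m, 'e) linf) \<Rightarrow> ennreal" where
  "mult_decay_coeff N \<Gamma> k A =
     (SUP p\<in>{..<k}. SUP i. SUP l.
       SUP (vs, w)\<in>{(vs, w). length vs = k - 1 \<and> (\<forall>v\<in>set vs. linf_norm N v \<le> 1) \<and>
                      linf_norm N w \<le> 1 \<and> (\<forall>j. j \<noteq> l \<longrightarrow> apply_bcontfun w j = 0)}.
        ennreal (N (apply_bcontfun (A (take p vs @ w # drop p vs)) i) / \<Gamma> (i - l)))"

definition mult_decay_norm ::
  "('e \<Rightarrow> real) \<Rightarrow> (int ^ 'm \<Rightarrow> real) \<Rightarrow> nat \<Rightarrow>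
    (('m::finite, 'e::real_normed_vector) linf list \<Rightarrow> ('m, 'e) linf) \<Rightarrow> ennreal" where
  "mult_decay_norm N \<Gamma> k A = max (mult_norm N k A) (mult_decay_coeff N \<Gamma> k A)"

definition bounded_multilinear ::
  "('e \<Rightarrow> real) \<Rightarrow> nat \<Rightarrow>
    (('m::finite, 'e::real_normed_vector) linf list \<Rightarrow> ('m, 'e) linf) set" where
  "bounded_multilinear N k = {A. multilinear_map k A \<and> mult_norm N k A < \<infinity>}"

definition L_decay ::
  "('e \<Rightarrow> real) \<Rightarrow> (int ^ 'm \<Rightarrow> real) \<Rightarrow> nat \<Rightarrow>
    (('m::finite, 'e::real_normed_vector) linf list \<Rightarrow> ('m, 'e) linf) set" where
  "L_decay N \<Gamma> k = {A \<in> bounded_multilinear N k. mult_decay_norm N \<Gamma> k A < \<infinity>}"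


section \<open>Differentiable maps with decay\<close>

text \<open>
  \<open>nth_deriv F [v\<^sub>1, \<dots>, v\<^sub>j] x\<close> is \<open>D\<^sup>jF(x)(v\<^sub>1, \<dots>, v\<^sub>j)\<close>, as an iterated derivative with all but the
  outermost direction frozen. It is meaningful only together with \<open>C_class\<close>, which
  demands that \<open>D\<^sup>jF\<close> be differentiable for the norm of the space of bounded \<open>j\<close>-linear maps,
  with derivative \<open>D\<^bsup>j+1\<^esup>F\<close>.
\<close>

primrec nth_deriv ::
  "('a::real_normed_vector \<Rightarrow> 'b::real_normed_vector) \<Rightarrow> 'a list \<Rightarrow> 'a \<Rightarrow> 'b" where
  "nth_deriv F [] = F"
| "nth_deriv F (h # vs) = (\<lambda>x. frechet_derivative (nth_deriv F vs) (at x) h)"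

abbreviation D_at ::
  "('a::real_normed_vector \<Rightarrow> 'b::real_normed_vector) \<Rightarrow> 'a \<Rightarrow> 'a list \<Rightarrow> 'b" where
  "D_at F x \<equiv> (\<lambda>vs. nth_deriv F vs x)"

definition C_class ::
  "('e \<Rightarrow> real) \<Rightarrow> nat \<Rightarrow> ('m::finite, 'e::real_normed_vector) linf set \<Rightarrow>
    (('m, 'e) linf \<Rightarrow> ('m, 'e) linf) \<Rightarrow> bool" where
  "C_class N r V F \<longleftrightarrow>
     (\<forall>x\<in>V. \<forall>j\<le>r. D_at F x \<in> bounded_multilinear N j) \<and>
     (\<forall>x\<in>V. \<forall>j<r. \<forall>\<epsilon>>0. \<exists>\<delta>>0. \<forall>y\<in>V. linf_norm N (y - x) < \<delta> \<longrightarrow>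
        mult_norm N j (\<lambda>vs. D_at F y vs - D_at F x vs - D_at F x ((y - x) # vs))
          \<le> ennreal (\<epsilon> * linf_norm N (y - x))) \<and>
     (\<forall>x\<in>V. \<forall>\<epsilon>>0. \<exists>\<delta>>0. \<forall>y\<in>V. linf_norm N (y - x) < \<delta> \<longrightarrow>
        mult_norm N r (\<lambda>vs. D_at F y vs - D_at F x vs) \<le> ennreal \<epsilon>)"

text \<open>Maps are total functions; only the values on the open set \<open>V\<close> are relevant.\<close>

definition C_decay ::
  "('e \<Rightarrow> real) \<Rightarrow> (int ^ 'm \<Rightarrow> real) \<Rightarrow> nat \<Rightarrow> ('m::finite, 'e::real_normed_vector) linf set \<Rightarrow>
    (('m, 'e) linf \<Rightarrow> ('m, 'e) linf) set" where
  "C_decay N \<Gamma> r V =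
     {F. C_class N r V F \<and>
         (SUP x\<in>V. ennreal (linf_norm N (F x))) < \<infinity> \<and>
         (\<forall>j\<in>{1..r}. (\<forall>x\<in>V. D_at F x \<in> L_decay N \<Gamma> j) \<and>
                      (SUP x\<in>V. mult_decay_norm N \<Gamma> j (D_at F x)) < \<infinity>)}"


section \<open>Complexification and spectrum\<close>

lemma bcontfun_linear_image:
  fixes f :: "'e::euclidean_space \<Rightarrow> 'f::real_normed_vector" and x :: "'i::topological_space \<Rightarrow> 'e"
  assumes "linear f" "x \<in> bcontfun"
  shows "(\<lambda>i. f (x i)) \<in> bcontfun"
proof -
  have f: "bounded_linear f" using assms(1) by (simp add: linear_conv_bounded_linear)
  have "bounded (f ` range x)"
    using assms(2) by (intro bounded_linear_image f) (simp add: bcontfun_def)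
  moreover have "continuous_on UNIV (\<lambda>i. f (x i))"
    using assms(2) by (intro bounded_linear.continuous_on[OF f]) (simp add: bcontfun_def)
  ultimately show ?thesis by (simp add: bcontfun_def image_image)
qed

setup_lifting type_definition_bcontfun

lift_definition linf_Re :: "('m::finite, complex ^ 'n) linf \<Rightarrow> ('m, real ^ 'n) linf"
  is "\<lambda>z i. \<chi> k. Re (z i $ k)"
  by (rule bcontfun_linear_image) (auto intro!: linearI simp: vec_eq_iff)

lift_definition linf_Im :: "('m::finite, complex ^ 'n) linf \<Rightarrow> ('m, real ^ 'n) linf"
  is "\<lambda>z i. \<chi> k. Im (z i $ k)"
  by (rule bcontfun_linear_image) (auto intro!: linearI simp: vec_eq_iff)

lift_definition linf_scale :: "complex \<Rightarrow> ('m::finite, complex ^ 'n) linf \<Rightarrow> ('m, complex ^ 'n) linf"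
  is "\<lambda>c z i. c *s z i"
  by (rule bcontfun_linear_image) (auto intro!: linearI simp: vec_eq_iff algebra_simps)

lift_definition linf_of_real :: "('m::finite, real ^ 'n) linf \<Rightarrow> ('m, complex ^ 'n) linf"
  is "\<lambda>x i. \<chi> k. complex_of_real (x i $ k)"
  by (rule bcontfun_linear_image[where f = "\<lambda>v. \<chi> k. complex_of_real (v $ k)"])
    (auto intro!: linearI simp: vec_eq_iff complex_eq_iff)

definition complexify ::
  "(('m::finite, real ^ 'n) linf \<Rightarrow> ('m, real ^ 'n) linf) \<Rightarrow>
    ('m, complex ^ 'n) linf \<Rightarrow> ('m, complex ^ 'n) linf" where
  "complexify A z = linf_of_real (A (linf_Re z)) + linf_scale \<i> (linf_of_real (A (linf_Im z)))"

definition L_decay_complex ::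
  "(complex ^ 'n \<Rightarrow> real) \<Rightarrow> (int ^ 'm \<Rightarrow> real) \<Rightarrow>
    (('m::finite, complex ^ 'n) linf \<Rightarrow> ('m, complex ^ 'n) linf) set" where
  "L_decay_complex N \<Gamma> =
     {B. bounded_linear B \<and> (\<forall>c z. B (linf_scale c z) = linf_scale c (B z)) \<and>
         decay_norm N \<Gamma> B < \<infinity>}"

definition decay_spectrum ::
  "(complex ^ 'n \<Rightarrow> real) \<Rightarrow> (int ^ 'm \<Rightarrow> real) \<Rightarrow>
    (('m::finite, real ^ 'n) linf \<Rightarrow> ('m, real ^ 'n) linf) \<Rightarrow> complex set" where
  "decay_spectrum N \<Gamma> A =
     - {\<mu>. \<exists>B\<in>L_decay_complex N \<Gamma>.
            (\<forall>z. B (complexify A z - linf_scale \<mu> z) = z) \<and>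
            (\<forall>z. complexify A (B z) - linf_scale \<mu> (B z) = z)}"

definition set_prods :: "complex set \<Rightarrow> nat \<Rightarrow> complex set" where
  "set_prods X j = {prod_list xs | xs. length xs = j \<and> set xs \<subseteq> X}"

end

theory Submission
  imports Defs "HOL-Library.Multiset" "HOL-Library.Function_Algebras"
begin

text \<open>
  By the spectral bounds there is an equivalent family of norms in which \<open>A\<close> contracts by
  \<open>b < 1\<close> and \<open>A\<^sup>-\<^sup>1\<close> is bounded by \<open>a\<close>, where \<open>a b\<^bsup>r\<^sub>0\<^esup> < 1\<close>. A polynomial \<open>P\<close> with \<open>P(0) = 0\<close> and
  \<open>DP(0) = Id\<close>, whose coefficients of orders \<open>2 \<le> j < r\<^sub>0\<close> solve the homological equations
  \<open>A H - H(A, \<dots>, A) = G\<close>, makes \<open>A\<^sup>-\<^sup>1 P F - P\<close> vanish to order \<open>r\<^sub>0\<close> at \<open>0\<close>. On such maps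
  \<open>t \<mapsto> A\<^sup>-\<^sup>1 t F\<close> is a contraction, since \<open>a b\<^bsup>r\<^sub>0\<^esup> < 1\<close>; its iterates sum to the correction
  \<open>R - P\<close>. The local solution is made global by composition with a componentwise truncation.

  The homological equations are solvable in the space of \<open>j\<close>-linear maps with decay because the
  operators \<open>H \<mapsto> A H\<close> and \<open>H \<mapsto> H(\<dots>, A, \<dots>)\<close> commute: they lie in a commutative algebra that is
  closed under inverses (a bicommutant), and a common zero of the difference in its character
  space would be a resonance. Characters are replaced by proper ideals, enlarged one generator
  at a time, so that no maximal ideal and no completeness of a quotient is needed.
\<close>

section \<open>Partitions of lists\<close>

text \<open>The obstacle is that decay is tested on arguments supported at one site, while the image
  of such an argument spreads over all sites, so the decay norm as stated is awkward to compose. It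
  is replaced by an equivalent condition: boundedness in the supremum norm and, uniformly in
  \<open>l\<close>, in the norm with weights \<open>\<Gamma> (i - l)\<close>. Such bounds compose by
  mere substitution; the convolution inequality is used once, in the comparison of the two
  conditions (\<open>gauge_of_localized\<close>). The norms enter through the abstract locale
  \<open>gauged\<close>, because the norm adapted to \<open>A\<close> has to serve in the same
  results. The order \<open>r\<^sub>0\<close> is the first integer above
  \<open>ln \<alpha> / ln \<beta>\<close>, so that \<open>\<beta>\<close> to this power is below
  \<open>\<alpha>\<close>; the room in this strict inequality provides \<open>a\<close> and
  \<open>b\<close>. The truncation acts on each real component separately, since a cutoff built from
  the supremum norm would not be smooth; its derivatives do not mix sites and therefore respect
  every weight.\<close>

primrec parts :: "'x list \<Rightarrow> 'x list list list" where
  "parts [] = [[]]"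
| "parts (h # ts) = map ((#) [h]) (parts ts) @
     concat (map (\<lambda>\<pi>. map (\<lambda>i. \<pi>[i := h # \<pi> ! i]) [0..<length \<pi>]) (parts ts))"

lemma parts_map: "parts (map f ts) = map (map (map f)) (parts ts)"
proof (induction ts)
  case (Cons h ts)
  have "map (\<lambda>i. (map (map f) \<pi>)[i := f h # map (map f) \<pi> ! i]) [0..<length \<pi>]
      = map (map (map f)) (map (\<lambda>i. \<pi>[i := h # \<pi> ! i]) [0..<length \<pi>])" for \<pi>
    by (auto simp: map_update)
  then show ?case using Cons
    by (simp add: map_concat o_def) (intro arg_cong[where f = concat] map_cong refl; auto simp: map_update)
qed simp

text \<open>Differentiating a Faa di Bruno term once more in direction \<open>h\<close> has these
  two outcomes: the derivative falls on the outer map and creates the block \<open>[h]\<close>, or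
  on one inner factor, whose block then receives \<open>h\<close>. The recursion of
  \<open>parts\<close> is this product rule, so the derivative of the sum over
  \<open>parts vs\<close> is the sum over \<open>parts (h # vs)\<close>.\<close>

lemma parts_ConsE:
  assumes "\<pi> \<in> set (parts (h # ts))"
  obtains \<rho> where "\<rho> \<in> set (parts ts)" "\<pi> = [h] # \<rho>"
  | \<rho> i where "\<rho> \<in> set (parts ts)" "i < length \<rho>" "\<pi> = \<rho>[i := h # \<rho> ! i]"
  using assms by auto

lemma parts_length: "\<pi> \<in> set (parts ts) \<Longrightarrow> length \<pi> \<le> length ts"
  by (induction ts arbitrary: \<pi>) (fastforce elim!: parts_ConsE)+

lemma parts_block_length: "\<pi> \<in> set (parts ts) \<Longrightarrow> b \<in> set \<pi> \<Longrightarrow> 0 < length b \<and> length b \<le> length ts"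
proof (induction ts arbitrary: \<pi> b)
  case (Cons h ts)
  from Cons.prems(1) show ?case
  proof (cases rule: parts_ConsE)
    case (1 \<rho>)
    then show ?thesis using Cons by fastforce
  next
    case (2 \<rho> i)
    then have "b = h # \<rho> ! i \<or> b \<in> set \<rho>" using Cons.prems(2) set_update_subset_insert by fastforce
    then show ?thesis using Cons.IH[OF 2(1)] 2(2) nth_mem by fastforce
  qed
qed simp

lemma prod_list_update:
  fixes xs :: "'a::comm_monoid_mult list"
  assumes "i < length xs"
  shows "prod_list (xs[i := a * xs ! i]) = a * prod_list xs"
  using assms
proof (induction xs arbitrary: i)
  case (Cons x xs)
  then show ?case by (cases i) (auto simp: mult_ac)
qed simp

lemma parts_prod:
  fixes f :: "'x \<Rightarrow> 'a::comm_monoid_mult"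
  assumes "\<pi> \<in> set (parts ts)"
  shows "prod_list (map (\<lambda>b. prod_list (map f b)) \<pi>) = prod_list (map f ts)"
  using assms
proof (induction ts arbitrary: \<pi>)
  case (Cons h ts)
  from Cons.prems show ?case
  proof (cases rule: parts_ConsE)
    case (1 \<rho>)
    then show ?thesis using Cons by simp
  next
    case (2 \<rho> i)
    then show ?thesis using Cons.IH[OF 2(1)]
        prod_list_update[of i "map (\<lambda>b. prod_list (map f b)) \<rho>" "f h"]
      by (simp add: map_update)
  qed
qed simp

text \<open>The partition into singletons is the only term of Faa di Bruno in which the outer map is
  differentiated to full order. All others involve a lower order of it: at the origin they vanish in
  \<open>normal_form\<close>, and in \<open>contraction_step\<close> they are small by the choice of
  weights.\<close>

lemma parts_singletons:
  "\<exists>rest. parts ts = map (\<lambda>x. [x]) ts # rest \<and> (\<forall>\<pi>\<in>set rest. length \<pi> < length ts)"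
proof (induction ts)
  case (Cons h ts)
  then obtain rest where r: "parts ts = map (\<lambda>x. [x]) ts # rest" "\<And>\<pi>. \<pi> \<in> set rest \<Longrightarrow> length \<pi> < length ts"
    by blast
  have "length \<pi> < Suc (length ts)" if "\<pi> \<in> set (map ((#) [h]) rest @
     concat (map (\<lambda>\<pi>. map (\<lambda>i. \<pi>[i := h # \<pi> ! i]) [0..<length \<pi>]) (parts ts)))" for \<pi>
    using that r(2) parts_length[of _ ts] by (fastforce simp: less_Suc_eq_le)
  then show ?case
    by (intro exI[of _ "map ((#) [h]) rest @
     concat (map (\<lambda>\<pi>. map (\<lambda>i. \<pi>[i := h # \<pi> ! i]) [0..<length \<pi>]) (parts ts))"])
       (simp add: r(1))
qed simp

text \<open>Partitions are formed by position, not by value. Passing to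
  \<open>[0..<length ts]\<close> fixes the index set, so that constants and limits can be treated
  for all lists of directions of a given length at once.\<close>

lemma parts_eq_map_nth: "parts ts = map (map (map ((!) ts))) (parts [0..<length ts])"
  by (subst parts_map[symmetric]) (simp add: map_nth)


section \<open>Differentiable families of multilinear maps\<close>

definition mbounded ::
  "nat \<Rightarrow> ('a::real_normed_vector list \<Rightarrow> 'b::real_normed_vector) \<Rightarrow> real \<Rightarrow> bool" where
  "mbounded k B c \<longleftrightarrow> 0 \<le> c \<and> (\<forall>zs. length zs = k \<longrightarrow> norm (B zs) \<le> c * prod_list (map norm zs))"

lemma mboundedD: "mbounded k B c \<Longrightarrow> length zs = k \<Longrightarrow> norm (B zs) \<le> c * prod_list (map norm zs)"
  by (simp add: mbounded_def)

lemma prod_list_norm_nonneg: "0 \<le> prod_list (map norm (zs::'a::real_normed_vector list))"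
  by (induction zs) auto

lemma multilinear_tail:
  fixes B :: "'a::real_vector list \<Rightarrow> 'b::real_vector"
  shows "multilinear_map (Suc k) B \<Longrightarrow> multilinear_map k (\<lambda>zs. B (w # zs))"
  unfolding multilinear_map_def
proof (intro allI impI)
  fix vs :: "'a list" and p assume "\<forall>vs p. length vs = Suc k \<longrightarrow> p < Suc k \<longrightarrow> linear (\<lambda>w. B (vs[p := w]))" "length vs = k" "p < k"
  then show "linear (\<lambda>u. B (w # vs[p := u]))"
    by (elim allE[of _ "w # vs"] allE[of _ "Suc p"]) simp
qed

lemma multilinear_head: "multilinear_map (Suc k) B \<Longrightarrow> length zs = k \<Longrightarrow> linear (\<lambda>w. B (w # zs))"
  unfolding multilinear_map_def by (elim allE[of _ "0 # zs"] allE[of _ 0]) simp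

lemma multilinear_add: "multilinear_map k B \<Longrightarrow> multilinear_map k C \<Longrightarrow> multilinear_map k (\<lambda>zs. B zs + C zs)"
  unfolding multilinear_map_def by (auto intro!: linear_compose_add)

lemma multilinear_scale: "multilinear_map k B \<Longrightarrow> multilinear_map k (\<lambda>zs. c *\<^sub>R B zs)"
  unfolding multilinear_map_def by (auto intro!: linear_compose_scale_right)

lemma multilinear_diff: "multilinear_map k B \<Longrightarrow> multilinear_map k C \<Longrightarrow> multilinear_map k (\<lambda>zs. B zs - C zs)"
  unfolding multilinear_map_def by (auto intro!: linear_compose_sub)

lemma multilinear_zero: "multilinear_map k (\<lambda>zs. 0)"
  unfolding multilinear_map_def by (auto intro!: module_hom_zero linearI)

lemma multilinear_compose_linear: "linear f \<Longrightarrow> multilinear_map k B \<Longrightarrow> multilinear_map k (\<lambda>zs. f (B zs))"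
  unfolding multilinear_map_def using linear_compose[unfolded o_def] by blast

text \<open>Frechet differentiability at \<open>x\<close> of a family of \<open>k\<close>-linear
  maps in the operator norm, with derivative \<open>M'\<close>. It is written as an estimate uniform
  in the arguments, so that no normed space of multilinear maps has to be constructed.\<close>

definition famdiff where
  "famdiff k M M' x \<longleftrightarrow>
    (\<forall>e>0. \<forall>\<^sub>F y in nhds x. \<forall>zs. length zs = k \<longrightarrow>
       norm (M y zs - M x zs - M' (y - x) zs) \<le> e * norm (y - x) * prod_list (map norm zs)) \<and>
    multilinear_map k (M x) \<and> (\<exists>c. mbounded k (M x) c) \<and>
    (\<forall>h. multilinear_map k (M' h)) \<and> (\<forall>zs. length zs = k \<longrightarrow> linear (\<lambda>h. M' h zs)) \<and>
    (\<exists>c\<ge>0. \<forall>h. mbounded k (M' h) (c * norm h))"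

lemma has_derivative_eventually:
  assumes "(f has_derivative f') (at x)" "e > 0"
  shows "\<forall>\<^sub>F y in nhds x. norm (f y - f x - f' (y - x)) \<le> e * norm (y - x)"
  using assms unfolding has_derivative_at_alt eventually_nhds_metric
  by (auto simp: dist_norm)

lemma famdiff_chain:
  fixes M :: "'b::real_normed_vector \<Rightarrow> 'c::real_normed_vector list \<Rightarrow> 'd::real_normed_vector"
    and G :: "'a::real_normed_vector \<Rightarrow> 'b"
  assumes M: "famdiff k M M' (G x)" and G: "(G has_derivative G') (at x)"
  shows "famdiff k (\<lambda>x. M (G x)) (\<lambda>h. M' (G' h)) x"
proof -
  obtain c where c: "c \<ge> 0" "\<And>h. mbounded k (M' h) (c * norm h)" using M unfolding famdiff_def by blast
  obtain B where B: "B > 0" "\<And>h. norm (G' h) \<le> norm h * B"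
    using bounded_linear.pos_bounded[OF has_derivative_bounded_linear[OF G]] by blast
  have lin: "linear (\<lambda>h. M' h zs)" if "length zs = k" for zs
    using M that unfolding famdiff_def by blast
  have "\<forall>\<^sub>F y in nhds x. \<forall>zs. length zs = k \<longrightarrow>
       norm (M (G y) zs - M (G x) zs - M' (G' (y - x)) zs) \<le> e * norm (y - x) * prod_list (map norm zs)"
    if e: "e > 0" for e
  proof -
    \<comment> \<open>Two errors share \<open>e\<close>: the remainder of \<open>M\<close>, taken at
      an increment of size at most \<open>(B + 1) * norm (y - x)\<close>, and \<open>M'\<close>
      applied to the remainder of \<open>G\<close>. The bound \<open>e2 \<le> 1\<close> is what
      yields the factor \<open>B + 1\<close>.\<close>
    define e1 where "e1 = e / (2 * (B + 1))"
    define e2 where "e2 = min 1 (e / (2 * (c + 1)))"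
    have e1: "e1 > 0" and e2: "e2 > 0" "e2 \<le> 1" using e B(1) c(1) by (auto simp: e1_def e2_def)
    have bb: "e1 * (B + 1) = e / 2" using B(1) by (simp add: e1_def field_simps)
    have cc: "c * e2 \<le> e / 2"
    proof -
      have "c * e2 \<le> c * (e / (2 * (c + 1)))" using c(1) by (intro mult_left_mono) (auto simp: e2_def)
      also have "\<dots> \<le> e / 2" using c(1) e by (simp add: field_simps)
      finally show ?thesis .
    qed
    have tend: "filterlim G (nhds (G x)) (nhds x)"
      using has_derivative_continuous[OF G] by (simp add: isCont_def continuous_within tendsto_at_iff_tendsto_nhds)
    have ev1: "\<forall>\<^sub>F y in nhds x. \<forall>zs. length zs = k \<longrightarrow>
       norm (M (G y) zs - M (G x) zs - M' (G y - G x) zs) \<le> e1 * norm (G y - G x) * prod_list (map norm zs)"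
      using M e1 unfolding famdiff_def by (intro eventually_compose_filterlim[OF _ tend]) blast
    show ?thesis using ev1 has_derivative_eventually[OF G e2(1)]
    proof eventually_elim
      case (elim y)
      have Gy: "norm (G y - G x) \<le> (B + 1) * norm (y - x)"
      proof -
        have "norm (G y - G x) \<le> norm (G y - G x - G' (y - x)) + norm (G' (y - x))"
          by (metis diff_add_cancel norm_triangle_ineq)
        also have "\<dots> \<le> 1 * norm (y - x) + norm (y - x) * B"
          using elim(2) e2(2) B(2) by (meson add_mono mult_right_mono norm_ge_zero order_trans)
        finally show ?thesis by (simp add: algebra_simps)
      qed
      show ?case
      proof (intro allI impI)
        fix zs :: "'c list" assume zs: "length zs = k"
        let ?p = "prod_list (map norm zs)"
        have p: "?p \<ge> 0" by (rule prod_list_norm_nonneg)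
        have "M (G y) zs - M (G x) zs - M' (G' (y - x)) zs
            = (M (G y) zs - M (G x) zs - M' (G y - G x) zs) + M' (G y - G x - G' (y - x)) zs"
          using linear_diff[OF lin[OF zs]] by simp
        also have "norm \<dots> \<le> e1 * norm (G y - G x) * ?p + c * norm (G y - G x - G' (y - x)) * ?p"
          using elim(1) zs mboundedD[OF c(2) zs] by (intro norm_triangle_mono) auto
        also have "\<dots> \<le> e1 * ((B + 1) * norm (y - x)) * ?p + c * (e2 * norm (y - x)) * ?p"
          using Gy elim(2) e1 c(1) p by (intro add_mono mult_right_mono mult_left_mono) auto
        also have "\<dots> = (e1 * (B + 1) + c * e2) * norm (y - x) * ?p" by (simp add: algebra_simps)
        also have "\<dots> \<le> e * norm (y - x) * ?p"
          using bb cc p by (intro mult_right_mono) auto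
        finally show "norm (M (G y) zs - M (G x) zs - M' (G' (y - x)) zs) \<le> e * norm (y - x) * ?p" .
      qed
    qed
  qed
  moreover have "multilinear_map k (M (G x))" "\<exists>c. mbounded k (M (G x)) c" "\<And>h. multilinear_map k (M' (G' h))"
    using M unfolding famdiff_def by blast+
  moreover have "linear (\<lambda>h. M' (G' h) zs)" if "length zs = k" for zs
    using linear_compose[OF has_derivative_linear[OF G] lin[OF that]] by (simp add: o_def)
  moreover have "mbounded k (M' (G' h)) ((c * B) * norm h)" for h
  proof -
    have "c * norm (G' h) \<le> c * B * norm h"
      using mult_left_mono[OF B(2) c(1)] by (simp add: mult_ac)
    then show ?thesis using c(1) B(1) order_trans[OF mboundedD[OF c(2)[of "G' h"]]]
      by (simp add: mbounded_def mult_right_mono prod_list_norm_nonneg)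
  qed
  moreover have "c * B \<ge> 0" using c(1) B(1) by simp
  ultimately show ?thesis unfolding famdiff_def by blast
qed

text \<open>Arguments are absorbed one at a time: inserting \<open>w x\<close> in the first slot
  leaves a differentiable family of one order less. A full list of varying arguments then follows by
  induction, with the product rule built up slot by slot.\<close>

lemma famdiff_apply:
  fixes M :: "'a::real_normed_vector \<Rightarrow> 'b::real_normed_vector list \<Rightarrow> 'd::real_normed_vector"
  assumes M: "famdiff (Suc k) M M' x" and w: "(w has_derivative w') (at x)"
  shows "famdiff k (\<lambda>x zs. M x (w x # zs)) (\<lambda>h zs. M' h (w x # zs) + M x (w' h # zs)) x"
proof -
  obtain c where c: "c \<ge> 0" "\<And>h. mbounded (Suc k) (M' h) (c * norm h)" using M unfolding famdiff_def by blast
  obtain d where "mbounded (Suc k) (M x) d" using M unfolding famdiff_def by blast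
  then have d: "d \<ge> 0" "\<And>zs. length zs = Suc k \<Longrightarrow> norm (M x zs) \<le> d * prod_list (map norm zs)"
    by (auto simp: mbounded_def)
  obtain B where B: "B > 0" "\<And>h. norm (w' h) \<le> norm h * B"
    using bounded_linear.pos_bounded[OF has_derivative_bounded_linear[OF w]] by blast
  have ml: "multilinear_map (Suc k) (M x)" "\<And>h. multilinear_map (Suc k) (M' h)"
    and lin: "\<And>zs. length zs = Suc k \<Longrightarrow> linear (\<lambda>h. M' h zs)"
    using M unfolding famdiff_def by blast+
  have "\<forall>\<^sub>F y in nhds x. \<forall>zs. length zs = k \<longrightarrow>
       norm (M y (w y # zs) - M x (w x # zs) - (M' (y - x) (w x # zs) + M x (w' (y - x) # zs)))
          \<le> e * norm (y - x) * prod_list (map norm zs)"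
    if e: "e > 0" for e
  proof -
    \<comment> \<open>Three errors of size \<open>e / 3\<close>: the remainder of \<open>M\<close>
      with first argument \<open>w y\<close>, of norm at most \<open>norm (w x) + 1\<close>; the
      change of \<open>M'\<close> from \<open>w x\<close> to \<open>w y\<close>; and
      \<open>M x\<close> at the remainder of \<open>w\<close>.\<close>
    define e1 where "e1 = e / 3 / (norm (w x) + 1)"
    define e2 where "e2 = e / (3 * (d + 1))"
    define e3 where "e3 = min 1 (e / (3 * (c + 1)))"
    have pos: "e1 > 0" "e2 > 0" "e3 > 0" "e3 \<le> 1"
      using e d(1) c(1) by (auto simp: e1_def e2_def e3_def add_nonneg_pos)
    have bb: "e1 * (norm (w x) + 1) = e / 3"
      unfolding e1_def using add_nonneg_pos[OF norm_ge_zero[of "w x"] zero_less_one]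
      by (metis less_irrefl nonzero_mult_div_cancel_right times_divide_eq_left)
    have cc: "c * e3 \<le> e / 3"
    proof -
      have "c * e3 \<le> c * (e / (3 * (c + 1)))" using c(1) by (intro mult_left_mono) (auto simp: e3_def)
      also have "\<dots> \<le> e / 3" using c(1) e by (simp add: field_simps)
      finally show ?thesis .
    qed
    have dd: "d * e2 \<le> e / 3" using d(1) e by (simp add: e2_def field_simps)
    have ev1: "\<forall>\<^sub>F y in nhds x. \<forall>zs. length zs = Suc k \<longrightarrow>
       norm (M y zs - M x zs - M' (y - x) zs) \<le> e1 * norm (y - x) * prod_list (map norm zs)"
      using M pos(1) unfolding famdiff_def by blast
    have tend: "filterlim w (nhds (w x)) (nhds x)"
      using has_derivative_continuous[OF w] by (simp add: isCont_def continuous_within tendsto_at_iff_tendsto_nhds)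
    have ev2: "\<forall>\<^sub>F y in nhds x. dist (w y) (w x) < e3"
      using tendstoD[OF tend pos(3)] .
    show ?thesis using ev1 ev2 has_derivative_eventually[OF w pos(2)]
    proof eventually_elim
      case (elim y)
      have wy: "norm (w y) \<le> norm (w x) + 1"
        using elim(2) pos(4) norm_triangle_ineq2[of "w y" "w x"] by (simp add: dist_norm)
      show ?case
      proof (intro allI impI)
        fix zs :: "'b list" assume zs: "length zs = k"
        let ?p = "prod_list (map norm zs)"
        have p: "?p \<ge> 0" by (rule prod_list_norm_nonneg)
        have l1: "M' (y - x) ((w y - w x) # zs) = M' (y - x) (w y # zs) - M' (y - x) (w x # zs)"
          using linear_diff[OF multilinear_head[OF ml(2) zs]] by simp
        have l2: "M x ((w y - w x - w' (y - x)) # zs) = M x (w y # zs) - M x (w x # zs) - M x (w' (y - x) # zs)"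
          using linear_diff[OF multilinear_head[OF ml(1) zs]] by simp
        have "M y (w y # zs) - M x (w x # zs) - (M' (y - x) (w x # zs) + M x (w' (y - x) # zs))
          = (M y (w y # zs) - M x (w y # zs) - M' (y - x) (w y # zs)) + M' (y - x) ((w y - w x) # zs)
            + M x ((w y - w x - w' (y - x)) # zs)"
          unfolding l1 l2 by (simp add: algebra_simps)
        also have "norm \<dots> \<le> e1 * norm (y - x) * (norm (w y) * ?p) + c * norm (y - x) * (norm (w y - w x) * ?p)
            + d * (norm (w y - w x - w' (y - x)) * ?p)"
          using elim(1)[rule_format, of "w y # zs"] zs mboundedD[OF c(2), of "(w y - w x) # zs"]
            d(2)[of "(w y - w x - w' (y - x)) # zs"]
          by (intro norm_triangle_mono) auto
        also have "\<dots> \<le> e1 * norm (y - x) * ((norm (w x) + 1) * ?p) + c * norm (y - x) * (e3 * ?p)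
            + d * ((e2 * norm (y - x)) * ?p)"
          using wy elim(2,3) pos c(1) d(1) p by (intro add_mono mult_left_mono mult_right_mono) (auto simp: dist_norm)
        also have "\<dots> = (e1 * (norm (w x) + 1) + c * e3 + d * e2) * norm (y - x) * ?p" by (simp add: algebra_simps)
        also have "\<dots> \<le> e * norm (y - x) * ?p"
          using bb cc dd p by (intro mult_right_mono) auto
        finally show "norm (M y (w y # zs) - M x (w x # zs) - (M' (y - x) (w x # zs) + M x (w' (y - x) # zs)))
          \<le> e * norm (y - x) * ?p" .
      qed
    qed
  qed
  moreover have "multilinear_map k (\<lambda>zs. M x (w x # zs))" using ml(1) by (rule multilinear_tail)
  moreover have "mbounded k (\<lambda>zs. M x (w x # zs)) (d * norm (w x))"
    using d(2)[of "w x # _"] d(1) by (auto simp: mbounded_def mult_ac)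
  moreover have "multilinear_map k (\<lambda>zs. M' h (w x # zs) + M x (w' h # zs))" for h
    using ml by (intro multilinear_add multilinear_tail)
  moreover have "linear (\<lambda>h. M' h (w x # zs) + M x (w' h # zs))" if "length zs = k" for zs
    using lin[of "w x # zs"] that linear_compose[OF has_derivative_linear[OF w] multilinear_head[OF ml(1) that]]
    by (intro linear_compose_add) (auto simp: o_def)
  moreover have "mbounded k (\<lambda>zs. M' h (w x # zs) + M x (w' h # zs)) ((c * norm (w x) + d * B) * norm h)" for h
    unfolding mbounded_def
  proof (intro conjI allI impI)
    show "0 \<le> (c * norm (w x) + d * B) * norm h" using c(1) d(1) B(1) by simp
    fix zs :: "'b list" assume zs: "length zs = k"
    let ?p = "prod_list (map norm zs)"
    have "norm (M' h (w x # zs) + M x (w' h # zs)) \<le> c * norm h * (norm (w x) * ?p) + d * (norm (w' h) * ?p)"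
      using zs mboundedD[OF c(2), of "w x # zs"] d(2)[of "w' h # zs"] by (intro norm_triangle_mono) auto
    also have "\<dots> \<le> c * norm h * (norm (w x) * ?p) + d * ((norm h * B) * ?p)"
      using B(2) d(1) prod_list_norm_nonneg by (intro add_mono mult_left_mono mult_right_mono) auto
    finally show "norm (M' h (w x # zs) + M x (w' h # zs)) \<le> (c * norm (w x) + d * B) * norm h * ?p"
      by (simp add: algebra_simps)
  qed
  moreover have "c * norm (w x) + d * B \<ge> 0" using c(1) d(1) B(1) by simp
  ultimately show ?thesis unfolding famdiff_def by blast
qed

lemma famdiff_0_has_derivative:
  assumes "famdiff 0 M M' x"
  shows "((\<lambda>x. M x []) has_derivative (\<lambda>h. M' h [])) (at x)"
proof -
  obtain c where c: "c \<ge> 0" "\<And>h. mbounded 0 (M' h) (c * norm h)" using assms unfolding famdiff_def by blast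
  have "norm (M' h []) \<le> norm h * c" for h using mboundedD[OF c(2), of "[]" h] by (simp add: mult.commute)
  moreover have "linear (\<lambda>h. M' h [])" using assms unfolding famdiff_def by simp
  ultimately have "bounded_linear (\<lambda>h. M' h [])"
    by (intro bounded_linear_intro[where K = c]) (auto simp: linear_add[of "\<lambda>h. M' h []"] linear_scale[of "\<lambda>h. M' h []"])
  moreover have "\<exists>d>0. \<forall>y. norm (y - x) < d \<longrightarrow> norm (M y [] - M x [] - M' (y - x) []) \<le> e * norm (y - x)" if "e > 0" for e
    using assms that unfolding famdiff_def eventually_nhds_metric by (auto simp: dist_norm)
  ultimately show ?thesis unfolding has_derivative_at_alt by blast
qed

lemma famdiff_apply_list:
  assumes "famdiff (length ws) M M' x"
    and "\<And>w w'. (w, w') \<in> set ws \<Longrightarrow> (w has_derivative w') (at x)"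
  shows "((\<lambda>x. M x (map (\<lambda>(w, w'). w x) ws)) has_derivative
    (\<lambda>h. M' h (map (\<lambda>(w, w'). w x) ws) +
       (\<Sum>i<length ws. M x ((map (\<lambda>(w, w'). w x) ws)[i := snd (ws ! i) h])))) (at x)"
  using assms
proof (induction ws arbitrary: M M')
  case Nil
  then show ?case using famdiff_0_has_derivative[of M M' x] by simp
next
  case (Cons a ws)
  obtain w w' where a: "a = (w, w')" by (cases a)
  have w: "(w has_derivative w') (at x)" using Cons.prems(2) a by simp
  have "famdiff (length ws) (\<lambda>x zs. M x (w x # zs)) (\<lambda>h zs. M' h (w x # zs) + M x (w' h # zs)) x"
    using Cons.prems(1) w by (intro famdiff_apply) auto
  from Cons.IH[OF this] Cons.prems(2) show ?case
    by (simp add: a sum.lessThan_Suc_shift add.assoc del: sum.lessThan_Suc)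
qed


declare nth_deriv.simps(2) [simp del]

section \<open>Estimates for multilinear maps and continuity in their norm\<close>

lemma multilinear_map_scale:
  fixes B :: "'a::real_vector list \<Rightarrow> 'b::real_vector"
  assumes "multilinear_map k B" "length vs = k"
  shows "B (map (\<lambda>v. c v *\<^sub>R v) vs) = prod_list (map c vs) *\<^sub>R B vs"
  using assms
proof (induction vs arbitrary: B k)
  case (Cons v vs)
  have k: "k = Suc (length vs)" using Cons.prems(2) by simp
  have B: "multilinear_map (Suc (length vs)) B" using Cons.prems(1) k by simp
  show ?case
    using linear_scale[OF multilinear_head[OF B refl]] multilinear_head[OF B, of "map (\<lambda>v. c v *\<^sub>R v) vs"]
      Cons.IH[OF multilinear_tail[OF B] refl, of v]
    by (simp add: linear_scale[of "\<lambda>w. B (w # map (\<lambda>v. c v *\<^sub>R v) vs)"])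
qed simp

lemma multilinear_map_zero:
  assumes "multilinear_map k B" "length vs = k" "0 \<in> set vs"
  shows "B vs = 0"
proof -
  obtain p where p: "p < k" "vs ! p = 0" using assms(2,3) by (auto simp: in_set_conv_nth)
  then have "linear (\<lambda>w. B (vs[p := w]))" using assms(1,2) by (simp add: multilinear_map_def)
  from linear_0[OF this] p show ?thesis by (metis list_update_id)
qed

text \<open>Telescoping: the arguments are exchanged one at a time, and the remaining ones
  contribute at most \<open>M\<close> each. Since \<open>1 \<le> M\<close>, the power
  \<open>M ^ k\<close> serves for every summand.\<close>

lemma multilinear_diff_bound:
  fixes B :: "'a::real_normed_vector list \<Rightarrow> 'b::real_normed_vector"
  assumes "multilinear_map k B" "mbounded k B c" "length zs = k" "length zs' = k"
    and "\<And>z. z \<in> set zs \<Longrightarrow> norm z \<le> M" "\<And>z. z \<in> set zs' \<Longrightarrow> norm z \<le> M" "1 \<le> M"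
  shows "norm (B zs - B zs') \<le> c * M ^ k * (\<Sum>i<k. norm (zs ! i - zs' ! i))"
  using assms
proof (induction k arbitrary: B c zs zs')
  case (Suc k)
  obtain z ws where z: "zs = z # ws" "length ws = k" using Suc.prems(3) by (cases zs) auto
  obtain z' ws' where z': "zs' = z' # ws'" "length ws' = k" using Suc.prems(4) by (cases zs') auto
  have c: "c \<ge> 0" using Suc.prems(2) by (simp add: mbounded_def)
  have nz': "norm z' \<le> M" using Suc.prems(6) z' by simp
  have p: "prod_list (map norm ws) \<le> M ^ k"
    using z(2) Suc.prems(5) unfolding z(1)
  proof (induction ws arbitrary: k)
    case (Cons w ws)
    then show ?case using prod_list_norm_nonneg[of ws] Suc.prems(7)
      by (cases k) (auto intro!: mult_mono)
  qed simp
  have mb: "mbounded k (\<lambda>zs. B (z' # zs)) (c * norm z')"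
    using Suc.prems(2) mboundedD[OF Suc.prems(2), of "z' # _"] by (auto simp: mbounded_def mult_ac)
  have IH: "norm (B (z' # ws) - B (z' # ws')) \<le> (c * norm z') * M ^ k * (\<Sum>i<k. norm (ws ! i - ws' ! i))"
    using Suc.prems(5,6) z z' by (intro Suc.IH[OF multilinear_tail[OF Suc.prems(1)] mb _ _ _ _ Suc.prems(7)]) auto
  have lin: "B ((z - z') # ws) = B (z # ws) - B (z' # ws)"
    using linear_diff[OF multilinear_head[OF Suc.prems(1) z(2)]] by simp
  have S: "0 \<le> (\<Sum>i<k. norm (ws ! i - ws' ! i))" by (intro sum_nonneg) simp
  have "B zs - B zs' = B ((z - z') # ws) + (B (z' # ws) - B (z' # ws'))"
    by (simp add: z z' lin)
  also have "norm \<dots> \<le> c * (norm (z - z') * M ^ k) + (c * M) * M ^ k * (\<Sum>i<k. norm (ws ! i - ws' ! i))"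
  proof (rule norm_triangle_mono)
    show "norm (B ((z - z') # ws)) \<le> c * (norm (z - z') * M ^ k)"
      using mboundedD[OF Suc.prems(2), of "(z - z') # ws"] z(2) p c
      by (simp add: order_trans[OF _ mult_left_mono] mult_left_mono)
    show "norm (B (z' # ws) - B (z' # ws')) \<le> (c * M) * M ^ k * (\<Sum>i<k. norm (ws ! i - ws' ! i))"
      by (rule order_trans[OF IH]) (use c nz' S Suc.prems(7) in \<open>auto intro!: mult_right_mono mult_left_mono\<close>)
  qed
  also have "\<dots> \<le> c * M ^ Suc k * norm (z - z') + c * M ^ Suc k * (\<Sum>i<k. norm (ws ! i - ws' ! i))"
  proof (rule add_mono)
    have "c * (norm (z - z') * M ^ k) * 1 \<le> c * (norm (z - z') * M ^ k) * M"
      using c Suc.prems(7) by (intro mult_left_mono) auto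
    then show "c * (norm (z - z') * M ^ k) \<le> c * M ^ Suc k * norm (z - z')" by (simp add: mult_ac)
  qed (simp add: mult_ac)
  also have "\<dots> = c * M ^ Suc k * (\<Sum>i<Suc k. norm (zs ! i - zs' ! i))"
    by (simp add: z z' sum.lessThan_Suc_shift distrib_left del: sum.lessThan_Suc)
  finally show ?case .
qed simp

text \<open>Continuity of \<open>\<Phi>\<close> at \<open>x\<close> in the norm of \<open>j\<close>-linear maps, tested on sequences.\<close>

definition eqc :: "nat \<Rightarrow> ('a::real_normed_vector \<Rightarrow> 'b::real_normed_vector list \<Rightarrow> 'c::real_normed_vector) \<Rightarrow> 'a \<Rightarrow> bool" where
  "eqc j \<Phi> x \<longleftrightarrow> (\<forall>Y VS c. Y \<longlonglongrightarrow> x \<and> (\<forall>n::nat. length (VS n) = j \<and> (\<forall>v\<in>set (VS n). norm v \<le> c)) \<longrightarrow>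
     (\<lambda>n. \<Phi> (Y n) (VS n) - \<Phi> x (VS n)) \<longlonglongrightarrow> 0)"

lemma eqcD:
  assumes "eqc j \<Phi> x" "Y \<longlonglongrightarrow> x" "\<And>n. length (VS n) = j" "\<And>n v. v \<in> set (VS n) \<Longrightarrow> norm v \<le> c"
  shows "(\<lambda>n. \<Phi> (Y n) (VS n) - \<Phi> x (VS n)) \<longlonglongrightarrow> 0"
  using assms unfolding eqc_def by blast

lemma eqcI_eventually:
  assumes "\<And>e. e > 0 \<Longrightarrow> \<forall>\<^sub>F y in nhds x. \<forall>vs. length vs = j \<longrightarrow>
    norm (\<Phi> y vs - \<Phi> x vs) \<le> e * prod_list (map norm vs)"
  shows "eqc j \<Phi> x"
  unfolding eqc_def
proof (intro allI impI, elim conjE)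
  fix Y :: "nat \<Rightarrow> 'a" and VS :: "nat \<Rightarrow> 'b list" and c
  assume Y: "Y \<longlonglongrightarrow> x" and VS: "\<forall>n. length (VS n) = j \<and> (\<forall>v\<in>set (VS n). norm v \<le> c)"
  define C where "C = max c 1"
  have C: "C \<ge> 1" by (simp add: C_def)
  have pl: "prod_list (map norm vs) \<le> C ^ length vs" if "\<forall>v\<in>set vs. norm v \<le> c" for vs :: "'b list"
    using that
  proof (induction vs)
    case (Cons v vs)
    then show ?case using C by (auto intro!: mult_mono prod_list_norm_nonneg simp: C_def)
  qed simp
  show "(\<lambda>n. \<Phi> (Y n) (VS n) - \<Phi> x (VS n)) \<longlonglongrightarrow> 0"
  proof (rule tendstoI)
    fix e :: real assume e: "e > 0"
    have "\<forall>\<^sub>F n in sequentially. \<forall>vs. length vs = j \<longrightarrow>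
       norm (\<Phi> (Y n) vs - \<Phi> x vs) \<le> e / (2 * C ^ j) * prod_list (map norm vs)"
      using e C by (intro eventually_compose_filterlim[OF assms Y]) auto
    then show "\<forall>\<^sub>F n in sequentially. dist (\<Phi> (Y n) (VS n) - \<Phi> x (VS n)) 0 < e"
    proof eventually_elim
      case (elim n)
      have "norm (\<Phi> (Y n) (VS n) - \<Phi> x (VS n)) \<le> e / (2 * C ^ j) * prod_list (map norm (VS n))"
        using elim VS by blast
      also have "\<dots> \<le> e / (2 * C ^ j) * C ^ j"
        using VS pl[of "VS n"] e C by (intro mult_left_mono) auto
      also have "\<dots> < e" using e C by (simp add: field_simps)
      finally show ?case by simp
    qed
  qed
qed

text \<open>If the estimate failed near \<open>x\<close>, there would be points \<open>Y n\<close>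
  tending to \<open>x\<close> and tuples violating it. By homogeneity the tuples can be scaled to
  unit vectors, and on bounded tuples \<open>eqc\<close> forces the difference to 0, below
  \<open>e\<close>.\<close>

lemma eqc_eventually:
  assumes eq: "eqc j \<Phi> x" and ml: "\<forall>\<^sub>F y in nhds x. multilinear_map j (\<Phi> y)" and e: "e > 0"
  shows "\<forall>\<^sub>F y in nhds x. \<forall>vs. length vs = j \<longrightarrow> norm (\<Phi> y vs - \<Phi> x vs) \<le> e * prod_list (map norm vs)"
proof (rule ccontr)
  assume "\<not> ?thesis"
  then have "\<exists>\<^sub>F y in nhds x. multilinear_map j (\<Phi> y) \<and> (\<exists>vs. length vs = j \<and> norm (\<Phi> y vs - \<Phi> x vs) > e * prod_list (map norm vs))"
    unfolding frequently_def
  proof (rule contrapos_nn)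
    assume "\<forall>\<^sub>F y in nhds x. \<not> (multilinear_map j (\<Phi> y) \<and> (\<exists>vs. length vs = j \<and> norm (\<Phi> y vs - \<Phi> x vs) > e * prod_list (map norm vs)))"
    with ml show "\<forall>\<^sub>F y in nhds x. \<forall>vs. length vs = j \<longrightarrow> norm (\<Phi> y vs - \<Phi> x vs) \<le> e * prod_list (map norm vs)"
      by eventually_elim (auto simp: not_less)
  qed
  then have "\<exists>y vs. dist y x < 1 / real (Suc n) \<and> multilinear_map j (\<Phi> y) \<and> length vs = j \<and>
      norm (\<Phi> y vs - \<Phi> x vs) > e * prod_list (map norm vs)" for n
    unfolding frequently_def eventually_nhds_metric
    by (metis of_nat_0_less_iff zero_less_Suc zero_less_divide_1_iff)
  then obtain Y VS where Y: "\<And>n. dist (Y n) x < 1 / real (Suc n)" "\<And>n. multilinear_map j (\<Phi> (Y n))"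
    and VS: "\<And>n. length (VS n) = j" "\<And>n. norm (\<Phi> (Y n) (VS n) - \<Phi> x (VS n)) > e * prod_list (map norm (VS n))"
    by metis
  have Yx: "Y \<longlonglongrightarrow> x"
  proof (rule metric_LIMSEQ_I)
    fix r :: real assume "r > 0"
    then obtain N where N: "1 / real (Suc N) < r" using nat_approx_posE by auto
    have "dist (Y n) x < r" if "n \<ge> N" for n
    proof -
      have "dist (Y n) x < 1 / real (Suc n)" by (rule Y(1))
      also have "\<dots> \<le> 1 / real (Suc N)" using that by (intro divide_left_mono) auto
      also have "\<dots> < r" by fact
      finally show ?thesis .
    qed
    then show "\<exists>no. \<forall>n\<ge>no. dist (Y n) x < r" by blast
  qed
  have mlx: "multilinear_map j (\<Phi> x)" using eventually_nhds_x_imp_x[OF ml] .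
  \<comment> \<open>A tuple containing 0 gives the value 0 at both points and cannot violate the
    estimate, so the entries can be normalised.\<close>
  have nz: "v \<noteq> 0" if "v \<in> set (VS n)" for n v
    using VS(2)[of n] multilinear_map_zero[OF Y(2) VS(1), of n n] multilinear_map_zero[OF mlx VS(1), of n] that
      mult_nonneg_nonneg[OF less_imp_le[OF e] prod_list_norm_nonneg[of "VS n"]] by fastforce
  define WS where "WS n = map (\<lambda>v. inverse (norm v) *\<^sub>R v) (VS n)" for n
  have lim: "(\<lambda>n. \<Phi> (Y n) (WS n) - \<Phi> x (WS n)) \<longlonglongrightarrow> 0"
    by (rule eqcD[OF eq Yx, where c = 1]) (auto simp: WS_def VS(1) nz)
  have ge: "norm (\<Phi> (Y n) (WS n) - \<Phi> x (WS n)) \<ge> e" for n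
  proof -
    have pi: "prod_list (map (\<lambda>v. inverse (norm v)) vs) = inverse (prod_list (map norm vs))" for vs :: "'b list"
      by (induction vs) auto
    have "(\<forall>v\<in>set vs. v \<noteq> 0) \<Longrightarrow> prod_list (map norm vs) > 0" for vs :: "'b list"
      by (induction vs) auto
    then have pos: "prod_list (map norm (VS n)) > 0" using nz by blast
    let ?p = "prod_list (map norm (VS n))"
    have "norm (\<Phi> (Y n) (WS n) - \<Phi> x (WS n)) = inverse ?p * norm (\<Phi> (Y n) (VS n) - \<Phi> x (VS n))"
      unfolding WS_def multilinear_map_scale[OF Y(2) VS(1)] multilinear_map_scale[OF mlx VS(1)] pi
        scaleR_diff_right[symmetric] norm_scaleR using pos by simp
    moreover have "inverse ?p * norm (\<Phi> (Y n) (VS n) - \<Phi> x (VS n)) \<ge> inverse ?p * (e * ?p)"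
      using VS(2)[of n] pos by (intro mult_left_mono) auto
    moreover have "inverse ?p * (e * ?p) = e" using pos by simp
    ultimately show ?thesis by linarith
  qed
  obtain N where "norm (\<Phi> (Y N) (WS N) - \<Phi> x (WS N) - 0) < e" using LIMSEQ_D[OF lim e] by blast
  with ge[of N] show False by simp
qed

text \<open>The two sequences of lists need not converge; only their entrywise differences tend to
  0. This is the situation in the Faa di Bruno formula, where the inner derivatives act on arbitrary
  bounded directions.\<close>

lemma eqc_apply:
  fixes \<Phi> :: "'a::real_normed_vector \<Rightarrow> 'b::real_normed_vector list \<Rightarrow> 'c::real_normed_vector"
  assumes eq: "eqc k \<Phi> y" and ml: "multilinear_map k (\<Phi> y)" and mb: "mbounded k (\<Phi> y) c" and Y: "Y \<longlonglongrightarrow> y"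
    and len: "\<And>n. length (ZS n) = k" "\<And>n. length (ZS' n) = k"
    and bd: "\<And>n z. z \<in> set (ZS n) \<Longrightarrow> norm z \<le> M" "\<And>n z. z \<in> set (ZS' n) \<Longrightarrow> norm z \<le> M"
    and lim: "\<And>i. i < k \<Longrightarrow> (\<lambda>n. ZS n ! i - ZS' n ! i) \<longlonglongrightarrow> 0"
  shows "(\<lambda>n. \<Phi> (Y n) (ZS n) - \<Phi> y (ZS' n)) \<longlonglongrightarrow> 0"
proof -
  have 1: "(\<lambda>n. \<Phi> (Y n) (ZS n) - \<Phi> y (ZS n)) \<longlonglongrightarrow> 0"
    by (rule eqcD[OF eq Y len(1) bd(1)])
  have 2: "(\<lambda>n. \<Phi> y (ZS n) - \<Phi> y (ZS' n)) \<longlonglongrightarrow> 0"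
  proof (rule tendsto_norm_zero_cancel, rule tendsto_sandwich[OF _ _ tendsto_const])
    have "norm (\<Phi> y (ZS n) - \<Phi> y (ZS' n)) \<le> c * (max M 1) ^ k * (\<Sum>i<k. norm (ZS n ! i - ZS' n ! i))" for n
      using bd by (intro multilinear_diff_bound[OF ml mb len]) fastforce+
    then show "\<forall>\<^sub>F n in sequentially. norm (\<Phi> y (ZS n) - \<Phi> y (ZS' n)) \<le> c * (max M 1) ^ k * (\<Sum>i<k. norm (ZS n ! i - ZS' n ! i))"
      by simp
    have "(\<lambda>n. c * (max M 1) ^ k * (\<Sum>i<k. norm (ZS n ! i - ZS' n ! i))) \<longlonglongrightarrow> c * (max M 1) ^ k * (\<Sum>i<k. 0)"
      by (intro tendsto_mult_left tendsto_sum tendsto_norm_zero lim) simp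
    then show "(\<lambda>n. c * (max M 1) ^ k * (\<Sum>i<k. norm (ZS n ! i - ZS' n ! i))) \<longlonglongrightarrow> 0" by simp
  qed simp
  from tendsto_add[OF 1 2] show ?thesis by simp
qed


section \<open>Maps of class $C^r$\<close>

text \<open>Differentiability is asked only with the directions frozen. Differentiability in the
  norm of multilinear maps is then a consequence of the continuity of the next derivative
  (\<open>smooth_famdiff\<close>), so closure properties reduce to pointwise derivatives, bounds and
  limits of sequences.\<close>

definition smooth :: "nat \<Rightarrow> 'a::real_normed_vector set \<Rightarrow> ('a \<Rightarrow> 'b::real_normed_vector) \<Rightarrow> bool" where
  "smooth r V F \<longleftrightarrow> open V \<and>
     (\<forall>x\<in>V. \<forall>vs. length vs < r \<longrightarrow> nth_deriv F vs differentiable (at x)) \<and>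
     (\<forall>x\<in>V. \<forall>j\<le>r. \<exists>c. mbounded j (D_at F x) c) \<and>
     (\<forall>x\<in>V. \<forall>j\<le>r. eqc j (D_at F) x)"

lemma smooth_open: "smooth r V F \<Longrightarrow> open V"
  by (simp add: smooth_def)

lemma smooth_deriv:
  assumes "smooth r V F" "x \<in> V" "length vs < r"
  shows "(nth_deriv F vs has_derivative (\<lambda>h. nth_deriv F (h # vs) x)) (at x)"
  using assms unfolding smooth_def by (simp add: frechet_derivative_works nth_deriv.simps(2))

lemma smooth_deriv0:
  assumes "smooth r V F" "x \<in> V" "1 \<le> r"
  shows "(F has_derivative (\<lambda>h. nth_deriv F [h] x)) (at x)"
  using smooth_deriv[OF assms(1,2), of "[]"] assms(3) by simp

lemma smooth_bounded: "smooth r V F \<Longrightarrow> x \<in> V \<Longrightarrow> j \<le> r \<Longrightarrow> \<exists>c. mbounded j (D_at F x) c"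
  by (simp add: smooth_def)

lemma smooth_eqc: "smooth r V F \<Longrightarrow> x \<in> V \<Longrightarrow> j \<le> r \<Longrightarrow> eqc j (D_at F) x"
  by (simp add: smooth_def)

lemma smooth_subset: "smooth r V F \<Longrightarrow> open V' \<Longrightarrow> V' \<subseteq> V \<Longrightarrow> smooth r V' F"
  unfolding smooth_def by blast

lemma smooth_isCont:
  assumes "smooth r V F" "x \<in> V"
  shows "isCont F x"
proof -
  have "(\<lambda>n. F (Y n) - F x) \<longlonglongrightarrow> 0" if "Y \<longlonglongrightarrow> x" for Y
    using eqcD[OF smooth_eqc[OF assms, of 0] that, of "\<lambda>_. []" 0] by simp
  then show ?thesis by (simp add: isCont_def tendsto_at_iff_sequentially LIM_zero_iff o_def)
qed

text \<open>The first slot is linear because a derivative is. In the other slots, linearity of the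
  lower derivative is an identity of functions on the open set \<open>V\<close>; differentiating it
  and using uniqueness of derivatives carries it over.\<close>

lemma nth_deriv_differentiable_multilinear:
  fixes F :: "'a::real_normed_vector \<Rightarrow> 'b::real_normed_vector"
  assumes V: "open V" and d: "\<And>x vs. x \<in> V \<Longrightarrow> length vs < r \<Longrightarrow> nth_deriv F vs differentiable (at x)"
  shows "x \<in> V \<Longrightarrow> j \<le> r \<Longrightarrow> multilinear_map j (D_at F x)"
proof (induction j arbitrary: x)
  case 0
  then show ?case by (simp add: multilinear_map_def)
next
  case (Suc j)
  have der: "(nth_deriv F vs has_derivative (\<lambda>h. nth_deriv F (h # vs) x)) (at x)" if "length vs = j" for vs
    using d[OF Suc.prems(1), of vs] that Suc.prems(2) by (simp add: frechet_derivative_works nth_deriv.simps(2))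
  show ?case
    unfolding multilinear_map_def
  proof (intro allI impI)
    fix ws :: "'a list" and p assume ws: "length ws = Suc j" "p < Suc j"
    obtain h vs where h: "ws = h # vs" "length vs = j" using ws(1) by (cases ws) auto
    show "linear (\<lambda>w. nth_deriv F (ws[p := w]) x)"
    proof (cases p)
      case 0
      then show ?thesis using has_derivative_linear[OF der[OF h(2)]] h(1) by simp
    next
      case (Suc q)
      then have q: "q < j" using ws(2) by simp
      have lin: "linear (\<lambda>w. nth_deriv F (vs[q := w]) y)" if "y \<in> V" for y
        using Suc.IH[OF that] Suc.prems(2) h(2) q by (simp add: multilinear_map_def)
      have der': "(nth_deriv F (vs[q := w]) has_derivative (\<lambda>h. nth_deriv F (h # vs[q := w]) x)) (at x)" for w
        by (rule der) (simp add: h(2))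
      have "nth_deriv F (h # vs[q := w + w']) x = nth_deriv F (h # vs[q := w]) x + nth_deriv F (h # vs[q := w']) x" for w w'
      proof -
        have "(nth_deriv F (vs[q := w + w']) has_derivative
            (\<lambda>h. nth_deriv F (h # vs[q := w]) x + nth_deriv F (h # vs[q := w']) x)) (at x)"
          by (rule has_derivative_transform_within_open[OF has_derivative_add[OF der' der'] V Suc.prems(1)])
            (simp add: linear_add[OF lin])
        from fun_cong[OF has_derivative_unique[OF this der'], of h] show ?thesis by (rule sym)
      qed
      moreover have "nth_deriv F (h # vs[q := c *\<^sub>R w]) x = c *\<^sub>R nth_deriv F (h # vs[q := w]) x" for w c
      proof -
        have "(nth_deriv F (vs[q := c *\<^sub>R w]) has_derivative (\<lambda>h. c *\<^sub>R nth_deriv F (h # vs[q := w]) x)) (at x)"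
          by (rule has_derivative_transform_within_open[OF has_derivative_scaleR_right[OF der'] V Suc.prems(1)])
            (simp add: linear_scale[OF lin])
        from fun_cong[OF has_derivative_unique[OF this der'], of h] show ?thesis by (rule sym)
      qed
      ultimately show ?thesis using Suc h(1) by (auto intro!: linearI)
    qed
  qed
qed

lemma smooth_multilinear:
  "smooth r V F \<Longrightarrow> x \<in> V \<Longrightarrow> j \<le> r \<Longrightarrow> multilinear_map j (D_at F x)"
  by (rule nth_deriv_differentiable_multilinear[of V r]) (auto simp: smooth_def)

lemma smooth_eventually:
  assumes "smooth r V F" "x \<in> V" "j \<le> r" "e > 0"
  shows "\<forall>\<^sub>F y in nhds x. \<forall>vs. length vs = j \<longrightarrow>
    norm (nth_deriv F vs y - nth_deriv F vs x) \<le> e * prod_list (map norm vs)"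
proof -
  have "\<forall>\<^sub>F y in nhds x. y \<in> V" using assms(1,2) by (auto simp: smooth_def intro: eventually_nhds_in_open)
  then have "\<forall>\<^sub>F y in nhds x. multilinear_map j (D_at F y)"
    by eventually_elim (rule smooth_multilinear[OF assms(1) _ assms(3)])
  from eqc_eventually[OF smooth_eqc[OF assms(1-3)] this assms(4)] show ?thesis .
qed

text \<open>The mean value inequality is applied to the map sending \<open>y\<close> to
  \<open>nth_deriv F zs y - nth_deriv F (y # zs) x\<close>. Its derivative is the increment of the
  derivative of order \<open>j + 1\<close>, which is small near \<open>x\<close> uniformly in
  \<open>zs\<close>.\<close>

lemma smooth_famdiff:
  fixes F :: "'a::real_normed_vector \<Rightarrow> 'b::real_normed_vector"
  assumes F: "smooth r V F" and x: "x \<in> V" and j: "j < r"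
  shows "famdiff j (D_at F) (\<lambda>h vs. nth_deriv F (h # vs) x) x"
proof -
  have V: "open V" using F by (rule smooth_open)
  have mlS: "multilinear_map (Suc j) (D_at F x)" using smooth_multilinear[OF F x] j by simp
  obtain c where c: "mbounded (Suc j) (D_at F x) c" using smooth_bounded[OF F x, of "Suc j"] j by auto
  have "\<forall>\<^sub>F y in nhds x. \<forall>zs. length zs = j \<longrightarrow>
       norm (nth_deriv F zs y - nth_deriv F zs x - nth_deriv F ((y - x) # zs) x) \<le> e * norm (y - x) * prod_list (map norm zs)"
    if e: "e > 0" for e
  proof -
    have "\<forall>\<^sub>F y in nhds x. y \<in> V \<and> (\<forall>vs. length vs = Suc j \<longrightarrow>
        norm (nth_deriv F vs y - nth_deriv F vs x) \<le> e * prod_list (map norm vs))"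
      using smooth_eventually[OF F x, of "Suc j" e] j e V x by (auto intro: eventually_conj eventually_nhds_in_open)
    then obtain d where d: "d > 0" "\<And>y. dist y x < d \<Longrightarrow> y \<in> V"
      "\<And>y vs. dist y x < d \<Longrightarrow> length vs = Suc j \<Longrightarrow> norm (nth_deriv F vs y - nth_deriv F vs x) \<le> e * prod_list (map norm vs)"
      unfolding eventually_nhds_metric by blast
    have "norm (nth_deriv F zs y - nth_deriv F zs x - nth_deriv F ((y - x) # zs) x) \<le> e * norm (y - x) * prod_list (map norm zs)"
      if y: "dist y x < d" and zs: "length zs = j" for y zs
    proof -
      let ?p = "prod_list (map norm zs)"
      have lin: "linear (\<lambda>h. nth_deriv F (h # zs) x)" using multilinear_head[OF mlS zs] .
      have bl: "bounded_linear (\<lambda>h. nth_deriv F (h # zs) x)"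
        using has_derivative_bounded_linear[OF smooth_deriv[OF F x]] zs j by simp
      have "norm ((nth_deriv F zs y - nth_deriv F (y # zs) x) - (nth_deriv F zs x - nth_deriv F (x # zs) x))
          \<le> (e * ?p) * norm (y - x)"
      proof (rule differentiable_bound[of "ball x d" "\<lambda>y. nth_deriv F zs y - nth_deriv F (y # zs) x"
            "\<lambda>y h. nth_deriv F (h # zs) y - nth_deriv F (h # zs) x"])
        fix z assume z: "z \<in> ball x d"
        then have zV: "z \<in> V" using d(2) by (simp add: dist_commute)
        show "((\<lambda>y. nth_deriv F zs y - nth_deriv F (y # zs) x) has_derivative
           (\<lambda>h. nth_deriv F (h # zs) z - nth_deriv F (h # zs) x)) (at z within ball x d)"
          by (intro has_derivative_diff[OF has_derivative_at_withinI[OF smooth_deriv[OF F zV]]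
              bounded_linear_imp_has_derivative[OF bl]]) (simp only: zs j)
        show "onorm (\<lambda>h. nth_deriv F (h # zs) z - nth_deriv F (h # zs) x) \<le> e * ?p"
        proof (rule onorm_bound)
          show "norm (nth_deriv F (h # zs) z - nth_deriv F (h # zs) x) \<le> e * ?p * norm h" for h
            using d(3)[of z "h # zs"] z zs by (simp add: dist_commute mult_ac)
        qed (use e in \<open>simp add: prod_list_norm_nonneg\<close>)
      qed (use d(1) y in \<open>auto simp: dist_commute\<close>)
      moreover have "(nth_deriv F zs y - nth_deriv F (y # zs) x) - (nth_deriv F zs x - nth_deriv F (x # zs) x)
          = nth_deriv F zs y - nth_deriv F zs x - nth_deriv F ((y - x) # zs) x"
        by (simp add: linear_diff[OF lin, of y x])
      ultimately show ?thesis by (simp add: mult_ac)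
    qed
    then show ?thesis unfolding eventually_nhds_metric using d(1) by blast
  qed
  moreover have "multilinear_map j (D_at F x)" using smooth_multilinear[OF F x] j by simp
  moreover have "\<exists>c. mbounded j (D_at F x) c" using smooth_bounded[OF F x] j by simp
  moreover have "multilinear_map j (\<lambda>vs. nth_deriv F (h # vs) x)" for h by (rule multilinear_tail[OF mlS])
  moreover have "linear (\<lambda>h. nth_deriv F (h # zs) x)" if "length zs = j" for zs
    by (rule multilinear_head[OF mlS that])
  moreover have "mbounded j (\<lambda>vs. nth_deriv F (h # vs) x) (c * norm h)" for h
    using c mboundedD[OF c, of "h # _"] unfolding mbounded_def by (auto simp: mult_ac)
  moreover have "c \<ge> 0" using c by (simp add: mbounded_def)
  ultimately show ?thesis unfolding famdiff_def by blast
qed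

text \<open>\<open>D\<close> is a candidate for all derivatives at once. If each \<open>D vs\<close>
  has derivative \<open>D (h # vs)\<close>, the candidate is correct, and boundedness and continuity
  need to be checked only on it. The first part alone delivers the explicit derivatives.\<close>

lemma smoothI:
  fixes F :: "'a::real_normed_vector \<Rightarrow> 'b::real_normed_vector" and D :: "'a list \<Rightarrow> 'a \<Rightarrow> 'b"
  assumes V: "open V" and D0: "\<And>x. x \<in> V \<Longrightarrow> D [] x = F x"
    and D1: "\<And>x vs. x \<in> V \<Longrightarrow> length vs < r \<Longrightarrow> (D vs has_derivative (\<lambda>h. D (h # vs) x)) (at x)"
  shows smoothI_deriv: "\<And>x vs. x \<in> V \<Longrightarrow> length vs \<le> r \<Longrightarrow> nth_deriv F vs x = D vs x"
    and "(\<And>x j. x \<in> V \<Longrightarrow> j \<le> r \<Longrightarrow> \<exists>c. mbounded j (\<lambda>vs. D vs x) c) \<Longrightarrow>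
         (\<And>x j. x \<in> V \<Longrightarrow> j \<le> r \<Longrightarrow> eqc j (\<lambda>x vs. D vs x) x) \<Longrightarrow> smooth r V F"
proof -
  have der: "(nth_deriv F vs has_derivative (\<lambda>h. D (h # vs) x)) (at x)"
    if "length vs < r" "x \<in> V" "\<And>y. y \<in> V \<Longrightarrow> nth_deriv F vs y = D vs y" for vs x
    by (rule has_derivative_transform_within_open[OF D1[OF that(2,1)] V that(2)]) (simp add: that(3))
  have eq: "x \<in> V \<Longrightarrow> length vs \<le> r \<Longrightarrow> nth_deriv F vs x = D vs x" for x vs
  proof (induction vs arbitrary: x)
    case (Cons h vs)
    have "(nth_deriv F vs has_derivative (\<lambda>h. D (h # vs) x)) (at x)"
      using Cons by (intro der) auto
    from frechet_derivative_at[OF this] show ?case by (simp add: fun_eq_iff nth_deriv.simps(2))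
  qed (simp add: D0)
  then show "\<And>x vs. x \<in> V \<Longrightarrow> length vs \<le> r \<Longrightarrow> nth_deriv F vs x = D vs x" .
  assume mb: "\<And>x j. x \<in> V \<Longrightarrow> j \<le> r \<Longrightarrow> \<exists>c. mbounded j (\<lambda>vs. D vs x) c"
    and ec: "\<And>x j. x \<in> V \<Longrightarrow> j \<le> r \<Longrightarrow> eqc j (\<lambda>x vs. D vs x) x"
  have "nth_deriv F vs differentiable (at x)" if "x \<in> V" "length vs < r" for x vs
    using der[OF that(2,1)] eq that by (auto simp: differentiable_def)
  moreover have "\<exists>c. mbounded j (D_at F x) c" if "x \<in> V" "j \<le> r" for x j
    using mb[OF that] eq[OF that(1)] that(2) by (auto simp: mbounded_def)
  moreover have "eqc j (D_at F) x" if x: "x \<in> V" and j: "j \<le> r" for x j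
    unfolding eqc_def
  proof (intro allI impI, elim conjE)
    fix Y :: "nat \<Rightarrow> 'a" and VS :: "nat \<Rightarrow> 'a list" and c
    assume Y: "Y \<longlonglongrightarrow> x" and VS: "\<forall>n. length (VS n) = j \<and> (\<forall>v\<in>set (VS n). norm v \<le> c)"
    have "\<forall>\<^sub>F n in sequentially. Y n \<in> V" using Y V x by (simp add: topological_tendstoD)
    then have "\<forall>\<^sub>F n in sequentially. D (VS n) (Y n) - D (VS n) x = D_at F (Y n) (VS n) - D_at F x (VS n)"
      by eventually_elim (use VS j x in \<open>simp add: eq\<close>)
    moreover have "(\<lambda>n. D (VS n) (Y n) - D (VS n) x) \<longlonglongrightarrow> 0"
      using eqcD[OF ec[OF x j] Y, of VS c] VS by blast
    ultimately show "(\<lambda>n. D_at F (Y n) (VS n) - D_at F x (VS n)) \<longlonglongrightarrow> 0"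
      by (rule Lim_transform_eventually[rotated])
  qed
  ultimately show "smooth r V F" using V unfolding smooth_def by blast
qed


section \<open>Sums, linear images and geometrically dominated series\<close>

lemma eqc_add:
  fixes \<Phi> \<Psi> :: "'a::real_normed_vector \<Rightarrow> 'b::real_normed_vector list \<Rightarrow> 'c::real_normed_vector"
  assumes "eqc j \<Phi> x" "eqc j \<Psi> x"
  shows "eqc j (\<lambda>x vs. \<Phi> x vs + \<Psi> x vs) x"
  unfolding eqc_def
proof (intro allI impI, elim conjE)
  fix Y :: "nat \<Rightarrow> 'a" and VS :: "nat \<Rightarrow> 'b list" and c
  assume Y: "Y \<longlonglongrightarrow> x" and VS: "\<forall>n. length (VS n) = j \<and> (\<forall>v\<in>set (VS n). norm v \<le> c)"
  have "(\<lambda>n. (\<Phi> (Y n) (VS n) - \<Phi> x (VS n)) + (\<Psi> (Y n) (VS n) - \<Psi> x (VS n))) \<longlonglongrightarrow> 0"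
    by (rule tendsto_add_zero[OF eqcD[OF assms(1) Y, of VS c] eqcD[OF assms(2) Y, of VS c]]) (use VS in blast)+
  then show "(\<lambda>n. \<Phi> (Y n) (VS n) + \<Psi> (Y n) (VS n) - (\<Phi> x (VS n) + \<Psi> x (VS n))) \<longlonglongrightarrow> 0"
    by (simp only: add_diff_add)
qed

lemma mbounded_add: "mbounded j B c \<Longrightarrow> mbounded j B' c' \<Longrightarrow> mbounded j (\<lambda>vs. B vs + B' vs) (c + c')"
  unfolding mbounded_def by (auto simp: distrib_right intro!: norm_triangle_mono)

lemma smooth_add:
  assumes F: "smooth r V F" and G: "smooth r V G"
  shows smooth_add_deriv: "\<And>x vs. x \<in> V \<Longrightarrow> length vs \<le> r \<Longrightarrow> nth_deriv (\<lambda>x. F x + G x) vs x = nth_deriv F vs x + nth_deriv G vs x"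
    and "smooth r V (\<lambda>x. F x + G x)"
proof -
  let ?D = "\<lambda>vs x. nth_deriv F vs x + nth_deriv G vs x"
  have V: "open V" using F by (rule smooth_open)
  have 0: "\<And>x. x \<in> V \<Longrightarrow> ?D [] x = F x + G x" by simp
  have 1: "(?D vs has_derivative (\<lambda>h. ?D (h # vs) x)) (at x)" if "x \<in> V" "length vs < r" for x vs
    by (intro has_derivative_add smooth_deriv[OF F that] smooth_deriv[OF G that])
  show "\<And>x vs. x \<in> V \<Longrightarrow> length vs \<le> r \<Longrightarrow> nth_deriv (\<lambda>x. F x + G x) vs x = ?D vs x"
    by (rule smoothI_deriv[OF V 0 1])
  show "smooth r V (\<lambda>x. F x + G x)"
  proof (rule smoothI(2)[OF V 0 1])
    fix x j assume x: "x \<in> V" "j \<le> r"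
    show "\<exists>c. mbounded j (\<lambda>vs. ?D vs x) c"
      using smooth_bounded[OF F x] smooth_bounded[OF G x] mbounded_add by blast
    show "eqc j (\<lambda>x vs. ?D vs x) x"
      by (rule eqc_add[OF smooth_eqc[OF F x] smooth_eqc[OF G x]])
  qed
qed

lemma smooth_bounded_linear:
  fixes F :: "'c::real_normed_vector \<Rightarrow> 'a::real_normed_vector" and B :: "'a \<Rightarrow> 'b::real_normed_vector"
  assumes B: "bounded_linear B" and F: "smooth r V F"
  shows smooth_bounded_linear_deriv: "\<And>x vs. x \<in> V \<Longrightarrow> length vs \<le> r \<Longrightarrow> nth_deriv (\<lambda>x. B (F x)) vs x = B (nth_deriv F vs x)"
    and "smooth r V (\<lambda>x. B (F x))"
proof -
  let ?D = "\<lambda>vs x. B (nth_deriv F vs x)"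
  have V: "open V" using F by (rule smooth_open)
  have 0: "\<And>x. x \<in> V \<Longrightarrow> ?D [] x = B (F x)" by simp
  have 1: "(?D vs has_derivative (\<lambda>h. ?D (h # vs) x)) (at x)" if "x \<in> V" "length vs < r" for x vs
    by (intro bounded_linear.has_derivative[OF B] smooth_deriv[OF F that])
  show "\<And>x vs. x \<in> V \<Longrightarrow> length vs \<le> r \<Longrightarrow> nth_deriv (\<lambda>x. B (F x)) vs x = ?D vs x"
    by (rule smoothI_deriv[OF V 0 1])
  show "smooth r V (\<lambda>x. B (F x))"
  proof (rule smoothI(2)[OF V 0 1])
    fix x j assume x: "x \<in> V" "j \<le> r"
    obtain K where K: "K > 0" "\<And>x. norm (B x) \<le> norm x * K" using bounded_linear.pos_bounded[OF B] by blast
    obtain c where c: "mbounded j (D_at F x) c" using smooth_bounded[OF F x] by blast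
    have "norm (B (nth_deriv F vs x)) \<le> c * K * prod_list (map norm vs)" if "length vs = j" for vs
    proof -
      have "norm (B (nth_deriv F vs x)) \<le> norm (nth_deriv F vs x) * K" by (rule K(2))
      also have "\<dots> \<le> (c * prod_list (map norm vs)) * K"
        using mboundedD[OF c that] K(1) by (intro mult_right_mono) auto
      finally show ?thesis by (simp add: mult_ac)
    qed
    then show "\<exists>c. mbounded j (\<lambda>vs. ?D vs x) c"
      using c K(1) by (intro exI[of _ "c * K"]) (auto simp: mbounded_def)
    show "eqc j (\<lambda>x vs. ?D vs x) x"
      unfolding eqc_def
    proof (intro allI impI, elim conjE)
      fix Y :: "nat \<Rightarrow> 'c" and VS :: "nat \<Rightarrow> 'c list" and c assume Y: "Y \<longlonglongrightarrow> x" and VS: "\<forall>n. length (VS n) = j \<and> (\<forall>v\<in>set (VS n). norm v \<le> c)"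
      have "(\<lambda>n. D_at F (Y n) (VS n) - D_at F x (VS n)) \<longlonglongrightarrow> 0"
        by (rule eqcD[OF smooth_eqc[OF F x] Y, where c = c]) (use VS in blast)+
      from bounded_linear.tendsto_zero[OF B this]
      show "(\<lambda>n. B (nth_deriv F (VS n) (Y n)) - B (nth_deriv F (VS n) x)) \<longlonglongrightarrow> 0"
        by (simp add: linear_diff[OF bounded_linear.linear[OF B]])
    qed
  qed
qed

lemma smooth_diff:
  assumes F: "smooth r V F" and G: "smooth r V G"
  shows smooth_diff_deriv: "\<And>x vs. x \<in> V \<Longrightarrow> length vs \<le> r \<Longrightarrow> nth_deriv (\<lambda>x. F x - G x) vs x = nth_deriv F vs x - nth_deriv G vs x"
    and "smooth r V (\<lambda>x. F x - G x)"
proof -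
  have m: "smooth r V (\<lambda>x. - G x)" "\<And>x vs. x \<in> V \<Longrightarrow> length vs \<le> r \<Longrightarrow> nth_deriv (\<lambda>x. - G x) vs x = - nth_deriv G vs x"
    using smooth_bounded_linear[OF bounded_linear_minus[OF bounded_linear_ident] G] by auto
  show "\<And>x vs. x \<in> V \<Longrightarrow> length vs \<le> r \<Longrightarrow> nth_deriv (\<lambda>x. F x - G x) vs x = nth_deriv F vs x - nth_deriv G vs x"
    "smooth r V (\<lambda>x. F x - G x)"
    using smooth_add[OF F m(1)] m(2) by auto
qed

lemma smooth_linear:
  assumes B: "bounded_linear B"
  shows "smooth r UNIV B" and nth_deriv_linear: "nth_deriv B vs x = (case vs of [] \<Rightarrow> B x | [h] \<Rightarrow> B h | _ \<Rightarrow> 0)"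
proof -
  let ?D = "\<lambda>vs x. (case vs of [] \<Rightarrow> B x | [h] \<Rightarrow> B h | _ \<Rightarrow> 0)"
  have 0: "\<And>x. x \<in> UNIV \<Longrightarrow> ?D [] x = B x" by simp
  have 1: "(?D vs has_derivative (\<lambda>h. ?D (h # vs) x)) (at x)" for x vs
  proof (cases vs)
    case (Cons a ws)
    then show ?thesis by (cases ws) auto
  qed (use bounded_linear_imp_has_derivative[OF B] in simp)
  show "nth_deriv B vs x = ?D vs x" by (rule smoothI_deriv[OF open_UNIV 0 1]) auto
  show "smooth r UNIV B"
  proof (rule smoothI(2)[OF open_UNIV 0 1])
    fix x :: 'a and j
    obtain K where K: "K > 0" "\<And>x. norm (B x) \<le> norm x * K" using bounded_linear.pos_bounded[OF B] by blast
    have "norm (?D vs x) \<le> (norm (B x) + K) * prod_list (map norm vs)" for vs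
    proof (cases vs)
      case (Cons h ws)
      have "norm (B h) \<le> norm (B x) * norm h + norm h * K" by (rule add_increasing[OF _ K(2)]) simp
      moreover have "0 \<le> (norm (B x) + K) * prod_list (map norm vs)"
        using K(1) prod_list_norm_nonneg[of vs] by simp
      ultimately show ?thesis using Cons by (cases ws) (auto simp: distrib_left distrib_right mult.commute)
    qed (use K(1) in auto)
    then show "\<exists>c. mbounded j (\<lambda>vs. ?D vs x) c" using K(1) unfolding mbounded_def
      by (intro exI[of _ "norm (B x) + K"]) auto
    show "eqc j (\<lambda>x vs. ?D vs x) x"
      unfolding eqc_def
    proof (intro allI impI, elim conjE)
      fix Y :: "nat \<Rightarrow> 'a" and VS :: "nat \<Rightarrow> 'a list" and c assume Y: "Y \<longlonglongrightarrow> x" and VS: "\<forall>n. length (VS n) = j \<and> (\<forall>v\<in>set (VS n). norm v \<le> c)"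
      have lim: "(\<lambda>n. norm (B (Y n) - B x)) \<longlonglongrightarrow> 0"
        by (rule tendsto_norm_zero[OF LIM_zero[OF bounded_linear.tendsto[OF B Y]]])
      have "norm (?D (VS n) (Y n) - ?D (VS n) x) \<le> norm (B (Y n) - B x)" for n
        by (auto split: list.split)
      then show "(\<lambda>n. ?D (VS n) (Y n) - ?D (VS n) x) \<longlonglongrightarrow> 0"
        by (intro Lim_null_comparison[OF always_eventually lim] allI)
    qed
  qed
qed

lemma geometric_tail:
  fixes f :: "nat \<Rightarrow> 'a::banach"
  assumes f: "\<And>k. norm (f k) \<le> C * \<theta> ^ k" and t: "0 \<le> \<theta>" "\<theta> < 1"
  shows "summable f" and "norm ((\<Sum>k<n. f k) - suminf f) \<le> C / (1 - \<theta>) * \<theta> ^ n"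
proof -
  have sg: "summable (\<lambda>k. C * \<theta> ^ k)" using t by (intro summable_mult summable_geometric) auto
  show sf: "summable f" by (rule summable_comparison_test'[OF sg, of 0]) (use f in auto)
  have "norm ((\<Sum>k<n. f k) - suminf f) = norm (\<Sum>k. f (k + n))"
    using suminf_split_initial_segment[OF sf, of n] by (simp add: norm_minus_commute)
  also have "\<dots> \<le> (\<Sum>k. (C * \<theta> ^ n) * \<theta> ^ k)"
    using f[of "_ + n"] t by (intro norm_suminf_le summable_mult summable_geometric) (auto simp: power_add mult_ac)
  also have "\<dots> = C / (1 - \<theta>) * \<theta> ^ n" using t by (subst suminf_mult) (auto simp: suminf_geometric summable_geometric)
  finally show "norm ((\<Sum>k<n. f k) - suminf f) \<le> C / (1 - \<theta>) * \<theta> ^ n" .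
qed

text \<open>Each derivative is dominated by the same geometric series, so termwise differentiation
  is legitimate on the convex set. Continuity of the sum in the norm of multilinear maps is tested
  on sequences, where Tannery's theorem interchanges limit and sum.\<close>

lemma smooth_series:
  fixes t :: "nat \<Rightarrow> 'a::real_normed_vector \<Rightarrow> 'b::banach"
  assumes V: "convex V" "open V" and t: "\<And>k. smooth r V (t k)"
    and bd: "\<And>k x j. x \<in> V \<Longrightarrow> j \<le> r \<Longrightarrow> mbounded j (D_at (t k) x) (C * \<theta> ^ k)"
    and th: "0 \<le> \<theta>" "\<theta> < 1"
  shows smooth_series_deriv: "\<And>x vs. x \<in> V \<Longrightarrow> length vs \<le> r \<Longrightarrow> nth_deriv (\<lambda>x. \<Sum>k. t k x) vs x = (\<Sum>k. nth_deriv (t k) vs x)"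
    and "smooth r V (\<lambda>x. \<Sum>k. t k x)"
    and "\<And>x vs. x \<in> V \<Longrightarrow> length vs \<le> r \<Longrightarrow> summable (\<lambda>k. nth_deriv (t k) vs x)"
proof -
  let ?D = "\<lambda>vs x. \<Sum>k. nth_deriv (t k) vs x"
  have bd': "norm (nth_deriv (t k) vs x) \<le> (C * prod_list (map norm vs)) * \<theta> ^ k" if "x \<in> V" "length vs \<le> r" for k x vs
    using mboundedD[OF bd[OF that] refl] by (simp add: mult_ac)
  note tail = geometric_tail[OF bd' th]
  show sm: "\<And>x vs. x \<in> V \<Longrightarrow> length vs \<le> r \<Longrightarrow> summable (\<lambda>k. nth_deriv (t k) vs x)" by (rule tail(1))
  have 0: "\<And>x. x \<in> V \<Longrightarrow> ?D [] x = (\<Sum>k. t k x)" by simp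
  have 1: "(?D vs has_derivative (\<lambda>h. ?D (h # vs) x)) (at x)" if x: "x \<in> V" and vs: "length vs < r" for x vs
  proof -
    let ?p = "prod_list (map norm vs)"
    have "\<exists>g. \<forall>x\<in>V. (\<lambda>n. nth_deriv (t n) vs x) sums (g x) \<and> (g has_derivative (\<lambda>h. ?D (h # vs) x)) (at x within V)"
    proof (rule has_derivative_series[OF V(1)])
      show "(nth_deriv (t n) vs has_derivative (\<lambda>h. nth_deriv (t n) (h # vs) y)) (at y within V)" if "y \<in> V" for n y
        by (rule has_derivative_at_withinI[OF smooth_deriv[OF t that vs]])
      show "(\<lambda>n. nth_deriv (t n) vs x) sums ?D vs x" using sm[OF x] vs by (simp add: summable_sums)
      fix e :: real assume e: "e > 0"
      have "(\<lambda>n. C * ?p / (1 - \<theta>) * \<theta> ^ n) \<longlonglongrightarrow> C * ?p / (1 - \<theta>) * 0"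
        using th by (intro tendsto_mult_left LIMSEQ_realpow_zero) auto
      then have "\<forall>\<^sub>F n in sequentially. C * ?p / (1 - \<theta>) * \<theta> ^ n < e" by (rule order_tendstoD) (use e in simp)
      then show "\<forall>\<^sub>F n in sequentially. \<forall>x\<in>V. \<forall>h. norm ((\<Sum>i<n. nth_deriv (t i) (h # vs) x) - ?D (h # vs) x) \<le> e * norm h"
      proof eventually_elim
        case (elim n)
        show ?case
        proof (intro ballI allI)
          fix x h assume x: "x \<in> V"
          have "norm ((\<Sum>i<n. nth_deriv (t i) (h # vs) x) - ?D (h # vs) x) \<le> (C * ?p / (1 - \<theta>) * \<theta> ^ n) * norm h"
            using tail(2)[OF x, of "h # vs" n] vs by (simp add: mult_ac)
          also have "\<dots> \<le> e * norm h" using elim by (intro mult_right_mono) auto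
          finally show "norm ((\<Sum>i<n. nth_deriv (t i) (h # vs) x) - ?D (h # vs) x) \<le> e * norm h" .
        qed
      qed
    qed (rule x)
    then obtain g where g: "\<And>x. x \<in> V \<Longrightarrow> (\<lambda>n. nth_deriv (t n) vs x) sums g x"
      "\<And>x. x \<in> V \<Longrightarrow> (g has_derivative (\<lambda>h. ?D (h # vs) x)) (at x within V)" by blast
    have gx: "(g has_derivative (\<lambda>h. ?D (h # vs) x)) (at x)"
      using g(2)[OF x] at_within_open[OF x V(2)] by simp
    show ?thesis
      by (rule has_derivative_transform_within_open[OF gx V(2) x]) (rule sums_unique[OF g(1)])
  qed
  show "\<And>x vs. x \<in> V \<Longrightarrow> length vs \<le> r \<Longrightarrow> nth_deriv (\<lambda>x. \<Sum>k. t k x) vs x = ?D vs x"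
    by (rule smoothI_deriv[OF V(2) 0 1])
  show "smooth r V (\<lambda>x. \<Sum>k. t k x)"
  proof (rule smoothI(2)[OF V(2) 0 1])
    fix x j assume x: "x \<in> V" and j: "j \<le> r"
    have C: "0 \<le> C" using bd[OF x j, of 0] by (simp add: mbounded_def)
    have "norm (?D vs x) \<le> C / (1 - \<theta>) * prod_list (map norm vs)" if "length vs = j" for vs
      using tail(2)[OF x, of vs 0] that j by (simp add: mult_ac)
    then show "\<exists>c. mbounded j (\<lambda>vs. ?D vs x) c"
      using C th by (intro exI[of _ "C / (1 - \<theta>)"]) (auto simp: mbounded_def)
    show "eqc j (\<lambda>x vs. ?D vs x) x"
      unfolding eqc_def
    proof (intro allI impI, elim conjE)
      fix Y :: "nat \<Rightarrow> 'a" and VS :: "nat \<Rightarrow> 'a list" and c0 assume Y: "Y \<longlonglongrightarrow> x" and VS0: "\<forall>n. length (VS n) = j \<and> (\<forall>v\<in>set (VS n). norm v \<le> c0)"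
      define c where "c = max c0 1"
      have VS: "length (VS n) = j" "\<And>v. v \<in> set (VS n) \<Longrightarrow> norm v \<le> c" for n
        using VS0 by (auto simp: c_def le_max_iff_disj)
      have c1: "c \<ge> 1" by (simp add: c_def)
      have pl: "prod_list (map norm (VS n)) \<le> c ^ j" for n
      proof -
        have "(\<forall>v\<in>set vs. norm v \<le> c) \<Longrightarrow> prod_list (map norm vs) \<le> c ^ length vs" for vs :: "'a list"
          using c1 by (induction vs) (auto intro!: mult_mono prod_list_norm_nonneg)
        then have "(\<forall>v\<in>set (VS n). norm v \<le> c) \<Longrightarrow> prod_list (map norm (VS n)) \<le> c ^ length (VS n)" .
        then show ?thesis using VS(1)[of n] VS(2)[of _ n] by simp
      qed
      define a where "a k n = norm (nth_deriv (t k) (VS n) (Y n) - nth_deriv (t k) (VS n) x)" for k n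
      have YV: "\<forall>\<^sub>F n in sequentially. Y n \<in> V" using Y V(2) x by (simp add: topological_tendstoD)
      have ab: "a k n \<le> 2 * C * c ^ j * \<theta> ^ k" if "Y n \<in> V" for k n
      proof -
        have "a k n \<le> (C * prod_list (map norm (VS n))) * \<theta> ^ k + (C * prod_list (map norm (VS n))) * \<theta> ^ k"
          unfolding a_def using VS(1) j x that by (intro order_trans[OF norm_triangle_ineq4] add_mono bd') auto
        also have "\<dots> \<le> (C * c ^ j) * \<theta> ^ k + (C * c ^ j) * \<theta> ^ k"
          using pl C th by (intro add_mono mult_right_mono mult_left_mono) auto
        finally show ?thesis by (simp add: mult_ac)
      qed
      have sM: "summable (\<lambda>k. 2 * C * c ^ j * \<theta> ^ k)" using th by (intro summable_mult summable_geometric) auto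
      have "(\<lambda>n. \<Sum>k. a k n) \<longlonglongrightarrow> (\<Sum>k. 0)"
      proof (rule tannerys_theorem[THEN conjunct2, THEN conjunct2])
        show "(\<lambda>n. a k n) \<longlonglongrightarrow> 0" for k
          unfolding a_def
          by (rule tendsto_norm_zero, rule eqcD[OF smooth_eqc[OF t x j] Y, where c = c]) (use VS in auto)
        show "\<forall>\<^sub>F (k, n) in at_top \<times>\<^sub>F sequentially. norm (a k n) \<le> 2 * C * c ^ j * \<theta> ^ k"
        proof -
          have "\<forall>\<^sub>F p in (at_top :: nat filter) \<times>\<^sub>F sequentially. Y (snd p) \<in> V"
            using eventually_prod2[of "at_top :: nat filter" "\<lambda>n. Y n \<in> V" sequentially] YV trivial_limit_at_top_linorder by (simp add: case_prod_unfold)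
          then show ?thesis by eventually_elim (use ab in \<open>simp add: a_def case_prod_unfold\<close>)
        qed
      qed (use sM in auto)
      then have lim: "(\<lambda>n. \<Sum>k. a k n) \<longlonglongrightarrow> 0" by simp
      have "\<forall>\<^sub>F n in sequentially. norm (?D (VS n) (Y n) - ?D (VS n) x) \<le> (\<Sum>k. a k n)"
        using YV
      proof eventually_elim
        case (elim n)
        have "summable (\<lambda>k. a k n)"
          by (rule summable_comparison_test'[OF sM, of 0]) (use ab[OF elim] in \<open>simp add: a_def\<close>)
        moreover have "?D (VS n) (Y n) - ?D (VS n) x = (\<Sum>k. nth_deriv (t k) (VS n) (Y n) - nth_deriv (t k) (VS n) x)"
          by (rule suminf_diff[OF sm[OF elim] sm[OF x]]) (simp_all add: VS(1) j)
        ultimately show ?case unfolding a_def by (simp only: summable_norm)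
      qed
      then show "(\<lambda>n. ?D (VS n) (Y n) - ?D (VS n) x) \<longlonglongrightarrow> 0"
        by (rule Lim_null_comparison[OF _ lim])
    qed
  qed
qed


section \<open>The formula of Faa di Bruno\<close>

abbreviation fdb_term ::
  "('b::real_normed_vector \<Rightarrow> 'c::real_normed_vector) \<Rightarrow> ('a::real_normed_vector \<Rightarrow> 'b) \<Rightarrow> 'a list list \<Rightarrow> 'a \<Rightarrow> 'c" where
  "fdb_term F G \<pi> x \<equiv> nth_deriv F (map (\<lambda>b. nth_deriv G b x) \<pi>) (G x)"

lemma has_derivative_sum_list:
  assumes "\<And>t. t \<in> set ts \<Longrightarrow> (f t has_derivative f' t) F"
  shows "((\<lambda>x. \<Sum>t\<leftarrow>ts. f t x) has_derivative (\<lambda>h. \<Sum>t\<leftarrow>ts. f' t h)) F"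
  using assms by (induction ts) (auto intro: has_derivative_add)

lemma norm_sum_list_le:
  "(\<And>t. t \<in> set ts \<Longrightarrow> norm (f t) \<le> g t) \<Longrightarrow> norm (\<Sum>t\<leftarrow>ts. f t) \<le> (\<Sum>t\<leftarrow>ts. g t)"
  by (induction ts) (auto intro!: norm_triangle_mono)

lemma tendsto_sum_list_zero:
  fixes f :: "'t \<Rightarrow> 'n \<Rightarrow> 'a::real_normed_vector"
  assumes "\<And>t. t \<in> set ts \<Longrightarrow> (f t \<longlongrightarrow> 0) F"
  shows "((\<lambda>n. \<Sum>t\<leftarrow>ts. f t n) \<longlongrightarrow> 0) F"
  using assms by (induction ts) (auto intro!: tendsto_add_zero)

lemma sum_list_diff:
  "(\<Sum>t\<leftarrow>ts. f t) - (\<Sum>t\<leftarrow>ts. g t) = (\<Sum>t\<leftarrow>ts. f t - g t :: 'a::ab_group_add)"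
  by (induction ts) (auto simp: algebra_simps)

lemma sum_list_add:
  "(\<Sum>t\<leftarrow>ts. f t + g t) = (\<Sum>t\<leftarrow>ts. f t) + (\<Sum>t\<leftarrow>ts. g t :: 'a::ab_group_add)"
  by (induction ts) (auto simp: algebra_simps)

lemma sum_list_concat_map:
  "(\<Sum>t\<leftarrow>concat (map g xs). f t) = (\<Sum>x\<leftarrow>xs. \<Sum>t\<leftarrow>g x. f t :: 'a::ab_group_add)"
  by (induction xs) auto

lemma fdb_term_has_derivative:
  fixes F :: "'b::real_normed_vector \<Rightarrow> 'c::real_normed_vector" and G :: "'a::real_normed_vector \<Rightarrow> 'b"
  assumes F: "smooth r W F" and G: "smooth r V G" and x: "x \<in> V" "G x \<in> W"
    and \<pi>: "length \<pi> < r" "\<And>b. b \<in> set \<pi> \<Longrightarrow> length b < r"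
  shows "(fdb_term F G \<pi> has_derivative
    (\<lambda>h. fdb_term F G ([h] # \<pi>) x + (\<Sum>i\<leftarrow>[0..<length \<pi>]. fdb_term F G (\<pi>[i := h # \<pi> ! i]) x))) (at x)"
proof -
  define ws where "ws = map (\<lambda>b. (nth_deriv G b, \<lambda>h. nth_deriv G (h # b) x)) \<pi>"
  have ev: "map (\<lambda>(w, w'). w y) ws = map (\<lambda>b. nth_deriv G b y) \<pi>" for y
    by (simp add: ws_def o_def)
  have len: "length ws = length \<pi>" by (simp add: ws_def)
  have r: "1 \<le> r" using \<pi>(1) by simp
  have "famdiff (length ws) (\<lambda>x. D_at F (G x)) (\<lambda>h zs. nth_deriv F (nth_deriv G [h] x # zs) (G x)) x"
    unfolding len by (rule famdiff_chain[OF smooth_famdiff[OF F x(2) \<pi>(1)] smooth_deriv0[OF G x(1) r]])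
  moreover have "(w has_derivative w') (at x)" if "(w, w') \<in> set ws" for w w'
    using that smooth_deriv[OF G x(1) \<pi>(2)] by (auto simp: ws_def)
  ultimately have "((\<lambda>x. D_at F (G x) (map (\<lambda>(w, w'). w x) ws)) has_derivative
    (\<lambda>h. nth_deriv F (nth_deriv G [h] x # map (\<lambda>(w, w'). w x) ws) (G x) +
       (\<Sum>i<length ws. D_at F (G x) ((map (\<lambda>(w, w'). w x) ws)[i := snd (ws ! i) h])))) (at x)"
    by (rule famdiff_apply_list)
  moreover have "(map (\<lambda>b. nth_deriv G b x) \<pi>)[i := snd (ws ! i) h] = map (\<lambda>b. nth_deriv G b x) (\<pi>[i := h # \<pi> ! i])"
    if "i < length \<pi>" for i h
    using that by (simp add: ws_def map_update)
  ultimately show ?thesis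
    by (simp add: ev len interv_sum_list_conv_sum_set_nat atLeast0LessThan)
qed

lemma fdb_sum_has_derivative:
  fixes F :: "'b::real_normed_vector \<Rightarrow> 'c::real_normed_vector" and G :: "'a::real_normed_vector \<Rightarrow> 'b"
  assumes F: "smooth r W F" and G: "smooth r V G" and x: "x \<in> V" "G x \<in> W" and vs: "length vs < r"
  shows "((\<lambda>x. \<Sum>\<pi>\<leftarrow>parts vs. fdb_term F G \<pi> x) has_derivative
    (\<lambda>h. \<Sum>\<pi>\<leftarrow>parts (h # vs). fdb_term F G \<pi> x)) (at x)"
proof -
  have "(fdb_term F G \<pi> has_derivative
    (\<lambda>h. fdb_term F G ([h] # \<pi>) x + (\<Sum>i\<leftarrow>[0..<length \<pi>]. fdb_term F G (\<pi>[i := h # \<pi> ! i]) x))) (at x)"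
    if "\<pi> \<in> set (parts vs)" for \<pi>
    using parts_length[OF that] parts_block_length[OF that] vs
    by (intro fdb_term_has_derivative[OF F G x]) (auto intro: le_less_trans)
  then show ?thesis
    using has_derivative_sum_list[of "parts vs" "fdb_term F G"
      "\<lambda>\<pi> h. fdb_term F G ([h] # \<pi>) x + (\<Sum>i\<leftarrow>[0..<length \<pi>]. fdb_term F G (\<pi>[i := h # \<pi> ! i]) x)" "at x"]
    by (simp add: sum_list_add sum_list_concat_map o_def)
qed

lemma fdb_term_bound:
  fixes F :: "'b::real_normed_vector \<Rightarrow> 'c::real_normed_vector" and G :: "'a::real_normed_vector \<Rightarrow> 'b"
  assumes F: "\<And>k. k \<le> j \<Longrightarrow> mbounded k (D_at F (G x)) (cF k)"
    and G: "\<And>k. k \<le> j \<Longrightarrow> mbounded k (D_at G x) (cG k)" and \<pi>: "\<pi> \<in> set (parts vs)" "length vs = j"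
  shows "norm (fdb_term F G \<pi> x) \<le> cF (length \<pi>) * prod_list (map (\<lambda>b. cG (length b)) \<pi>) * prod_list (map norm vs)"
proof -
  have 0: "0 \<le> cF (length \<pi>)" using F[of "length \<pi>"] parts_length[OF \<pi>(1)] \<pi>(2) by (simp add: mbounded_def)
  have "prod_list (map norm (map (\<lambda>b. nth_deriv G b x) \<rho>)) \<le> prod_list (map (\<lambda>b. cG (length b) * prod_list (map norm b)) \<rho>)"
    if "\<And>b. b \<in> set \<rho> \<Longrightarrow> length b \<le> j" for \<rho>
    using that
  proof (induction \<rho>)
    case (Cons b \<rho>)
    then show ?case using mboundedD[OF G, of "length b" b] prod_list_norm_nonneg[of "map (\<lambda>b. nth_deriv G b x) \<rho>"]
      by (auto intro!: mult_mono simp: order_trans[OF norm_ge_zero])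
  qed simp
  then have "prod_list (map norm (map (\<lambda>b. nth_deriv G b x) \<pi>)) \<le> prod_list (map (\<lambda>b. cG (length b) * prod_list (map norm b)) \<pi>)"
    using parts_block_length[OF \<pi>(1)] \<pi>(2) by blast
  also have "\<dots> = prod_list (map (\<lambda>b. cG (length b)) \<pi>) * prod_list (map (\<lambda>b. prod_list (map norm b)) \<pi>)"
    by (induction \<pi>) (auto simp: mult_ac)
  also have "prod_list (map (\<lambda>b. prod_list (map norm b)) \<pi>) = prod_list (map norm vs)"
    by (rule parts_prod[OF \<pi>(1)])
  finally have "cF (length \<pi>) * prod_list (map norm (map (\<lambda>b. nth_deriv G b x) \<pi>)) \<le>
      cF (length \<pi>) * (prod_list (map (\<lambda>b. cG (length b)) \<pi>) * prod_list (map norm vs))"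
    by (rule mult_left_mono[OF _ 0])
  moreover have "norm (fdb_term F G \<pi> x) \<le> cF (length \<pi>) * prod_list (map norm (map (\<lambda>b. nth_deriv G b x) \<pi>))"
    using parts_length[OF \<pi>(1)] \<pi>(2) by (intro mboundedD[OF F]) auto
  ultimately show ?thesis by (simp add: mult_ac)
qed

lemma sum_list_parts_shape:
  "(\<Sum>\<pi>\<leftarrow>parts vs. f (map length \<pi>)) = (\<Sum>\<pi>\<leftarrow>parts [0..<length vs]. f (map length \<pi>))"
  by (subst parts_eq_map_nth[of vs]) (simp add: o_def)

text \<open>Directions vary with \<open>n\<close>, so the partitions are transported to positions:
  one finite index set serves all \<open>n\<close>, and each term is an outer derivative evaluated
  at inner derivatives, to which \<open>eqc_apply\<close> applies.\<close>

lemma fdb_eqc: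
  fixes F :: "'b::real_normed_vector \<Rightarrow> 'c::real_normed_vector" and G :: "'a::real_normed_vector \<Rightarrow> 'b"
  assumes F: "smooth r W F" and G: "smooth r V G" and x: "x \<in> V" "G x \<in> W" and j: "j \<le> r"
  shows "eqc j (\<lambda>x vs. \<Sum>\<pi>\<leftarrow>parts vs. fdb_term F G \<pi> x) x"
  unfolding eqc_def
proof (intro allI impI, elim conjE)
  fix Y :: "nat \<Rightarrow> 'a" and VS :: "nat \<Rightarrow> 'a list" and c0
  assume Y: "Y \<longlonglongrightarrow> x" and VS0: "\<forall>n. length (VS n) = j \<and> (\<forall>v\<in>set (VS n). norm v \<le> c0)"
  define c where "c = max c0 1"
  have c1: "c \<ge> 1" by (simp add: c_def)
  have VS: "length (VS n) = j" "\<And>i. i < j \<Longrightarrow> norm (VS n ! i) \<le> c" for n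
    using VS0[rule_format, of n] by (auto simp: c_def le_max_iff_disj)
  let ?\<sigma> = "\<lambda>n. map (map ((!) (VS n)))"
  have GY: "(\<lambda>n. G (Y n)) \<longlonglongrightarrow> G x"
    using isCont_tendsto_compose[OF smooth_isCont[OF G x(1)] Y] .
  have "(\<lambda>n. fdb_term F G (?\<sigma> n \<pi>) (Y n) - fdb_term F G (?\<sigma> n \<pi>) x) \<longlonglongrightarrow> 0"
    if \<pi>: "\<pi> \<in> set (parts [0..<j])" for \<pi>
  proof -
    have l\<pi>: "length \<pi> \<le> j" using parts_length[OF \<pi>] by simp
    have sub: "i < j" if "b \<in> set \<pi>" "i \<in> set b" for b i
    proof -
      have "\<pi> \<in> set (parts ts) \<Longrightarrow> b \<in> set \<pi> \<Longrightarrow> set b \<subseteq> set ts" for ts :: "nat list"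
      proof (induction ts arbitrary: \<pi> b)
        case (Cons h ts)
        from Cons.prems(1) show ?case
        proof (cases rule: parts_ConsE)
          case (1 \<rho>)
          then show ?thesis using Cons by fastforce
        next
          case (2 \<rho> i)
          then have "b = h # \<rho> ! i \<or> b \<in> set \<rho>" using Cons.prems(2) set_update_subset_insert by fastforce
          then show ?thesis using Cons.IH[OF 2(1)] nth_mem[OF 2(2)] by fastforce
        qed
      qed simp
      then show ?thesis using \<pi> that by fastforce
    qed
    have lb: "length b \<le> j" if "b \<in> set \<pi>" for b using parts_block_length[OF \<pi> that] by simp
    have d0: "(\<lambda>n. nth_deriv G (map ((!) (VS n)) b) (Y n) - nth_deriv G (map ((!) (VS n)) b) x) \<longlonglongrightarrow> 0"
      if b: "b \<in> set \<pi>" for b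
      by (rule eqcD[OF smooth_eqc[OF G x(1), of "length b"] Y, where c = c])
         (use lb[OF b] j sub[OF b] VS in auto)
    have "\<exists>M. \<forall>n. norm (nth_deriv G (map ((!) (VS n)) b) (Y n)) \<le> M \<and> norm (nth_deriv G (map ((!) (VS n)) b) x) \<le> M"
      if b: "b \<in> set \<pi>" for b
    proof -
      obtain cG where cG: "mbounded (length b) (D_at G x) cG"
        using smooth_bounded[OF G x(1), of "length b"] lb[OF b] j by auto
      have pl: "(\<And>v. v \<in> set vs \<Longrightarrow> norm v \<le> c) \<Longrightarrow> prod_list (map norm vs) \<le> c ^ length vs" for vs :: "'a list"
        using c1 by (induction vs) (auto intro!: mult_mono prod_list_norm_nonneg)
      have 1: "norm (nth_deriv G (map ((!) (VS n)) b) x) \<le> cG * c ^ length b" for n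
      proof -
        have "norm (nth_deriv G (map ((!) (VS n)) b) x) \<le> cG * prod_list (map norm (map ((!) (VS n)) b))"
          by (rule mboundedD[OF cG]) simp
        also have "\<dots> \<le> cG * c ^ length (map ((!) (VS n)) b)"
          using cG VS sub[OF b] by (intro mult_left_mono pl) (auto simp: mbounded_def)
        finally show ?thesis by simp
      qed
      obtain K where K: "\<And>n. norm (nth_deriv G (map ((!) (VS n)) b) (Y n) - nth_deriv G (map ((!) (VS n)) b) x) \<le> K"
        using convergent_imp_Bseq[OF convergentI[OF d0[OF b]]] unfolding Bseq_def by blast
      have K0: "K \<ge> 0" using K[of 0] norm_ge_zero order_trans by blast
      have "norm (nth_deriv G (map ((!) (VS n)) b) (Y n)) \<le> K + cG * c ^ length b" for n
        using norm_triangle_mono[OF K[of n] 1[of n]] by simp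
      moreover have "norm (nth_deriv G (map ((!) (VS n)) b) x) \<le> K + cG * c ^ length b" for n
        using 1[of n] K0 by simp
      ultimately show ?thesis by blast
    qed
    then obtain Mb where Mb: "\<And>b n. b \<in> set \<pi> \<Longrightarrow> norm (nth_deriv G (map ((!) (VS n)) b) (Y n)) \<le> Mb b"
      "\<And>b n. b \<in> set \<pi> \<Longrightarrow> norm (nth_deriv G (map ((!) (VS n)) b) x) \<le> Mb b"
      by metis
    define M where "M = sum_list (map (\<lambda>b. \<bar>Mb b\<bar>) \<pi>)"
    have M: "Mb b \<le> M" if "b \<in> set \<pi>" for b
      unfolding M_def using that
    proof (induction \<pi>)
      case (Cons a \<pi>)
      have "0 \<le> sum_list (map (\<lambda>b. \<bar>Mb b\<bar>) \<pi>)" by (rule sum_list_nonneg) auto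
      then show ?case using Cons by (cases "b = a") auto
    qed simp
    obtain cF where cF: "mbounded (length \<pi>) (D_at F (G x)) cF"
      using smooth_bounded[OF F x(2), of "length \<pi>"] l\<pi> j by auto
    show ?thesis
    proof (rule eqc_apply[OF smooth_eqc[OF F x(2)] smooth_multilinear[OF F x(2)] cF GY, where M = M])
      fix n z
      { assume "z \<in> set (map (\<lambda>b. nth_deriv G b (Y n)) (?\<sigma> n \<pi>))"
        then obtain b where "b \<in> set \<pi>" "z = nth_deriv G (map ((!) (VS n)) b) (Y n)" by auto
        then show "norm z \<le> M" using Mb(1) M order_trans by blast }
      { assume "z \<in> set (map (\<lambda>b. nth_deriv G b x) (?\<sigma> n \<pi>))"
        then obtain b where "b \<in> set \<pi>" "z = nth_deriv G (map ((!) (VS n)) b) x" by auto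
        then show "norm z \<le> M" using Mb(2) M order_trans by blast }
    next
      fix i assume "i < length \<pi>"
      then show "(\<lambda>n. map (\<lambda>b. nth_deriv G b (Y n)) (?\<sigma> n \<pi>) ! i - map (\<lambda>b. nth_deriv G b x) (?\<sigma> n \<pi>) ! i) \<longlonglongrightarrow> 0"
        using d0[of "\<pi> ! i"] by simp
    qed (use l\<pi> j in auto)
  qed
  from tendsto_sum_list_zero[of "parts [0..<j]", OF this]
  have "(\<lambda>n. \<Sum>\<pi>\<leftarrow>parts [0..<j]. fdb_term F G (?\<sigma> n \<pi>) (Y n) - fdb_term F G (?\<sigma> n \<pi>) x) \<longlonglongrightarrow> 0" .
  moreover have "(\<Sum>\<pi>\<leftarrow>parts (VS n). fdb_term F G \<pi> y) = (\<Sum>\<pi>\<leftarrow>parts [0..<j]. fdb_term F G (?\<sigma> n \<pi>) y)" for n y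
    by (subst parts_eq_map_nth) (simp add: VS(1) o_def)
  ultimately show "(\<lambda>n. (\<Sum>\<pi>\<leftarrow>parts (VS n). fdb_term F G \<pi> (Y n)) - (\<Sum>\<pi>\<leftarrow>parts (VS n). fdb_term F G \<pi> x)) \<longlonglongrightarrow> 0"
    by (simp add: sum_list_diff)
qed

lemma smooth_compose:
  fixes F :: "'b::real_normed_vector \<Rightarrow> 'c::real_normed_vector" and G :: "'a::real_normed_vector \<Rightarrow> 'b"
  assumes F: "smooth r W F" and G: "smooth r V G" and sub: "\<And>x. x \<in> V \<Longrightarrow> G x \<in> W"
  shows smooth_compose_deriv: "\<And>x vs. x \<in> V \<Longrightarrow> length vs \<le> r \<Longrightarrow> nth_deriv (\<lambda>x. F (G x)) vs x = (\<Sum>\<pi>\<leftarrow>parts vs. fdb_term F G \<pi> x)"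
    and "smooth r V (\<lambda>x. F (G x))"
proof -
  let ?D = "\<lambda>vs x. \<Sum>\<pi>\<leftarrow>parts vs. fdb_term F G \<pi> x"
  have V: "open V" using G by (rule smooth_open)
  have 0: "?D [] x = F (G x)" for x by simp
  have 1: "(?D vs has_derivative (\<lambda>h. ?D (h # vs) x)) (at x)" if "x \<in> V" "length vs < r" for x vs
    by (rule fdb_sum_has_derivative[OF F G that(1) sub[OF that(1)] that(2)])
  show "\<And>x vs. x \<in> V \<Longrightarrow> length vs \<le> r \<Longrightarrow> nth_deriv (\<lambda>x. F (G x)) vs x = ?D vs x"
    by (rule smoothI_deriv[OF V 0 1])
  show "smooth r V (\<lambda>x. F (G x))"
  proof (rule smoothI(2)[OF V 0 1])
    fix x j assume x: "x \<in> V" and j: "j \<le> r"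
    obtain cF where cF: "\<And>k. k \<le> r \<Longrightarrow> mbounded k (D_at F (G x)) (cF k)"
      using smooth_bounded[OF F sub[OF x]] by metis
    obtain cG where cG: "\<And>k. k \<le> r \<Longrightarrow> mbounded k (D_at G x) (cG k)"
      using smooth_bounded[OF G x] by metis
    let ?f = "\<lambda>ls. cF (length ls) * prod_list (map cG ls)"
    define C where "C = (\<Sum>\<pi>\<leftarrow>parts [0..<j]. ?f (map length \<pi>))"
    have "norm (?D vs x) \<le> C * prod_list (map norm vs)" if vs: "length vs = j" for vs
    proof -
      have "norm (?D vs x) \<le> (\<Sum>\<pi>\<leftarrow>parts vs. cF (length \<pi>) * prod_list (map (\<lambda>b. cG (length b)) \<pi>) * prod_list (map norm vs))"
        by (intro norm_sum_list_le fdb_term_bound[where j = j]) (use cF cG j vs in auto)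
      also have "\<dots> = (\<Sum>\<pi>\<leftarrow>parts vs. ?f (map length \<pi>)) * prod_list (map norm vs)"
        by (simp add: sum_list_mult_const o_def)
      finally show ?thesis by (simp only: C_def sum_list_parts_shape[of ?f vs] vs)
    qed
    moreover have "0 \<le> C"
    proof -
      have "0 \<le> ?f (map length \<pi>)" if "\<pi> \<in> set (parts [0..<j])" for \<pi>
      proof -
        have "0 \<le> cG (length b)" if "b \<in> set \<pi>" for b
          using parts_block_length[OF \<open>\<pi> \<in> _\<close> that] cG[of "length b"] j by (simp add: mbounded_def)
        moreover have "0 \<le> cF (length \<pi>)"
          using parts_length[OF that] cF[of "length \<pi>"] j by (simp add: mbounded_def)
        ultimately show ?thesis by (auto intro!: mult_nonneg_nonneg prod_list_nonneg)
      qed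
      then show ?thesis unfolding C_def by (intro sum_list_nonneg) auto
    qed
    ultimately show "\<exists>c. mbounded j (\<lambda>vs. ?D vs x) c"
      by (auto simp: mbounded_def)
    show "eqc j (\<lambda>x vs. ?D vs x) x" by (rule fdb_eqc[OF F G x sub[OF x] j])
  qed
qed


section \<open>Gauges\<close>

text \<open>\<open>gauge Fam q u K\<close> below says that \<open>u\<close> has norm at most \<open>K\<close> in the norm with index \<open>q\<close>. For bounded
  families, \<open>None\<close> is the supremum norm and \<open>Some l\<close> the norm with weights \<open>\<Gamma>(i - l)\<close> (\<open>lgauge\<close>). The
  indices at which the arguments of a multilinear map are measured are admissible for \<open>q\<close> if
  \<open>q\<close> is among them when it is not \<open>None\<close>, and all others are \<open>None\<close>.\<close>

primrec adm :: "'o option \<Rightarrow> 'o option list \<Rightarrow> bool" where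
  "adm q [] \<longleftrightarrow> q = None"
| "adm q (m # ms) \<longleftrightarrow> m = None \<and> adm q ms \<or> m \<noteq> None \<and> m = q \<and> adm None ms"

primrec omark :: "'o option list \<Rightarrow> 'o option" where
  "omark [] = None"
| "omark (m # ms) = (if m = None then omark ms else m)"

lemma adm_None: "adm None ms \<longleftrightarrow> (\<forall>m\<in>set ms. m = None)"
  by (induction ms) auto

lemma adm_None_update: "adm None ms \<Longrightarrow> i < length ms \<Longrightarrow> adm q (ms[i := q])"
proof (induction ms arbitrary: i)
  case (Cons m ms)
  then show ?case by (cases i; cases q) (auto simp: adm_None)
qed simp

text \<open>This is why decay survives composition. At most one argument is measured with a weight;
  it lies in one block, whose inner derivative inherits that weight, while all other blocks are
  measured with index \<open>None\<close>. The inner derivatives on the blocks and the outer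
  derivative on their values are therefore both used admissibly.\<close>

lemma adm_parts:
  assumes "\<pi> \<in> set (parts ts)" "adm q (map f ts)"
  shows "(\<forall>b\<in>set \<pi>. adm (omark (map f b)) (map f b)) \<and> adm q (map (\<lambda>b. omark (map f b)) \<pi>)"
  using assms
proof (induction ts arbitrary: \<pi> q)
  case (Cons h ts)
  let ?om = "\<lambda>b. omark (map f b)"
  show ?case
  proof (cases "f h")
    case None
    then have "adm q (map f ts)" using Cons.prems(2) by simp
    note IH = Cons.IH[OF _ this]
    from Cons.prems(1) show ?thesis
    proof (cases rule: parts_ConsE)
      case (1 \<rho>)
      then show ?thesis using IH[OF 1(1)] None by simp
    next
      case (2 \<rho> i)
      have "map ?om \<pi> = (map ?om \<rho>)[i := map ?om \<rho> ! i]" using 2 None by (simp add: map_update)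
      then have "map ?om \<pi> = map ?om \<rho>" by (simp only: list_update_id)
      moreover have "adm (?om b) (map f b)" if "b \<in> set \<pi>" for b
      proof -
        have "b = h # \<rho> ! i \<or> b \<in> set \<rho>" using that 2 set_update_subset_insert by fastforce
        then show ?thesis using IH[OF 2(1)] None nth_mem[OF 2(2)] by auto
      qed
      ultimately show ?thesis using IH[OF 2(1)] by metis
    qed
  next
    case (Some l)
    then have q: "q = Some l" and "adm None (map f ts)" using Cons.prems(2) by auto
    note IH = Cons.IH[OF _ this(2)]
    from Cons.prems(1) show ?thesis
    proof (cases rule: parts_ConsE)
      case (1 \<rho>)
      then show ?thesis using IH[OF 1(1)] Some q by simp
    next
      case (2 \<rho> i)
      have N: "?om b = None" if "b \<in> set \<rho>" for b
        using IH[OF 2(1)] that by (auto simp: adm_None)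
      have "map ?om \<pi> = (map ?om \<rho>)[i := q]" using 2 Some q by (simp add: map_update)
      then have "adm q (map ?om \<pi>)" using adm_None_update[of "map ?om \<rho>" i q] IH[OF 2(1)] 2(2) by simp
      moreover have "adm (?om b) (map f b)" if "b \<in> set \<pi>" for b
      proof -
        have "b = h # \<rho> ! i \<or> b \<in> set \<rho>" using that 2 set_update_subset_insert by fastforce
        moreover have "adm None (map f (\<rho> ! i))" using IH[OF 2(1)] N nth_mem[OF 2(2)] by metis
        ultimately show ?thesis using IH[OF 2(1)] Some by auto
      qed
      ultimately show ?thesis by blast
    qed
  qed
qed simp

definition gauge :: "('o option \<Rightarrow> (('a::real_normed_vector \<Rightarrow> 'b::real_normed_vector) \<times> real) set) \<Rightarrow> 'o option \<Rightarrow> 'a \<Rightarrow> real \<Rightarrow> bool" where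
  "gauge Fam q u K \<longleftrightarrow> 0 \<le> K \<and> (\<forall>T c. (T, c) \<in> Fam q \<longrightarrow> norm (T u) \<le> K * c)"

text \<open>The functionals \<open>T\<close> with weights \<open>c\<close> stand for the evaluations
  at the sites. The axioms keep only what the analysis needs, in particular that the norm with index
  \<open>None\<close> is equivalent to the given one, so that the weighted and the adapted norms are
  instances of one theory.\<close>

locale gauged =
  fixes Fam :: "'o option \<Rightarrow> (('a::banach \<Rightarrow> 'b::real_normed_vector) \<times> real) set"
  assumes Fam_linear: "(T, c) \<in> Fam q \<Longrightarrow> bounded_linear T"
    and Fam_pos: "(T, c) \<in> Fam q \<Longrightarrow> 0 < c"
    and gauge_le_norm: "\<exists>C>0. \<forall>u. gauge Fam None u (C * norm u)"
    and norm_le_gauge: "\<exists>C>0. \<forall>u K. gauge Fam None u K \<longrightarrow> norm u \<le> C * K"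
begin

abbreviation g :: "'o option \<Rightarrow> 'a \<Rightarrow> real \<Rightarrow> bool" where "g \<equiv> gauge Fam"

lemma g_nonneg: "g q u K \<Longrightarrow> 0 \<le> K"
  by (simp add: gauge_def)

lemma g_mono:
  assumes "g q u K" "K \<le> L"
  shows "g q u L"
  unfolding gauge_def
proof (intro conjI allI impI)
  fix T c assume T: "(T, c) \<in> Fam q"
  then have "norm (T u) \<le> K * c" using assms(1) by (simp add: gauge_def)
  also have "\<dots> \<le> L * c" using assms(2) Fam_pos[OF T] by simp
  finally show "norm (T u) \<le> L * c" .
qed (use assms in \<open>simp add: gauge_def\<close>)

lemma g_add: "g q u K \<Longrightarrow> g q v L \<Longrightarrow> g q (u + v) (K + L)"
  unfolding gauge_def by (auto simp: linear_add[OF bounded_linear.linear[OF Fam_linear]] distrib_right intro!: norm_triangle_mono)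

lemma g_scale: "g q u K \<Longrightarrow> g q (c *\<^sub>R u) (\<bar>c\<bar> * K)"
  unfolding gauge_def by (auto simp: linear_scale[OF bounded_linear.linear[OF Fam_linear]] mult.assoc intro!: mult_left_mono)

lemma g_zero: "0 \<le> K \<Longrightarrow> g q 0 K"
  unfolding gauge_def using Fam_linear Fam_pos by (auto simp: linear_0[OF bounded_linear.linear[OF Fam_linear]] less_imp_le)

lemma g_None_zeroD: "g None u 0 \<Longrightarrow> u = 0"
  using norm_le_gauge by fastforce

lemma g_limit:
  assumes "u \<longlonglongrightarrow> v" "\<And>n. g q (u n) (K n)" "K \<longlonglongrightarrow> L"
  shows "g q v L"
  unfolding gauge_def
proof (intro conjI allI impI)
  show "0 \<le> L" using assms(2) by (intro LIMSEQ_le_const[OF assms(3)]) (auto simp: gauge_def)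
  fix T c assume T: "(T, c) \<in> Fam q"
  show "norm (T v) \<le> L * c"
    by (rule LIMSEQ_le[OF tendsto_norm[OF bounded_linear.tendsto[OF Fam_linear[OF T] assms(1)]] tendsto_mult_right[OF assms(3)]])
       (use assms(2) T in \<open>auto simp: gauge_def\<close>)
qed

lemma g_None_bounds:
  "\<exists>C\<ge>1. (\<forall>u. g None u (C * norm u)) \<and> (\<forall>u K. g None u K \<longrightarrow> norm u \<le> C * K)"
proof -
  obtain C1 C2 where C: "\<And>u. g None u (C1 * norm u)" "\<And>u K. g None u K \<Longrightarrow> norm u \<le> C2 * K"
    using gauge_le_norm norm_le_gauge by blast
  let ?C = "max 1 (max C1 C2)"
  have "g None u (?C * norm u)" for u by (rule g_mono[OF C(1)]) (simp add: mult_right_mono)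
  moreover have "norm u \<le> ?C * K" if "g None u K" for u K
    by (rule order_trans[OF C(2)[OF that]]) (use g_nonneg[OF that] in \<open>simp add: mult_right_mono\<close>)
  ultimately show ?thesis by (intro exI[of _ ?C]) simp
qed

section \<open>Decay bounds for linear and multilinear maps\<close>

definition good :: "('a \<times> real \<times> 'o option) list \<Rightarrow> bool" where
  "good ts \<longleftrightarrow> (\<forall>v k m. (v, k, m) \<in> set ts \<longrightarrow> g m v k)"

abbreviation tv :: "'a \<times> real \<times> 'o option \<Rightarrow> 'a" where "tv \<equiv> fst"
abbreviation tk :: "'a \<times> real \<times> 'o option \<Rightarrow> real" where "tk \<equiv> \<lambda>t. fst (snd t)"
abbreviation tm :: "'a \<times> real \<times> 'o option \<Rightarrow> 'o option" where "tm \<equiv> \<lambda>t. snd (snd t)"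

lemma good_Nil [simp]: "good []" by (simp add: good_def)

lemma good_Cons [simp]: "good (t # ts) \<longleftrightarrow> g (tm t) (tv t) (tk t) \<and> good ts"
  by (cases t) (auto simp: good_def)

lemma good_prod_nonneg: "good ts \<Longrightarrow> 0 \<le> prod_list (map tk ts)"
  by (induction ts) (auto dest: g_nonneg)

text \<open>Arguments are tagged by a bound and by the index of the norm that it refers to. Up to constants,
  \<open>MB j K\<close> bounds the decay norm by \<open>K\<close>, without reference to the support of the arguments.\<close>

definition MB :: "nat \<Rightarrow> real \<Rightarrow> ('a list \<Rightarrow> 'a) \<Rightarrow> bool" where
  "MB j K B \<longleftrightarrow> 0 \<le> K \<and> (\<forall>ts q. length ts = j \<and> good ts \<and> adm q (map tm ts) \<longrightarrow>
      g q (B (map tv ts)) (K * prod_list (map tk ts)))"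

definition dec :: "real \<Rightarrow> ('a \<Rightarrow> 'a) \<Rightarrow> bool" where
  "dec K B \<longleftrightarrow> linear B \<and> 0 \<le> K \<and> (\<forall>q u k. g q u k \<longrightarrow> g q (B u) (K * k))"

lemma MBD: "MB j K B \<Longrightarrow> length ts = j \<Longrightarrow> good ts \<Longrightarrow> adm q (map tm ts) \<Longrightarrow> g q (B (map tv ts)) (K * prod_list (map tk ts))"
  by (simp add: MB_def)

lemma MB_nonneg: "MB j K B \<Longrightarrow> 0 \<le> K"
  by (simp add: MB_def)

lemma MBI:
  assumes "0 \<le> K" "\<And>ts q. length ts = j \<Longrightarrow> good ts \<Longrightarrow> adm q (map tm ts) \<Longrightarrow> g q (B (map tv ts)) (K * prod_list (map tk ts))"
  shows "MB j K B"
  using assms by (simp add: MB_def)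

lemma MB_cong:
  assumes "MB j K B" "\<And>vs. length vs = j \<Longrightarrow> B vs = C vs"
  shows "MB j K C"
  using assms by (simp add: MB_def)

lemma MB_mono:
  assumes "MB j K B" "K \<le> L"
  shows "MB j L B"
proof (rule MBI)
  show "0 \<le> L" using MB_nonneg[OF assms(1)] assms(2) by simp
  fix ts q assume ts: "length ts = j" "good ts" "adm q (map tm ts)"
  show "g q (B (map tv ts)) (L * prod_list (map tk ts))"
    by (rule g_mono[OF MBD[OF assms(1) ts]]) (simp add: mult_right_mono good_prod_nonneg ts(2) assms(2))
qed

lemma MB_add: "MB j K B \<Longrightarrow> MB j L C \<Longrightarrow> MB j (K + L) (\<lambda>vs. B vs + C vs)"
  unfolding MB_def by (auto simp: distrib_right intro: g_add)

lemma MB_scale: "MB j K B \<Longrightarrow> MB j (\<bar>c\<bar> * K) (\<lambda>vs. c *\<^sub>R B vs)"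
  unfolding MB_def by (auto simp: mult.assoc intro: g_scale)

lemma MB_diff: "MB j K B \<Longrightarrow> MB j L C \<Longrightarrow> MB j (K + L) (\<lambda>vs. B vs - C vs)"
  using MB_add[of j K B L "\<lambda>vs. (-1) *\<^sub>R C vs"] MB_scale[of j L C "-1"] by simp

lemma MB_zero: "0 \<le> K \<Longrightarrow> MB j K (\<lambda>vs. 0)"
  by (intro MBI g_zero mult_nonneg_nonneg good_prod_nonneg)

lemma MB_sum_list:
  "(\<And>t. t \<in> set ts \<Longrightarrow> MB j (K t) (B t)) \<Longrightarrow> MB j (\<Sum>t\<leftarrow>ts. K t) (\<lambda>vs. \<Sum>t\<leftarrow>ts. B t vs)"
  by (induction ts) (simp_all add: MB_add MB_zero)

lemma MB_limit:
  assumes "\<And>vs. length vs = j \<Longrightarrow> (\<lambda>n. B n vs) \<longlonglongrightarrow> C vs" "\<And>n. MB j (K n) (B n)" "K \<longlonglongrightarrow> L"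
  shows "MB j L C"
proof (rule MBI)
  show "0 \<le> L" using assms(2) by (intro LIMSEQ_le_const[OF assms(3)]) (auto simp: MB_def)
  fix ts q assume ts: "length ts = j" "good ts" "adm q (map tm ts)"
  show "g q (C (map tv ts)) (L * prod_list (map tk ts))"
    by (rule g_limit[OF assms(1) MBD[OF assms(2) ts] tendsto_mult_right[OF assms(3)]]) (simp add: ts)
qed

lemma MB_zeroD:
  assumes "MB j 0 B" "length vs = j"
  shows "B vs = 0"
proof -
  obtain C where "C \<ge> 1" and C: "\<And>u. g None u (C * norm u)" and "\<And>u K. g None u K \<Longrightarrow> norm u \<le> C * K" using g_None_bounds by blast
  let ?ts = "map (\<lambda>v. (v, C * norm v, None)) vs"
  have "g None (B (map tv ?ts)) (0 * prod_list (map tk ?ts))"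
    using C assms(2) by (intro MBD[OF assms(1)]) (auto simp: good_def adm_None)
  then show ?thesis by (simp add: o_def g_None_zeroD)
qed

text \<open>The constant is chosen before \<open>K\<close> and \<open>B\<close> of the conclusion.
  This uniformity turns geometric bounds of type \<open>MB\<close> into the geometric norm bounds
  that a convergent series needs.\<close>

lemma MB_mbounded:
  assumes "MB j K B"
  shows "\<exists>c. 0 \<le> c \<and> (\<forall>K B. MB j K B \<longrightarrow> mbounded j B (c * K))"
proof -
  obtain C where C: "C \<ge> 1" "\<And>u. g None u (C * norm u)" "\<And>u K. g None u K \<Longrightarrow> norm u \<le> C * K" using g_None_bounds by blast
  have "norm (B vs) \<le> (C * C ^ j) * K * prod_list (map norm vs)" if B: "MB j K B" and vs: "length vs = j" for K B vs
  proof -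
    let ?ts = "map (\<lambda>v. (v, C * norm v, None)) vs"
    have "g None (B (map tv ?ts)) (K * prod_list (map tk ?ts))"
      using C vs by (intro MBD[OF B]) (auto simp: good_def adm_None)
    moreover have "prod_list (map (\<lambda>v. C * norm v) vs) = C ^ length vs * prod_list (map norm vs)"
      by (induction vs) auto
    ultimately have "g None (B vs) (K * (C ^ j * prod_list (map norm vs)))" using vs by (simp add: o_def)
    from C(3)[OF this] show ?thesis by (simp add: mult_ac)
  qed
  then show ?thesis using C(1) by (intro exI[of _ "C * C ^ j"]) (auto simp: mbounded_def MB_def)
qed

lemma dec_linear: "dec K B \<Longrightarrow> linear B" by (simp add: dec_def)
lemma dec_nonneg: "dec K B \<Longrightarrow> 0 \<le> K" by (simp add: dec_def)
lemma decD: "dec K B \<Longrightarrow> g q u k \<Longrightarrow> g q (B u) (K * k)" by (simp add: dec_def)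

lemma dec_mono:
  assumes "dec K B" "K \<le> L"
  shows "dec L B"
  unfolding dec_def
proof (intro conjI allI impI)
  fix q u k assume u: "g q u k"
  show "g q (B u) (L * k)"
    by (rule g_mono[OF decD[OF assms(1) u]]) (rule mult_right_mono[OF assms(2) g_nonneg[OF u]])
qed (use assms dec_nonneg dec_linear in force)+

lemma dec_bounded_linear:
  assumes "dec K B"
  shows "bounded_linear B"
proof -
  obtain C where "C \<ge> 1" and C: "\<And>u. g None u (C * norm u)" "\<And>u K. g None u K \<Longrightarrow> norm u \<le> C * K" using g_None_bounds by blast
  have "norm (B u) \<le> norm u * (C * K * C)" for u
    using C(2)[OF decD[OF assms C(1)[of u]]] by (simp add: mult_ac)
  then show ?thesis using dec_linear[OF assms] by (intro bounded_linear_intro[where K = "C * K * C"]) (auto simp: linear_add linear_scale)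
qed

lemma dec_id: "dec 1 (\<lambda>x. x)" by (simp add: dec_def linear_id[unfolded id_def])

lemma dec_compose: "dec K B \<Longrightarrow> dec L C \<Longrightarrow> dec (K * L) (\<lambda>x. B (C x))"
  unfolding dec_def by (auto simp: mult.assoc intro: linear_compose[unfolded o_def])

lemma dec_add: "dec K B \<Longrightarrow> dec L C \<Longrightarrow> dec (K + L) (\<lambda>x. B x + C x)"
  unfolding dec_def by (auto simp: distrib_right intro: g_add linear_compose_add)

lemma dec_scale: "dec K B \<Longrightarrow> dec (\<bar>c\<bar> * K) (\<lambda>x. c *\<^sub>R B x)"
  unfolding dec_def by (auto simp: mult.assoc intro: g_scale linear_compose_scale_right)

lemma dec_funpow: "dec K B \<Longrightarrow> dec (K ^ n) (B ^^ n)"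
proof (induction n)
  case 0
  then show ?case using dec_id by (simp add: id_def)
next
  case (Suc n)
  then show ?case using dec_compose[of K B "K ^ n" "B ^^ n"] by (simp add: o_def)
qed

lemma MB_dec: "MB j K B \<Longrightarrow> dec a A \<Longrightarrow> MB j (a * K) (\<lambda>vs. A (B vs))"
  unfolding MB_def dec_def by (auto simp: mult.assoc)

lemma dec_MB: "dec K B \<Longrightarrow> MB 1 K (\<lambda>vs. B (hd vs))"
  unfolding MB_def dec_def by (auto simp: length_Suc_conv)

lemma MB_imp_dec:
  assumes "MB 1 K (\<lambda>vs. B (hd vs))" "linear B"
  shows "dec K B"
  unfolding dec_def
proof (intro conjI allI impI)
  fix q u k assume "g q u k"
  then show "g q (B u) (K * k)" using MBD[OF assms(1), of "[(u, k, q)]" q] by (cases q) auto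
qed (use assms in \<open>auto simp: MB_def\<close>)

lemma MB_slot:
  assumes B: "MB j K B" and A: "dec a A" and i: "i < j"
  shows "MB j (a * K) (\<lambda>vs. B (vs[i := A (vs ! i)]))"
proof (rule MBI)
  show "0 \<le> a * K" using MB_nonneg[OF B] dec_nonneg[OF A] by simp
  fix ts q assume ts: "length ts = j" "good ts" "adm q (map tm ts)"
  let ?ts = "ts[i := (A (tv (ts ! i)), a * tk (ts ! i), tm (ts ! i))]"
  have gi: "g (tm t) (tv t) (tk t)" if "t \<in> set ts" for t
    using ts(2) that by (cases t) (auto simp: good_def)
  have "good ?ts"
    unfolding good_def
  proof (intro allI impI)
    fix v k m assume "(v, k, m) \<in> set ?ts"
    then have "(v, k, m) = (A (tv (ts ! i)), a * tk (ts ! i), tm (ts ! i)) \<or> (v, k, m) \<in> set ts"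
      using set_update_subset_insert by fastforce
    then show "g m v k"
      using decD[OF A gi[OF nth_mem]] i ts(1) gi[of "(v, k, m)"] by auto
  qed
  moreover have "map tv ?ts = (map tv ts)[i := A (map tv ts ! i)]" "map tm ?ts = map tm ts"
    "map tk ?ts = (map tk ts)[i := a * map tk ts ! i]"
    using i ts(1) by (auto simp: map_update list_update_same_conv)
  ultimately show "g q (B ((map tv ts)[i := A (map tv ts ! i)])) (a * K * prod_list (map tk ts))"
    using MBD[OF B, of ?ts q] ts i prod_list_update[of i "map tk ts" a] by (simp add: mult_ac)
qed

lemma fdb_term_MB:
  assumes F: "\<And>k. k \<le> j \<Longrightarrow> MB k (cF k) (D_at F (G x))"
    and G: "\<And>k. 1 \<le> k \<Longrightarrow> k \<le> j \<Longrightarrow> MB k (cG k) (D_at G x)"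
    and \<pi>: "\<pi> \<in> set (parts ts)" "length ts = j" and ts: "good ts" "adm q (map tm ts)"
  shows "g q (fdb_term F G (map (map tv) \<pi>) x) (cF (length \<pi>) * prod_list (map (\<lambda>b. cG (length b)) \<pi>) * prod_list (map tk ts))"
proof -
  \<comment> \<open>A block becomes one tagged argument of the outer derivative: its value, the
    bound from the inner derivative, and the index inherited from its members.\<close>
  let ?t = "\<lambda>b. (nth_deriv G (map tv b) x, cG (length b) * prod_list (map tk b), omark (map tm b))"
  have sub: "set b \<subseteq> set ts" if "b \<in> set \<pi>" for b
    using \<pi>(1) that
  proof (induction ts arbitrary: \<pi> b)
    case (Cons h ts)
    from Cons.prems(1) show ?case
    proof (cases rule: parts_ConsE)
      case (1 \<rho>)
      then show ?thesis using Cons by fastforce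
    next
      case (2 \<rho> i)
      then have "b = h # \<rho> ! i \<or> b \<in> set \<rho>" using Cons.prems(2) set_update_subset_insert by fastforce
      then show ?thesis using Cons.IH[OF 2(1)] nth_mem[OF 2(2)] by fastforce
    qed
  qed simp
  have gb: "good b" if "b \<in> set \<pi>" for b using ts(1) sub[OF that] by (auto simp: good_def)
  have "g (omark (map tm b)) (nth_deriv G (map tv b) x) (cG (length b) * prod_list (map tk b))" if "b \<in> set \<pi>" for b
    using parts_block_length[OF \<pi>(1) that] \<pi>(2) adm_parts[OF \<pi>(1) ts(2)] gb[OF that] that
    by (intro MBD[OF G]) (simp_all add: Suc_le_eq)
  then have "good (map ?t \<pi>)" by (auto simp: good_def)
  moreover have "adm q (map tm (map ?t \<pi>))" using adm_parts[OF \<pi>(1) ts(2)] by (simp add: o_def)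
  moreover have "prod_list (map tk (map ?t \<pi>)) = prod_list (map (\<lambda>b. cG (length b)) \<pi>) * prod_list (map (\<lambda>b. prod_list (map tk b)) \<pi>)"
    by (induction \<pi>) (auto simp: mult_ac)
  moreover have "prod_list (map (\<lambda>b. prod_list (map tk b)) \<pi>) = prod_list (map tk ts)" by (rule parts_prod[OF \<pi>(1)])
  moreover have "length \<pi> \<le> j" using parts_length[OF \<pi>(1)] \<pi>(2) by simp
  moreover have "map tv (map ?t \<pi>) = map (\<lambda>b. nth_deriv G b x) (map (map tv) \<pi>)" by simp
  ultimately show ?thesis using MBD[OF F, of "length \<pi>" "map ?t \<pi>" q] by (simp only: length_map mult.assoc)
qed

text \<open>Bounds on \<open>G\<close> start at order 1 because blocks are nonempty. The constant is
  a sum over the partitions of \<open>[0..<j]\<close>, hence the same for all directions.\<close>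

lemma MB_fdb:
  assumes F: "\<And>k. k \<le> j \<Longrightarrow> MB k (cF k) (D_at F (G x))"
    and G: "\<And>k. 1 \<le> k \<Longrightarrow> k \<le> j \<Longrightarrow> MB k (cG k) (D_at G x)"
  shows "MB j (\<Sum>\<pi>\<leftarrow>parts [0..<j]. cF (length \<pi>) * prod_list (map (\<lambda>b. cG (length b)) \<pi>))
     (\<lambda>vs. \<Sum>\<pi>\<leftarrow>parts vs. fdb_term F G \<pi> x)"
proof (rule MBI)
  show "0 \<le> (\<Sum>\<pi>\<leftarrow>parts [0..<j]. cF (length \<pi>) * prod_list (map (\<lambda>b. cG (length b)) \<pi>))"
  proof (rule sum_list_nonneg)
    fix c assume "c \<in> set (map (\<lambda>\<pi>. cF (length \<pi>) * prod_list (map (\<lambda>b. cG (length b)) \<pi>)) (parts [0..<j]))"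
    then obtain \<pi> where \<pi>: "\<pi> \<in> set (parts [0..<j])" "c = cF (length \<pi>) * prod_list (map (\<lambda>b. cG (length b)) \<pi>)" by auto
    have "0 \<le> cF (length \<pi>)" using parts_length[OF \<pi>(1)] by (intro MB_nonneg[OF F]) auto
    moreover have "0 \<le> cG (length b)" if "b \<in> set \<pi>" for b
      using parts_block_length[OF \<pi>(1) that] by (intro MB_nonneg[OF G]) (simp_all add: Suc_le_eq)
    ultimately show "0 \<le> c" unfolding \<pi>(2) by (auto intro!: mult_nonneg_nonneg prod_list_nonneg)
  qed
  fix ts q assume ts: "length ts = j" "good ts" "adm q (map tm ts)"
  let ?f = "\<lambda>ls. cF (length ls) * prod_list (map cG ls)"
  have *: "(\<And>\<pi>. \<pi> \<in> set \<pi>s \<Longrightarrow> g q (f \<pi>) (k \<pi> * p)) \<Longrightarrow> g q (\<Sum>\<pi>\<leftarrow>\<pi>s. f \<pi>) ((\<Sum>\<pi>\<leftarrow>\<pi>s. k \<pi>) * p)"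
    for f :: "'c \<Rightarrow> 'a" and k \<pi>s and p :: real
    by (induction \<pi>s) (auto simp: distrib_right g_zero intro: g_add)
  have "g q (\<Sum>\<pi>\<leftarrow>parts ts. fdb_term F G (map (map tv) \<pi>) x)
     ((\<Sum>\<pi>\<leftarrow>parts ts. cF (length \<pi>) * prod_list (map (\<lambda>b. cG (length b)) \<pi>)) * prod_list (map tk ts))"
    by (intro * fdb_term_MB[where j = j, OF F G _ ts])
  moreover have "(\<Sum>\<pi>\<leftarrow>parts ts. cF (length \<pi>) * prod_list (map (\<lambda>b. cG (length b)) \<pi>))
      = (\<Sum>\<pi>\<leftarrow>parts [0..<j]. cF (length \<pi>) * prod_list (map (\<lambda>b. cG (length b)) \<pi>))"
    using sum_list_parts_shape[of ?f ts] ts(1) by (simp add: o_def)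
  moreover have "(\<Sum>\<pi>\<leftarrow>parts ts. fdb_term F G (map (map tv) \<pi>) x) = (\<Sum>\<pi>\<leftarrow>parts (map tv ts). fdb_term F G \<pi> x)"
    by (simp add: parts_map o_def)
  ultimately show "g q (\<Sum>\<pi>\<leftarrow>parts (map tv ts). fdb_term F G \<pi> x)
     ((\<Sum>\<pi>\<leftarrow>parts [0..<j]. cF (length \<pi>) * prod_list (map (\<lambda>b. cG (length b)) \<pi>)) * prod_list (map tk ts))" by simp
qed

text \<open>A gauge is a family of seminorms, one for each functional \<open>T\<close> and scaled by
  its weight, so the ordinary mean value inequality is applied to each \<open>T\<close>.\<close>

lemma g_mvt:
  fixes f :: "real \<Rightarrow> 'a"
  assumes f: "\<And>t. 0 \<le> t \<Longrightarrow> t \<le> 1 \<Longrightarrow> (f has_vector_derivative f' t) (at t)"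
    and K: "\<And>t. 0 \<le> t \<Longrightarrow> t \<le> 1 \<Longrightarrow> g q (f' t) K"
  shows "g q (f 1 - f 0) K"
  unfolding gauge_def
proof (intro conjI allI impI)
  show "0 \<le> K" using K[of 0] by (simp add: gauge_def)
  fix T c assume T: "(T, c) \<in> Fam q"
  interpret T: bounded_linear T using T by (rule Fam_linear)
  have "norm (T (f 1) - T (f 0)) \<le> (K * c) * norm (1 - 0 :: real)"
  proof (rule differentiable_bound[of "{0..1}" _ "\<lambda>t h. h *\<^sub>R T (f' t)"])
    fix t :: real assume t: "t \<in> {0..1}"
    have "((\<lambda>t. T (f t)) has_derivative (\<lambda>h. T (h *\<^sub>R f' t))) (at t)"
      using f[of t] t by (intro T.has_derivative) (auto simp: has_vector_derivative_def)
    then show "((\<lambda>t. T (f t)) has_derivative (\<lambda>h. h *\<^sub>R T (f' t))) (at t within {0..1})"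
      by (simp add: T.scaleR has_derivative_at_withinI)
    have "norm (T (f' t)) \<le> K * c" using K[of t] t T by (auto simp: gauge_def)
    then show "onorm (\<lambda>h. h *\<^sub>R T (f' t)) \<le> K * c"
      by (intro onorm_le) (simp add: mult.commute[of "K * c"] mult_left_mono)
  qed auto
  then show "norm (T (f 1 - f 0)) \<le> K * c" by (simp add: T.diff)
qed

text \<open>Integration along the segment from 0 to \<open>x\<close>. The additional argument
  \<open>x\<close> is measured with index \<open>None\<close> and bound \<open>\<rho>\<close>, so it
  leaves the indices of the others admissible and contributes one power of
  \<open>\<rho>\<close>.\<close>

lemma MB_increment:
  assumes F: "smooth r V F" and s: "s < r" and star: "\<And>t y. y \<in> V \<Longrightarrow> 0 \<le> t \<Longrightarrow> t \<le> 1 \<Longrightarrow> t *\<^sub>R y \<in> V"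
    and bd: "\<And>y \<rho>. y \<in> V \<Longrightarrow> g None y \<rho> \<Longrightarrow> MB (Suc s) (C * \<rho> ^ k) (D_at F y)"
    and x: "x \<in> V" "g None x \<rho>"
  shows "MB s (C * \<rho> ^ Suc k) (\<lambda>vs. D_at F x vs - D_at F 0 vs)"
proof (rule MBI)
  have C: "0 \<le> C * \<rho> ^ k" using MB_nonneg[OF bd[OF x]] .
  show "0 \<le> C * \<rho> ^ Suc k" using mult_nonneg_nonneg[OF C g_nonneg[OF x(2)]] by (simp only: power_Suc mult_ac)
  fix ts q assume ts: "length ts = s" "good ts" "adm q (map tm ts)"
  let ?p = "prod_list (map tk ts)"
  have "g q (nth_deriv F (map tv ts) (1 *\<^sub>R x) - nth_deriv F (map tv ts) (0 *\<^sub>R x)) (C * \<rho> ^ Suc k * ?p)"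
  proof (rule g_mvt)
    fix t :: real assume t: "0 \<le> t" "t \<le> 1"
    have tx: "t *\<^sub>R x \<in> V" by (rule star[OF x(1) t])
    have g: "g None (t *\<^sub>R x) \<rho>"
      by (rule g_mono[OF g_scale[OF x(2)]]) (use t g_nonneg[OF x(2)] in \<open>simp add: mult_left_le_one_le\<close>)
    have d: "(nth_deriv F (map tv ts) has_derivative (\<lambda>h. nth_deriv F (h # map tv ts) (t *\<^sub>R x))) (at (t *\<^sub>R x))"
      using ts(1) s by (intro smooth_deriv[OF F tx]) simp
    have "((\<lambda>t. nth_deriv F (map tv ts) (t *\<^sub>R x)) has_derivative (\<lambda>h. nth_deriv F (h *\<^sub>R x # map tv ts) (t *\<^sub>R x))) (at t)"
      by (rule has_derivative_compose[where g = "nth_deriv F (map tv ts)" and f = "\<lambda>t. t *\<^sub>R x"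
            and f' = "\<lambda>h. h *\<^sub>R x", OF _ d]) (auto intro!: derivative_eq_intros)
    then show "((\<lambda>t. nth_deriv F (map tv ts) (t *\<^sub>R x)) has_vector_derivative nth_deriv F (x # map tv ts) (t *\<^sub>R x)) (at t)"
      unfolding has_vector_derivative_def by (simp add: linear_scale[OF has_derivative_linear[OF d]])
    show "g q (nth_deriv F (x # map tv ts) (t *\<^sub>R x)) (C * \<rho> ^ Suc k * ?p)"
      using MBD[OF bd[OF tx g], of "(x, \<rho>, None) # ts" q] ts x(2) by (simp add: mult_ac)
  qed
  then show "g q (D_at F x (map tv ts) - D_at F 0 (map tv ts)) (C * \<rho> ^ Suc k * ?p)" by simp
qed

end


section \<open>Homogeneous polynomials\<close>

text \<open>The derivatives of \<open>x \<mapsto> B(x, \<dots>, x)\<close> in directions \<open>vs\<close> are sums over all placements of \<open>vs\<close> in the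
  \<open>j\<close> slots of \<open>B\<close>; the empty slots \<open>None\<close> are filled with \<open>x\<close>.\<close>

primrec fill :: "nat \<Rightarrow> 'x list \<Rightarrow> 'x option list list" where
  "fill j [] = [replicate j None]"
| "fill j (h # vs) = concat (map (\<lambda>L. map (\<lambda>i. L[i := Some h]) (filter (\<lambda>i. L ! i = None) [0..<length L])) (fill j vs))"

definition plug :: "'x \<Rightarrow> 'x option list \<Rightarrow> 'x list" where
  "plug x = map (case_option x (\<lambda>v. v))"

lemma fill_map: "fill j (map f vs) = map (map (map_option f)) (fill j vs)"
proof (induction vs)
  case (Cons h vs)
  have "filter (\<lambda>i. map (map_option f) L ! i = None) [0..<length L] = filter (\<lambda>i. L ! i = None) [0..<length L]" for L
    by (rule filter_cong) auto
  then show ?case using Cons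
    by (simp add: map_concat o_def) (intro arg_cong[where f = concat] map_cong refl; auto simp: map_update)
qed (simp add: map_replicate_const)

lemma fill_ConsE:
  assumes "L' \<in> set (fill j (h # vs))"
  obtains L i where "L \<in> set (fill j vs)" "i < length L" "L ! i = None" "L' = L[i := Some h]"
  using assms by auto

lemma fill_length: "L \<in> set (fill j vs) \<Longrightarrow> length L = j"
proof (induction vs arbitrary: L)
  case (Cons h vs)
  from Cons.prems obtain L0 i where "L0 \<in> set (fill j vs)" "L = L0[i := Some h]" by (rule fill_ConsE)
  then show ?case using Cons.IH by simp
qed simp

lemma fill_mset: "L \<in> set (fill j vs) \<Longrightarrow> mset L = image_mset Some (mset vs) + replicate_mset (j - length vs) None \<and> length vs \<le> j"
proof (induction vs arbitrary: L)
  case (Cons h vs)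
  from Cons.prems obtain L0 i where L: "L0 \<in> set (fill j vs)" "i < length L0" "L0 ! i = None" "L = L0[i := Some h]" by (rule fill_ConsE)
  have m: "mset L0 = image_mset Some (mset vs) + replicate_mset (j - length vs) None" "length vs \<le> j" using Cons.IH[OF L(1)] by auto
  have "None \<in># mset L0" using L(2,3) by (metis nth_mem_mset)
  then have "j - length vs \<noteq> 0" using m by (auto simp: image_iff)
  then obtain d where d: "j - length vs = Suc d" by (cases "j - length vs") auto
  then have "j - length (h # vs) = d" "length (h # vs) \<le> j" using m(2) by auto
  moreover have "mset L = mset L0 - {#None#} + {#Some h#}" using L by (simp add: mset_update)
  ultimately show ?case using m d by simp
qed simp

text \<open>For \<open>length vs = j\<close> there are \<open>fact j\<close> placements, which
  cancels the factor \<open>1 / fact q\<close> in \<open>normal_form\<close>.\<close>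

lemma fill_count: "length vs \<le> j \<Longrightarrow> length (fill j vs) * fact (j - length vs) = fact j"
proof (induction vs)
  case (Cons h vs)
  have "length (filter (\<lambda>i. L ! i = None) [0..<length L]) = j - length vs" if "L \<in> set (fill j vs)" for L
  proof -
    have "length (filter (\<lambda>i. L ! i = None) [0..<length L]) = length (filter (\<lambda>m. m = None) (map ((!) L) [0..<length L]))"
      by (simp add: filter_map o_def)
    also have "\<dots> = size (filter_mset (\<lambda>m. m = None) (mset L))" by (metis map_nth mset_filter size_mset)
    also have "\<dots> = j - length vs"
    proof -
      have "filter_mset (\<lambda>m. m = None) (replicate_mset d (None :: 'a option)) = replicate_mset d None" for d
        by (induction d) auto
      then show ?thesis using fill_mset[OF that] by (simp add: filter_mset_image_mset)
    qed
    finally show ?thesis .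
  qed
  then have "length (fill j (h # vs)) = length (fill j vs) * (j - length vs)"
    by (simp add: length_concat o_def sum_list_triv cong: map_cong)
  moreover have "(j - length vs) * fact (j - Suc (length vs)) = (fact (j - length vs) :: nat)"
    using Cons.prems by (simp add: fact_reduce)
  ultimately show ?case using Cons by (simp add: mult.assoc)
qed simp

text \<open>With as many directions as slots every placement is a permutation of \<open>vs\<close>;
  a symmetric form takes the same value on all of them.\<close>

lemma fill_full:
  assumes "L \<in> set (fill (length vs) vs)"
  shows "plug x L = map the L" "mset (map the L) = mset vs"
proof -
  have m: "mset L = image_mset Some (mset vs)" using fill_mset[OF assms] by simp
  have "\<forall>m\<in>set L. m \<noteq> None" using m by (metis (no_types, lifting) imageE option.distinct(1) set_image_mset set_mset_mset)
  then show "plug x L = map the L" unfolding plug_def by (intro map_cong) (auto split: option.split)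
  have "mset (map the L) = image_mset the (mset L)" by simp
  also have "\<dots> = mset vs" unfolding m by (simp add: multiset.map_comp o_def)
  finally show "mset (map the L) = mset vs" .
qed

lemma fill_None:
  assumes "L \<in> set (fill j vs)" "length vs < j"
  shows "None \<in> set L"
proof -
  have "None \<in># mset L" using fill_mset[OF assms(1)] assms(2) by simp
  then show ?thesis by simp
qed

lemma plug_length [simp]: "length (plug x L) = length L"
  by (simp add: plug_def)

lemma famdiff_const:
  fixes H :: "'b::real_normed_vector list \<Rightarrow> 'c::real_normed_vector"
  assumes "multilinear_map j H" "mbounded j H c"
  shows "famdiff j (\<lambda>_::'a::real_normed_vector. H) (\<lambda>_ _. 0) x"
  unfolding famdiff_def
proof (intro conjI allI impI)
  show "\<exists>c\<ge>0. \<forall>h. mbounded j (\<lambda>_. 0 :: 'c) (c * norm (h :: 'a))"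
    by (rule exI[of _ 0]) (simp add: mbounded_def)
  show "\<forall>\<^sub>F y in nhds x. \<forall>zs. length zs = j \<longrightarrow> norm (H zs - H zs - 0) \<le> e * norm (y - x) * prod_list (map norm zs)"
    if "e > 0" for e
    using that prod_list_norm_nonneg[where 'a = 'b] by simp
qed (use assms in \<open>auto simp: multilinear_zero linearI\<close>)

text \<open>The form is constant and its arguments are either the identity, in the empty slots, or
  constants. Only the empty slots contribute to the product rule, which is the recursion of
  \<open>fill\<close>.\<close>

lemma plug_has_derivative:
  fixes H :: "'a::real_normed_vector list \<Rightarrow> 'b::real_normed_vector"
  assumes H: "multilinear_map j H" "mbounded j H c" and L: "length L = j"
  shows "((\<lambda>x. H (plug x L)) has_derivative
    (\<lambda>h. \<Sum>i\<leftarrow>filter (\<lambda>i. L ! i = None) [0..<length L]. H (plug x (L[i := Some h])))) (at x)"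
proof -
  define ws :: "(('a \<Rightarrow> 'a) \<times> ('a \<Rightarrow> 'a)) list" where
    "ws = map (case_option (\<lambda>x. x, \<lambda>h. h) (\<lambda>v. (\<lambda>_. v, \<lambda>_. 0))) L"
  have len: "length ws = j" by (simp add: ws_def L)
  have ev: "map (\<lambda>(w, w'). w y) ws = plug y L" for y
    by (auto simp: ws_def plug_def split: option.split)
  have "((\<lambda>x. H (map (\<lambda>(w, w'). w x) ws)) has_derivative
    (\<lambda>h. 0 + (\<Sum>i<length ws. H ((map (\<lambda>(w, w'). w x) ws)[i := snd (ws ! i) h])))) (at x)"
    by (rule famdiff_apply_list) (auto simp: len famdiff_const[OF H], auto simp: ws_def split: option.splits)
  moreover have "(\<Sum>i<j. H ((plug x L)[i := snd (ws ! i) h])) =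
     (\<Sum>i\<leftarrow>filter (\<lambda>i. L ! i = None) [0..<length L]. H (plug x (L[i := Some h])))" for h
  proof -
    have *: "H ((plug x L)[i := snd (ws ! i) h]) = (if L ! i = None then H (plug x (L[i := Some h])) else 0)" if i: "i < j" for i
    proof (cases "L ! i")
      case None
      then show ?thesis using i L by (simp add: ws_def plug_def map_update)
    next
      case (Some v)
      have "H ((plug x L)[i := 0]) = 0"
        using i L by (intro multilinear_map_zero[OF H(1)]) (auto simp: set_update_memI)
      then show ?thesis using Some i L by (simp add: ws_def)
    qed
    have "(\<Sum>i<j. H ((plug x L)[i := snd (ws ! i) h])) = (\<Sum>i\<in>{..<j}. if L ! i = None then H (plug x (L[i := Some h])) else 0)"
      by (rule sum.cong) (use * in auto)
    also have "\<dots> = (\<Sum>i\<in>set (filter (\<lambda>i. L ! i = None) [0..<length L]). H (plug x (L[i := Some h])))"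
      by (subst sum.inter_filter[symmetric]) (auto simp: L intro: sum.cong)
    also have "\<dots> = (\<Sum>i\<leftarrow>filter (\<lambda>i. L ! i = None) [0..<length L]. H (plug x (L[i := Some h])))"
      by (subst sum_list_distinct_conv_sum_set) auto
    finally show ?thesis .
  qed
  ultimately show ?thesis by (simp add: ev len)
qed

lemma poly_eqc:
  fixes H :: "'a::real_normed_vector list \<Rightarrow> 'b::real_normed_vector"
  assumes H: "multilinear_map j H" "mbounded j H C"
  shows "eqc s (\<lambda>x vs. \<Sum>L\<leftarrow>fill j vs. H (plug x L)) x"
  unfolding eqc_def
proof (intro allI impI, elim conjE)
  fix Y :: "nat \<Rightarrow> 'a" and VS :: "nat \<Rightarrow> 'a list" and c
  assume Y: "Y \<longlonglongrightarrow> x" and VS0: "\<forall>n. length (VS n) = s \<and> (\<forall>v\<in>set (VS n). norm v \<le> c)"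
  have VS: "length (VS n) = s" "\<And>i. i < s \<Longrightarrow> norm (VS n ! i) \<le> c" for n
    using VS0[rule_format, of n] by auto
  obtain K where K: "\<And>n. norm (Y n) \<le> K" using convergent_imp_Bseq[OF convergentI[OF Y]] unfolding Bseq_def by blast
  have Kx: "norm x \<le> K" by (rule LIMSEQ_le_const2[OF tendsto_norm[OF Y]]) (use K in auto)
  let ?L = "\<lambda>n. map (map_option ((!) (VS n)))"
  have eqH: "eqc j (\<lambda>_::'a. H) x" by (simp add: eqc_def)
  have "(\<lambda>n. H (plug (Y n) (?L n L)) - H (plug x (?L n L))) \<longlonglongrightarrow> 0" if L: "L \<in> set (fill j [0..<s])" for L
  proof -
    have lL: "length L = j" by (rule fill_length[OF L])
    have m: "i < s" if "Some i \<in> set L" for i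
    proof -
      have "Some i \<in># mset L" using that by simp
      then show ?thesis using fill_mset[OF L] by (auto split: if_splits)
    qed
    have bd: "norm z \<le> max K c" if "z \<in> set (plug y (?L n L))" "norm y \<le> K" for z y n
      using that m VS(2) by (auto simp: plug_def le_max_iff_disj split: option.splits)
    show ?thesis
    proof (rule eqc_apply[OF eqH H Y, where M = "max K c"])
      fix i assume i: "i < j"
      have "(\<lambda>n. Y n - x) \<longlonglongrightarrow> 0" using Y by (simp add: LIM_zero_iff)
      then show "(\<lambda>n. plug (Y n) (?L n L) ! i - plug x (?L n L) ! i) \<longlonglongrightarrow> 0"
        using i lL by (cases "L ! i") (auto simp: plug_def)
    qed (use lL bd K Kx in auto)
  qed
  from tendsto_sum_list_zero[of "fill j [0..<s]", OF this]
  have "(\<lambda>n. \<Sum>L\<leftarrow>fill j [0..<s]. H (plug (Y n) (?L n L)) - H (plug x (?L n L))) \<longlonglongrightarrow> 0" .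
  moreover have "(\<Sum>L\<leftarrow>fill j (VS n). H (plug y L)) = (\<Sum>L\<leftarrow>fill j [0..<s]. H (plug y (?L n L)))" for n y
  proof -
    have "fill j (VS n) = fill j (map ((!) (VS n)) [0..<s])" using map_nth[of "VS n"] VS(1)[of n] by simp
    then show ?thesis by (simp add: fill_map o_def)
  qed
  ultimately show "(\<lambda>n. (\<Sum>L\<leftarrow>fill j (VS n). H (plug (Y n) L)) - (\<Sum>L\<leftarrow>fill j (VS n). H (plug x L))) \<longlonglongrightarrow> 0"
    by (simp add: sum_list_diff)
qed

context gauged
begin

text \<open>Empty slots hold \<open>x\<close> with bound 1 and index \<open>None\<close>. They
  affect neither the product of the bounds nor the admissibility, so each placement is bounded by
  \<open>K\<close> and the constant counts placements.\<close>

lemma MB_fill: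
  assumes H: "MB j K H" and x: "g None x \<rho>" "\<rho> \<le> 1"
  shows "MB s (real (length (fill j [0..<s])) * K) (\<lambda>vs. \<Sum>L\<leftarrow>fill j vs. H (plug x L))"
proof (rule MBI)
  show "0 \<le> real (length (fill j [0..<s])) * K" using MB_nonneg[OF H] by simp
  fix ts q assume ts: "length ts = s" "good ts" "adm q (map tm ts)"
  have x1: "g None x 1" by (rule g_mono[OF x])
  have *: "good (plug (x, 1, None) L) \<and> adm q (map tm (plug (x, 1, None) L)) \<and>
      prod_list (map tk (plug (x, 1, None) L)) = prod_list (map tk ts)"
    if "L \<in> set (fill j ts)" for L
    using that ts(2,3) unfolding ts(1)[symmetric]
  proof (induction ts arbitrary: L q)
    case Nil
    then show ?case by (auto simp: plug_def good_def adm_None x1 map_replicate_const prod_list_replicate)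
  next
    case (Cons t ts)
    from Cons.prems(1) obtain L0 i where L: "L0 \<in> set (fill j ts)" "i < length L0" "L0 ! i = None" "L = L0[i := Some t]"
      by (rule fill_ConsE)
    have gt: "g (tm t) (tv t) (tk t)" "good ts" using Cons.prems(2) by auto
    have pl: "plug (x, 1, None) L = (plug (x, 1, None) L0)[i := t]" using L by (simp add: plug_def map_update)
    have pi: "plug (x, 1, None) L0 ! i = (x, 1, None)" using L by (simp add: plug_def)
    have "\<exists>q'. adm q' (map tm ts)" using Cons.prems(3) by auto
    then have IH: "good (plug (x, 1, None) L0)" "prod_list (map tk (plug (x, 1, None) L0)) = prod_list (map tk ts)"
      using Cons.IH[OF L(1) gt(2)] by blast+
    have "good (plug (x, 1, None) L)"
      unfolding pl good_def
    proof (intro allI impI)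
      fix v k m assume "(v, k, m) \<in> set ((plug (x, 1, None) L0)[i := t])"
      then have "(v, k, m) = t \<or> (v, k, m) \<in> set (plug (x, 1, None) L0)" using set_update_subset_insert by fastforce
      then show "g m v k" using gt(1) IH(1) by (auto simp: good_def)
    qed
    moreover have "prod_list (map tk (plug (x, 1, None) L)) = prod_list (map tk (t # ts))"
      using prod_list_update[of i "map tk (plug (x, 1, None) L0)" "tk t"] L(2) IH(2) pi
      by (simp add: pl map_update)
    moreover have "adm q (map tm (plug (x, 1, None) L))"
    proof (cases "tm t")
      case None
      then have "adm q (map tm ts)" using Cons.prems(3) by simp
      then have "adm q (map tm (plug (x, 1, None) L0))" using Cons.IH[OF L(1) gt(2)] by blast
      moreover have "map tm (plug (x, 1, None) L) = map tm (plug (x, 1, None) L0)"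
        using None pi L(2) by (simp add: pl map_update list_update_same_conv)
      ultimately show ?thesis by simp
    next
      case (Some l)
      then have "adm None (map tm ts)" "q = tm t" using Cons.prems(3) by auto
      then have "adm None (map tm (plug (x, 1, None) L0))" "q = tm t" using Cons.IH[OF L(1) gt(2)] by blast+
      then show ?thesis using adm_None_update[of "map tm (plug (x, 1, None) L0)" i q] L(2) by (simp add: pl map_update)
    qed
    ultimately show ?case by blast
  qed
  have "g q (H (plug x (map (map_option tv) L))) (K * prod_list (map tk ts))" if L: "L \<in> set (fill j ts)" for L
  proof -
    have "map tv (plug (x, 1, None) L) = plug x (map (map_option tv) L)"
      by (auto simp: plug_def split: option.split)
    then show ?thesis using MBD[OF H, of "plug (x, 1, None) L" q] *[OF L] fill_length[OF L] by simp
  qed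
  then have sum: "g q (\<Sum>L\<leftarrow>Ls. H (plug x (map (map_option tv) L))) (real (length Ls) * K * prod_list (map tk ts))"
    if "set Ls \<subseteq> set (fill j ts)" for Ls
    using that by (induction Ls) (auto simp: g_zero distrib_right intro: g_add)
  have "length (fill j ts) = length (fill j [0..<s])"
    using fill_map[of j "(!) ts" "[0..<s]"] map_nth[of ts] ts(1) by (metis length_map)
  then show "g q (\<Sum>L\<leftarrow>fill j (map tv ts). H (plug x L)) (real (length (fill j [0..<s])) * K * prod_list (map tk ts))"
    using sum[OF order_refl] by (simp add: fill_map o_def)
qed

lemma poly_smooth:
  assumes H: "multilinear_map j H" "MB j K H" and V: "open V"
    and V1: "\<And>x. x \<in> V \<Longrightarrow> \<exists>\<rho>\<le>1. g None x \<rho>"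
  shows "smooth r V (\<lambda>x. H (replicate j x))"
    and "\<And>x vs. x \<in> V \<Longrightarrow> nth_deriv (\<lambda>x. H (replicate j x)) vs x = (\<Sum>L\<leftarrow>fill j vs. H (plug x L))"
    and "\<And>x s. x \<in> V \<Longrightarrow> MB s (real (length (fill j [0..<s])) * K) (D_at (\<lambda>x. H (replicate j x)) x)"
proof -
  let ?D = "\<lambda>vs x. \<Sum>L\<leftarrow>fill j vs. H (plug x L)"
  obtain c where c: "mbounded j H c" using MB_mbounded[OF H(2)] H(2) by blast
  have 0: "?D [] x = H (replicate j x)" for x by (simp add: plug_def)
  have 1: "(?D vs has_derivative (\<lambda>h. ?D (h # vs) x)) (at x)" for x vs
  proof -
    have "(?D vs has_derivative (\<lambda>h. \<Sum>L\<leftarrow>fill j vs. \<Sum>i\<leftarrow>filter (\<lambda>i. L ! i = None) [0..<length L]. H (plug x (L[i := Some h])))) (at x)"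
      by (intro has_derivative_sum_list plug_has_derivative[OF H(1) c] fill_length)
    then show ?thesis by (simp add: sum_list_concat_map o_def)
  qed
  show d: "nth_deriv (\<lambda>x. H (replicate j x)) vs x = ?D vs x" if "x \<in> V" for x vs
    by (rule smoothI_deriv[OF V 0 1 that order_refl])
  show mb: "MB s (real (length (fill j [0..<s])) * K) (D_at (\<lambda>x. H (replicate j x)) x)" if x: "x \<in> V" for x s
  proof -
    obtain \<rho> where "g None x \<rho>" "\<rho> \<le> 1" using V1[OF x] by blast
    from MB_fill[OF H(2) this, of s] show ?thesis by (simp add: d[OF x])
  qed
  show "smooth r V (\<lambda>x. H (replicate j x))"
  proof (rule smoothI(2)[OF V 0 1])
    fix x s assume x: "x \<in> V"
    obtain \<rho> where "g None x \<rho>" "\<rho> \<le> 1" using V1[OF x] by blast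
    from MB_fill[OF H(2) this, of s] show "\<exists>c. mbounded s (\<lambda>vs. ?D vs x) c"
      using MB_mbounded by blast
    show "eqc s (\<lambda>x vs. ?D vs x) x" by (rule poly_eqc[OF H(1) c])
  qed
qed

end


section \<open>Symmetry of higher derivatives\<close>

text \<open>The mixed second difference is the increment in direction \<open>v\<close> of the first
  difference in direction \<open>u\<close>. Its derivative along \<open>v\<close> is compared with
  \<open>s\<close> times the mixed derivative by expanding the derivative in direction
  \<open>v\<close> to first order about \<open>x\<close>.\<close>

lemma schwarz_increment:
  fixes F :: "'a::real_normed_vector \<Rightarrow> 'b::real_normed_vector"
  assumes F: "smooth r V F" and x: "x \<in> V" and vs: "length vs + 2 \<le> r" and e: "e > 0"
  shows "\<exists>d>0. \<forall>s. 0 < s \<and> s < d \<longrightarrow>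
    norm (nth_deriv F vs (x + s *\<^sub>R u + s *\<^sub>R v) - nth_deriv F vs (x + s *\<^sub>R u) - nth_deriv F vs (x + s *\<^sub>R v) + nth_deriv F vs x
      - s\<^sup>2 *\<^sub>R nth_deriv F (u # v # vs) x) \<le> e * s\<^sup>2"
proof -
  let ?p = "norm v * prod_list (map norm vs)"
  \<comment> \<open>Two first-order remainders occur, at distance at most
    \<open>s * (norm u + norm v)\<close> from \<open>x\<close>; the summand 1 keeps \<open>B\<close>
    positive.\<close>
  define B where "B = 2 * (norm u + norm v) * ?p + 1"
  have B: "B > 0" unfolding B_def using prod_list_norm_nonneg[of vs] by (intro add_nonneg_pos mult_nonneg_nonneg) auto
  define e' where "e' = e / B"
  have e': "e' > 0" using e B by (simp add: e'_def)
  have "\<forall>\<^sub>F y in nhds x. y \<in> V \<and> (\<forall>zs. length zs = Suc (length vs) \<longrightarrow>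
       norm (nth_deriv F zs y - nth_deriv F zs x - nth_deriv F ((y - x) # zs) x) \<le> e' * norm (y - x) * prod_list (map norm zs))"
    using smooth_famdiff[OF F x, of "Suc (length vs)"] vs e' smooth_open[OF F] x
    unfolding famdiff_def by (auto intro!: eventually_conj eventually_nhds_in_open)
  then obtain d0 where d00: "d0 > 0" "\<And>y. dist y x < d0 \<Longrightarrow> y \<in> V \<and> (\<forall>zs. length zs = Suc (length vs) \<longrightarrow>
       norm (nth_deriv F zs y - nth_deriv F zs x - nth_deriv F ((y - x) # zs) x) \<le> e' * norm (y - x) * prod_list (map norm zs))"
    unfolding eventually_nhds_metric by blast
  have d0: "d0 > 0" "\<And>y. dist y x < d0 \<Longrightarrow> y \<in> V"
    "\<And>y. dist y x < d0 \<Longrightarrow> norm (nth_deriv F (v # vs) y - nth_deriv F (v # vs) x - nth_deriv F ((y - x) # v # vs) x) \<le> e' * norm (y - x) * ?p"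
    using d00(1) d00(2)[THEN conjunct1] d00(2)[THEN conjunct2, rule_format, of _ "v # vs"] by (simp_all add: mult.assoc)
  define d where "d = d0 / (norm u + norm v + 1)"
  have d: "d > 0" using d0(1) unfolding d_def by (intro divide_pos_pos add_nonneg_pos) auto
  have ml: "linear (\<lambda>w. nth_deriv F (w # v # vs) x)"
    using has_derivative_linear[OF smooth_deriv[OF F x, of "v # vs"]] vs by simp
  show ?thesis
  proof (intro exI[of _ d] conjI allI impI d, elim conjE)
    fix s :: real assume s: "0 < s" "s < d"
    define y where "y \<tau> = x + s *\<^sub>R u + \<tau> *\<^sub>R v" for \<tau>
    define z where "z \<tau> = x + \<tau> *\<^sub>R v" for \<tau>
    have near: "dist (y \<tau>) x < d0" "dist (z \<tau>) x < d0" "norm (y \<tau> - x) \<le> s * (norm u + norm v)" "norm (z \<tau> - x) \<le> s * (norm u + norm v)"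
      if t: "0 \<le> \<tau>" "\<tau> \<le> s" for \<tau>
    proof -
      have sd: "s * (norm u + norm v) < d0"
      proof -
        have "s * (norm u + norm v) \<le> s * (norm u + norm v + 1)" using s by (intro mult_left_mono) auto
        also have "\<dots> < d * (norm u + norm v + 1)" using s by (intro mult_strict_right_mono add_nonneg_pos) auto
        also have "\<dots> = d0" unfolding d_def using add_nonneg_pos[of "norm u + norm v" 1] by simp
        finally show ?thesis .
      qed
      have "norm (s *\<^sub>R u + \<tau> *\<^sub>R v) \<le> s * norm u + s * norm v"
        using s t by (intro norm_triangle_mono) (auto intro: mult_right_mono)
      then show 1: "norm (y \<tau> - x) \<le> s * (norm u + norm v)" by (simp add: y_def algebra_simps)
      have "norm (\<tau> *\<^sub>R v) \<le> s * norm v" using s t by (auto intro: mult_right_mono)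
      also have "\<dots> \<le> s * (norm u + norm v)" using s by (intro mult_left_mono) auto
      finally show 2: "norm (z \<tau> - x) \<le> s * (norm u + norm v)" by (simp add: z_def)
      show "dist (y \<tau>) x < d0" "dist (z \<tau>) x < d0" using 1 2 sd by (auto simp: dist_norm)
    qed
    let ?D = "nth_deriv F (u # v # vs) x"
    define f where "f \<tau> = nth_deriv F vs (y \<tau>) - nth_deriv F vs (z \<tau>) - \<tau> *\<^sub>R (s *\<^sub>R ?D)" for \<tau>
    have "norm (f s - f 0) \<le> (s * e) * norm (s - 0)"
    proof (rule differentiable_bound[of "{0..s}" _ "\<lambda>\<tau> h. h *\<^sub>R (nth_deriv F (v # vs) (y \<tau>) - nth_deriv F (v # vs) (z \<tau>) - s *\<^sub>R ?D)"])
      fix \<tau> assume t: "\<tau> \<in> {0..s}"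
      then have t': "0 \<le> \<tau>" "\<tau> \<le> s" by auto
      have yd: "((\<lambda>\<tau>. nth_deriv F vs (y \<tau>)) has_derivative (\<lambda>h. nth_deriv F ((h *\<^sub>R v) # vs) (y \<tau>))) (at \<tau>)"
        by (rule has_derivative_compose[where g = "nth_deriv F vs" and f = y and f' = "\<lambda>h. h *\<^sub>R v", OF _ smooth_deriv[OF F d0(2)[OF near(1)[OF t']]]])
           (use vs in \<open>auto simp: y_def[abs_def] intro!: derivative_eq_intros\<close>)
      have zd: "((\<lambda>\<tau>. nth_deriv F vs (z \<tau>)) has_derivative (\<lambda>h. nth_deriv F ((h *\<^sub>R v) # vs) (z \<tau>))) (at \<tau>)"
        by (rule has_derivative_compose[where g = "nth_deriv F vs" and f = z and f' = "\<lambda>h. h *\<^sub>R v", OF _ smooth_deriv[OF F d0(2)[OF near(2)[OF t']]]])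
           (use vs in \<open>auto simp: z_def[abs_def] intro!: derivative_eq_intros\<close>)
      have ly: "nth_deriv F ((h *\<^sub>R v) # vs) (y \<tau>) = h *\<^sub>R nth_deriv F (v # vs) (y \<tau>)" for h
        using linear_scale[OF has_derivative_linear[OF smooth_deriv[OF F d0(2)[OF near(1)[OF t']], of vs]]] vs by simp
      have lz: "nth_deriv F ((h *\<^sub>R v) # vs) (z \<tau>) = h *\<^sub>R nth_deriv F (v # vs) (z \<tau>)" for h
        using linear_scale[OF has_derivative_linear[OF smooth_deriv[OF F d0(2)[OF near(2)[OF t']], of vs]]] vs by simp
      have "(f has_derivative (\<lambda>h. nth_deriv F ((h *\<^sub>R v) # vs) (y \<tau>) - nth_deriv F ((h *\<^sub>R v) # vs) (z \<tau>) - h *\<^sub>R (s *\<^sub>R ?D))) (at \<tau>)"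
        unfolding f_def[abs_def] by (intro has_derivative_diff yd zd) (auto intro!: derivative_eq_intros)
      then show "(f has_derivative (\<lambda>h. h *\<^sub>R (nth_deriv F (v # vs) (y \<tau>) - nth_deriv F (v # vs) (z \<tau>) - s *\<^sub>R ?D))) (at \<tau> within {0..s})"
        unfolding ly lz by (simp add: scaleR_diff_right has_derivative_at_withinI)
      have "nth_deriv F ((y \<tau> - x) # v # vs) x - nth_deriv F ((z \<tau> - x) # v # vs) x = nth_deriv F ((s *\<^sub>R u) # v # vs) x"
        using linear_diff[OF ml, of "y \<tau> - x" "z \<tau> - x"] by (simp add: y_def z_def)
      also have "\<dots> = s *\<^sub>R ?D" using linear_scale[OF ml] by simp
      finally have split: "nth_deriv F (v # vs) (y \<tau>) - nth_deriv F (v # vs) (z \<tau>) - s *\<^sub>R ?D =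
         (nth_deriv F (v # vs) (y \<tau>) - nth_deriv F (v # vs) x - nth_deriv F ((y \<tau> - x) # v # vs) x) -
         (nth_deriv F (v # vs) (z \<tau>) - nth_deriv F (v # vs) x - nth_deriv F ((z \<tau> - x) # v # vs) x)"
        by (simp add: algebra_simps)
      have p: "0 \<le> ?p" using prod_list_norm_nonneg[of vs] by simp
      have "norm (nth_deriv F (v # vs) (y \<tau>) - nth_deriv F (v # vs) (z \<tau>) - s *\<^sub>R ?D)
          \<le> e' * norm (y \<tau> - x) * ?p + e' * norm (z \<tau> - x) * ?p"
        unfolding split by (rule order_trans[OF norm_triangle_ineq4 add_mono[OF d0(3)[OF near(1)[OF t']] d0(3)[OF near(2)[OF t']]]])
      also have "\<dots> \<le> e' * (s * (norm u + norm v)) * ?p + e' * (s * (norm u + norm v)) * ?p"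
        using near(3,4)[OF t'] e' p by (intro add_mono mult_right_mono mult_left_mono) auto
      also have "\<dots> = (s * e') * (B - 1)" by (simp add: B_def algebra_simps)
      also have "\<dots> \<le> (s * e') * B" using s e' by (intro mult_left_mono) auto
      also have "\<dots> = s * e" using B by (simp add: e'_def)
      finally have n: "norm (nth_deriv F (v # vs) (y \<tau>) - nth_deriv F (v # vs) (z \<tau>) - s *\<^sub>R ?D) \<le> s * e" .
      show "onorm (\<lambda>h. h *\<^sub>R (nth_deriv F (v # vs) (y \<tau>) - nth_deriv F (v # vs) (z \<tau>) - s *\<^sub>R ?D)) \<le> s * e"
        by (intro onorm_le) (use n in \<open>simp add: mult.commute[of "s * e"] mult_left_mono\<close>)
    qed (use s in auto)
    moreover have "f s - f 0 = nth_deriv F vs (x + s *\<^sub>R u + s *\<^sub>R v) - nth_deriv F vs (x + s *\<^sub>R u) - nth_deriv F vs (x + s *\<^sub>R v) + nth_deriv F vs x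
      - s\<^sup>2 *\<^sub>R ?D"
      by (simp add: f_def y_def z_def power2_eq_square)
    ultimately show "norm (nth_deriv F vs (x + s *\<^sub>R u + s *\<^sub>R v) - nth_deriv F vs (x + s *\<^sub>R u) - nth_deriv F vs (x + s *\<^sub>R v) + nth_deriv F vs x
      - s\<^sup>2 *\<^sub>R ?D) \<le> e * s\<^sup>2" using s by (simp add: power2_eq_square mult_ac)
  qed
qed

text \<open>The second difference is symmetric in \<open>u\<close> and \<open>v\<close>, so both
  mixed derivatives are its limit after division by the square of \<open>s\<close>.\<close>

lemma schwarz:
  fixes F :: "'a::real_normed_vector \<Rightarrow> 'b::real_normed_vector"
  assumes F: "smooth r V F" and x: "x \<in> V" and vs: "length vs + 2 \<le> r"
  shows "nth_deriv F (u # v # vs) x = nth_deriv F (v # u # vs) x"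
proof -
  let ?N = "norm (nth_deriv F (u # v # vs) x - nth_deriv F (v # u # vs) x)"
  have "?N \<le> e" if e: "e > 0" for e
  proof -
    let ?A = "\<lambda>s. nth_deriv F vs (x + s *\<^sub>R u + s *\<^sub>R v) - nth_deriv F vs (x + s *\<^sub>R u) - nth_deriv F vs (x + s *\<^sub>R v) + nth_deriv F vs x"
    let ?B = "\<lambda>s. nth_deriv F vs (x + s *\<^sub>R v + s *\<^sub>R u) - nth_deriv F vs (x + s *\<^sub>R v) - nth_deriv F vs (x + s *\<^sub>R u) + nth_deriv F vs x"
    have e2: "e / 2 > 0" using e by simp
    obtain d1 where d1: "d1 > 0" "\<And>s. 0 < s \<and> s < d1 \<Longrightarrow> norm (?A s - s\<^sup>2 *\<^sub>R nth_deriv F (u # v # vs) x) \<le> e / 2 * s\<^sup>2"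
      using schwarz_increment[OF F x vs e2, of u v] by blast
    obtain d2 where d2: "d2 > 0" "\<And>s. 0 < s \<and> s < d2 \<Longrightarrow> norm (?B s - s\<^sup>2 *\<^sub>R nth_deriv F (v # u # vs) x) \<le> e / 2 * s\<^sup>2"
      using schwarz_increment[OF F x vs e2, of v u] by blast
    define s where "s = min d1 d2 / 2"
    have s: "0 < s" "s < d1" "s < d2" using d1(1) d2(1) by (auto simp: s_def min_def)
    have AB: "?A s = ?B s" by (simp add: algebra_simps)
    have "s\<^sup>2 * ?N = norm (s\<^sup>2 *\<^sub>R nth_deriv F (u # v # vs) x - s\<^sup>2 *\<^sub>R nth_deriv F (v # u # vs) x)"
      by (simp flip: scaleR_diff_right)
    also have "\<dots> = norm ((?B s - s\<^sup>2 *\<^sub>R nth_deriv F (v # u # vs) x) - (?A s - s\<^sup>2 *\<^sub>R nth_deriv F (u # v # vs) x))"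
      unfolding AB by simp
    also have "\<dots> \<le> e / 2 * s\<^sup>2 + e / 2 * s\<^sup>2"
      by (intro order_trans[OF norm_triangle_ineq4] add_mono d1(2) d2(2) conjI s)
    also have "\<dots> = s\<^sup>2 * e" by simp
    finally show ?thesis using s(1) by simp
  qed
  then have "?N \<le> 0" by (rule field_le_epsilon[of _ 0, simplified])
  then show ?thesis by simp
qed

text \<open>Insertion by adjacent exchanges: once the heads agree, the head joins the prefix
  \<open>xs\<close> and the induction continues with the tails.\<close>

lemma adjacent_swaps_imp_mset:
  assumes "\<And>xs u v ys. length (xs @ u # v # ys) = n \<Longrightarrow> f (xs @ u # v # ys) = f (xs @ v # u # ys)"
    and "mset ws = mset ws'" "length ws = n"
  shows "f ws = f ws'"
proof -
  have move: "length (xs @ a @ h # b) = n \<Longrightarrow> f (xs @ a @ h # b) = f (xs @ h # a @ b)" for xs a h b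
  proof (induction a arbitrary: xs)
    case (Cons c a)
    have "f (xs @ c # a @ h # b) = f ((xs @ [c]) @ h # a @ b)" using Cons.IH[of "xs @ [c]"] Cons.prems by simp
    also have "\<dots> = f (xs @ h # c # a @ b)" using assms(1)[of xs c h "a @ b"] Cons.prems by simp
    finally show ?case by simp
  qed simp
  have "length (xs @ ws) = n \<Longrightarrow> mset ws = mset ws' \<Longrightarrow> f (xs @ ws) = f (xs @ ws')" for xs
  proof (induction ws arbitrary: xs ws')
    case (Cons h t)
    have "h \<in> set ws'" using Cons.prems(2) by (metis list.set_intros(1) set_mset_mset)
    then obtain a b where ab: "ws' = a @ h # b" by (meson split_list)
    then have m: "mset t = mset (a @ b)" using Cons.prems(2) by simp
    have l: "length ws' = length (h # t)" using Cons.prems(2) by (metis size_mset)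
    have "f (xs @ h # t) = f ((xs @ [h]) @ (a @ b))" using Cons.IH[of "xs @ [h]" "a @ b"] Cons.prems m by simp
    also have "\<dots> = f (xs @ ws')" using move[of xs a h b] l Cons.prems(1) ab by simp
    finally show ?case .
  qed simp
  from this[of "[]"] assms(2,3) show ?thesis by simp
qed

text \<open>An exchange behind the directions \<open>xs\<close> is an identity on all of
  \<open>V\<close> and may be differentiated; \<open>schwarz\<close> starts this induction. Adjacent
  exchanges then generate all permutations.\<close>

lemma nth_deriv_symmetric:
  fixes F :: "'a::real_normed_vector \<Rightarrow> 'b::real_normed_vector"
  assumes F: "smooth r V F" and x: "x \<in> V" and "length ws \<le> r" and "mset ws = mset ws'"
  shows "nth_deriv F ws x = nth_deriv F ws' x"
proof (rule adjacent_swaps_imp_mset[of "length ws", where f = "\<lambda>ws. nth_deriv F ws x"])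
  have "y \<in> V \<Longrightarrow> length (xs @ u # v # ys) \<le> r \<Longrightarrow> nth_deriv F (xs @ u # v # ys) y = nth_deriv F (xs @ v # u # ys) y" for xs u v ys y
  proof (induction xs arbitrary: y)
    case Nil
    then show ?case using schwarz[OF F] by simp
  next
    case (Cons h xs)
    have 1: "(nth_deriv F (xs @ u # v # ys) has_derivative (\<lambda>h. nth_deriv F (h # xs @ u # v # ys) y)) (at y)"
      and 2: "(nth_deriv F (xs @ v # u # ys) has_derivative (\<lambda>h. nth_deriv F (h # xs @ v # u # ys) y)) (at y)"
      using Cons.prems by (auto intro!: smooth_deriv[OF F])
    have "(nth_deriv F (xs @ v # u # ys) has_derivative (\<lambda>h. nth_deriv F (h # xs @ u # v # ys) y)) (at y)"
      by (rule has_derivative_transform_within_open[OF 1 smooth_open[OF F] Cons.prems(1)])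
         (use Cons in auto)
    from fun_cong[OF has_derivative_unique[OF this 2], of h] show ?case by simp
  qed
  then show "length (xs @ u # v # ys) = length ws \<Longrightarrow> nth_deriv F (xs @ u # v # ys) x = nth_deriv F (xs @ v # u # ys) x" for xs u v ys
    using x assms(3) by simp
qed (use assms in auto)


section \<open>Linearization on a gauge ball\<close>

context gauged
begin

text \<open>A gauge is a relation between a vector and its bounds, so the ball is described by
  bounds; the strict inequality makes it open.\<close>

definition gball :: "real \<Rightarrow> 'a set" where
  "gball \<delta> = {x. \<exists>\<rho><\<delta>. g None x \<rho>}"

lemma open_gball: "open (gball \<delta>)"
proof -
  obtain C where C: "C \<ge> 1" "\<And>u. g None u (C * norm u)" using g_None_bounds by blast
  have "\<exists>e>0. \<forall>y. dist y x < e \<longrightarrow> y \<in> gball \<delta>" if x: "x \<in> gball \<delta>" for x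
  proof -
    obtain \<rho> where \<rho>: "\<rho> < \<delta>" "g None x \<rho>" using x by (auto simp: gball_def)
    have "y \<in> gball \<delta>" if y: "dist y x < (\<delta> - \<rho>) / C" for y
    proof -
      have "g None (x + (y - x)) (\<rho> + C * norm (y - x))" by (rule g_add[OF \<rho>(2) C(2)])
      moreover have "\<rho> + C * norm (y - x) < \<delta>" using y C(1) by (simp add: dist_norm field_simps)
      ultimately show ?thesis by (auto simp: gball_def)
    qed
    then show ?thesis using \<rho>(1) C(1) by (intro exI[of _ "(\<delta> - \<rho>) / C"]) auto
  qed
  then show ?thesis by (simp add: open_dist)
qed

lemma convex_gball: "convex (gball \<delta>)"
proof (rule convexI)
  fix x y and u v :: real assume x: "x \<in> gball \<delta>" and y: "y \<in> gball \<delta>" and uv: "0 \<le> u" "0 \<le> v" "u + v = 1"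
  obtain \<rho> \<sigma> where r: "\<rho> < \<delta>" "g None x \<rho>" "\<sigma> < \<delta>" "g None y \<sigma>" using x y by (auto simp: gball_def)
  have "g None (u *\<^sub>R x + v *\<^sub>R y) (u * \<rho> + v * \<sigma>)"
    using g_add[OF g_scale[OF r(2), of u] g_scale[OF r(4), of v]] uv by simp
  moreover have "u * \<rho> + v * \<sigma> < \<delta>" by (rule convex_bound_lt[OF r(1,3) uv])
  ultimately show "u *\<^sub>R x + v *\<^sub>R y \<in> gball \<delta>" by (auto simp: gball_def)
qed

lemma zero_in_gball: "0 < \<delta> \<Longrightarrow> 0 \<in> gball \<delta>"
  using g_zero[of 0 None] by (auto simp: gball_def)

lemma gball_star:
  assumes "x \<in> gball \<delta>" "0 \<le> t" "t \<le> 1"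
  shows "t *\<^sub>R x \<in> gball \<delta>"
proof -
  obtain \<rho> where \<rho>: "\<rho> < \<delta>" "g None x \<rho>" using assms(1) by (auto simp: gball_def)
  have "g None (t *\<^sub>R x) \<rho>"
    by (rule g_mono[OF g_scale[OF \<rho>(2)]]) (use assms(2,3) g_nonneg[OF \<rho>(2)] in \<open>simp add: mult_left_le_one_le\<close>)
  then show ?thesis using \<rho>(1) by (auto simp: gball_def)
qed

lemma MB_0: "g None x \<rho> \<Longrightarrow> MB 0 \<rho> (\<lambda>_. x)"
  unfolding MB_def by (auto dest: g_nonneg)

lemma nth_deriv_ident: "nth_deriv (\<lambda>x. x) vs x = (case vs of [] \<Rightarrow> x | [h] \<Rightarrow> h | _ \<Rightarrow> 0)"
  by (rule nth_deriv_linear[OF bounded_linear_ident])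

lemma ident_MB:
  assumes "g None x 1"
  shows "MB s 1 (D_at (\<lambda>x. x) x)"
proof -
  consider "s = 0" | "s = 1" | k where "s = Suc (Suc k)" by (metis One_nat_def not0_implies_Suc)
  then show ?thesis
  proof cases
    case 1
    then show ?thesis using MB_cong[OF MB_0[OF assms]] by simp
  next
    case 2
    have "MB 1 1 (D_at (\<lambda>x. x) x)"
      by (rule MB_cong[OF dec_MB[OF dec_id]]) (auto simp: nth_deriv_ident length_Suc_conv)
    then show ?thesis using 2 by simp
  next
    case (3 k)
    have "MB (Suc (Suc k)) 1 (D_at (\<lambda>x. x) x)"
      by (rule MB_cong[OF MB_zero]) (auto simp: nth_deriv_ident length_Suc_conv)
    then show ?thesis using 3 by simp
  qed
qed

text \<open>The Taylor polynomial of the linearization: it removes the terms of order below \<open>q\<close>, one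
  homological equation at each order.\<close>

lemma normal_form:
  assumes Ai: "dec a Ai" and inv: "\<And>x. A (Ai x) = x" "\<And>x. Ai (A x) = x" and A: "dec KA A"
    and F: "smooth r V F" and FV: "\<And>x. x \<in> V \<Longrightarrow> F x \<in> V" and V: "0 \<in> V" "\<And>x. x \<in> V \<Longrightarrow> g None x 1"
    and F0: "F 0 = 0" "\<And>h. nth_deriv F [h] 0 = A h" and FMB: "\<And>s x. s \<le> r \<Longrightarrow> x \<in> V \<Longrightarrow> MB s KF (D_at F x)"
    and hom: "\<And>j G K. 2 \<le> j \<Longrightarrow> j < q \<Longrightarrow> multilinear_map j G \<Longrightarrow> MB j K G \<Longrightarrow>
       \<exists>H L. multilinear_map j H \<and> MB j L H \<and> (\<forall>vs. length vs = j \<longrightarrow> A (H vs) - H (map A vs) = G vs)"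
    and q: "2 \<le> q" "q \<le> r"
  shows "\<exists>P. smooth r V P \<and> P 0 = 0 \<and> (\<forall>h. nth_deriv P [h] 0 = h) \<and> (\<forall>s\<le>r. \<exists>K. \<forall>x\<in>V. MB s K (D_at P x)) \<and>
     (\<forall>vs. length vs < q \<longrightarrow> nth_deriv (\<lambda>x. Ai (P (F x)) - P x) vs 0 = 0)"
  using q hom
proof (induction q rule: nat_induct_at_least)
  \<comment> \<open>With \<open>P\<close> the identity, \<open>Ai (F x) - x\<close> has zero value
    and zero derivative at 0, which is vanishing to order 2.\<close>
  case base
  have blAi: "bounded_linear Ai" by (rule dec_bounded_linear[OF Ai])
  have id: "smooth r V (\<lambda>x. x :: 'a)"
    by (rule smooth_subset[OF smooth_linear(1)[OF bounded_linear_ident] smooth_open[OF F]]) simp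
  have "nth_deriv (\<lambda>x. Ai (F x) - x) vs 0 = 0" if vs: "length vs < 2" for vs
  proof -
    have l: "length vs \<le> r" using vs base by simp
    have "nth_deriv (\<lambda>x. Ai (F x) - x) vs 0 = Ai (nth_deriv F vs 0) - nth_deriv (\<lambda>x. x) vs 0"
      using smooth_diff_deriv[OF smooth_bounded_linear(2)[OF blAi F] id V(1) l]
        smooth_bounded_linear_deriv[OF blAi F V(1) l] by simp
    also have "\<dots> = 0"
    proof (cases vs)
      case Nil
      then show ?thesis using F0 linear_0[OF dec_linear[OF Ai]] by simp
    next
      case (Cons h ws)
      then have "vs = [h]" using vs by simp
      then show ?thesis using F0(2) inv(2) by (simp add: nth_deriv_ident)
    qed
    finally show ?thesis .
  qed
  moreover have "\<forall>s\<le>r. \<exists>K. \<forall>x\<in>V. MB s K (D_at (\<lambda>x. x) x)" using ident_MB V(2) by blast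
  moreover have "nth_deriv (\<lambda>x. x) [h] 0 = h" for h :: 'a by (simp add: nth_deriv_ident)
  ultimately show ?case using id by (intro exI[of _ "\<lambda>x. x"]) blast
next
  case (Suc q)
  have "\<exists>P. smooth r V P \<and> P 0 = 0 \<and> (\<forall>h. nth_deriv P [h] 0 = h) \<and> (\<forall>s\<le>r. \<exists>K. \<forall>x\<in>V. MB s K (D_at P x)) \<and>
     (\<forall>vs. length vs < q \<longrightarrow> nth_deriv (\<lambda>x. Ai (P (F x)) - P x) vs 0 = 0)"
    by (rule Suc.IH) (use Suc.prems in auto)
  then obtain P where P: "smooth r V P" "P 0 = 0" "\<And>h. nth_deriv P [h] 0 = h" "\<And>s. s \<le> r \<Longrightarrow> \<exists>K. \<forall>x\<in>V. MB s K (D_at P x)"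
    and PE: "\<And>vs. length vs < q \<Longrightarrow> nth_deriv (\<lambda>x. Ai (P (F x)) - P x) vs 0 = 0" by blast
  have q: "2 \<le> q" "q \<le> r" using Suc.hyps Suc.prems by auto
  have blAi: "bounded_linear Ai" by (rule dec_bounded_linear[OF Ai])
  have linAi: "linear Ai" by (rule dec_linear[OF Ai])
  have V1: "\<exists>\<rho>\<le>1. g None x \<rho>" if "x \<in> V" for x using V(2)[OF that] by auto
  define E where "E = (\<lambda>x. Ai (P (F x)) - P x)"
  have PF: "smooth r V (\<lambda>x. P (F x))" by (rule smooth_compose(2)[OF P(1) F FV])
  have E: "smooth r V E" unfolding E_def by (rule smooth_diff(2)[OF smooth_bounded_linear(2)[OF blAi PF] P(1)])
  have DE: "nth_deriv E vs 0 = Ai (\<Sum>\<pi>\<leftarrow>parts vs. fdb_term P F \<pi> 0) - nth_deriv P vs 0" if "length vs \<le> r" for vs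
    unfolding E_def
    by (simp add: smooth_diff_deriv[OF smooth_bounded_linear(2)[OF blAi PF] P(1) V(1) that]
        smooth_bounded_linear_deriv[OF blAi PF V(1) that] smooth_compose_deriv[OF P(1) F FV V(1) that])
  \<comment> \<open>Adding the polynomial with coefficient \<open>H\<close> changes the derivative
    of order \<open>q\<close> of the error by a sum of \<open>- Ai (G _)\<close> over
    \<open>fact q\<close> placements. This \<open>G\<close> makes the sum cancel the derivative of
    \<open>E\<close>.\<close>
  define G where "G = (\<lambda>vs. (1 / fact q) *\<^sub>R A (nth_deriv E vs 0))"
  have mlG: "multilinear_map q G"
    unfolding G_def by (rule multilinear_scale[OF multilinear_compose_linear[OF dec_linear[OF A] smooth_multilinear[OF E V(1) q(2)]]])
  obtain KP where KP: "\<And>s x. s \<le> r \<Longrightarrow> x \<in> V \<Longrightarrow> MB s (KP s) (D_at P x)" using P(4) by metis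
  have "\<exists>K. MB q K (D_at E 0)"
  proof -
    have "MB q (\<Sum>\<pi>\<leftarrow>parts [0..<q]. KP (length \<pi>) * prod_list (map (\<lambda>b. KF) \<pi>)) (\<lambda>vs. \<Sum>\<pi>\<leftarrow>parts vs. fdb_term P F \<pi> 0)"
      by (rule MB_fdb) (use KP FMB V(1) F0(1) q(2) in auto)
    note mb = MB_diff[OF MB_dec[OF this Ai] KP[OF q(2) V(1)]]
    show ?thesis by (rule exI, rule MB_cong[OF mb]) (simp add: DE q(2))
  qed
  then obtain KG where KG: "MB q KG G" unfolding G_def using MB_scale[OF MB_dec[OF _ A]] by blast
  then obtain H L where H: "multilinear_map q H" "MB q L H" "\<And>vs. length vs = q \<Longrightarrow> A (H vs) - H (map A vs) = G vs"
    using Suc.prems(2)[OF q(1) lessI mlG KG] by blast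
  define p where "p = (\<lambda>x. H (replicate q x))"
  have ps: "smooth r V p" "\<And>x vs. x \<in> V \<Longrightarrow> nth_deriv p vs x = (\<Sum>L\<leftarrow>fill q vs. H (plug x L))"
    "\<And>x s. x \<in> V \<Longrightarrow> MB s (real (length (fill q [0..<s])) * L) (D_at p x)"
    unfolding p_def by (rule poly_smooth[OF H(1,2) smooth_open[OF F] V1]; assumption)+
  have pF: "smooth r V (\<lambda>x. p (F x))" by (rule smooth_compose(2)[OF ps(1) F FV])
  have E': "(\<lambda>x. Ai (P (F x) + p (F x)) - (P x + p x)) = (\<lambda>x. E x + (Ai (p (F x)) - p x))"
    by (simp add: E_def linear_add[OF linAi] algebra_simps)
  have Aip: "smooth r V (\<lambda>x. Ai (p (F x)))" by (rule smooth_bounded_linear(2)[OF blAi pF])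
  have DE': "nth_deriv (\<lambda>x. Ai (P (F x) + p (F x)) - (P x + p x)) vs 0 =
      nth_deriv E vs 0 + (Ai (\<Sum>\<pi>\<leftarrow>parts vs. fdb_term p F \<pi> 0) - nth_deriv p vs 0)" if "length vs \<le> r" for vs
    unfolding E'
    by (simp add: smooth_add_deriv[OF E smooth_diff(2)[OF Aip ps(1)] V(1) that] smooth_diff_deriv[OF Aip ps(1) V(1) that]
        smooth_bounded_linear_deriv[OF blAi pF V(1) that] smooth_compose_deriv[OF ps(1) F FV V(1) that])
  have p0: "nth_deriv p vs 0 = 0" if "length vs < q" for vs
  proof -
    have "H (plug 0 L) = 0" if "L \<in> set (fill q vs)" for L
      using fill_None[OF that \<open>length vs < q\<close>] fill_length[OF that]
      by (intro multilinear_map_zero[OF H(1)]) (force simp: plug_def)+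
    then show ?thesis by (simp add: ps(2)[OF V(1)] cong: map_cong)
  qed
  \<comment> \<open>Since \<open>F 0 = 0\<close>, the outer derivative is evaluated at 0, where the
    derivatives of order below \<open>q\<close> of a homogeneous polynomial of degree
    \<open>q\<close> vanish.\<close>
  have small: "fdb_term p F \<pi> 0 = 0" if "length \<pi> < q" for \<pi>
    using p0[of "map (\<lambda>b. nth_deriv F b 0) \<pi>"] that F0(1) by simp
  have "nth_deriv (\<lambda>x. Ai (P (F x) + p (F x)) - (P x + p x)) vs 0 = 0" if vs: "length vs < Suc q" for vs
  proof (cases "length vs < q")
    case True
    have "fdb_term p F \<pi> 0 = 0" if "\<pi> \<in> set (parts vs)" for \<pi>
      using parts_length[OF that] True by (intro small) simp
    then have "(\<Sum>\<pi>\<leftarrow>parts vs. fdb_term p F \<pi> 0) = 0" by (simp cong: map_cong)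
    then show ?thesis using DE'[of vs] PE[OF True] p0[OF True] True q(2) linear_0[OF linAi] by (simp add: E_def)
  next
    case False
    then have lq: "length vs = q" using vs by simp
    obtain rest where rest: "parts vs = map (\<lambda>x. [x]) vs # rest" "\<And>\<pi>. \<pi> \<in> set rest \<Longrightarrow> length \<pi> < q"
      using parts_singletons[of vs] lq by auto
    have "(\<Sum>\<pi>\<leftarrow>rest. fdb_term p F \<pi> 0) = (\<Sum>\<pi>\<leftarrow>rest. 0)"
      by (rule arg_cong[where f = sum_list], rule map_cong) (use rest(2) small in auto)
    then have "(\<Sum>\<pi>\<leftarrow>parts vs. fdb_term p F \<pi> 0) = fdb_term p F (map (\<lambda>x. [x]) vs) 0"
      by (simp add: rest(1))
    also have "\<dots> = nth_deriv p (map A vs) 0" by (simp add: F0 o_def)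
    also have "\<dots> = (\<Sum>L\<leftarrow>fill q vs. H (plug 0 (map (map_option A) L)))"
      by (simp add: ps(2)[OF V(1)] fill_map o_def)
    also have "\<dots> = (\<Sum>L\<leftarrow>fill q vs. H (map A (map the L)))"
    proof (rule arg_cong[where f = sum_list], rule map_cong)
      fix L assume L: "L \<in> set (fill q vs)"
      then have "map (map_option A) L \<in> set (fill (length (map A vs)) (map A vs))" by (simp add: fill_map lq)
      from fill_full(1)[OF this, of 0] have "plug 0 (map (map_option A) L) = map the (map (map_option A) L)" .
      also have "\<dots> = map A (map the L)"
      proof -
        have "m \<noteq> None" if "m \<in> set L" for m
        proof -
          have "m \<in># mset L" using that by simp
          then show ?thesis using fill_mset[OF L] lq by auto
        qed
        then show ?thesis by (auto simp: option.map_sel)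
      qed
      finally show "H (plug 0 (map (map_option A) L)) = H (map A (map the L))" by simp
    qed simp
    finally have 1: "(\<Sum>\<pi>\<leftarrow>parts vs. fdb_term p F \<pi> 0) = (\<Sum>L\<leftarrow>fill q vs. H (map A (map the L)))" .
    have "nth_deriv p vs 0 = (\<Sum>L\<leftarrow>fill q vs. H (plug 0 L))" by (rule ps(2)[OF V(1)])
    also have "\<dots> = (\<Sum>L\<leftarrow>fill q vs. H (map the L))"
      by (rule arg_cong[where f = sum_list], rule map_cong) (use fill_full(1)[of _ vs 0] lq in auto)
    finally have 2: "nth_deriv p vs 0 = (\<Sum>L\<leftarrow>fill q vs. H (map the L))" .
    have sl: "Ai (\<Sum>L\<leftarrow>Ls. f L) = (\<Sum>L\<leftarrow>Ls. Ai (f L))" for f :: "'c \<Rightarrow> 'a" and Ls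
      by (induction Ls) (auto simp: linear_0[OF linAi] linear_add[OF linAi])
    have "Ai (\<Sum>\<pi>\<leftarrow>parts vs. fdb_term p F \<pi> 0) - nth_deriv p vs 0 = (\<Sum>L\<leftarrow>fill q vs. Ai (H (map A (map the L))) - H (map the L))"
      unfolding 1 2 sl sum_list_diff ..
    \<comment> \<open>\<open>H\<close> is not assumed symmetric. Each placement produces
      \<open>G\<close> on a permuted list of directions, and \<open>G\<close> is symmetric because
      it comes from a derivative.\<close>
    also have "\<dots> = (\<Sum>L\<leftarrow>fill q vs. - (1 / fact q) *\<^sub>R nth_deriv E vs 0)"
    proof (rule arg_cong[where f = sum_list], rule map_cong)
      fix L assume L: "L \<in> set (fill q vs)"
      then have m: "mset (map the L) = mset vs" using fill_full(2)[of L vs] lq by simp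
      have ll: "length (map the L) = q" using fill_length[OF L] by simp
      have "Ai (H (map A (map the L))) - H (map the L) = - Ai (A (H (map the L)) - H (map A (map the L)))"
        by (simp only: linear_diff[OF linAi] inv(2) minus_diff_eq)
      also have "\<dots> = - Ai (G (map the L))" by (simp only: H(3)[OF ll])
      also have "\<dots> = - (1 / fact q) *\<^sub>R nth_deriv E (map the L) 0" unfolding G_def
        by (simp only: linear_scale[OF linAi] inv(2) scaleR_minus_left)
      also have "nth_deriv E (map the L) 0 = nth_deriv E vs 0"
        by (rule nth_deriv_symmetric[OF E V(1)]) (use ll q m in auto)
      finally show "Ai (H (map A (map the L))) - H (map the L) = - (1 / fact q) *\<^sub>R nth_deriv E vs 0" .
    qed simp
    also have "\<dots> = - (real (length (fill q vs)) * (1 / fact q)) *\<^sub>R nth_deriv E vs 0"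
    proof -
      have *: "(\<Sum>L\<leftarrow>Ls. c *\<^sub>R y) = (real (length Ls) * c) *\<^sub>R y" for Ls :: "'a option list list" and c and y :: 'a
        by (induction Ls) (auto simp: algebra_simps)
      show ?thesis unfolding * by simp
    qed
    also have "real (length (fill q vs)) * (1 / fact q) = 1"
    proof -
      have "length (fill q vs) = fact q" using fill_count[of vs q] lq by simp
      then show ?thesis by simp
    qed
    finally show ?thesis using DE'[of vs] lq q(2) by simp
  qed
  moreover have "nth_deriv (\<lambda>x. P x + p x) [h] 0 = h" for h
    using smooth_add_deriv[OF P(1) ps(1) V(1), of "[h]"] P(3) p0[of "[h]"] q by simp
  moreover have "P 0 + p 0 = 0" using p0[of "[]"] P(2) q by simp
  moreover have "\<exists>K. \<forall>x\<in>V. MB s K (D_at (\<lambda>x. P x + p x) x)" if s: "s \<le> r" for s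
  proof (intro exI ballI)
    fix x assume x: "x \<in> V"
    show "MB s (KP s + real (length (fill q [0..<s])) * L) (D_at (\<lambda>x. P x + p x) x)"
      by (rule MB_cong[OF MB_add[OF KP[OF s x] ps(3)[OF x]]])
         (use s in \<open>simp add: smooth_add_deriv[OF P(1) ps(1) x]\<close>)
  qed
  ultimately show ?case using smooth_add(2)[OF P(1) ps(1)]
    by (intro exI[of _ "\<lambda>x. P x + p x"]) auto
qed

end


section \<open>The contraction on maps vanishing to order \<open>q\<close>\<close>

lemma mbounded_mono:
  assumes "mbounded j B c" "c \<le> d"
  shows "mbounded j B d"
  unfolding mbounded_def
proof (intro conjI allI impI)
  show "0 \<le> d" using assms by (simp add: mbounded_def)
  show "norm (B zs) \<le> d * prod_list (map norm zs)" if "length zs = j" for zs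
    by (rule order_trans[OF mboundedD[OF assms(1) that] mult_right_mono[OF assms(2) prod_list_norm_nonneg]])
qed

context gauged
begin

text \<open>Starting from the uniform bound at order \<open>q\<close>, each integration from the
  origin lowers the order by one and gains a factor \<open>\<rho>\<close>, since the derivative at 0
  vanishes there. Truncated subtraction makes the exponent 0 for orders above
  \<open>q\<close>.\<close>

lemma MB_vanishing:
  assumes E: "smooth r (gball \<delta>) E" and r0: "q \<le> r" and K: "\<And>s x. s \<le> r \<Longrightarrow> x \<in> gball \<delta> \<Longrightarrow> MB s K (D_at E x)"
    and van: "\<And>vs. length vs < q \<Longrightarrow> nth_deriv E vs 0 = 0"
  shows "s \<le> r \<Longrightarrow> x \<in> gball \<delta> \<Longrightarrow> g None x \<rho> \<Longrightarrow> MB s (K * \<rho> ^ (q - s)) (D_at E x)"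
proof (induction "q - s" arbitrary: s x \<rho>)
  case 0
  then show ?case using K by simp
next
  case (Suc k)
  then have s: "s < q" and k: "k = q - Suc s" by auto
  have "MB s (K * \<rho> ^ Suc k) (\<lambda>vs. D_at E x vs - D_at E 0 vs)"
    by (rule MB_increment[OF E _ gball_star _ Suc.prems(2,3)])
      (use Suc.hyps(1)[OF k] s r0 k in auto)
  then show ?case unfolding Suc.hyps(2)[symmetric] by (rule MB_cong) (use van s in simp)
qed

text \<open>Derivatives of order \<open>s\<close> carry the weight \<open>M ^ s\<close>. The term
  with the full outer derivative contributes \<open>b ^ q\<close>, from the contraction of the point
  and of the \<open>s\<close> directions. Every other term has an outer derivative of lower order
  and gains a factor \<open>1 / M\<close>, so for large \<open>M\<close> the total factor is close
  to \<open>a * b ^ q\<close>.\<close>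

lemma contraction_step:
  assumes Ai: "dec a Ai" and F: "smooth r (gball \<delta>) F"
    and Fg: "\<And>x \<rho>. x \<in> gball \<delta> \<Longrightarrow> g None x \<rho> \<Longrightarrow> g None (F x) (b * \<rho>)" and b: "0 < b" "b < 1"
    and F1: "\<And>x. x \<in> gball \<delta> \<Longrightarrow> MB 1 b (D_at F x)"
    and F2: "\<And>s x. 2 \<le> s \<Longrightarrow> s \<le> r \<Longrightarrow> x \<in> gball \<delta> \<Longrightarrow> MB s KF (D_at F x)" and KF: "1 \<le> KF"
    and M: "1 \<le> M" and N: "\<And>s. s \<le> r \<Longrightarrow> length (parts [0..<s]) \<le> N"
    and t: "smooth r (gball \<delta>) t" and L: "0 \<le> L"
    and tB: "\<And>s x \<rho>. s \<le> r \<Longrightarrow> x \<in> gball \<delta> \<Longrightarrow> g None x \<rho> \<Longrightarrow> \<rho> \<le> 1 \<Longrightarrow> MB s (L * M ^ s * \<rho> ^ (q - s)) (D_at t x)"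
  shows "smooth r (gball \<delta>) (\<lambda>x. Ai (t (F x)))"
    and "\<And>s x \<rho>. s \<le> r \<Longrightarrow> x \<in> gball \<delta> \<Longrightarrow> g None x \<rho> \<Longrightarrow> \<rho> \<le> 1 \<Longrightarrow>
      MB s ((a * (b ^ q + N * KF ^ r / M)) * L * M ^ s * \<rho> ^ (q - s)) (D_at (\<lambda>x. Ai (t (F x))) x)"
proof -
  have FV: "F x \<in> gball \<delta>" if x: "x \<in> gball \<delta>" for x
  proof -
    obtain \<rho> where \<rho>: "\<rho> < \<delta>" "g None x \<rho>" using x by (auto simp: gball_def)
    have "b * \<rho> \<le> \<rho>" using b g_nonneg[OF \<rho>(2)] by (simp add: mult_left_le_one_le)
    then show ?thesis using Fg[OF x \<rho>(2)] \<rho>(1) unfolding gball_def by (intro CollectI exI[of _ "b * \<rho>"]) simp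
  qed
  have blAi: "bounded_linear Ai" by (rule dec_bounded_linear[OF Ai])
  have tF: "smooth r (gball \<delta>) (\<lambda>x. t (F x))" by (rule smooth_compose(2)[OF t F FV])
  show "smooth r (gball \<delta>) (\<lambda>x. Ai (t (F x)))" by (rule smooth_bounded_linear(2)[OF blAi tF])
  fix s x \<rho> assume s: "s \<le> r" and x: "x \<in> gball \<delta>" and \<rho>: "g None x \<rho>" "\<rho> \<le> 1"
  have r0: "0 \<le> \<rho>" by (rule g_nonneg[OF \<rho>(1)])
  have br: "b * \<rho> \<le> \<rho>" using b r0 by (simp add: mult_left_le_one_le)
  define cF where "cF k = L * M ^ k * (b * \<rho>) ^ (q - k)" for k
  define cG where "cG k = (if k = 1 then b else KF)" for k :: nat
  have cG0: "0 \<le> cG k" "cG k \<le> KF" for k using b KF by (auto simp: cG_def)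
  have "MB s (\<Sum>\<pi>\<leftarrow>parts [0..<s]. cF (length \<pi>) * prod_list (map (\<lambda>b. cG (length b)) \<pi>)) (\<lambda>vs. \<Sum>\<pi>\<leftarrow>parts vs. fdb_term t F \<pi> x)"
  proof (rule MB_fdb)
    show "MB k (cF k) (D_at t (F x))" if "k \<le> s" for k
      unfolding cF_def using that s br \<rho>(2) by (intro tB FV[OF x] Fg[OF x \<rho>(1)]) auto
    show "MB k (cG k) (D_at F x)" if "1 \<le> k" "k \<le> s" for k
      using that s F1[OF x] F2[OF _ _ x] by (auto simp: cG_def)
  qed
  moreover have "(\<Sum>\<pi>\<leftarrow>parts [0..<s]. cF (length \<pi>) * prod_list (map (\<lambda>b. cG (length b)) \<pi>))
      \<le> (b ^ q + N * KF ^ r / M) * L * M ^ s * \<rho> ^ (q - s)"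
  proof -
    define Z where "Z = L * M ^ s * \<rho> ^ (q - s)"
    have Z: "0 \<le> Z" unfolding Z_def using L M r0 by simp
    obtain rest where rest: "parts [0..<s] = map (\<lambda>x. [x]) [0..<s] # rest" "\<And>\<pi>. \<pi> \<in> set rest \<Longrightarrow> length \<pi> < s"
      using parts_singletons[of "[0..<s]"] by auto
    have "cF s * prod_list (map (\<lambda>b. cG (length b)) (map (\<lambda>x. [x]) [0..<s])) = Z * (b ^ (q - s) * b ^ s)"
      by (simp add: cF_def cG_def Z_def o_def map_replicate_const prod_list_replicate power_mult_distrib mult_ac)
    also have "b ^ (q - s) * b ^ s = b ^ (q - s + s)" by (simp add: power_add)
    \<comment> \<open>\<open>q - s\<close> is truncated: for \<open>s \<le> q\<close> the exponent
      is \<open>q\<close>, beyond that it is \<open>s\<close>, and \<open>b < 1\<close> gives the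
      bound in both cases.\<close>
    also have "Z * b ^ (q - s + s) \<le> Z * b ^ q" using b Z by (intro mult_left_mono power_decreasing) auto
    finally have 1: "cF s * prod_list (map (\<lambda>b. cG (length b)) (map (\<lambda>x. [x]) [0..<s])) \<le> Z * b ^ q" .
    have "cF (length \<pi>) * prod_list (map (\<lambda>b. cG (length b)) \<pi>) \<le> Z * (KF ^ r / M)" if \<pi>: "\<pi> \<in> set rest" for \<pi>
    proof -
      let ?k = "length \<pi>"
      have k: "?k < s" by (rule rest(2)[OF \<pi>])
      have "prod_list (map (\<lambda>b. cG (length b)) \<pi>) \<le> KF ^ ?k \<and> 0 \<le> prod_list (map (\<lambda>b. cG (length b)) \<pi>)"
        using cG0 KF by (induction \<pi>) (auto intro!: mult_mono)
      moreover have "KF ^ ?k \<le> KF ^ r" using k s KF by (intro power_increasing) auto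
      ultimately have p: "prod_list (map (\<lambda>b. cG (length b)) \<pi>) \<le> KF ^ r" "0 \<le> prod_list (map (\<lambda>b. cG (length b)) \<pi>)" by auto
      have "M ^ ?k \<le> M ^ (s - 1)" using k M by (intro power_increasing) auto
      also have "M ^ (s - 1) = M ^ s / M" using k M by (cases s) auto
      finally have m: "M ^ ?k \<le> M ^ s / M" .
      have "(b * \<rho>) ^ (q - ?k) \<le> \<rho> ^ (q - ?k)" using br b r0 by (intro power_mono) auto
      also have "\<dots> \<le> \<rho> ^ (q - s)" using k r0 \<rho>(2) by (intro power_decreasing) auto
      finally have e: "(b * \<rho>) ^ (q - ?k) \<le> \<rho> ^ (q - s)" .
      have "cF ?k \<le> L * (M ^ s / M) * \<rho> ^ (q - s)"
        unfolding cF_def using m e L M b r0 by (intro mult_mono) auto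
      then have c: "cF ?k \<le> Z / M" by (simp add: Z_def)
      have "cF ?k * prod_list (map (\<lambda>b. cG (length b)) \<pi>) \<le> (Z / M) * KF ^ r"
        using c p Z M by (intro mult_mono) auto
      then show ?thesis by simp
    qed
    then have "(\<Sum>\<pi>\<leftarrow>rest. cF (length \<pi>) * prod_list (map (\<lambda>b. cG (length b)) \<pi>)) \<le> (\<Sum>\<pi>\<leftarrow>rest. Z * (KF ^ r / M))"
      by (intro sum_list_mono)
    also have "\<dots> = length rest * (Z * (KF ^ r / M))" by (simp add: sum_list_triv)
    also have "\<dots> \<le> N * (Z * (KF ^ r / M))"
    proof (rule mult_right_mono)
      have "length rest \<le> length (parts [0..<s])" by (simp add: rest(1))
      then show "real (length rest) \<le> real N" using N[OF s] by linarith
    qed (use Z KF M in auto)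
    finally have "(\<Sum>\<pi>\<leftarrow>parts [0..<s]. cF (length \<pi>) * prod_list (map (\<lambda>b. cG (length b)) \<pi>)) \<le> Z * b ^ q + N * (Z * (KF ^ r / M))"
      using 1 unfolding rest(1) by simp
    also have "\<dots> = (b ^ q + N * KF ^ r / M) * L * M ^ s * \<rho> ^ (q - s)" by (simp add: Z_def algebra_simps)
    finally show ?thesis .
  qed
  ultimately have "MB s ((b ^ q + N * KF ^ r / M) * L * M ^ s * \<rho> ^ (q - s)) (\<lambda>vs. \<Sum>\<pi>\<leftarrow>parts vs. fdb_term t F \<pi> x)"
    by (rule MB_mono)
  from MB_dec[OF this Ai]
  have "MB s ((a * (b ^ q + N * KF ^ r / M)) * L * M ^ s * \<rho> ^ (q - s)) (\<lambda>vs. Ai (\<Sum>\<pi>\<leftarrow>parts vs. fdb_term t F \<pi> x))"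
    by (simp add: mult.assoc)
  then show "MB s ((a * (b ^ q + N * KF ^ r / M)) * L * M ^ s * \<rho> ^ (q - s)) (D_at (\<lambda>x. Ai (t (F x))) x)"
    by (rule MB_cong) (use s in \<open>simp add: smooth_bounded_linear_deriv[OF blAi tF x] smooth_compose_deriv[OF t F FV x]\<close>)
qed

theorem linearize_gball:
  assumes Ai: "dec a Ai" and inv: "\<And>x. A (Ai x) = x" "\<And>x. Ai (A x) = x" and A: "dec KA A"
    and F: "smooth r (gball \<delta>) F" and d: "0 < \<delta>" "\<delta> \<le> 1"
    and Fg: "\<And>x \<rho>. x \<in> gball \<delta> \<Longrightarrow> g None x \<rho> \<Longrightarrow> g None (F x) (b * \<rho>)" and b: "0 < b" "b < 1"
    and F0: "\<And>h. nth_deriv F [h] 0 = A h"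
    and F1: "\<And>x. x \<in> gball \<delta> \<Longrightarrow> MB 1 b (D_at F x)"
    and F2: "\<And>s x. 2 \<le> s \<Longrightarrow> s \<le> r \<Longrightarrow> x \<in> gball \<delta> \<Longrightarrow> MB s KF (D_at F x)"
    and hom: "\<And>j G K. 2 \<le> j \<Longrightarrow> j < q \<Longrightarrow> multilinear_map j G \<Longrightarrow> MB j K G \<Longrightarrow>
       \<exists>H L. multilinear_map j H \<and> MB j L H \<and> (\<forall>vs. length vs = j \<longrightarrow> A (H vs) - H (map A vs) = G vs)"
    and q: "2 \<le> q" "q \<le> r" and ab: "a * b ^ q < 1"
  shows "\<exists>R. smooth r (gball \<delta>) R \<and> R 0 = 0 \<and> (\<forall>h. nth_deriv R [h] 0 = h) \<and>
     (\<forall>s\<le>r. \<exists>K. \<forall>x\<in>gball \<delta>. MB s K (D_at R x)) \<and> (\<forall>x\<in>gball \<delta>. F x \<in> gball \<delta> \<and> R (F x) = A (R x))"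
proof -
  let ?V = "gball \<delta>"
  have V0: "0 \<in> ?V" by (rule zero_in_gball[OF d(1)])
  have Vg: "\<exists>\<rho>. g None x \<rho> \<and> \<rho> < \<delta>" if "x \<in> ?V" for x using that by (auto simp: gball_def)
  have V1: "g None x 1" if "x \<in> ?V" for x using Vg[OF that] d(2) by (auto intro: g_mono)
  have FV: "F x \<in> ?V" if x: "x \<in> ?V" for x
  proof -
    obtain \<rho> where \<rho>: "\<rho> < \<delta>" "g None x \<rho>" using x by (auto simp: gball_def)
    have "b * \<rho> \<le> \<rho>" using b g_nonneg[OF \<rho>(2)] by (simp add: mult_left_le_one_le)
    then show ?thesis using Fg[OF x \<rho>(2)] \<rho>(1) unfolding gball_def by (intro CollectI exI[of _ "b * \<rho>"]) simp
  qed
  have F00: "F 0 = 0" using Fg[OF V0 g_zero[of 0 None]] by (intro g_None_zeroD) simp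
  define K1 where "K1 = max 1 KF"
  have K1: "1 \<le> K1" "KF \<le> K1" by (auto simp: K1_def)
  have FMB: "MB s K1 (D_at F x)" if "s \<le> r" "x \<in> ?V" for s x
  proof -
    consider "s = 0" | "s = 1" | "2 \<le> s" by linarith
    then show ?thesis
    proof cases
      case 1
      have "MB 0 1 (\<lambda>_. F x)" by (rule MB_0[OF V1[OF FV[OF that(2)]]])
      then show ?thesis using 1 K1(1) by (auto intro: MB_mono MB_cong)
    next
      case 2
      have "b \<le> K1" using b K1(1) by simp
      with 2 show ?thesis using MB_mono[OF F1[OF that(2)]] by simp
    next
      case 3
      then show ?thesis using MB_mono[OF F2[OF _ that] K1(2)] by simp
    qed
  qed
  have "\<exists>P. smooth r ?V P \<and> P 0 = 0 \<and> (\<forall>h. nth_deriv P [h] 0 = h) \<and> (\<forall>s\<le>r. \<exists>K. \<forall>x\<in>?V. MB s K (D_at P x)) \<and>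
     (\<forall>vs. length vs < q \<longrightarrow> nth_deriv (\<lambda>x. Ai (P (F x)) - P x) vs 0 = 0)"
    by (rule normal_form[OF Ai inv A F FV V0 V1 F00 F0 FMB hom q]; assumption)
  then obtain P where P: "smooth r ?V P" "P 0 = 0" "\<And>h. nth_deriv P [h] 0 = h" "\<forall>s\<le>r. \<exists>K. \<forall>x\<in>?V. MB s K (D_at P x)"
    and PE: "\<And>vs. length vs < q \<Longrightarrow> nth_deriv (\<lambda>x. Ai (P (F x)) - P x) vs 0 = 0"
    by blast
  obtain KP where KP: "\<And>s x. s \<le> r \<Longrightarrow> x \<in> ?V \<Longrightarrow> MB s (KP s) (D_at P x)" using P(4) by metis
  have blAi: "bounded_linear Ai" by (rule dec_bounded_linear[OF Ai])
  have linAi: "linear Ai" by (rule dec_linear[OF Ai])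
  define E where "E = (\<lambda>x. Ai (P (F x)) - P x)"
  have PF: "smooth r ?V (\<lambda>x. P (F x))" by (rule smooth_compose(2)[OF P(1) F FV])
  have E: "smooth r ?V E" unfolding E_def by (rule smooth_diff(2)[OF smooth_bounded_linear(2)[OF blAi PF] P(1)])
  define KE where "KE s = a * (\<Sum>\<pi>\<leftarrow>parts [0..<s]. KP (length \<pi>) * prod_list (map (\<lambda>_. K1) \<pi>)) + KP s" for s
  have KE: "MB s (KE s) (D_at E x)" if "s \<le> r" "x \<in> ?V" for s x
  proof -
    have "MB s (\<Sum>\<pi>\<leftarrow>parts [0..<s]. KP (length \<pi>) * prod_list (map (\<lambda>_. K1) \<pi>)) (\<lambda>vs. \<Sum>\<pi>\<leftarrow>parts vs. fdb_term P F \<pi> x)"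
      by (rule MB_fdb) (use KP FMB FV that in auto)
    from MB_diff[OF MB_dec[OF this Ai] KP[OF that]] show ?thesis
      unfolding KE_def E_def
      by (rule MB_cong) (use that in \<open>simp add: smooth_diff_deriv[OF smooth_bounded_linear(2)[OF blAi PF] P(1)]
        smooth_bounded_linear_deriv[OF blAi PF] smooth_compose_deriv[OF P(1) F FV]\<close>)
  qed
  have KE0: "0 \<le> KE s" if "s \<le> r" for s by (rule MB_nonneg[OF KE[OF that V0]])
  define K where "K = (\<Sum>s\<le>r. KE s)"
  have KK: "KE s \<le> K" if "s \<le> r" for s
    unfolding K_def by (rule member_le_sum) (use that KE0 in auto)
  have K0: "0 \<le> K" unfolding K_def by (rule sum_nonneg) (use KE0 in auto)
  have EB: "MB s (K * \<rho> ^ (q - s)) (D_at E x)" if "s \<le> r" "x \<in> ?V" "g None x \<rho>" for s x \<rho>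
    by (rule MB_vanishing[OF E q(2) _ _ that]) (use MB_mono[OF KE KK] PE in \<open>auto simp: E_def\<close>)
  define N where "N = (\<Sum>s\<le>r. length (parts [0..<s]))"
  have N: "length (parts [0..<s]) \<le> N" if "s \<le> r" for s
    unfolding N_def by (rule member_le_sum) (use that in auto)
  \<comment> \<open>\<open>M\<close> is so large that the terms of lower outer order use at most
    half of the gap between \<open>a * b ^ q\<close> and 1.\<close>
  define M where "M = max 1 (2 * (a * (N * K1 ^ r)) / (1 - a * b ^ q))"
  have M1: "1 \<le> M" by (simp add: M_def)
  define \<theta> where "\<theta> = a * (b ^ q + N * K1 ^ r / M)"
  have a0: "0 \<le> a" by (rule dec_nonneg[OF Ai])
  have th0: "0 \<le> \<theta>" unfolding \<theta>_def using a0 b K1 M1 by simp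
  have th1: "\<theta> < 1"
  proof -
    have "2 * (a * (N * K1 ^ r)) / (1 - a * b ^ q) \<le> M" by (simp add: M_def)
    then have "2 * (a * (N * K1 ^ r)) \<le> M * (1 - a * b ^ q)" using ab by (simp add: pos_divide_le_eq)
    then have "a * (N * K1 ^ r) / M \<le> (1 - a * b ^ q) / 2" using M1 by (simp add: field_simps)
    then have "\<theta> \<le> a * b ^ q + (1 - a * b ^ q) / 2" by (simp add: \<theta>_def algebra_simps)
    also have "\<dots> < 1"
    proof -
      have "z + (1 - z) / 2 < 1" if "z < 1" for z :: real using that by (simp add: field_simps)
      from this[OF ab] show ?thesis .
    qed
    finally show ?thesis .
  qed
  define t where "t k = ((\<lambda>f x. Ai (f (F x))) ^^ k) E" for k
  have t0: "t 0 = E" and tS: "t (Suc k) = (\<lambda>x. Ai (t k (F x)))" for k by (simp_all add: t_def)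
  have "smooth r ?V (t k) \<and> (\<forall>s\<le>r. \<forall>x\<in>?V. \<forall>\<rho>\<le>1. g None x \<rho> \<longrightarrow> MB s (K * \<theta> ^ k * M ^ s * \<rho> ^ (q - s)) (D_at (t k) x))" for k
  proof (induction k)
    case 0
    have "MB s (K * M ^ s * \<rho> ^ (q - s)) (D_at E x)" if s: "s \<le> r" "x \<in> ?V" "g None x \<rho>" for s x \<rho>
    proof (rule MB_mono[OF EB[OF s]])
      have "K * \<rho> ^ (q - s) * 1 \<le> K * \<rho> ^ (q - s) * M ^ s"
        using K0 g_nonneg[OF s(3)] M1 by (intro mult_left_mono) auto
      then show "K * \<rho> ^ (q - s) \<le> K * M ^ s * \<rho> ^ (q - s)" by (simp add: mult_ac)
    qed
    then show ?case using E by (simp add: t0)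
  next
    case (Suc k)
    have L: "0 \<le> K * \<theta> ^ k" using K0 th0 by simp
    have IH: "MB s (K * \<theta> ^ k * M ^ s * \<rho> ^ (q - s)) (D_at (t k) x)"
      if "s \<le> r" "x \<in> ?V" "g None x \<rho>" "\<rho> \<le> 1" for s x \<rho> using Suc.IH that by blast
    have "smooth r ?V (t (Suc k))" unfolding tS
      by (rule contraction_step(1)[OF Ai F Fg b F1 MB_mono[OF F2 K1(2)] K1(1) M1 N conjunct1[OF Suc.IH] L IH]; assumption)
    moreover have "MB s (K * \<theta> ^ Suc k * M ^ s * \<rho> ^ (q - s)) (D_at (t (Suc k)) x)"
      if sx: "s \<le> r" "x \<in> ?V" "g None x \<rho>" "\<rho> \<le> 1" for s x \<rho>
    proof -
      have "MB s ((a * (b ^ q + N * K1 ^ r / M)) * (K * \<theta> ^ k) * M ^ s * \<rho> ^ (q - s)) (D_at (\<lambda>x. Ai (t k (F x))) x)"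
        by (rule contraction_step(2)[OF Ai F Fg b F1 MB_mono[OF F2 K1(2)] K1(1) M1 N conjunct1[OF Suc.IH] L IH sx]; assumption)
      then have "MB s (\<theta> * (K * \<theta> ^ k) * M ^ s * \<rho> ^ (q - s)) (D_at (t (Suc k)) x)"
        unfolding tS by (simp only: \<theta>_def)
      then show ?thesis by (simp add: mult_ac)
    qed
    ultimately show ?case by blast
  qed
  then have ts: "smooth r ?V (t k)" and tB: "\<And>s x \<rho>. s \<le> r \<Longrightarrow> x \<in> ?V \<Longrightarrow> \<rho> \<le> 1 \<Longrightarrow> g None x \<rho> \<Longrightarrow> MB s (K * \<theta> ^ k * M ^ s * \<rho> ^ (q - s)) (D_at (t k) x)" for k
    by blast+
  have tB1: "MB s (K * M ^ r * \<theta> ^ k) (D_at (t k) x)" if "s \<le> r" "x \<in> ?V" for s x k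
  proof (rule MB_mono[OF tB[OF that order_refl V1[OF that(2)]]])
    have "K * \<theta> ^ k * M ^ s \<le> K * \<theta> ^ k * M ^ r"
      using K0 th0 M1 that(1) by (intro mult_left_mono power_increasing) auto
    then show "K * \<theta> ^ k * M ^ s * 1 ^ (q - s) \<le> K * M ^ r * \<theta> ^ k" by (simp add: mult_ac)
  qed
  obtain c where c: "\<And>j. 0 \<le> c j" "\<And>j K B. MB j K B \<Longrightarrow> mbounded j B (c j * K)"
  proof -
    have "\<exists>c. 0 \<le> c \<and> (\<forall>K B. MB j K B \<longrightarrow> mbounded j B (c * K))" for j
      using MB_mbounded[OF MB_zero[of 0 j]] by simp
    then have "\<exists>c. \<forall>j. 0 \<le> c j \<and> (\<forall>K B. MB j K B \<longrightarrow> mbounded j B (c j * K))" by (intro choice) blast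
    then show thesis using that by blast
  qed
  define C where "C = (\<Sum>j\<le>r. c j) * (K * M ^ r)"
  have bd: "mbounded j (D_at (t k) x) (C * \<theta> ^ k)" if x: "x \<in> ?V" and j: "j \<le> r" for k x j
  proof -
    have 1: "mbounded j (D_at (t k) x) (c j * (K * M ^ r * \<theta> ^ k))" by (rule c(2)[OF tB1[OF j x]])
    have "c j \<le> (\<Sum>j\<le>r. c j)" by (rule member_le_sum) (use c j in auto)
    then have "c j * (K * M ^ r * \<theta> ^ k) \<le> C * \<theta> ^ k"
      unfolding C_def mult.assoc using K0 M1 th0 by (intro mult_right_mono) auto
    then show ?thesis by (rule mbounded_mono[OF 1])
  qed
  define Q where "Q = (\<lambda>x. \<Sum>k. t k x)"
  have ser: "\<And>x vs. x \<in> ?V \<Longrightarrow> length vs \<le> r \<Longrightarrow> nth_deriv Q vs x = (\<Sum>k. nth_deriv (t k) vs x)"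
    "smooth r ?V Q" "\<And>x vs. x \<in> ?V \<Longrightarrow> length vs \<le> r \<Longrightarrow> summable (\<lambda>k. nth_deriv (t k) vs x)"
    unfolding Q_def by (rule smooth_series[OF convex_gball open_gball ts bd th0 th1]; assumption)+
  have DQ: "MB s (K * M ^ r / (1 - \<theta>)) (D_at Q x)" if s: "s \<le> r" and x: "x \<in> ?V" for s x
  proof (rule MB_limit[OF _ _ tendsto_const])
    show "(\<lambda>n. \<Sum>k<n. nth_deriv (t k) vs x) \<longlonglongrightarrow> D_at Q x vs" if "length vs = s" for vs
      using summable_LIMSEQ[OF ser(3)[OF x, of vs]] ser(1)[OF x, of vs] that s by simp
    fix n
    have "MB s (\<Sum>k\<leftarrow>[0..<n]. K * M ^ r * \<theta> ^ k) (\<lambda>vs. \<Sum>k\<leftarrow>[0..<n]. nth_deriv (t k) vs x)"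
      by (intro MB_sum_list tB1[OF s x])
    moreover have "(\<Sum>k\<leftarrow>[0..<n]. K * M ^ r * \<theta> ^ k) \<le> K * M ^ r / (1 - \<theta>)"
    proof -
      have "(\<Sum>k\<leftarrow>[0..<n]. K * M ^ r * \<theta> ^ k) = (\<Sum>k<n. K * M ^ r * \<theta> ^ k)"
        by (simp add: interv_sum_list_conv_sum_set_nat atLeast0LessThan)
      also have "\<dots> \<le> (\<Sum>k. K * M ^ r * \<theta> ^ k)"
        using K0 M1 th0 th1 by (intro sum_le_suminf summable_mult summable_geometric) auto
      also have "\<dots> = K * M ^ r / (1 - \<theta>)"
        using th0 th1 by (subst suminf_mult) (auto simp: suminf_geometric summable_geometric)
      finally show ?thesis .
    qed
    ultimately show "MB s (K * M ^ r / (1 - \<theta>)) (\<lambda>vs. \<Sum>k<n. nth_deriv (t k) vs x)"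
      by (auto simp: interv_sum_list_conv_sum_set_nat atLeast0LessThan intro: MB_mono)
  qed
  \<comment> \<open>At the origin the bound holds with radius 0, and \<open>0 ^ (q - s)\<close>
    vanishes for \<open>s < q\<close>. Thus the correction changes neither the value nor the first
    derivative of \<open>P\<close> there.\<close>
  have DQ0: "nth_deriv Q vs 0 = 0" if vs: "length vs < q" for vs
  proof -
    have "nth_deriv (t k) vs 0 = 0" for k
    proof (rule MB_zeroD[OF _ refl])
      have "MB (length vs) (K * \<theta> ^ k * M ^ length vs * 0 ^ (q - length vs)) (D_at (t k) 0)"
        using vs q by (intro tB V0 g_zero) auto
      moreover have "(0::real) ^ (q - length vs) = 0" using vs by simp
      ultimately show "MB (length vs) 0 (D_at (t k) 0)" by (simp only: mult_zero_right)
    qed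
    then show ?thesis using ser(1)[OF V0, of vs] vs q by simp
  qed
  define R where "R = (\<lambda>x. P x + Q x)"
  have R: "smooth r ?V R" unfolding R_def by (rule smooth_add(2)[OF P(1) ser(2)])
  have DR: "nth_deriv R vs x = nth_deriv P vs x + nth_deriv Q vs x" if "x \<in> ?V" "length vs \<le> r" for x vs
    unfolding R_def by (rule smooth_add_deriv[OF P(1) ser(2) that])
  have "R 0 = 0" using DQ0[of "[]"] P(2) q by (simp add: R_def)
  moreover have "nth_deriv R [h] 0 = h" for h
    using DR[OF V0, of "[h]"] DQ0[of "[h]"] P(3) q by simp
  moreover have "\<exists>K. \<forall>x\<in>?V. MB s K (D_at R x)" if s: "s \<le> r" for s
  proof (intro exI ballI)
    fix x assume x: "x \<in> ?V"
    show "MB s (KP s + K * M ^ r / (1 - \<theta>)) (D_at R x)"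
      by (rule MB_cong[OF MB_add[OF KP[OF s x] DQ[OF s x]]]) (use DR[OF x] s in simp)
  qed
  moreover have "R (F x) = A (R x)" if x: "x \<in> ?V" for x
  proof -
    have sm: "summable (\<lambda>k. t k y)" if "y \<in> ?V" for y using ser(3)[OF that, of "[]"] by simp
    \<comment> \<open>The iteration shifts the series by one term, so applying it to
      \<open>Q\<close> loses exactly \<open>E\<close>, which is what applying it to \<open>P\<close>
      gains.\<close>
    have "Ai (Q (F x)) = (\<Sum>k. t (Suc k) x)"
      unfolding Q_def tS by (rule bounded_linear.suminf[OF blAi sm[OF FV[OF x]]])
    also have "\<dots> = Q x - E x" unfolding Q_def using suminf_split_head[OF sm[OF x]] t0 by simp
    finally have "Ai (R (F x)) = R x"
      by (simp add: R_def linear_add[OF linAi] E_def)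
    then show ?thesis using inv(1) by metis
  qed
  ultimately show ?thesis using R FV by (intro exI[of _ R]) blast
qed

end


section \<open>Joint spectra in commutative algebras\<close>

text \<open>\<open>bd x K\<close> stands for \<open>\<parallel>x\<parallel> \<le> K\<close>. The Neumann series enters as an axiom, so that no completeness
  is assumed of \<open>C\<close>.\<close>

locale comm_algebra =
  fixes C :: "'c::ab_group_add set" and mul :: "'c \<Rightarrow> 'c \<Rightarrow> 'c" (infixl "\<odot>" 70)
    and e :: 'c and cc :: "complex \<Rightarrow> 'c" and bd :: "'c \<Rightarrow> real \<Rightarrow> bool"
  assumes add_in [simp]: "x \<in> C \<Longrightarrow> y \<in> C \<Longrightarrow> x + y \<in> C"
    and minus_in [simp]: "x \<in> C \<Longrightarrow> - x \<in> C"
    and mul_in [simp]: "x \<in> C \<Longrightarrow> y \<in> C \<Longrightarrow> x \<odot> y \<in> C"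
    and cc_in [simp]: "cc \<mu> \<in> C"
    and mul_assoc: "x \<in> C \<Longrightarrow> y \<in> C \<Longrightarrow> z \<in> C \<Longrightarrow> (x \<odot> y) \<odot> z = x \<odot> (y \<odot> z)"
    and mul_comm: "x \<in> C \<Longrightarrow> y \<in> C \<Longrightarrow> x \<odot> y = y \<odot> x"
    and mul_add: "x \<in> C \<Longrightarrow> y \<in> C \<Longrightarrow> z \<in> C \<Longrightarrow> x \<odot> (y + z) = x \<odot> y + x \<odot> z"
    and cc_1: "cc 1 = e" and cc_add: "cc (\<mu> + \<nu>) = cc \<mu> + cc \<nu>" and cc_mult: "cc (\<mu> * \<nu>) = cc \<mu> \<odot> cc \<nu>"
    and mul_e [simp]: "x \<in> C \<Longrightarrow> x \<odot> e = x"
    and bd_nonneg: "bd x K \<Longrightarrow> 0 \<le> K"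
    and bd_mono: "bd x K \<Longrightarrow> K \<le> L \<Longrightarrow> bd x L"
    and bd_add: "x \<in> C \<Longrightarrow> y \<in> C \<Longrightarrow> bd x K \<Longrightarrow> bd y L \<Longrightarrow> bd (x + y) (K + L)"
    and bd_minus: "x \<in> C \<Longrightarrow> bd x K \<Longrightarrow> bd (- x) K"
    and bd_mul: "x \<in> C \<Longrightarrow> y \<in> C \<Longrightarrow> bd x K \<Longrightarrow> bd y L \<Longrightarrow> bd (x \<odot> y) (K * L)"
    and bd_cc: "bd (cc \<mu>) (\<bar>Re \<mu>\<bar> + \<bar>Im \<mu>\<bar>)"
    and bd_ex: "x \<in> C \<Longrightarrow> \<exists>K. bd x K"
    and neumann: "x \<in> C \<Longrightarrow> bd x (1/2) \<Longrightarrow> \<exists>y\<in>C. y \<odot> (e - x) = e"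
begin

lemma e_in [simp]: "e \<in> C" using cc_in[of 1] by (simp add: cc_1)

lemma zero_in [simp]: "0 \<in> C" using add_in[OF e_in minus_in[OF e_in]] by simp

lemma diff_in [simp]: "x \<in> C \<Longrightarrow> y \<in> C \<Longrightarrow> x - y \<in> C"
  using add_in[OF _ minus_in] by fastforce

lemma mul_zero [simp]: "x \<in> C \<Longrightarrow> x \<odot> 0 = 0"
  using mul_add[of x 0 0] by simp

lemma mul_minus: "x \<in> C \<Longrightarrow> y \<in> C \<Longrightarrow> x \<odot> (- y) = - (x \<odot> y)"
  using mul_add[of x y "- y"] by (simp add: eq_neg_iff_add_eq_0 add.commute)

lemma mul_diff: "x \<in> C \<Longrightarrow> y \<in> C \<Longrightarrow> z \<in> C \<Longrightarrow> x \<odot> (y - z) = x \<odot> y - x \<odot> z"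
  using mul_add[of x y "- z"] mul_minus[of x z] by simp

lemma add_mul: "x \<in> C \<Longrightarrow> y \<in> C \<Longrightarrow> z \<in> C \<Longrightarrow> (y + z) \<odot> x = y \<odot> x + z \<odot> x"
  by (simp add: mul_comm[of _ x] mul_add)

lemma diff_mul: "x \<in> C \<Longrightarrow> y \<in> C \<Longrightarrow> z \<in> C \<Longrightarrow> (y - z) \<odot> x = y \<odot> x - z \<odot> x"
  by (simp add: mul_comm[of _ x] mul_diff)

lemma minus_mul: "x \<in> C \<Longrightarrow> y \<in> C \<Longrightarrow> (- y) \<odot> x = - (y \<odot> x)"
  by (simp add: mul_comm[of _ x] mul_minus)

lemma e_mul [simp]: "x \<in> C \<Longrightarrow> e \<odot> x = x"
  by (simp add: mul_comm[of e])

lemma mul_lcomm: "x \<in> C \<Longrightarrow> y \<in> C \<Longrightarrow> z \<in> C \<Longrightarrow> x \<odot> (y \<odot> z) = y \<odot> (x \<odot> z)"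
  by (metis mul_assoc mul_comm)

lemmas ring_rules = mul_add mul_diff add_mul diff_mul mul_minus minus_mul mul_assoc mul_comm mul_lcomm

lemma cc_0: "cc 0 = 0" using cc_add[of 0 0] by simp
lemma cc_minus: "cc (- z) = - cc z" using cc_add[of z "- z"] by (simp add: cc_0 eq_neg_iff_add_eq_0 add.commute)
lemma cc_diff: "cc (z - w) = cc z - cc w" using cc_add[of z "- w"] by (simp add: cc_minus)

lemma bd_cc_le: "bd (cc z) (2 * cmod z)"
  using bd_mono[OF bd_cc] abs_Re_le_cmod[of z] abs_Im_le_cmod[of z] by simp

primrec pw :: "'c \<Rightarrow> nat \<Rightarrow> 'c" where
  "pw x 0 = e"
| "pw x (Suc n) = x \<odot> pw x n"

lemma pw_in [simp]: "x \<in> C \<Longrightarrow> pw x n \<in> C"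
  by (induction n) auto

lemma pw_add: "x \<in> C \<Longrightarrow> pw x (m + n) = pw x m \<odot> pw x n"
  by (induction m) (auto simp: mul_assoc)

lemma pw_mul: "x \<in> C \<Longrightarrow> y \<in> C \<Longrightarrow> pw (x \<odot> y) n = pw x n \<odot> pw y n"
  by (induction n) (simp_all add: ring_rules)

lemma pw_pw: "x \<in> C \<Longrightarrow> pw (pw x m) n = pw x (m * n)"
  by (induction n) (auto simp: pw_add)

lemma pw_cc: "pw (cc z) n = cc (z ^ n)"
  by (induction n) (auto simp: cc_1 cc_mult)

section \<open>Ideals and quotient seminorms\<close>

definition ideal :: "'c set \<Rightarrow> bool" where
  "ideal I \<longleftrightarrow> I \<subseteq> C \<and> 0 \<in> I \<and> (\<forall>x\<in>I. \<forall>y\<in>I. x + y \<in> I) \<and> (\<forall>x\<in>I. \<forall>y\<in>C. y \<odot> x \<in> I)"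

lemma ideal_in: "ideal I \<Longrightarrow> x \<in> I \<Longrightarrow> x \<in> C" by (auto simp: ideal_def)
lemma ideal_add: "ideal I \<Longrightarrow> x \<in> I \<Longrightarrow> y \<in> I \<Longrightarrow> x + y \<in> I" by (auto simp: ideal_def)
lemma ideal_mul: "ideal I \<Longrightarrow> x \<in> I \<Longrightarrow> y \<in> C \<Longrightarrow> y \<odot> x \<in> I" by (auto simp: ideal_def)
lemma ideal_minus: "ideal I \<Longrightarrow> x \<in> I \<Longrightarrow> - x \<in> I"
  using ideal_mul[of I x "- e"] by (simp add: minus_mul ideal_in)
lemma ideal_diff: "ideal I \<Longrightarrow> x \<in> I \<Longrightarrow> y \<in> I \<Longrightarrow> x - y \<in> I"
  using ideal_add[OF _ _ ideal_minus] by fastforce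

text \<open>A bound for the quotient seminorm on the algebra modulo \<open>I\<close>. Congruence
  modulo \<open>I\<close> (\<open>bq_cong\<close>) plays the part of equality of classes.\<close>

definition bq :: "'c set \<Rightarrow> 'c \<Rightarrow> real \<Rightarrow> bool" where
  "bq I x K \<longleftrightarrow> (\<exists>a\<in>I. bd (x - a) K)"

context
  fixes I assumes I: "ideal I"
begin

lemma bq_bd: "bd x K \<Longrightarrow> bq I x K"
  using I unfolding bq_def ideal_def by (intro bexI[of _ 0]) auto

lemma bq_nonneg: "bq I x K \<Longrightarrow> 0 \<le> K"
  unfolding bq_def using bd_nonneg by blast

lemma bq_mono: "bq I x K \<Longrightarrow> K \<le> L \<Longrightarrow> bq I x L"
  unfolding bq_def using bd_mono by blast

lemma bq_ex: "x \<in> C \<Longrightarrow> \<exists>K. bq I x K"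
  using bd_ex bq_bd by blast

lemma bq_add:
  assumes "x \<in> C" "y \<in> C" "bq I x K" "bq I y L"
  shows "bq I (x + y) (K + L)"
proof -
  obtain a b where a: "a \<in> I" "bd (x - a) K" and b: "b \<in> I" "bd (y - b) L" using assms(3,4) unfolding bq_def by blast
  have "bd ((x - a) + (y - b)) (K + L)" using a b assms(1,2) ideal_in[OF I] by (intro bd_add) auto
  then have "bd ((x + y) - (a + b)) (K + L)" by (simp add: algebra_simps)
  then show ?thesis unfolding bq_def using ideal_add[OF I a(1) b(1)] by blast
qed

lemma bq_minus:
  assumes "x \<in> C" "bq I x K"
  shows "bq I (- x) K"
proof -
  obtain a where a: "a \<in> I" "bd (x - a) K" using assms(2) unfolding bq_def by blast
  have "bd (- (x - a)) K" using a assms(1) ideal_in[OF I] by (intro bd_minus) auto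
  then have "bd (- x - (- a)) K" by simp
  then show ?thesis unfolding bq_def using ideal_minus[OF I a(1)] by blast
qed

lemma bq_diff: "x \<in> C \<Longrightarrow> y \<in> C \<Longrightarrow> bq I x K \<Longrightarrow> bq I y L \<Longrightarrow> bq I (x - y) (K + L)"
  using bq_add[OF _ minus_in _ bq_minus] by fastforce

lemma bq_mul:
  assumes "x \<in> C" "y \<in> C" "bq I x K" "bq I y L"
  shows "bq I (x \<odot> y) (K * L)"
proof -
  obtain a b where a: "a \<in> I" "bd (x - a) K" and b: "b \<in> I" "bd (y - b) L" using assms(3,4) unfolding bq_def by blast
  have ab: "a \<in> C" "b \<in> C" using a b ideal_in[OF I] by auto
  have "bd ((x - a) \<odot> (y - b)) (K * L)" using a b ab assms(1,2) by (intro bd_mul) auto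
  moreover have "(x - a) \<odot> (y - b) = x \<odot> y - (x \<odot> b + (y - b) \<odot> a)"
    using ab assms(1,2) by (simp add: ring_rules)
  moreover have "x \<odot> b + (y - b) \<odot> a \<in> I" using ab assms(1,2) a(1) b(1) by (intro ideal_add[OF I] ideal_mul[OF I]) auto
  ultimately show ?thesis unfolding bq_def by (intro bexI) simp_all
qed

lemma bq_cong:
  assumes "x - y \<in> I" "bq I y K"
  shows "bq I x K"
proof -
  obtain a where a: "a \<in> I" "bd (y - a) K" using assms(2) unfolding bq_def by blast
  have "x - (x - y + a) = y - a" by simp
  then have "bd (x - (x - y + a)) K" using a(2) by simp
  then show ?thesis unfolding bq_def using ideal_add[OF I assms(1) a(1)] by blast
qed

lemma bq_pw: "x \<in> C \<Longrightarrow> bq I x K \<Longrightarrow> bq I (pw x n) (K ^ n)"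
proof (induction n)
  case 0
  then show ?case using bq_bd[OF bd_cc[of 1]] by (simp add: cc_1)
next
  case (Suc n)
  then show ?case by (simp add: bq_mul)
qed

text \<open>Iterating the improvement drives any initial bound towards \<open>2 * a\<close>. Bounds
  are not assumed to pass to the limit, so the iteration stops when the rest is below
  \<open>a\<close>.\<close>

lemma bq_absorb:
  assumes "bq I z K0" "\<And>K. bq I z K \<Longrightarrow> bq I z (a + K / 2)" "0 < a"
  shows "bq I z (3 * a)"
proof -
  have "bq I z (2 * a + K0 / 2 ^ n)" for n
  proof (induction n)
    case 0
    then show ?case using bq_mono[OF assms(1)] assms(3) by simp
  next
    case (Suc n)
    have "bq I z (a + (2 * a + K0 / 2 ^ n) / 2)" by (rule assms(2)[OF Suc])
    then show ?case by (simp add: field_simps)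
  qed
  moreover obtain n where "K0 / a < 2 ^ n" using real_arch_pow[of 2 "K0 / a"] by auto
  then have "K0 / 2 ^ n \<le> a" using assms(3) by (simp add: field_simps)
  ultimately show ?thesis using bq_mono by (metis add_left_mono mult_2 mult.commute distrib_right one_add_one add.commute numeral_plus_one numeral_Bit1 mult_1 numeral_One mult_numeral_1 add_mono_thms_linordered_semiring(2) semiring_norm(5))
qed

section \<open>Resolvents modulo an ideal and the spectral radius\<close>

lemma resolvent_identity:
  assumes "x \<in> C" "y \<in> C" "y' \<in> C" "(e - cc \<mu> \<odot> x) \<odot> y - e \<in> I" "(e - cc \<nu> \<odot> x) \<odot> y' - e \<in> I"
  shows "(y - y') - cc (\<mu> - \<nu>) \<odot> (x \<odot> y \<odot> y') \<in> I"
proof -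
  have "(y - y') - cc (\<mu> - \<nu>) \<odot> (x \<odot> y \<odot> y') = y' \<odot> ((e - cc \<mu> \<odot> x) \<odot> y - e) - y \<odot> ((e - cc \<nu> \<odot> x) \<odot> y' - e)"
    using assms(1-3) by (simp add: ring_rules cc_diff)
  then show ?thesis using assms by (auto intro!: ideal_diff[OF I] ideal_mul[OF I])
qed

text \<open>The inverses \<open>Y z\<close> are merely chosen, without continuity. The resolvent
  identity estimates a difference by a product of bounds; near a point this product is absorbed into
  a local bound, compactness of the disc makes the bound uniform, and the identity then gives the
  Lipschitz estimate.\<close>

lemma resolvent_lipschitz:
  assumes x: "x \<in> C" and Y: "\<And>z. cmod z \<le> R \<Longrightarrow> Y z \<in> C" "\<And>z. cmod z \<le> R \<Longrightarrow> (e - cc z \<odot> x) \<odot> Y z - e \<in> I"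
  shows "\<exists>D>0. \<forall>z w. cmod z \<le> R \<longrightarrow> cmod w \<le> R \<longrightarrow> bq I (Y z - Y w) (D * cmod (z - w))"
proof -
  obtain Kx0 where Kx0: "bq I x Kx0" using bq_ex[OF x] by blast
  define Kx where "Kx = Kx0 + 1"
  have Kx: "bq I x Kx" "0 < Kx" using bq_mono[OF Kx0, of Kx] bq_nonneg[OF Kx0] by (auto simp: Kx_def)
  have diff: "bq I (Y z - Y w) (2 * cmod (z - w) * (Kx * K * L))" if "cmod z \<le> R" "cmod w \<le> R" "bq I (Y z) K" "bq I (Y w) L" for z w K L
    by (rule bq_cong[OF resolvent_identity[OF x Y(1) Y(1) Y(2) Y(2)]])
       (use that x Y(1) Kx(1) in \<open>auto intro!: bq_mul bq_bd[OF bd_cc_le]\<close>)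
  have local: "\<exists>d>0. \<exists>B. \<forall>w. cmod w \<le> R \<and> cmod (w - z) < d \<longrightarrow> bq I (Y w) B" if z: "cmod z \<le> R" for z
  proof -
    obtain K0 where K0: "bq I (Y z) K0" using bq_ex[OF Y(1)[OF z]] by blast
    define K where "K = K0 + 1"
    have K: "bq I (Y z) K" "0 < K" using bq_mono[OF K0, of K] bq_nonneg[OF K0] by (auto simp: K_def)
    \<comment> \<open>For \<open>w\<close> this close to \<open>z\<close> the coefficient
      \<open>2 * cmod (w - z) * Kx * K\<close> is at most 1/2, as \<open>bq_absorb\<close>
      requires.\<close>
    have "bq I (Y w) (3 * K)" if w: "cmod w \<le> R" "cmod (w - z) < 1 / (4 * Kx * K)" for w
    proof -
      obtain L0 where L0: "bq I (Y w) L0" using bq_ex[OF Y(1)[OF w(1)]] by blast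
      show ?thesis
      proof (rule bq_absorb[OF L0 _ K(2)])
        fix L assume L: "bq I (Y w) L"
        have "bq I (Y z + (Y w - Y z)) (K + 2 * cmod (w - z) * (Kx * L * K))"
          by (intro bq_add K(1) diff w(1) z L Y(1) diff_in)
        then have 1: "bq I (Y w) (K + 2 * cmod (w - z) * (Kx * L * K))" by simp
        have "cmod (w - z) * (4 * Kx * K) \<le> 1" using w(2) Kx(2) K(2) by (simp add: field_simps)
        then have "cmod (w - z) * (4 * Kx * K) * L \<le> 1 * L" using bq_nonneg[OF L] by (rule mult_right_mono)
        then show "bq I (Y w) (K + L / 2)" by (intro bq_mono[OF 1]) (simp add: algebra_simps)
      qed
    qed
    then show ?thesis using Kx(2) K(2) by (intro exI[of _ "1 / (4 * Kx * K)"]) auto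
  qed
  have "\<exists>B. \<forall>z. cmod z \<le> R \<longrightarrow> bq I (Y z) B"
  proof (rule ccontr)
    assume "\<not> ?thesis"
    then have "\<forall>n::nat. \<exists>z. cmod z \<le> R \<and> \<not> bq I (Y z) (real n)" by blast
    then obtain f where f: "\<And>n::nat. cmod (f n) \<le> R" "\<And>n. \<not> bq I (Y (f n)) (real n)" by metis
    have "\<forall>n. f n \<in> cball 0 R" using f(1) by simp
    then obtain z \<sigma> where z: "z \<in> cball 0 R" "strict_mono \<sigma>" "(f \<circ> \<sigma>) \<longlonglongrightarrow> z"
      using compact_cball[of 0 R] unfolding compact_def by blast
    obtain d B where d: "d > 0" "\<And>w. cmod w \<le> R \<Longrightarrow> cmod (w - z) < d \<Longrightarrow> bq I (Y w) B"
      using local[of z] z(1) by auto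
    obtain N where N: "\<And>n. n \<ge> N \<Longrightarrow> norm ((f \<circ> \<sigma>) n - z) < d" using LIMSEQ_D[OF z(3) d(1)] by blast
    obtain m where m: "B \<le> real m" using real_arch_simple by blast
    let ?n = "max N m"
    have "bq I (Y (f (\<sigma> ?n))) B" using N[of ?n] f(1) by (intro d(2)) auto
    moreover have "B \<le> real (\<sigma> ?n)"
      using m seq_suble[OF z(2), of ?n] by (meson max.cobounded2 of_nat_mono order_trans)
    ultimately show False using bq_mono f(2) by blast
  qed
  then obtain B where B: "\<And>z. cmod z \<le> R \<Longrightarrow> bq I (Y z) B" by blast
  have "B \<le> \<bar>B\<bar> + 1" "0 < \<bar>B\<bar> + 1" by auto
  then obtain B1 where B1: "B \<le> B1" "0 < B1" by blast
  define D where "D = 2 * Kx * B1 * B1"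
  have "bq I (Y z - Y w) (D * cmod (z - w))" if "cmod z \<le> R" "cmod w \<le> R" for z w
  proof -
    have B': "bq I (Y z) B1" "bq I (Y w) B1" using bq_mono[OF B B1(1)] that by auto
    from diff[OF that B'] show ?thesis by (simp add: D_def mult_ac)
  qed
  moreover have "D > 0" using Kx(2) B1(2) by (simp add: D_def)
  ultimately show ?thesis by blast
qed

lemma pw_bounded_if_pw_le_1:
  assumes y: "y \<in> C" and N: "N > 0" "bq I (pw y N) 1"
  shows "\<exists>K. \<forall>n. bq I (pw y n) K"
proof -
  obtain K0 where K0: "bq I y K0" using bq_ex[OF y] by blast
  define K where "K = max 1 K0"
  have K: "bq I y K" "1 \<le> K" using bq_mono[OF K0, of K] by (auto simp: K_def)
  have "bq I (pw y n) (1 ^ (n div N) * K ^ (n mod N))" for n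
  proof -
    have "pw y n = pw (pw y N) (n div N) \<odot> pw y (n mod N)"
      using pw_add[OF y, of "N * (n div N)" "n mod N"] by (simp add: pw_pw y)
    then show ?thesis using bq_mul[OF _ _ bq_pw[OF _ N(2)] bq_pw[OF y K(1)]] y by simp
  qed
  moreover have "K ^ (n mod N) \<le> K ^ N" for n using K(2) N(1) by (intro power_increasing) (auto intro: less_imp_le)
  ultimately have "bq I (pw y n) (K ^ N)" for n by (metis bq_mono mult_1 power_one)
  then show ?thesis by blast
qed

text \<open>\<open>avg Y m r u\<close> is the mean of \<open>Y\<close> over the points
  \<open>r w\<close>, where \<open>w\<close> runs through the roots of order \<open>2 ^ m\<close> of
  \<open>u\<close>. Such means take the place of the Cauchy integral in the spectral radius
  formula.\<close>

primrec avg :: "(complex \<Rightarrow> 'c) \<Rightarrow> nat \<Rightarrow> real \<Rightarrow> complex \<Rightarrow> 'c" where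
  "avg Y 0 r u = Y (of_real r * u)"
| "avg Y (Suc m) r u = cc (1/2) \<odot> (avg Y m r (csqrt u) + avg Y m r (- csqrt u))"

text \<open>The averages invert \<open>e - r\<^sup>n u x\<^sup>n\<close> for \<open>n = 2^m\<close>, because
  \<open>1 / (1 - z\<^sup>2)\<close> is the mean of \<open>1 / (1 - z)\<close> and \<open>1 / (1 + z)\<close>.\<close>

lemma avg_inverse:
  assumes x: "x \<in> C" and Y: "\<And>z. cmod z \<le> R \<Longrightarrow> Y z \<in> C" "\<And>z. cmod z \<le> R \<Longrightarrow> (e - cc z \<odot> x) \<odot> Y z - e \<in> I"
    and r: "0 \<le> r" "r \<le> R"
  shows "cmod u = 1 \<Longrightarrow> avg Y m r u \<in> C \<and> (e - cc (of_real (r ^ (2 ^ m)) * u) \<odot> pw x (2 ^ m)) \<odot> avg Y m r u - e \<in> I"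
proof (induction m arbitrary: u)
  case 0
  then show ?case using Y[of "of_real r * u"] r x by (simp add: norm_mult)
next
  case (Suc m)
  let ?s = "csqrt u" and ?X = "pw x (2 ^ m)" and ?t = "of_real (r ^ (2 ^ m)) :: complex"
  have s: "cmod ?s = 1" "cmod (- ?s) = 1" using Suc.prems by (simp_all add: norm_csqrt)
  note a = Suc.IH[OF s(1)] and b = Suc.IH[OF s(2)]
  define p where "p = avg Y m r ?s"
  define q where "q = avg Y m r (- ?s)"
  define z where "z = cc (?t * ?s) \<odot> ?X"
  have zX: "z \<in> C" "p \<in> C" "q \<in> C" using a b x by (auto simp: z_def p_def q_def)
  have ia: "(e - z) \<odot> p - e \<in> I" using a by (simp add: z_def p_def)
  have "cc (?t * - ?s) \<odot> ?X = - z" using x by (simp add: z_def cc_minus minus_mul)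
  then have ib: "(e + z) \<odot> q - e \<in> I" using b by (simp add: q_def)
  have zz: "cc (of_real (r ^ (2 ^ Suc m)) * u) \<odot> pw x (2 ^ Suc m) = z \<odot> z"
  proof -
    have "of_real (r ^ (2 ^ Suc m)) * u = (?t * ?s) * (?t * ?s)"
    proof -
      have "r ^ (2 ^ Suc m) = r ^ (2 ^ m) * r ^ (2 ^ m)" by (simp add: mult_2 flip: power_add)
      then have "of_real (r ^ (2 ^ Suc m)) * u = (?t * ?t) * (?s * ?s)"
        using power2_csqrt[of u] by (simp only: power2_eq_square of_real_mult)
      then show ?thesis by (simp only: mult_ac)
    qed
    moreover have "pw x (2 ^ Suc m) = ?X \<odot> ?X" using pw_add[OF x, of "2 ^ m" "2 ^ m"] by (simp add: mult_2)
    ultimately show ?thesis using x unfolding z_def by (simp add: cc_mult ring_rules)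
  qed
  let ?h = "cc (1/2)"
  have hh: "?h \<odot> y + ?h \<odot> y = y" if "y \<in> C" for y
  proof -
    have "?h \<odot> y + ?h \<odot> y = (?h + ?h) \<odot> y" using that by (simp add: add_mul)
    also have "?h + ?h = e" unfolding cc_add[symmetric] by (simp add: cc_1)
    finally show ?thesis using that by simp
  qed
  have "(e - z \<odot> z) \<odot> (?h \<odot> (p + q)) - (?h \<odot> e + ?h \<odot> e) =
     ?h \<odot> ((e + z) \<odot> ((e - z) \<odot> p - e)) + ?h \<odot> ((e - z) \<odot> ((e + z) \<odot> q - e))"
    using zX by (simp add: ring_rules)
  also have "\<dots> \<in> I" using ia ib zX by (intro ideal_add[OF I] ideal_mul[OF I]) auto
  finally have "(e - z \<odot> z) \<odot> (?h \<odot> (p + q)) - e \<in> I" using hh[OF e_in] by simp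
  then show ?case unfolding zz using zX by (simp add: p_def q_def)
qed

text \<open>A mean inherits the Lipschitz constant of \<open>Y\<close> for every \<open>m\<close>.
  This independence of the number of roots is what \<open>spectral_radius_step\<close>
  exploits.\<close>

lemma avg_diff:
  assumes Y: "\<And>z. cmod z \<le> R \<Longrightarrow> Y z \<in> C"
    and D: "\<And>z w. cmod z \<le> R \<Longrightarrow> cmod w \<le> R \<Longrightarrow> bq I (Y z - Y w) (D * cmod (z - w))"
    and r: "0 \<le> r" "r \<le> R" "0 \<le> s" "s \<le> R"
  shows "cmod u = 1 \<Longrightarrow> avg Y m r u \<in> C \<and> avg Y m s u \<in> C \<and> bq I (avg Y m r u - avg Y m s u) (D * \<bar>r - s\<bar>)"
proof (induction m arbitrary: u)
  case 0
  have "cmod (of_real r * u - of_real s * u) = \<bar>r - s\<bar>"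
    using 0 by (metis left_diff_distrib mult.right_neutral norm_mult norm_of_real of_real_diff)
  then show ?case using Y D[of "of_real r * u" "of_real s * u"] 0 r by (simp add: norm_mult)
next
  case (Suc m)
  have s: "cmod (csqrt u) = 1" "cmod (- csqrt u) = 1" using Suc.prems by (simp_all add: norm_csqrt)
  note a = Suc.IH[OF s(1)] and b = Suc.IH[OF s(2)]
  have "bq I (cc (1/2) \<odot> ((avg Y m r (csqrt u) - avg Y m s (csqrt u)) + (avg Y m r (- csqrt u) - avg Y m s (- csqrt u))))
     ((\<bar>Re (1/2)\<bar> + \<bar>Im (1/2)\<bar>) * (D * \<bar>r - s\<bar> + D * \<bar>r - s\<bar>))"
    using a b by (intro bq_mul bq_add bq_bd[OF bd_cc]) auto
  moreover have "avg Y (Suc m) r u - avg Y (Suc m) s u =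
     cc (1/2) \<odot> ((avg Y m r (csqrt u) - avg Y m s (csqrt u)) + (avg Y m r (- csqrt u) - avg Y m s (- csqrt u)))"
    using a b by (simp add: mul_add mul_diff algebra_simps)
  ultimately show ?case using a b by simp
qed

text \<open>At radius \<open>s\<close> the power with exponent \<open>N\<close> is almost 0, so its
  averaged resolvent is close to \<open>e\<close>. The averages at \<open>s\<close> and
  \<open>r\<close> differ by at most \<open>D * (r - s)\<close> whatever \<open>N\<close> is, so the
  one at \<open>r\<close> is close to \<open>e\<close> too; then the power at \<open>r\<close> is
  small, and all powers are bounded.\<close>

lemma spectral_radius_step:
  assumes x: "x \<in> C" and Y: "\<And>z. cmod z \<le> R \<Longrightarrow> Y z \<in> C" "\<And>z. cmod z \<le> R \<Longrightarrow> (e - cc z \<odot> x) \<odot> Y z - e \<in> I"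
    and D: "0 < D" "\<And>z w. cmod z \<le> R \<Longrightarrow> cmod w \<le> R \<Longrightarrow> bq I (Y z - Y w) (D * cmod (z - w))"
    and s: "0 \<le> s" "s \<le> r" "r \<le> R" "D * (r - s) \<le> 1 / 16"
    and small: "\<And>n. n > 0 \<Longrightarrow> bq I (pw (cc (of_real s) \<odot> x) n) (K * t ^ n)" "0 \<le> t" "t < 1"
  shows "\<exists>K. \<forall>n. bq I (pw (cc (of_real r) \<odot> x) n) K"
proof -
  have "(\<lambda>n. K * t ^ n) \<longlonglongrightarrow> K * 0" using small(2,3) by (intro tendsto_mult_left LIMSEQ_realpow_zero) auto
  then have "\<forall>\<^sub>F n in sequentially. K * t ^ n < 1 / 48" by (rule order_tendstoD) simp
  then obtain m0 where m0: "\<And>n. n \<ge> m0 \<Longrightarrow> K * t ^ n < 1 / 48" unfolding eventually_sequentially by blast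
  define N :: nat where "N = 2 ^ m0"
  have N: "N > 0" "N \<ge> m0" by (auto simp: N_def intro: less_imp_le)
  define v where "v = pw (cc (of_real s) \<odot> x) N"
  define w where "w = pw (cc (of_real r) \<odot> x) N"
  have vw: "v \<in> C" "w \<in> C" using x by (auto simp: v_def w_def)
  have eqw: "cc (of_real (r ^ (2 ^ m0)) * 1) \<odot> pw x (2 ^ m0) = w" "cc (of_real (s ^ (2 ^ m0)) * 1) \<odot> pw x (2 ^ m0) = v"
    using x by (simp_all add: v_def w_def N_def pw_mul pw_cc)
  \<comment> \<open>With \<open>p\<close> bounded by 3 this puts \<open>p\<close> within 1/16 of
    \<open>e\<close>; adding the 1/16 between \<open>q\<close> and \<open>p\<close> gives 1/8, and
    absorption bounds \<open>w\<close> by 3/8.\<close>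
  have small': "bq I v (1 / 48)" using bq_mono[OF small(1)[OF N(1)], of "1/48"] m0[OF N(2)] by (simp add: v_def)
  define p where "p = avg Y m0 s 1"
  define q where "q = avg Y m0 r 1"
  have s0: "s \<le> R" "0 \<le> r" using s by auto
  have p: "p \<in> C" "(e - v) \<odot> p - e \<in> I" using avg_inverse[where Y = Y, OF x Y s(1) s0(1), of 1 m0] eqw(2) by (auto simp: p_def)
  have q: "q \<in> C" "(e - w) \<odot> q - e \<in> I" using avg_inverse[where Y = Y, OF x Y s0(2) s(3), of 1 m0] eqw(1) by (auto simp: q_def)
  have qp: "bq I (q - p) (1 / 16)"
    using avg_diff[where Y = Y, OF Y(1) D(2) s0(2) s(3) s(1) s0(1), of 1 m0] s(2,4) by (auto simp: p_def q_def intro: bq_mono)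
  have be: "bq I e 1" using bq_bd[OF bd_cc[of 1]] by (simp add: cc_1)
  have p3: "bq I p 3"
  proof -
    obtain K0 where "bq I p K0" using bq_ex[OF p(1)] by blast
    then have "bq I p (3 * 1)"
    proof (rule bq_absorb)
      fix K assume K: "bq I p K"
      have "bq I (e + v \<odot> p) (1 + 1 / 48 * K)" using vw p by (intro bq_add be bq_mul small' K) auto
      moreover have "p - (e + v \<odot> p) = (e - v) \<odot> p - e" using vw p by (simp add: diff_mul)
      ultimately have "bq I p (1 + 1 / 48 * K)" using bq_cong p(2) by metis
      then show "bq I p (1 + K / 2)" by (rule bq_mono) (use bq_nonneg[OF K] in simp)
    qed simp
    then show ?thesis by simp
  qed
  have "bq I (v \<odot> p) (1 / 48 * 3)" using vw p by (intro bq_mul small' p3)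
  moreover have "(p - e) - v \<odot> p \<in> I" using p vw by (simp add: diff_mul algebra_simps)
  ultimately have pe: "bq I (p - e) (1 / 16)" using bq_cong by fastforce
  have "bq I ((q - p) + (p - e)) (1 / 16 + 1 / 16)" using p q by (intro bq_add qp pe) auto
  then have qe: "bq I (q - e) (1 / 8)" by simp
  obtain K0 where "bq I w K0" using bq_ex[OF vw(2)] by blast
  then have "bq I w (3 * (1 / 8))"
  proof (rule bq_absorb)
    fix K assume K: "bq I w K"
    have "bq I ((q - e) - w \<odot> (q - e)) (1 / 8 + K * (1 / 8))" using vw q by (intro bq_diff qe bq_mul K) auto
    moreover have "w - ((q - e) - w \<odot> (q - e)) = - ((e - w) \<odot> q - e)" using vw q by (simp add: diff_mul mul_diff algebra_simps)
    ultimately have "bq I w (1 / 8 + K * (1 / 8))" using bq_cong ideal_minus[OF I q(2)] by metis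
    then show "bq I w (1 / 8 + K / 2)" by (rule bq_mono) (use bq_nonneg[OF K] in simp)
  qed simp
  then have "bq I w 1" by (rule bq_mono) simp
  then show ?thesis using x by (intro pw_bounded_if_pw_le_1[OF _ N(1)]) (auto simp: w_def)
qed

text \<open>A continuation in the radius. Bounded powers at one radius decay geometrically at any
  smaller one, and \<open>spectral_radius_step\<close> then carries boundedness a fixed distance
  beyond, so finitely many steps reach \<open>R\<close>.\<close>

lemma spectral_radius:
  assumes x: "x \<in> C" and R: "0 < R"
    and Y: "\<And>z. cmod z \<le> R \<Longrightarrow> \<exists>y\<in>C. (e - cc z \<odot> x) \<odot> y - e \<in> I"
  shows "\<exists>K. \<forall>n. bq I (pw (cc (of_real R) \<odot> x) n) K"
proof -
  have "\<forall>z. \<exists>y. cmod z \<le> R \<longrightarrow> y \<in> C \<and> (e - cc z \<odot> x) \<odot> y - e \<in> I" using Y by blast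
  then obtain Y' where Y': "\<And>z. cmod z \<le> R \<Longrightarrow> Y' z \<in> C" "\<And>z. cmod z \<le> R \<Longrightarrow> (e - cc z \<odot> x) \<odot> Y' z - e \<in> I" by metis
  obtain D where D: "0 < D" "\<And>z w. cmod z \<le> R \<Longrightarrow> cmod w \<le> R \<Longrightarrow> bq I (Y' z - Y' w) (D * cmod (z - w))"
    using resolvent_lipschitz[of x R Y', OF x Y'] by blast
  define d where "d = 1 / (32 * D)"
  have d: "d > 0" "D * (2 * d) \<le> 1 / 16" using D(1) by (auto simp: d_def)
  have "\<exists>K. \<forall>n. bq I (pw (cc (of_real (min R (real k * d))) \<odot> x) n) K" for k :: nat
  proof (induction k)
    case 0
    have "bq I (pw 0 n) 1" for n
    proof (cases n)
      case 0
      then show ?thesis using bq_bd[OF bd_cc[of 1]] by (simp add: cc_1)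
    next
      case (Suc m)
      have "0 \<odot> pw 0 m = 0" using mul_comm[of 0 "pw 0 m"] by simp
      then show ?thesis using Suc bq_mono[OF bq_bd[OF bd_cc[of 0]], of 1] by (simp add: cc_0)
    qed
    then show ?case using R x mul_comm[of 0 x] by (auto simp: cc_0 min_def)
  next
    case (Suc k)
    let ?r = "min R (real k * d)" and ?r' = "min R (real (Suc k) * d)"
    \<comment> \<open>One step behind the current radius: if \<open>s\<close> is positive, the
      powers decay there with ratio \<open>s / ?r\<close>, and the next radius is at most
      \<open>2 * d\<close> away, which is the admissible distance.\<close>
    define s where "s = max 0 (?r - d)"
    obtain K where K: "\<And>n. bq I (pw (cc (of_real ?r) \<odot> x) n) K" using Suc by blast
    have s: "0 \<le> s" "s \<le> ?r'" "D * (?r' - s) \<le> 1 / 16"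
    proof -
      show "0 \<le> s" by (simp add: s_def)
      have "?r \<le> ?r'" "?r' \<le> ?r + d" using d(1) by (auto simp: min_def distrib_right)
      moreover have "0 \<le> ?r'" using R d(1) by simp
      ultimately show "s \<le> ?r'" using d(1) by (auto simp: s_def)
      have "?r' - s \<le> 2 * d" using \<open>?r' \<le> ?r + d\<close> by (simp add: s_def)
      then have "D * (?r' - s) \<le> D * (2 * d)" using D(1) by (intro mult_left_mono) auto
      then show "D * (?r' - s) \<le> 1 / 16" using d(2) by simp
    qed
    have "\<exists>K t. 0 \<le> t \<and> t < 1 \<and> (\<forall>n>0. bq I (pw (cc (of_real s) \<odot> x) n) (K * t ^ n))"
    proof (cases "s = 0")
      case True
      have "bq I (pw (cc (of_real s) \<odot> x) n) (0 * (0::real) ^ n)" if n0: "n > 0" for n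
      proof -
        obtain m where m: "n = Suc m" using n0 by (cases n) auto
        have "0 \<odot> pw 0 m = 0" "0 \<odot> x = 0" using mul_comm[of 0 "pw 0 m"] mul_comm[of 0 x] x by auto
        then show ?thesis using m True bq_bd[OF bd_cc[of 0]] by (simp add: cc_0)
      qed
      then show ?thesis by (intro exI[of _ 0]) auto
    next
      case False
      then have r: "s < ?r" "0 < ?r" using s(1) d(1) by (auto simp: s_def)
      define t where "t = s / ?r"
      have t: "0 \<le> t" "t < 1" using r s(1) by (auto simp: t_def)
      have "bq I (pw (cc (of_real s) \<odot> x) n) (K * t ^ n)" for n
      proof -
        have "cc (of_real s) \<odot> x = cc (of_real t) \<odot> (cc (of_real ?r) \<odot> x)"
        proof -
          have "s = s / q * q" if "0 < q" for q :: real using that by simp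
          from this[OF r(2)] have "s = t * ?r" by (simp only: t_def)
          then have "of_real s = of_real t * (of_real ?r :: complex)" by (metis of_real_mult)
          then show ?thesis using x by (simp add: cc_mult mul_assoc)
        qed
        then have "pw (cc (of_real s) \<odot> x) n = cc (of_real t ^ n) \<odot> pw (cc (of_real ?r) \<odot> x) n"
          using x by (simp add: pw_mul pw_cc)
        moreover have "bq I (cc (of_real t ^ n) \<odot> pw (cc (of_real ?r) \<odot> x) n) ((\<bar>Re (of_real t ^ n)\<bar> + \<bar>Im (of_real t ^ n)\<bar>) * K)"
          using x by (intro bq_mul bq_bd[OF bd_cc] K) auto
        moreover have "\<bar>Re (of_real t ^ n)\<bar> + \<bar>Im (of_real t ^ n)\<bar> = t ^ n" using t(1) by (simp flip: of_real_power)
        ultimately show ?thesis by (simp add: mult.commute)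
      qed
      then show ?thesis using t by blast
    qed
    then obtain K' t where "0 \<le> t" "t < 1" "\<And>n. n > 0 \<Longrightarrow> bq I (pw (cc (of_real s) \<odot> x) n) (K' * t ^ n)" by blast
    then show ?case by (intro spectral_radius_step[of x R Y' D s, OF x Y' D s(1,2) _ s(3)]) auto
  qed
  moreover obtain k :: nat where "R / d < real k" using reals_Archimedean2 by blast
  then have "min R (real k * d) = R" using d(1) by (simp add: field_simps min_def)
  ultimately show ?thesis by metis
qed

text \<open>An element within 1/2 of \<open>e\<close> is invertible by the Neumann series, and an
  ideal containing one contains \<open>e\<close>.\<close>

lemma not_bq_e_small:
  assumes "e \<notin> I"
  shows "\<not> bq I e (1/2)"
proof
  assume "bq I e (1/2)"
  then obtain a where a: "a \<in> I" "bd (e - a) (1/2)" unfolding bq_def by blast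
  have aC: "a \<in> C" by (rule ideal_in[OF I a(1)])
  obtain y where y: "y \<in> C" "y \<odot> (e - (e - a)) = e" using neumann[OF _ a(2)] aC by auto
  then have "y \<odot> a = e" by simp
  then show False using ideal_mul[OF I a(1) y(1)] assms by simp
qed

text \<open>The conclusion says that \<open>I\<close> and \<open>x - cc z\<close> together generate
  a proper ideal. Otherwise \<open>x - cc z\<close> is invertible modulo \<open>I\<close> for every
  \<open>z\<close>, so the powers of \<open>x\<close> are dominated by every geometric sequence. But
  \<open>b 0\<close> inverts \<open>x\<close> modulo \<open>I\<close>, so \<open>e\<close> is
  congruent to all powers of \<open>b 0 \<odot> x\<close>, and these tend to 0. This is the argument
  of Gelfand and Mazur, with the spectral radius in place of Liouville's theorem.\<close>

lemma exists_character_value: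
  assumes x: "x \<in> C" and ne: "e \<notin> I"
  shows "\<exists>z. \<forall>a\<in>I. \<forall>b\<in>C. a + b \<odot> (x - cc z) \<noteq> e"
proof (rule ccontr)
  assume "\<not> ?thesis"
  then have "\<forall>z. \<exists>b\<in>C. \<exists>a\<in>I. a + b \<odot> (x - cc z) = e" by blast
  then obtain b where b: "\<And>z. b z \<in> C" "\<And>z. \<exists>a\<in>I. a + b z \<odot> (x - cc z) = e" by metis
  have bI: "b z \<odot> (x - cc z) - e \<in> I" for z
  proof -
    obtain a where a: "a \<in> I" "a + b z \<odot> (x - cc z) = e" using b(2) by blast
    then have "b z \<odot> (x - cc z) - e = - a" by (simp add: algebra_simps flip: a(2))
    then show ?thesis using ideal_minus[OF I a(1)] by simp
  qed
  have inv: "\<exists>y\<in>C. (e - cc z \<odot> x) \<odot> y - e \<in> I" for z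
  proof (cases "z = 0")
    case True
    have "(e - cc z \<odot> x) \<odot> e - e = 0" using True x mul_comm[of 0 x] by (simp add: cc_0)
    then show ?thesis using I by (intro bexI[of _ e]) (auto simp: ideal_def)
  next
    case False
    \<comment> \<open>From the factorization of \<open>x - 1/z\<close> as \<open>- (1/z)\<close>
      times \<open>e - z x\<close>.\<close>
    let ?y = "cc (- (1 / z)) \<odot> b (1 / z)"
    have "cc z \<odot> cc (1 / z) = e" using False by (simp add: cc_1 flip: cc_mult)
    then have "cc z \<odot> (cc (1 / z) \<odot> y) = y" if "y \<in> C" for y
      using that by (metis cc_in e_mul mul_assoc)
    then have "(e - cc z \<odot> x) \<odot> ?y - e = b (1 / z) \<odot> (x - cc (1 / z)) - e"
      using x b(1) mul_lcomm[of x "cc (1/z)" "b (1/z)"]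
      by (simp add: cc_minus minus_mul mul_minus mul_diff diff_mul mul_assoc mul_comm[of x] mul_comm[of _ "cc (1/z)"])
    then show ?thesis using bI x b(1) by (intro bexI[of _ ?y]) auto
  qed
  obtain B0 where B0: "bq I (b 0) B0" using bq_ex[OF b(1)] by blast
  define B where "B = B0 + 1"
  have B: "bq I (b 0) B" "0 < B" using bq_mono[OF B0, of B] bq_nonneg[OF B0] by (auto simp: B_def)
  \<comment> \<open>The powers of \<open>b 0\<close> contribute at most \<open>B ^ n\<close>, so the
    ratio \<open>B / R = 1/2\<close> makes the bound on \<open>e\<close> tend to 0.\<close>
  define R where "R = 2 * B"
  have R: "R > 0" using B by (simp add: R_def)
  obtain K where K: "\<And>n. bq I (pw (cc (of_real R) \<odot> x) n) K" using spectral_radius[of x R, OF x R inv] by blast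
  have be: "bq I e (K * (1/2) ^ n)" for n
  proof -
    have e1: "e - pw (b 0 \<odot> x) n \<in> I"
    proof (induction n)
      case 0
      then show ?case using I by (simp add: ideal_def)
    next
      case (Suc n)
      let ?p = "pw (b 0 \<odot> x) n"
      have p: "?p \<in> C" using x b(1) by simp
      have "e - b 0 \<odot> x \<odot> ?p = (e - ?p) - ?p \<odot> (b 0 \<odot> x - e)"
        using p x b(1) mul_comm[of ?p "b 0 \<odot> x"] by (simp add: mul_diff)
      moreover have m: "b 0 \<odot> x - e \<in> I" using bI[of 0] by (simp add: cc_0)
      have "(e - ?p) - ?p \<odot> (b 0 \<odot> x - e) \<in> I" by (rule ideal_diff[OF I Suc ideal_mul[OF I m p]])
      ultimately show ?case by (simp only: pw.simps)
    qed
    have m1: "pw (b 0 \<odot> x) n = cc (of_real ((1 / R) ^ n)) \<odot> (pw (b 0) n \<odot> pw (cc (of_real R) \<odot> x) n)"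
    proof -
      have "cc (of_real ((1 / R) ^ n)) \<odot> cc (of_real R ^ n) = e"
        using R by (simp add: cc_1 flip: cc_mult of_real_power power_mult_distrib of_real_mult)
      then have "cc (of_real ((1 / R) ^ n)) \<odot> (cc (of_real R ^ n) \<odot> y) = y" if "y \<in> C" for y
        using that by (metis cc_in e_mul mul_assoc)
      then show ?thesis using x b(1) mul_lcomm[of "pw (b 0) n" "cc (of_real R ^ n)" "pw x n"]
        by (simp add: pw_mul pw_cc)
    qed
    have m2: "bq I (cc (of_real ((1 / R) ^ n)) \<odot> (pw (b 0) n \<odot> pw (cc (of_real R) \<odot> x) n))
        ((\<bar>Re (of_real ((1 / R) ^ n))\<bar> + \<bar>Im (of_real ((1 / R) ^ n))\<bar>) * (B ^ n * K))"
      using x b(1) by (intro bq_mul bq_bd[OF bd_cc] bq_pw B(1) K) auto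
    have m3: "(\<bar>Re (of_real ((1 / R) ^ n))\<bar> + \<bar>Im (of_real ((1 / R) ^ n))\<bar>) * (B ^ n * K) = K * (1/2) ^ n"
      using R B(2) by (simp add: R_def power_divide power_mult_distrib)
    have "bq I (pw (b 0 \<odot> x) n) (K * (1/2) ^ n)" unfolding m1 by (rule m2[unfolded m3])
    then show ?thesis by (rule bq_cong[OF e1])
  qed
  have "(\<lambda>n. K * (1/2::real) ^ n) \<longlonglongrightarrow> K * 0" by (intro tendsto_mult_left LIMSEQ_realpow_zero) auto
  then have "\<forall>\<^sub>F n in sequentially. K * (1/2) ^ n < 1 / 2" by (rule order_tendstoD) simp
  then obtain n where "K * (1/2) ^ n < 1 / 2" by (auto simp: eventually_sequentially)
  then have "bq I e (1/2)" using bq_mono[OF be[of n]] by simp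
  then show False using not_bq_e_small[OF ne] by blast
qed

end

section \<open>Joint character values and invertibility\<close>

lemma exists_character_values:
  assumes "ideal I" "e \<notin> I" "set xs \<subseteq> C"
  shows "\<exists>I' zs. ideal I' \<and> e \<notin> I' \<and> I \<subseteq> I' \<and> length zs = length xs \<and> (\<forall>i<length xs. xs ! i - cc (zs ! i) \<in> I')"
  using assms
proof (induction xs arbitrary: I)
  case Nil
  then show ?case by auto
next
  case (Cons x xs)
  have x: "x \<in> C" using Cons.prems by simp
  obtain z where z: "\<And>a b. a \<in> I \<Longrightarrow> b \<in> C \<Longrightarrow> a + b \<odot> (x - cc z) \<noteq> e"
    using exists_character_value[OF Cons.prems(1) x Cons.prems(2)] by blast
  define I1 where "I1 = {a + b \<odot> (x - cc z) | a b. a \<in> I \<and> b \<in> C}"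
  have I: "0 \<in> I" "I \<subseteq> C" using Cons.prems(1) by (auto simp: ideal_def)
  have sub: "I \<subseteq> I1"
  proof
    fix a assume "a \<in> I"
    then show "a \<in> I1" unfolding I1_def using x mul_comm[of 0 "x - cc z"] by (intro CollectI exI[of _ a] exI[of _ 0]) simp
  qed
  have "ideal I1"
    unfolding ideal_def
  proof (intro conjI ballI)
    show "I1 \<subseteq> C" using I(2) x by (auto simp: I1_def)
    show "0 \<in> I1" using sub I(1) by blast
    fix u assume "u \<in> I1"
    then obtain a b where u: "u = a + b \<odot> (x - cc z)" "a \<in> I" "b \<in> C" by (auto simp: I1_def)
    { fix v assume "v \<in> I1"
      then obtain a' b' where v: "v = a' + b' \<odot> (x - cc z)" "a' \<in> I" "b' \<in> C" by (auto simp: I1_def)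
      have "u + v = (a + a') + (b + b') \<odot> (x - cc z)" using u v x by (simp add: add_mul)
      then show "u + v \<in> I1" unfolding I1_def using ideal_add[OF Cons.prems(1) u(2) v(2)] u(3) v(3) add_in by blast }
    { fix y assume y: "y \<in> C"
      have "y \<odot> u = y \<odot> a + (y \<odot> b) \<odot> (x - cc z)" using u x y I(2) by (simp add: mul_add mul_assoc subset_iff)
      then show "y \<odot> u \<in> I1" unfolding I1_def using ideal_mul[OF Cons.prems(1) u(2) y] u(3) y mul_in by blast }
  qed
  moreover have "e \<notin> I1" using z by (fastforce simp: I1_def)
  ultimately obtain I' zs where I': "ideal I'" "e \<notin> I'" "I1 \<subseteq> I'" "length zs = length xs" "\<And>i. i < length xs \<Longrightarrow> xs ! i - cc (zs ! i) \<in> I'"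
    using Cons.IH[of I1] Cons.prems(3) by auto
  have "x - cc z \<in> I1" unfolding I1_def using I(1) x by (intro CollectI exI[of _ 0] exI[of _ e]) simp
  then have "(x # xs) ! i - cc ((z # zs) ! i) \<in> I'" if "i < length (x # xs)" for i
    using that I'(3,5) by (cases i) auto
  then show ?case using I' sub by (intro exI[of _ I'] exI[of _ "z # zs"]) auto
qed

primrec list_product :: "'c list \<Rightarrow> 'c" where
  "list_product [] = e"
| "list_product (x # xs) = x \<odot> list_product xs"

lemma list_product_in [simp]: "set xs \<subseteq> C \<Longrightarrow> list_product xs \<in> C"
  by (induction xs) auto

lemma list_product_cong_ideal:
  assumes "ideal I" "set xs \<subseteq> C" "length zs = length xs" "\<forall>i<length xs. xs ! i - cc (zs ! i) \<in> I"
  shows "list_product xs - cc (prod_list zs) \<in> I"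
  using assms(2-)
proof (induction xs arbitrary: zs)
  case Nil
  then show ?case using assms(1) by (simp add: cc_1 ideal_def)
next
  case (Cons x xs)
  obtain z ws where z: "zs = z # ws" using Cons.prems(2) by (cases zs) auto
  have 1: "list_product xs - cc (prod_list ws) \<in> I" using Cons z by (intro Cons.IH) auto
  have 2: "x - cc z \<in> I" using Cons.prems(3) z by auto
  have c: "x \<in> C" "list_product xs \<in> C" using Cons.prems(1) by auto
  have "x \<odot> list_product xs - cc (prod_list zs) = x \<odot> (list_product xs - cc (prod_list ws)) + cc (prod_list ws) \<odot> (x - cc z)"
    using c z by (simp add: mul_diff cc_mult mul_comm[of "cc (prod_list ws)"])
  then show ?case using 1 2 c by (simp add: ideal_add[OF assms(1)] ideal_mul[OF assms(1)])
qed

text \<open>A common zero of \<open>x\<^sub>0 - \<Prod> xs\<close> in the character space would give a relation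
  \<open>z\<^sub>0 = \<Prod> zs\<close> between spectral values.\<close>

theorem product_invertible:
  assumes x0: "x0 \<in> C" and xs: "set xs \<subseteq> C"
    and res: "\<And>z0 zs. length zs = length xs \<Longrightarrow> z0 = prod_list zs \<Longrightarrow>
      (\<exists>y\<in>C. y \<odot> (x0 - cc z0) = e) \<or> (\<exists>i<length xs. \<exists>y\<in>C. y \<odot> (xs ! i - cc (zs ! i)) = e)"
  shows "\<exists>y\<in>C. y \<odot> (x0 - list_product xs) = e"
proof (rule ccontr)
  assume no: "\<not> ?thesis"
  let ?d = "x0 - list_product xs"
  have d: "?d \<in> C" using x0 xs by simp
  define I where "I = {b \<odot> ?d | b. b \<in> C}"
  have "ideal I"
    unfolding ideal_def
  proof (intro conjI ballI)
    show "I \<subseteq> C" using d by (auto simp: I_def)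
    show "0 \<in> I" unfolding I_def using d mul_comm[of 0 ?d] by (intro CollectI exI[of _ 0]) simp
    fix u assume "u \<in> I"
    then obtain b where u: "u = b \<odot> ?d" "b \<in> C" by (auto simp: I_def)
    { fix v assume "v \<in> I"
      then obtain b' where v: "v = b' \<odot> ?d" "b' \<in> C" by (auto simp: I_def)
      have "u + v = (b + b') \<odot> ?d" using u v d by (simp add: add_mul)
      then show "u + v \<in> I" unfolding I_def using u v by auto }
    { fix y assume y: "y \<in> C"
      have "y \<odot> u = (y \<odot> b) \<odot> ?d" using u d y by (simp add: mul_assoc)
      then show "y \<odot> u \<in> I" unfolding I_def using u y by auto }
  qed
  moreover have "e \<notin> I" using no by (auto simp: I_def)
  ultimately obtain I' zs where I': "ideal I'" "e \<notin> I'" "I \<subseteq> I'" "length zs = length (x0 # xs)"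
    "\<And>i. i < length (x0 # xs) \<Longrightarrow> (x0 # xs) ! i - cc (zs ! i) \<in> I'"
    using exists_character_values[of I "x0 # xs"] x0 xs by auto
  obtain z0 ws where z: "zs = z0 # ws" "length ws = length xs" using I'(4) by (cases zs) auto
  have i0: "x0 - cc z0 \<in> I'" using I'(5)[of 0] z by simp
  have iss: "xs ! i - cc (ws ! i) \<in> I'" if "i < length xs" for i using I'(5)[of "Suc i"] z that by simp
  have mI: "list_product xs - cc (prod_list ws) \<in> I'" using iss by (intro list_product_cong_ideal[OF I'(1) xs z(2)]) auto
  have "?d \<in> I" unfolding I_def using d by (intro CollectI exI[of _ e]) simp
  then have dI: "?d \<in> I'" using I'(3) by blast
  have "?d - (x0 - cc z0) + (list_product xs - cc (prod_list ws)) \<in> I'"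
    by (rule ideal_add[OF I'(1) ideal_diff[OF I'(1) dI i0] mI])
  \<comment> \<open>A proper ideal contains no nonzero scalar, so the character values satisfy the
    resonance relation exactly.\<close>
  then have c: "cc (z0 - prod_list ws) \<in> I'" by (simp add: cc_diff)
  have "z0 = prod_list ws"
  proof (rule ccontr)
    assume "z0 \<noteq> prod_list ws"
    then have "cc (1 / (z0 - prod_list ws)) \<odot> cc (z0 - prod_list ws) = e" by (simp add: cc_1 flip: cc_mult)
    then show False using ideal_mul[OF I'(1) c, of "cc (1 / (z0 - prod_list ws))"] I'(2) by simp
  qed
  from res[OF z(2) this] show False
  proof (elim disjE exE conjE bexE)
    fix y assume "y \<in> C" "y \<odot> (x0 - cc z0) = e"
    then show False using ideal_mul[OF I'(1) i0] I'(2) by metis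
  next
    fix i y assume "i < length xs" "y \<in> C" "y \<odot> (xs ! i - cc (ws ! i)) = e"
    then show False using ideal_mul[OF I'(1) iss] I'(2) by metis
  qed
qed

end


section \<open>Operators on multilinear maps with decay\<close>

text \<open>The pair \<open>(x, y)\<close> stands for \<open>x + i y\<close>. Operators vanish outside the carrier \<open>W\<close>, so that equality of
  operators is equality of functions.\<close>

definition csc :: "complex \<Rightarrow> 'v \<times> 'v \<Rightarrow> 'v \<times> 'v::real_vector" where
  "csc z p = (Re z *\<^sub>R fst p - Im z *\<^sub>R snd p, Re z *\<^sub>R snd p + Im z *\<^sub>R fst p)"

lemma csc_1 [simp]: "csc 1 p = p" by (simp add: csc_def)
lemma csc_add: "csc (z + w) p = csc z p + csc w p" by (simp add: csc_def algebra_simps)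
lemma csc_mult: "csc (z * w) p = csc z (csc w p)"
  by (simp add: csc_def scaleR_diff_left scaleR_add_left scaleR_diff_right scaleR_add_right algebra_simps)
lemma linear_csc: "linear (csc z)"
  by (rule linearI) (simp_all add: csc_def algebra_simps)
lemmas csc_linear = linear_add[OF linear_csc] linear_diff[OF linear_csc] linear_neg[OF linear_csc] linear_0[OF linear_csc]
lemma csc_of_real: "csc (of_real c) p = c *\<^sub>R p" by (simp add: csc_def scaleR_prod_def)

locale decay_operators = gauged Fam
  for Fam :: "'o option \<Rightarrow> (('a::banach \<Rightarrow> 'b::real_normed_vector) \<times> real) set" +
  fixes j :: nat
begin

definition NB :: "real \<Rightarrow> ('a list \<Rightarrow> 'a \<times> 'a) \<Rightarrow> bool" where
  "NB K P \<longleftrightarrow> (\<exists>K1 K2. MB j K1 (\<lambda>vs. fst (P vs)) \<and> MB j K2 (\<lambda>vs. snd (P vs)) \<and> K1 + K2 \<le> K)"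

text \<open>Values on lists of other lengths are set to 0, so that elements agreeing on lists of
  length \<open>j\<close> are equal as functions.\<close>

definition W :: "('a list \<Rightarrow> 'a \<times> 'a) set" where
  "W = {P. multilinear_map j P \<and> (\<exists>K. NB K P) \<and> (\<forall>vs. length vs \<noteq> j \<longrightarrow> P vs = 0)}"

lemma NB_nonneg: "NB K P \<Longrightarrow> 0 \<le> K"
  unfolding NB_def by (auto dest!: MB_nonneg)

lemma NB_mono: "NB K P \<Longrightarrow> K \<le> L \<Longrightarrow> NB L P"
  unfolding NB_def by (meson order_trans)

lemma NB_add:
  assumes "NB K P" "NB L P'"
  shows "NB (K + L) (P + P')"
proof -
  obtain K1 K2 L1 L2 where K: "MB j K1 (\<lambda>vs. fst (P vs))" "MB j K2 (\<lambda>vs. snd (P vs))" "K1 + K2 \<le> K"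
    and L: "MB j L1 (\<lambda>vs. fst (P' vs))" "MB j L2 (\<lambda>vs. snd (P' vs))" "L1 + L2 \<le> L"
    using assms unfolding NB_def by blast
  have "MB j (K1 + L1) (\<lambda>vs. fst ((P + P') vs))" "MB j (K2 + L2) (\<lambda>vs. snd ((P + P') vs))"
    using MB_add[OF K(1) L(1)] MB_add[OF K(2) L(2)] by simp_all
  moreover have "(K1 + L1) + (K2 + L2) \<le> K + L" using K(3) L(3) by simp
  ultimately show ?thesis unfolding NB_def by blast
qed

lemma NB_csc:
  assumes "NB K P"
  shows "NB ((\<bar>Re z\<bar> + \<bar>Im z\<bar>) * K) (\<lambda>vs. csc z (P vs))"
proof -
  obtain K1 K2 where K: "MB j K1 (\<lambda>vs. fst (P vs))" "MB j K2 (\<lambda>vs. snd (P vs))" "K1 + K2 \<le> K"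
    using assms unfolding NB_def by blast
  have "MB j (\<bar>Re z\<bar> * K1 + \<bar>Im z\<bar> * K2) (\<lambda>vs. fst (csc z (P vs)))"
    using MB_diff[OF MB_scale[OF K(1), of "Re z"] MB_scale[OF K(2), of "Im z"]] by (simp add: csc_def)
  moreover have "MB j (\<bar>Re z\<bar> * K2 + \<bar>Im z\<bar> * K1) (\<lambda>vs. snd (csc z (P vs)))"
    using MB_add[OF MB_scale[OF K(2), of "Re z"] MB_scale[OF K(1), of "Im z"]] by (simp add: csc_def)
  moreover have "(\<bar>Re z\<bar> * K1 + \<bar>Im z\<bar> * K2) + (\<bar>Re z\<bar> * K2 + \<bar>Im z\<bar> * K1) \<le> (\<bar>Re z\<bar> + \<bar>Im z\<bar>) * K"
  proof -
    have "(\<bar>Re z\<bar> * K1 + \<bar>Im z\<bar> * K2) + (\<bar>Re z\<bar> * K2 + \<bar>Im z\<bar> * K1) = (\<bar>Re z\<bar> + \<bar>Im z\<bar>) * (K1 + K2)" by (simp add: algebra_simps)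
    also have "\<dots> \<le> (\<bar>Re z\<bar> + \<bar>Im z\<bar>) * K" using K(3) by (intro mult_left_mono) auto
    finally show ?thesis .
  qed
  ultimately show ?thesis unfolding NB_def by blast
qed

lemma NB_minus: "NB K P \<Longrightarrow> NB K (- P)"
  using NB_csc[of K P "-1"] by (simp add: csc_def fun_Compl_def uminus_prod_def)

lemma NB_diff: "NB K P \<Longrightarrow> NB L P' \<Longrightarrow> NB (K + L) (P - P')"
  using NB_add[OF _ NB_minus, of K P L P'] by simp

lemma NB_zero_imp:
  assumes "\<And>n::nat. NB (K / 2 ^ n) P" "P \<in> W"
  shows "P = 0"
proof
  fix vs
  show "P vs = 0 vs"
  proof (cases "length vs = j")
    case True
    have lim: "(\<lambda>n. K / 2 ^ n) \<longlonglongrightarrow> 0"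
      using LIMSEQ_divide_realpow_zero[of 2 K] by simp
    have "MB j (K / 2 ^ n) (\<lambda>vs. fst (P vs)) \<and> MB j (K / 2 ^ n) (\<lambda>vs. snd (P vs))" for n
    proof -
      obtain K1 K2 where K: "MB j K1 (\<lambda>vs. fst (P vs))" "MB j K2 (\<lambda>vs. snd (P vs))" "K1 + K2 \<le> K / 2 ^ n"
        using assms(1) unfolding NB_def by blast
      have "K1 \<le> K / 2 ^ n" "K2 \<le> K / 2 ^ n" using K(3) MB_nonneg[OF K(1)] MB_nonneg[OF K(2)] by auto
      then show ?thesis using MB_mono[OF K(1)] MB_mono[OF K(2)] by blast
    qed
    then have "MB j 0 (\<lambda>vs. fst (P vs))" "MB j 0 (\<lambda>vs. snd (P vs))"
      using MB_limit[OF tendsto_const _ lim] by blast+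
    then have "fst (P vs) = 0" "snd (P vs) = 0" using MB_zeroD True by blast+
    then show ?thesis by (simp add: prod_eq_iff)
  next
    case False
    then show ?thesis using assms(2) by (simp add: W_def)
  qed
qed

lemma W_add: "P \<in> W \<Longrightarrow> P' \<in> W \<Longrightarrow> P + P' \<in> W"
  unfolding W_def using NB_add multilinear_add[of j P P'] by (fastforce simp: plus_fun_def)

lemma W_csc: "P \<in> W \<Longrightarrow> (\<lambda>vs. csc z (P vs)) \<in> W"
  unfolding W_def using NB_csc multilinear_compose_linear[OF linear_csc] by (fastforce simp: linear_0[OF linear_csc])

lemma csc_minus1: "(\<lambda>vs. csc (-1) (P vs)) = - P"
  by (simp add: csc_def fun_eq_iff prod_eq_iff)

lemma W_minus: "P \<in> W \<Longrightarrow> - P \<in> W"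
  using W_csc[of P "-1"] unfolding csc_minus1[of P] .

lemma W_diff: "P \<in> W \<Longrightarrow> P' \<in> W \<Longrightarrow> P - P' \<in> W"
  using W_add[OF _ W_minus, of P P'] by simp

lemma W_0: "0 \<in> W"
  unfolding W_def NB_def using MB_zero[of 0 j] multilinear_zero[of j]
  by (auto simp: zero_fun_def intro!: exI[of _ 0])

lemma W_NB: "P \<in> W \<Longrightarrow> \<exists>K. NB K P" by (simp add: W_def)

text \<open>The sum is taken pointwise, in each of the two components, and the bounds pass to the
  limit by \<open>MB_limit\<close>. The tail is at most \<open>2 * L / 2 ^ n\<close> in each
  component, hence the factor 4.\<close>

lemma W_complete:
  assumes Q: "\<And>n::nat. Q n \<in> W" "\<And>n. NB (L / 2 ^ n) (Q n)"
  shows "\<exists>S\<in>W. \<forall>n. NB (4 * L / 2 ^ n) (S - (\<Sum>k<n. Q k))"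
proof -
  have sm: "(\<Sum>k<n. Q k) vs = (\<Sum>k<n. Q k vs)" for n vs by (induction n) auto
  have sumNB: "NB (2 * L / 2 ^ n) (\<Sum>k\<in>{n..<m}. Q k)" if "n \<le> m" for n m
  proof -
    have "NB (2 * L / 2 ^ n - 2 * L / 2 ^ m) (\<Sum>k\<in>{n..<m}. Q k)" using that
    proof (induction m rule: dec_induct)
      case base
      have "NB 0 0" unfolding NB_def using MB_zero[of 0 j] by (auto simp: zero_fun_def intro!: exI[of _ 0])
      then show ?case by (simp add: zero_fun_def)
    next
      case (step m)
      have "2 * L / 2 ^ n - 2 * L / 2 ^ m + L / 2 ^ m = 2 * L / 2 ^ n - 2 * L / 2 ^ Suc m" by simp
      then show ?case using NB_add[OF step.IH Q(2)[of m]] sum.atLeastLessThan_Suc[OF step.hyps(1), of Q] by (simp only:)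
    qed
    moreover have "0 \<le> 2 * L / 2 ^ m" using NB_nonneg[OF Q(2)[of 0]] by simp
    ultimately show ?thesis by (elim NB_mono) simp
  qed
  obtain c where c: "0 \<le> c" "\<And>K B. MB j K B \<Longrightarrow> mbounded j B (c * K)"
    using MB_mbounded[OF MB_zero[of 0 j]] by auto
  have bnd: "norm (fst (Q n vs)) \<le> (c * L * prod_list (map norm vs)) * (1/2) ^ n \<and>
      norm (snd (Q n vs)) \<le> (c * L * prod_list (map norm vs)) * (1/2) ^ n" if vs: "length vs = j" for n vs
  proof -
    obtain K1 K2 where K: "MB j K1 (\<lambda>vs. fst (Q n vs))" "MB j K2 (\<lambda>vs. snd (Q n vs))" "K1 + K2 \<le> L / 2 ^ n"
      using Q(2)[of n] unfolding NB_def by blast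
    have *: "K1 \<le> L / 2 ^ n" "K2 \<le> L / 2 ^ n" using K(3) MB_nonneg[OF K(1)] MB_nonneg[OF K(2)] by auto
    have "norm (fst (Q n vs)) \<le> c * (L / 2 ^ n) * prod_list (map norm vs)"
      using c(2)[OF MB_mono[OF K(1) *(1)]] vs by (rule mboundedD)
    moreover have "norm (snd (Q n vs)) \<le> c * (L / 2 ^ n) * prod_list (map norm vs)"
      using c(2)[OF MB_mono[OF K(2) *(2)]] vs by (rule mboundedD)
    ultimately show ?thesis by (simp add: power_divide mult_ac)
  qed
  define S where "S vs = (if length vs = j then (\<Sum>k. fst (Q k vs), \<Sum>k. snd (Q k vs)) else 0)" for vs
  have lim: "(\<lambda>n. fst ((\<Sum>k<n. Q k) vs)) \<longlonglongrightarrow> fst (S vs)" "(\<lambda>n. snd ((\<Sum>k<n. Q k) vs)) \<longlonglongrightarrow> snd (S vs)" if vs: "length vs = j" for vs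
    using summable_LIMSEQ[OF geometric_tail(1)[of "\<lambda>k. fst (Q k vs)", OF conjunct1[OF bnd[OF vs]]]]
      summable_LIMSEQ[OF geometric_tail(1)[of "\<lambda>k. snd (Q k vs)", OF conjunct2[OF bnd[OF vs]]]] vs
    by (simp_all add: S_def sm fst_sum snd_sum)
  have limS: "(\<lambda>n. (\<Sum>k<n. Q k) vs) \<longlonglongrightarrow> S vs" for vs
  proof (cases "length vs = j")
    case True
    from tendsto_Pair[OF lim[OF True]] show ?thesis by simp
  next
    case False
    then show ?thesis using Q(1) by (simp add: sm S_def W_def)
  qed
  have SW: "(\<Sum>k<n. Q k) \<in> W" for n
    by (induction n) (simp_all only: sum.lessThan_Suc lessThan_0 sum.empty W_0 W_add Q(1))
  have ml: "multilinear_map j S"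
    unfolding multilinear_map_def
  proof (intro allI impI)
    fix vs :: "'a list" and p assume vs: "length vs = j" "p < j"
    have l: "linear (\<lambda>w. (\<Sum>k<n. Q k) (vs[p := w]))" for n
      using SW[of n] vs by (simp add: W_def multilinear_map_def)
    show "linear (\<lambda>w. S (vs[p := w]))"
    proof (rule linearI)
      show "S (vs[p := u + v]) = S (vs[p := u]) + S (vs[p := v])" for u v
        using LIMSEQ_unique[OF limS tendsto_add[OF limS limS, of "vs[p := u]" "vs[p := v]", folded linear_add[OF l]]] .
      show "S (vs[p := c *\<^sub>R u]) = c *\<^sub>R S (vs[p := u])" for c u
        using LIMSEQ_unique[OF limS tendsto_scaleR[OF tendsto_const limS, of c "vs[p := u]", folded linear_scale[OF l]]] .
    qed
  qed
  have NB: "NB (4 * L / 2 ^ n) (S - (\<Sum>k<n. Q k))" for n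
  proof -
    have eq: "(\<Sum>k<n + m. Q k) vs - (\<Sum>k<n. Q k) vs = (\<Sum>k\<in>{n..<n + m}. Q k) vs" for m vs
    proof -
      have "(\<Sum>k<n + m. Q k) = (\<Sum>k<n. Q k) + (\<Sum>k\<in>{n..<n + m}. Q k)"
        by (simp add: lessThan_atLeast0 sum.atLeastLessThan_concat)
      then show ?thesis by simp
    qed
    have MBs: "MB j (2 * L / 2 ^ n) (\<lambda>vs. fst ((\<Sum>k\<in>{n..<n + m}. Q k) vs)) \<and> MB j (2 * L / 2 ^ n) (\<lambda>vs. snd ((\<Sum>k\<in>{n..<n + m}. Q k) vs))" for m
    proof -
      obtain K1 K2 where K: "MB j K1 (\<lambda>vs. fst ((\<Sum>k\<in>{n..<n + m}. Q k) vs))" "MB j K2 (\<lambda>vs. snd ((\<Sum>k\<in>{n..<n + m}. Q k) vs))" "K1 + K2 \<le> 2 * L / 2 ^ n"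
        using sumNB[of n "n + m"] unfolding NB_def by auto
      have "K1 \<le> 2 * L / 2 ^ n" "K2 \<le> 2 * L / 2 ^ n" using K(3) MB_nonneg[OF K(1)] MB_nonneg[OF K(2)] by auto
      then show ?thesis using MB_mono[OF K(1)] MB_mono[OF K(2)] by blast
    qed
    have lF: "(\<lambda>m. fst ((\<Sum>k\<in>{n..<n + m}. Q k) vs)) \<longlonglongrightarrow> fst ((S - (\<Sum>k<n. Q k)) vs)"
      and lG: "(\<lambda>m. snd ((\<Sum>k\<in>{n..<n + m}. Q k) vs)) \<longlonglongrightarrow> snd ((S - (\<Sum>k<n. Q k)) vs)" if "length vs = j" for vs
      unfolding eq[symmetric] minus_apply fst_diff snd_diff
      by (intro tendsto_diff tendsto_const; subst add.commute; rule LIMSEQ_ignore_initial_segment; rule lim[OF that])+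
    have "MB j (2 * L / 2 ^ n) (\<lambda>vs. fst ((S - (\<Sum>k<n. Q k)) vs))"
      by (rule MB_limit[OF lF conjunct1[OF MBs] tendsto_const])
    moreover have "MB j (2 * L / 2 ^ n) (\<lambda>vs. snd ((S - (\<Sum>k<n. Q k)) vs))"
      by (rule MB_limit[OF lG conjunct2[OF MBs] tendsto_const])
    moreover have "2 * L / 2 ^ n + 2 * L / 2 ^ n \<le> 4 * L / 2 ^ n" by simp
    ultimately show ?thesis unfolding NB_def by blast
  qed
  have "S \<in> W" using ml NB[of 0] by (auto simp: W_def S_def)
  then show ?thesis using NB by blast
qed

section \<open>The algebra of bounded operators\<close>

definition obd :: "(('a list \<Rightarrow> 'a \<times> 'a) \<Rightarrow> ('a list \<Rightarrow> 'a \<times> 'a)) \<Rightarrow> real \<Rightarrow> bool" where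
  "obd f K \<longleftrightarrow> 0 \<le> K \<and> (\<forall>P\<in>W. \<forall>L. NB L P \<longrightarrow> NB (K * L) (f P))"

lemma obdD: "obd f K \<Longrightarrow> P \<in> W \<Longrightarrow> NB L P \<Longrightarrow> NB (K * L) (f P)"
  by (simp add: obd_def)

definition Op :: "(('a list \<Rightarrow> 'a \<times> 'a) \<Rightarrow> ('a list \<Rightarrow> 'a \<times> 'a)) set" where
  "Op = {f. (\<forall>P\<in>W. f P \<in> W) \<and> (\<forall>P. P \<notin> W \<longrightarrow> f P = 0) \<and> (\<forall>P\<in>W. \<forall>P'\<in>W. f (P + P') = f P + f P') \<and>
     (\<forall>P\<in>W. \<forall>z. f (\<lambda>vs. csc z (P vs)) = (\<lambda>vs. csc z (f P vs))) \<and> (\<exists>K. obd f K)}"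

definition occ :: "complex \<Rightarrow> ('a list \<Rightarrow> 'a \<times> 'a) \<Rightarrow> ('a list \<Rightarrow> 'a \<times> 'a)" where
  "occ z P = (if P \<in> W then (\<lambda>vs. csc z (P vs)) else 0)"

lemma OpD:
  assumes "f \<in> Op"
  shows "P \<in> W \<Longrightarrow> f P \<in> W" "P \<notin> W \<Longrightarrow> f P = 0" "P \<in> W \<Longrightarrow> P' \<in> W \<Longrightarrow> f (P + P') = f P + f P'"
    "P \<in> W \<Longrightarrow> f (\<lambda>vs. csc z (P vs)) = (\<lambda>vs. csc z (f P vs))" "\<exists>K. obd f K"
  using assms unfolding Op_def by blast+

lemma Op_0: "f \<in> Op \<Longrightarrow> f 0 = 0"
  using OpD(3)[of f 0 0] W_0 by simp

lemma Op_minus: "f \<in> Op \<Longrightarrow> P \<in> W \<Longrightarrow> f (- P) = - f P"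
  using OpD(4)[of f P "-1"] unfolding csc_minus1[of P] csc_minus1[of "f P"] .

lemma Op_diff: "f \<in> Op \<Longrightarrow> P \<in> W \<Longrightarrow> P' \<in> W \<Longrightarrow> f (P - P') = f P - f P'"
  using OpD(3)[of f P "- P'"] by (simp only: diff_conv_add_uminus Op_minus W_minus)

lemma Op_add:
  assumes "f \<in> Op" "f' \<in> Op"
  shows "f + f' \<in> Op" "obd f K \<Longrightarrow> obd f' L \<Longrightarrow> obd (f + f') (K + L)"
proof -
  show b: "obd (f + f') (K + L)" if "obd f K" "obd f' L" for K L
    unfolding obd_def using that NB_add unfolding obd_def by (auto simp: distrib_right)
  obtain K L where "obd f K" "obd f' L" using OpD(5) assms by blast
  then have "\<exists>K. obd (f + f') K" using b by blast
  then show "f + f' \<in> Op"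
    unfolding Op_def using OpD(1-4)[OF assms(1)] OpD(1-4)[OF assms(2)] W_add
    by (auto simp: algebra_simps fun_eq_iff csc_linear)
qed

lemma Op_uminus:
  assumes "f \<in> Op"
  shows "- f \<in> Op" "obd f K \<Longrightarrow> obd (- f) K"
proof -
  show b: "obd (- f) K" if "obd f K" for K using that NB_minus by (auto simp: obd_def)
  have "\<exists>K. obd (- f) K" using b OpD(5)[OF assms] by blast
  then show "- f \<in> Op"
    unfolding Op_def using OpD(1-4)[OF assms] W_minus by (auto simp: fun_eq_iff csc_linear)
qed

lemma Op_comp:
  assumes "f \<in> Op" "f' \<in> Op"
  shows "f \<circ> f' \<in> Op" "obd f K \<Longrightarrow> obd f' L \<Longrightarrow> obd (f \<circ> f') (K * L)"
proof -
  show b: "obd (f \<circ> f') (K * L)" if "obd f K" "obd f' L" for K L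
    using that OpD(1)[OF assms(2)] by (auto simp: obd_def mult.assoc)
  obtain K L where "obd f K" "obd f' L" using OpD(5) assms by blast
  then have "\<exists>K. obd (f \<circ> f') K" using b by blast
  then show "f \<circ> f' \<in> Op"
    unfolding Op_def using OpD(1-4)[OF assms(1)] OpD(1-4)[OF assms(2)] Op_0[OF assms(1)] by auto
qed

lemma occ_Op: "occ z \<in> Op" "obd (occ z) (\<bar>Re z\<bar> + \<bar>Im z\<bar>)"
proof -
  show b: "obd (occ z) (\<bar>Re z\<bar> + \<bar>Im z\<bar>)" using NB_csc by (simp add: obd_def occ_def)
  have "csc z (csc w p) = csc w (csc z p)" for w and p :: "'a \<times> 'a" by (metis csc_mult mult.commute)
  then show "occ z \<in> Op"
    unfolding Op_def using W_csc W_add b by (auto simp: occ_def fun_eq_iff csc_linear)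
qed

text \<open>The Neumann series is summed on each element of \<open>W\<close> rather than in the
  space of operators. Injectivity of the map from \<open>S\<close> to \<open>S - f S\<close> makes
  the limit unique, and linearity of the inverse follows from this uniqueness.\<close>

lemma Op_inverse:
  assumes f: "f \<in> Op" "obd f (1/2)"
  shows "\<exists>y\<in>Op. (\<forall>P\<in>W. y P - f (y P) = P \<and> y (P - f P) = P)"
proof -
  have inj: "S = S'" if S: "S \<in> W" "S' \<in> W" "S - f S = S' - f S'" for S S'
  proof -
    define D where "D = S - S'"
    have "S - S' = f S - f S'" using S(3) by (simp add: algebra_simps)
    then have D: "D \<in> W" "f D = D" using W_diff[OF S(1,2)] Op_diff[OF f(1) S(1,2)] by (simp_all only: D_def)
    obtain K where K: "NB K D" using W_NB[OF D(1)] by blast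
    have "NB (K / 2 ^ n) D" for n
    proof (induction n)
      case (Suc n)
      have "NB (1/2 * (K / 2 ^ n)) (f D)" by (rule obdD[OF f(2) D(1) Suc])
      then show ?case by (simp add: D(2))
    qed (use K in simp)
    from NB_zero_imp[OF this D(1)] show ?thesis by (simp add: D_def)
  qed
  have ex: "\<exists>S\<in>W. S - f S = P \<and> (\<forall>L. NB L P \<longrightarrow> NB (4 * L) S)" if P: "P \<in> W" for P
  proof -
    define Q where "Q n = (f ^^ n) P" for n
    have QW: "Q n \<in> W" for n by (induction n) (auto simp: Q_def P OpD(1)[OF f(1)])
    have QB: "NB (L / 2 ^ n) (Q n)" if "NB L P" for n L
    proof (induction n)
      case (Suc n)
      have "NB (1/2 * (L / 2 ^ n)) (f (Q n))" by (rule obdD[OF f(2) QW Suc])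
      then show ?case by (simp add: Q_def)
    qed (use that in \<open>simp add: Q_def\<close>)
    obtain L where L: "NB L P" using W_NB[OF P] by blast
    obtain S where S: "S \<in> W" "\<And>n. NB (4 * L / 2 ^ n) (S - (\<Sum>k<n. Q k))" using W_complete[OF QW QB[OF L]] by blast
    have sW: "(\<Sum>k<n. Q k) \<in> W" for n
      by (induction n) (simp_all only: sum.lessThan_Suc lessThan_0 sum.empty W_0 W_add QW)
    have tel: "(\<Sum>k<n. Q k) - f (\<Sum>k<n. Q k) = P - Q n" for n
    proof (induction n)
      case 0
      have "Q 0 = P" by (simp add: Q_def)
      then show ?case by (simp only: lessThan_0 sum.empty Op_0[OF f(1)] diff_self)
    next
      case (Suc n)
      have "(\<Sum>k<Suc n. Q k) - f (\<Sum>k<Suc n. Q k) = ((\<Sum>k<n. Q k) - f (\<Sum>k<n. Q k)) + Q n - f (Q n)"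
        using OpD(3)[OF f(1) sW QW] by (simp add: algebra_simps)
      also have "\<dots> = P - Q n + Q n - f (Q n)" by (simp only: Suc)
      also have "\<dots> = P - f (Q n)" by (simp only: diff_add_cancel)
      also have "f (Q n) = Q (Suc n)" by (simp add: Q_def)
      finally show ?case .
    qed
    \<comment> \<open>7 = 4 + 2 + 1: the error of the partial sum, its image under \<open>f\<close>,
      and the last term of the telescoping sum.\<close>
    have "NB (7 * L / 2 ^ n) (S - f S - P)" for n
    proof -
      let ?s = "\<Sum>k<n. Q k"
      have fd: "NB (1/2 * (4 * L / 2 ^ n)) (f (S - ?s))" by (rule obdD[OF f(2) W_diff[OF S(1) sW] S(2)])
      have "NB (4 * L / 2 ^ n + 1/2 * (4 * L / 2 ^ n) + L / 2 ^ n) ((S - ?s) - f (S - ?s) - Q n)"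
        by (intro NB_diff S(2) fd QB[OF L])
      moreover have "(S - ?s) - f (S - ?s) - Q n = S - f S - P"
      proof -
        have "(S - ?s) - f (S - ?s) - Q n = S - f S - (?s - f ?s) - Q n"
          unfolding Op_diff[OF f(1) S(1) sW] by (simp add: algebra_simps)
        also have "\<dots> = S - f S - P" unfolding tel by (simp add: algebra_simps)
        finally show ?thesis .
      qed
      moreover have "4 * L / 2 ^ n + 1/2 * (4 * L / 2 ^ n) + L / 2 ^ n = 7 * L / 2 ^ n" by simp
      ultimately show ?thesis by simp
    qed
    then have eq: "S - f S - P = 0"
      by (rule NB_zero_imp) (intro W_diff S(1) P OpD(1)[OF f(1)])
    \<comment> \<open>\<open>S\<close> was obtained from one bound \<open>L\<close> of
      \<open>P\<close>. Limits obtained from different bounds coincide, so \<open>S\<close>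
      satisfies the estimate for every bound of \<open>P\<close>, and the inverse is bounded by
      4.\<close>
    have "NB (4 * L') S" if L': "NB L' P" for L'
    proof -
      obtain S' where S': "S' \<in> W" "\<And>n. NB (4 * L' / 2 ^ n) (S' - (\<Sum>k<n. Q k))" using W_complete[OF QW QB[OF L']] by blast
      have "NB (4 * (L + L') / 2 ^ n) (S - S')" for n
        using NB_diff[OF S(2)[of n] S'(2)[of n]] by (simp add: add_divide_distrib distrib_left)
      then have "S - S' = 0" by (rule NB_zero_imp) (intro W_diff S(1) S'(1))
      then show ?thesis using S'(2)[of 0] by simp
    qed
    then show ?thesis using S(1) eq by auto
  qed
  define y where "y P = (if P \<in> W then (THE S. S \<in> W \<and> S - f S = P) else 0)" for P
  have y: "y P \<in> W" "y P - f (y P) = P" "\<And>L. NB L P \<Longrightarrow> NB (4 * L) (y P)" if P: "P \<in> W" for P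
  proof -
    obtain S where S: "S \<in> W" "S - f S = P" "\<And>L. NB L P \<Longrightarrow> NB (4 * L) S" using ex[OF P] by blast
    have "(THE S. S \<in> W \<and> S - f S = P) = S" by (rule the_equality) (use S inj in auto)
    then have "y P = S" using P by (simp add: y_def)
    then show "y P \<in> W" "y P - f (y P) = P" "\<And>L. NB L P \<Longrightarrow> NB (4 * L) (y P)" using S by auto
  qed
  have yu: "y P = S" if "S \<in> W" "S - f S = P" for P S
  proof -
    have "P \<in> W" using that W_diff OpD(1)[OF f(1)] by blast
    then show ?thesis using inj[OF y(1) that(1)] y(2) that(2) by simp
  qed
  have "y \<in> Op"
    unfolding Op_def
  proof (intro CollectI conjI ballI allI impI)
    fix P assume P: "P \<in> W"
    show "y P \<in> W" by (rule y(1)[OF P])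
    show "y (P + P') = y P + y P'" if P': "P' \<in> W" for P'
    proof (rule yu)
      show "y P + y P' \<in> W" using y(1) P P' W_add by blast
      show "y P + y P' - f (y P + y P') = P + P'"
      proof -
        have "y P + y P' - f (y P + y P') = (y P - f (y P)) + (y P' - f (y P'))"
          unfolding OpD(3)[OF f(1) y(1)[OF P] y(1)[OF P']] by (simp add: algebra_simps)
        also have "\<dots> = P + P'" unfolding y(2)[OF P] y(2)[OF P'] ..
        finally show ?thesis .
      qed
    qed
    show "y (\<lambda>vs. csc z (P vs)) = (\<lambda>vs. csc z (y P vs))" for z
    proof (rule yu)
      show "(\<lambda>vs. csc z (y P vs)) \<in> W" by (rule W_csc[OF y(1)[OF P]])
      have "csc z (y P vs) - csc z (f (y P) vs) = csc z (P vs)" for vs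
        using fun_cong[OF y(2)[OF P], of vs] by (simp flip: linear_diff[OF linear_csc])
      then show "(\<lambda>vs. csc z (y P vs)) - f (\<lambda>vs. csc z (y P vs)) = (\<lambda>vs. csc z (P vs))"
        using OpD(4)[OF f(1) y(1)[OF P], of z] by (simp add: fun_eq_iff)
    qed
  next
    show "\<exists>K. obd y K" unfolding obd_def using y(3) by (intro exI[of _ 4]) auto
  qed (simp add: y_def)
  moreover have "y (P - f P) = P" if "P \<in> W" for P by (rule yu[OF that refl])
  ultimately show ?thesis using y(2) by blast
qed

section \<open>Bicommutants\<close>

definition bicomm where
  "bicomm G = {f \<in> Op. \<forall>h\<in>Op. (\<forall>s\<in>G. h \<circ> s = s \<circ> h) \<longrightarrow> f \<circ> h = h \<circ> f}"

lemma comp_add: "h \<in> Op \<Longrightarrow> f \<in> Op \<Longrightarrow> f' \<in> Op \<Longrightarrow> h \<circ> (f + f') = (h \<circ> f) + (h \<circ> f')"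
proof
  fix P assume h: "h \<in> Op" "f \<in> Op" "f' \<in> Op"
  show "(h \<circ> (f + f')) P = ((h \<circ> f) + (h \<circ> f')) P"
  proof (cases "P \<in> W")
    case True
    then show ?thesis using OpD(3)[OF h(1) OpD(1)[OF h(2)] OpD(1)[OF h(3)]] by simp
  next
    case False
    then show ?thesis using OpD(2)[OF h(2)] OpD(2)[OF h(3)] Op_0[OF h(1)] by simp
  qed
qed

lemma comp_minus: "h \<in> Op \<Longrightarrow> f \<in> Op \<Longrightarrow> h \<circ> (- f) = - (h \<circ> f)"
proof
  fix P assume h: "h \<in> Op" "f \<in> Op"
  show "(h \<circ> (- f)) P = (- (h \<circ> f)) P"
  proof (cases "P \<in> W")
    case True
    then show ?thesis using Op_minus[OF h(1) OpD(1)[OF h(2)]] by simp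
  next
    case False
    then show ?thesis using OpD(2)[OF h(2)] Op_0[OF h(1)] by simp
  qed
qed

lemma add_comp: "(f + f') \<circ> h = (f \<circ> h) + (f' \<circ> h)" by (auto simp: fun_eq_iff)
lemma minus_comp: "(- f) \<circ> h = - (f \<circ> h)" by (auto simp: fun_eq_iff)

lemma occ_comm:
  assumes h: "h \<in> Op"
  shows "occ z \<circ> h = h \<circ> occ z"
proof
  fix P
  show "(occ z \<circ> h) P = (h \<circ> occ z) P"
  proof (cases "P \<in> W")
    case True
    then show ?thesis using OpD(1,4)[OF h True] by (simp add: occ_def)
  next
    case False
    then show ?thesis using OpD(2)[OF h] Op_0[OF h] by (simp add: occ_def W_0 linear_0[OF linear_csc] fun_eq_iff)
  qed
qed

text \<open>Since the generators commute, they belong to their own commutant. Elements of the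
  bicommutant therefore commute with the generators, hence lie in the commutant, and so commute with
  each other. An inverse in \<open>Op\<close> commutes with everything its element commutes with,
  hence stays in the bicommutant.\<close>

lemma bicomm_comm_algebra:
  assumes G: "G \<subseteq> Op" "\<And>s t. s \<in> G \<Longrightarrow> t \<in> G \<Longrightarrow> s \<circ> t = t \<circ> s"
  shows "comm_algebra (bicomm G) (\<circ>) (occ 1) occ obd" and "G \<subseteq> bicomm G" and "bicomm G \<subseteq> Op"
    and "\<And>x y. x \<in> bicomm G \<Longrightarrow> y \<in> Op \<Longrightarrow> y \<circ> x = occ 1 \<Longrightarrow> x \<circ> y = occ 1 \<Longrightarrow> y \<in> bicomm G"
proof -
  show GB: "G \<subseteq> bicomm G" using G unfolding bicomm_def by fastforce
  show BO: "bicomm G \<subseteq> Op" by (auto simp: bicomm_def)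
  have comm: "f \<circ> f' = f' \<circ> f" if "f \<in> bicomm G" "f' \<in> bicomm G" for f f'
  proof -
    have "f' \<circ> s = s \<circ> f'" if "s \<in> G" for s
      using \<open>f' \<in> bicomm G\<close> G that unfolding bicomm_def by blast
    then show ?thesis using that unfolding bicomm_def by blast
  qed
  have e: "occ 1 \<circ> f = f \<and> f \<circ> occ 1 = f" if f: "f \<in> Op" for f
  proof -
    have "(occ 1 \<circ> f) P = f P" for P
      using OpD(1,2)[OF f, of P] W_0 by (cases "P \<in> W") (auto simp: occ_def)
    then show ?thesis using occ_comm[OF f, of 1] by (metis ext)
  qed
  show inv: "y \<in> bicomm G" if x: "x \<in> bicomm G" and y: "y \<in> Op" "y \<circ> x = occ 1" "x \<circ> y = occ 1" for x y
    unfolding bicomm_def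
  proof (intro CollectI conjI ballI impI y(1))
    fix h assume h: "h \<in> Op" "\<forall>s\<in>G. h \<circ> s = s \<circ> h"
    have xh: "x \<circ> h = h \<circ> x" using x h unfolding bicomm_def by blast
    have "y \<circ> h = y \<circ> h \<circ> (x \<circ> y)" using e[OF Op_comp(1)[OF y(1) h(1)]] y(3) by simp
    also have "\<dots> = y \<circ> (h \<circ> x) \<circ> y" by (simp add: o_assoc)
    also have "\<dots> = (y \<circ> x) \<circ> h \<circ> y" by (simp add: xh[symmetric] o_assoc)
    also have "\<dots> = h \<circ> y" using y(2) e[OF h(1)] by (simp add: o_assoc)
    finally show "y \<circ> h = h \<circ> y" .
  qed
  show "comm_algebra (bicomm G) (\<circ>) (occ 1) occ obd"
  proof
    fix x y z assume x: "x \<in> bicomm G"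
    then have xO: "x \<in> Op" using BO by blast
    show "- x \<in> bicomm G" using x Op_uminus(1)[OF xO] unfolding bicomm_def
      by (auto simp: minus_comp comp_minus)
    show "x \<circ> occ 1 = x" using e[OF xO] by simp
    show "\<exists>K. obd x K" by (rule OpD(5)[OF xO])
    show "obd (- x) K" if "obd x K" for K by (rule Op_uminus(2)[OF xO that])
    show "\<exists>y\<in>bicomm G. y \<circ> (occ 1 - x) = occ 1" if b: "obd x (1/2)"
    proof -
      obtain y where y: "y \<in> Op" "\<And>P. P \<in> W \<Longrightarrow> y P - x (y P) = P" "\<And>P. P \<in> W \<Longrightarrow> y (P - x P) = P"
        using Op_inverse[OF xO b] by blast
      have xB: "occ 1 - x \<in> bicomm G"
      proof -
        have "occ 1 + (- x) \<in> Op" by (intro Op_add(1) occ_Op(1) Op_uminus(1) xO)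
        then have "occ 1 - x \<in> Op" by simp
        moreover have "(occ 1 - x) \<circ> h = h \<circ> (occ 1 - x)" if "h \<in> Op" "\<forall>s\<in>G. h \<circ> s = s \<circ> h" for h
        proof -
          have xh: "x \<circ> h = h \<circ> x" using x that unfolding bicomm_def by blast
          have "(occ 1 - x) \<circ> h = (occ 1 \<circ> h) + - (x \<circ> h)" by (auto simp: fun_eq_iff)
          also have "\<dots> = (h \<circ> occ 1) + - (h \<circ> x)" by (simp only: occ_comm[OF that(1)] xh)
          also have "\<dots> = h \<circ> (occ 1 + - x)" by (simp only: comp_add[OF that(1) occ_Op(1) Op_uminus(1)[OF xO]] comp_minus[OF that(1) xO])
          finally show ?thesis by simp
        qed
        ultimately show ?thesis unfolding bicomm_def by blast
      qed
      have o1: "y \<circ> (occ 1 - x) = occ 1"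
      proof
        fix P show "(y \<circ> (occ 1 - x)) P = occ 1 P"
          using y(3)[of P] OpD(2)[OF xO, of P] Op_0[OF y(1)] by (cases "P \<in> W") (auto simp: occ_def)
      qed
      have "(occ 1 - x) \<circ> y = occ 1"
      proof
        fix P show "((occ 1 - x) \<circ> y) P = occ 1 P"
          using y(2)[of P] OpD(1,2)[OF y(1), of P] W_0 Op_0[OF xO] by (cases "P \<in> W") (auto simp: occ_def)
      qed
      with o1 show ?thesis using inv[OF xB y(1)] by blast
    qed
    assume y: "y \<in> bicomm G"
    then have yO: "y \<in> Op" using BO by blast
    show "x + y \<in> bicomm G" using x y Op_add(1)[OF xO yO] unfolding bicomm_def
      by (auto simp: add_comp comp_add)
    have "x \<circ> y \<circ> h = h \<circ> (x \<circ> y)" if "h \<in> Op" "\<forall>s\<in>G. h \<circ> s = s \<circ> h" for h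
    proof -
      have xh: "x \<circ> h = h \<circ> x" "y \<circ> h = h \<circ> y" using x y that unfolding bicomm_def by blast+
      have "x \<circ> y \<circ> h = x \<circ> (y \<circ> h)" by (simp only: o_assoc)
      also have "\<dots> = (x \<circ> h) \<circ> y" by (simp only: xh(2) o_assoc)
      also have "\<dots> = h \<circ> (x \<circ> y)" by (simp only: xh(1) o_assoc)
      finally show ?thesis .
    qed
    then show "x \<circ> y \<in> bicomm G" using Op_comp(1)[OF xO yO] unfolding bicomm_def by blast
    show "x \<circ> y = y \<circ> x" by (rule comm[OF x y])
    show "obd (x + y) (K + L)" if "obd x K" "obd y L" for K L by (rule Op_add(2)[OF xO yO that])
    show "obd (x \<circ> y) (K * L)" if "obd x K" "obd y L" for K L by (rule Op_comp(2)[OF xO yO that])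
    assume z: "z \<in> bicomm G"
    show "x \<circ> y \<circ> z = x \<circ> (y \<circ> z)" by (simp only: o_assoc)
    show "x \<circ> (y + z) = (x \<circ> y) + (x \<circ> z)" using BO z by (intro comp_add xO yO) blast
  next
    fix \<mu> \<nu>
    show "occ \<mu> \<in> bicomm G" unfolding bicomm_def using occ_Op(1) occ_comm by blast
    show "occ (\<mu> + \<nu>) = occ \<mu> + occ \<nu>" by (auto simp: fun_eq_iff occ_def csc_add)
    show "occ (\<mu> * \<nu>) = occ \<mu> \<circ> occ \<nu>"
      by (auto simp: fun_eq_iff occ_def csc_mult W_csc W_0 linear_0[OF linear_csc])
    show "obd (occ \<mu>) (\<bar>Re \<mu>\<bar> + \<bar>Im \<mu>\<bar>)" by (rule occ_Op(2))
  next
    fix x K L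
    show "obd x K \<Longrightarrow> 0 \<le> K" by (simp add: obd_def)
    show "obd x L" if "obd x K" "K \<le> L"
      unfolding obd_def
    proof (intro conjI ballI allI impI)
      show "0 \<le> L" using that by (simp add: obd_def)
      fix P M assume P: "P \<in> W" "NB M P"
      then have "NB (K * M) (x P)" using that(1) by (auto simp: obd_def)
      then show "NB (L * M) (x P)" using that(2) NB_nonneg[OF P(2)] by (elim NB_mono) (rule mult_right_mono)
    qed
  qed simp
qed

end


section \<open>Resolvents of real operators\<close>

context gauged
begin

text \<open>The complex resolvent set of a real operator, in real terms: \<open>A - \<mu>\<close> is invertible iff
  \<open>(A - \<mu>)(A - cnj \<mu>)\<close> is.\<close>

definition quad :: "('a \<Rightarrow> 'a) \<Rightarrow> complex \<Rightarrow> 'a \<Rightarrow> 'a" where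
  "quad A \<mu> u = A (A u) - (2 * Re \<mu>) *\<^sub>R A u + (cmod \<mu>)\<^sup>2 *\<^sub>R u"

definition Res :: "('a \<Rightarrow> 'a) \<Rightarrow> complex \<Rightarrow> bool" where
  "Res A \<mu> \<longleftrightarrow> (\<exists>K Q. dec K Q \<and> (\<forall>u. Q (quad A \<mu> u) = u) \<and> (\<forall>u. quad A \<mu> (Q u) = u))"

text \<open>On a vector \<open>A (A w)\<close> the quadratic for \<open>Ai\<close> and
  \<open>\<mu>\<close> equals the square of \<open>cmod \<mu>\<close> times the quadratic for
  \<open>A\<close> and \<open>1 / \<mu>\<close> on \<open>w\<close>. The inverse of one is thus
  obtained from the other by composing with \<open>A\<close> twice and rescaling.\<close>

lemma Res_inverse:
  assumes A: "linear A" "dec KA A" and inv: "\<And>x. A (Ai x) = x" "\<And>x. Ai (A x) = x" "linear Ai"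
    and mu: "\<mu> \<noteq> 0" and R: "Res A (1 / \<mu>)"
  shows "Res Ai \<mu>"
proof -
  obtain K Q where Q: "dec K Q" "\<And>u. Q (quad A (1 / \<mu>) u) = u" "\<And>u. quad A (1 / \<mu>) (Q u) = u"
    using R unfolding Res_def by blast
  have c: "(cmod \<mu>)\<^sup>2 \<noteq> 0" using mu by simp
  note lA = linear_add[OF A(1)] linear_diff[OF A(1)] linear_scale[OF A(1)]
  note lAi = linear_add[OF inv(3)] linear_diff[OF inv(3)] linear_scale[OF inv(3)]
  have com: "Q (A u) = A (Q u)" for u
  proof -
    have "quad A (1 / \<mu>) (A (Q u)) = A (quad A (1 / \<mu>) (Q u))" by (simp add: quad_def lA)
    then show ?thesis using Q(2)[of "A (Q u)"] Q(3) by simp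
  qed
  have key: "quad Ai \<mu> (A (A w)) = (cmod \<mu>)\<^sup>2 *\<^sub>R quad A (1 / \<mu>) w" for w
  proof -
    have "Re (1 / \<mu>) = Re \<mu> / (cmod \<mu>)\<^sup>2" by (simp add: Re_divide cmod_power2)
    moreover have "(cmod (1 / \<mu>))\<^sup>2 = 1 / (cmod \<mu>)\<^sup>2" by (simp add: norm_divide power_divide)
    ultimately show ?thesis using c by (simp add: quad_def inv(2) scaleR_add_right scaleR_diff_right)
  qed
  define Q' where "Q' u = (1 / (cmod \<mu>)\<^sup>2) *\<^sub>R Q (A (A u))" for u
  have lQ: "linear Q" by (rule dec_linear[OF Q(1)])
  have "quad Ai \<mu> (Q' u) = u" for u
  proof -
    have "quad Ai \<mu> (c *\<^sub>R x) = c *\<^sub>R quad Ai \<mu> x" for c x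
      by (simp add: quad_def lAi scaleR_add_right scaleR_diff_right mult.commute)
    then show ?thesis using c key[of "Q u"] Q(3) by (simp add: Q'_def com)
  qed
  moreover have "Q' (quad Ai \<mu> u) = u" for u
  proof -
    have "u = A (A (Ai (Ai u)))" by (simp add: inv(1))
    then have "quad Ai \<mu> u = (cmod \<mu>)\<^sup>2 *\<^sub>R quad A (1 / \<mu>) (Ai (Ai u))" using key[of "Ai (Ai u)"] by simp
    then show ?thesis using c by (simp add: Q'_def lA linear_scale[OF lQ] com Q(2) inv(1))
  qed
  moreover have "dec (\<bar>1 / (cmod \<mu>)\<^sup>2\<bar> * (K * (KA * KA))) Q'"
    unfolding Q'_def using dec_scale[OF dec_compose[OF Q(1) dec_compose[OF A(2) A(2)]]] .
  ultimately show ?thesis unfolding Res_def by blast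
qed

end

section \<open>Composition operators and the homological equation\<close>

context decay_operators
begin

definition left_comp :: "('a \<Rightarrow> 'a) \<Rightarrow> ('a list \<Rightarrow> 'a \<times> 'a) \<Rightarrow> ('a list \<Rightarrow> 'a \<times> 'a)" where
  "left_comp B P = (if P \<in> W then (\<lambda>vs. (B (fst (P vs)), B (snd (P vs)))) else 0)"

definition slot_comp :: "nat \<Rightarrow> ('a \<Rightarrow> 'a) \<Rightarrow> ('a list \<Rightarrow> 'a \<times> 'a) \<Rightarrow> ('a list \<Rightarrow> 'a \<times> 'a)" where
  "slot_comp i B P = (if P \<in> W then (\<lambda>vs. if length vs = j then P (vs[i := B (vs ! i)]) else 0) else 0)"

lemma WI: "multilinear_map j P \<Longrightarrow> NB K P \<Longrightarrow> (\<And>vs. length vs \<noteq> j \<Longrightarrow> P vs = 0) \<Longrightarrow> P \<in> W"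
  by (auto simp: W_def)

lemma W_outside: "P \<in> W \<Longrightarrow> length vs \<noteq> j \<Longrightarrow> P vs = 0"
  by (simp add: W_def)

lemma W_slot: "P \<in> W \<Longrightarrow> length vs = j \<Longrightarrow> i < j \<Longrightarrow> linear (\<lambda>w. P (vs[i := w]))"
  by (simp add: W_def multilinear_map_def)

lemma left_comp_Op:
  assumes B: "dec K B"
  shows "left_comp B \<in> Op"
proof -
  have lB: "linear B" by (rule dec_linear[OF B])
  note l = linear_add[OF lB] linear_diff[OF lB] linear_scale[OF lB] linear_0[OF lB]
  have lp: "linear (\<lambda>p. (B (fst p), B (snd p)))" by (rule linearI) (simp_all add: l)
  have NBl: "NB (K * L) (\<lambda>vs. (B (fst (P vs)), B (snd (P vs))))" if N: "NB L P" for L P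
  proof -
    obtain K1 K2 where K: "MB j K1 (\<lambda>vs. fst (P vs))" "MB j K2 (\<lambda>vs. snd (P vs))" "K1 + K2 \<le> L"
      using N unfolding NB_def by blast
    have "K * K1 + K * K2 \<le> K * L" using K(3) dec_nonneg[OF B] by (simp add: mult_left_mono flip: distrib_left)
    then show ?thesis unfolding NB_def fst_conv snd_conv using MB_dec[OF K(1) B] MB_dec[OF K(2) B] by blast
  qed
  have LW: "(\<lambda>vs. (B (fst (P vs)), B (snd (P vs)))) \<in> W" if P: "P \<in> W" for P
  proof -
    obtain L where "NB L P" using W_NB[OF P] by blast
    moreover have "multilinear_map j (\<lambda>vs. (B (fst (P vs)), B (snd (P vs))))"
      using multilinear_compose_linear[OF lp, of j P] P by (simp add: W_def)
    ultimately show ?thesis using NBl W_outside[OF P] by (intro WI) (auto simp: l zero_prod_def)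
  qed
  have "obd (left_comp B) K" unfolding obd_def using NBl dec_nonneg[OF B] by (simp add: left_comp_def)
  then show ?thesis unfolding Op_def using LW W_add W_csc by (auto simp: left_comp_def fun_eq_iff l csc_def)
qed

lemma slot_comp_Op:
  assumes B: "dec K B" and i: "i < j"
  shows "slot_comp i B \<in> Op"
proof -
  have lB: "linear B" by (rule dec_linear[OF B])
  have NBt: "NB (K * L) (\<lambda>vs. if length vs = j then P (vs[i := B (vs ! i)]) else 0)" if N: "NB L P" for L P
  proof -
    obtain K1 K2 where K: "MB j K1 (\<lambda>vs. fst (P vs))" "MB j K2 (\<lambda>vs. snd (P vs))" "K1 + K2 \<le> L"
      using N unfolding NB_def by blast
    have "MB j (K * K1) (\<lambda>vs. fst (if length vs = j then P (vs[i := B (vs ! i)]) else 0))"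
      by (rule MB_cong[OF MB_slot[OF K(1) B i]]) simp
    moreover have "MB j (K * K2) (\<lambda>vs. snd (if length vs = j then P (vs[i := B (vs ! i)]) else 0))"
      by (rule MB_cong[OF MB_slot[OF K(2) B i]]) simp
    moreover have "K * K1 + K * K2 \<le> K * L" using K(3) dec_nonneg[OF B] by (simp add: mult_left_mono flip: distrib_left)
    ultimately show ?thesis unfolding NB_def by blast
  qed
  have TW: "(\<lambda>vs. if length vs = j then P (vs[i := B (vs ! i)]) else 0) \<in> W" if P: "P \<in> W" for P
  proof -
    obtain L where L: "NB L P" using W_NB[OF P] by blast
    have "multilinear_map j (\<lambda>vs. if length vs = j then P (vs[i := B (vs ! i)]) else 0)"
      unfolding multilinear_map_def
    proof (intro allI impI)
      fix vs :: "'a list" and p assume vs: "length vs = j" "p < j"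
      show "linear (\<lambda>w. if length (vs[p := w]) = j then P ((vs[p := w])[i := B (vs[p := w] ! i)]) else 0)"
      proof (cases "p = i")
        case True
        then show ?thesis using linear_compose[OF lB W_slot[OF P vs]] vs by (simp add: o_def)
      next
        case False
        then have "(vs[p := w])[i := B (vs[p := w] ! i)] = (vs[i := B (vs ! i)])[p := w]" for w
          by (simp add: list_update_swap)
        then show ?thesis using W_slot[OF P _ vs(2), of "vs[i := B (vs ! i)]"] vs by simp
      qed
    qed
    then show ?thesis using NBt[OF L] by (intro WI) auto
  qed
  have "obd (slot_comp i B) K" unfolding obd_def using NBt dec_nonneg[OF B] by (simp add: slot_comp_def)
  then show ?thesis unfolding Op_def using TW W_add W_csc by (auto simp: slot_comp_def fun_eq_iff csc_linear)
qed

lemma W_scale: "P \<in> W \<Longrightarrow> (\<lambda>vs. c *\<^sub>R P vs) \<in> W"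
  using W_csc[of P "of_real c"] by (simp only: csc_of_real)

text \<open>The quadratic in \<open>S\<close> factors into \<open>S - occ \<mu>\<close> and
  \<open>S - occ (cnj \<mu>)\<close>. Its inverse \<open>Q\<close> lies in the bicommutant, and
  composing \<open>Q\<close> with the second factor inverts the first: a real inverse yields the
  complex resolvent.\<close>

lemma resolvent_in_bicomm:
  assumes G: "G \<subseteq> Op" "\<And>s t. s \<in> G \<Longrightarrow> t \<in> G \<Longrightarrow> s \<circ> t = t \<circ> s" and S: "S \<in> G" and Q: "Q \<in> Op"
    and SQ: "\<And>P. P \<in> W \<Longrightarrow> S (S (Q P)) - (\<lambda>vs. (2 * Re \<mu>) *\<^sub>R (S (Q P) vs)) + (\<lambda>vs. (cmod \<mu>)\<^sup>2 *\<^sub>R (Q P vs)) = P"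
    and QS: "\<And>P. P \<in> W \<Longrightarrow> Q (S (S P) - (\<lambda>vs. (2 * Re \<mu>) *\<^sub>R (S P vs)) + (\<lambda>vs. (cmod \<mu>)\<^sup>2 *\<^sub>R (P vs))) = P"
  shows "\<exists>y\<in>bicomm G. y \<circ> (S - occ \<mu>) = occ 1"
proof -
  interpret c: comm_algebra "bicomm G" "(\<circ>)" "occ 1" occ obd by (rule bicomm_comm_algebra(1)[OF G])
  have SB: "S \<in> bicomm G" using bicomm_comm_algebra(2)[OF G] S by blast
  have SO: "S \<in> Op" using S G by blast
  let ?X = "(S - occ \<mu>) \<circ> (S - occ (cnj \<mu>))"
  have XB: "?X \<in> bicomm G" using SB by simp
  have sum: "\<mu> + cnj \<mu> = of_real (2 * Re \<mu>)" "\<mu> * cnj \<mu> = of_real ((cmod \<mu>)\<^sup>2)"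
    by (simp_all add: complex_eq_iff complex_norm_square[symmetric] cmod_power2 power2_eq_square)
  have Xe: "?X = (S \<circ> S) - (occ (\<mu> + cnj \<mu>) \<circ> S) + occ (\<mu> * cnj \<mu>)"
    using SB by (simp add: c.ring_rules c.cc_add c.cc_mult algebra_simps)
  have X: "?X P = S (S P) - (\<lambda>vs. (2 * Re \<mu>) *\<^sub>R (S P vs)) + (\<lambda>vs. (cmod \<mu>)\<^sup>2 *\<^sub>R (P vs))" if "P \<in> W" for P
  proof -
    have sc: "occ (of_real c) R = (\<lambda>vs. c *\<^sub>R R vs)" if "R \<in> W" for c R
      using that by (simp only: occ_def csc_of_real if_True)
    show ?thesis unfolding Xe sum using sc[OF that] sc[OF OpD(1)[OF SO that]] by (simp only: o_apply plus_fun_apply minus_apply)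
  qed
  have "?X \<circ> Q = occ 1"
  proof
    fix P show "(?X \<circ> Q) P = occ 1 P"
    proof (cases "P \<in> W")
      case True
      then show ?thesis using SQ[OF True] X[OF OpD(1)[OF Q True]] by (simp only: o_apply) (simp add: occ_def)
    next
      case False
      have "?X \<in> Op" using XB bicomm_comm_algebra(3)[OF G] by blast
      from Op_0[OF this] show ?thesis using False OpD(2)[OF Q False] by (simp only: o_apply) (simp add: occ_def)
    qed
  qed
  moreover have "Q \<circ> ?X = occ 1"
  proof
    fix P show "(Q \<circ> ?X) P = occ 1 P"
    proof (cases "P \<in> W")
      case True
      then show ?thesis using QS[OF True] X[OF True] by (simp only: o_apply) (simp add: occ_def)
    next
      case False
      have "?X \<in> Op" using XB bicomm_comm_algebra(3)[OF G] by blast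
      from OpD(2)[OF this False] show ?thesis using False Op_0[OF Q] by (simp only: o_apply) (simp add: occ_def)
    qed
  qed
  ultimately have QB: "Q \<in> bicomm G" using bicomm_comm_algebra(4)[OF G XB Q] by blast
  have "Q \<circ> (S - occ (cnj \<mu>)) \<circ> (S - occ \<mu>) = Q \<circ> ?X"
    using SB QB c.mul_comm[of "S - occ (cnj \<mu>)" "S - occ \<mu>"] by (simp add: o_assoc[symmetric])
  then have "Q \<circ> (S - occ (cnj \<mu>)) \<circ> (S - occ \<mu>) = occ 1" using \<open>Q \<circ> ?X = occ 1\<close> by simp
  moreover have "Q \<circ> (S - occ (cnj \<mu>)) \<in> bicomm G" using SB QB by simp
  ultimately show ?thesis by blast
qed

definition gens :: "('a \<Rightarrow> 'a) \<Rightarrow> (('a list \<Rightarrow> 'a \<times> 'a) \<Rightarrow> ('a list \<Rightarrow> 'a \<times> 'a)) set" where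
  "gens A = insert (left_comp A) ((\<lambda>i. slot_comp i A) ` {..<j})"

lemma left_comp_apply: "P \<in> W \<Longrightarrow> left_comp B P vs = (B (fst (P vs)), B (snd (P vs)))"
  by (simp add: left_comp_def)

lemma slot_comp_apply: "P \<in> W \<Longrightarrow> length vs = j \<Longrightarrow> slot_comp i B P vs = P (vs[i := B (vs ! i)])"
  by (simp add: slot_comp_def)

lemma W_eqI: "P \<in> W \<Longrightarrow> P' \<in> W \<Longrightarrow> (\<And>vs. length vs = j \<Longrightarrow> P vs = P' vs) \<Longrightarrow> P = P'"
  by (rule ext) (metis W_outside)

lemma Op_eqI: "f \<in> Op \<Longrightarrow> f' \<in> Op \<Longrightarrow> (\<And>P vs. P \<in> W \<Longrightarrow> length vs = j \<Longrightarrow> f P vs = f' P vs) \<Longrightarrow> f = f'"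
  by (rule ext) (metis W_eqI OpD(1,2))

context
  fixes A :: "'a \<Rightarrow> 'a" and KA assumes A: "dec KA A"
begin

lemma gens_Op: "gens A \<subseteq> Op"
  using left_comp_Op[OF A] slot_comp_Op[OF A] by (auto simp: gens_def)

lemma gens_comm:
  assumes "s \<in> gens A" "t \<in> gens A"
  shows "s \<circ> t = t \<circ> s"
proof -
  have LT: "left_comp A \<circ> slot_comp i A = slot_comp i A \<circ> left_comp A" if i: "i < j" for i
  proof (rule Op_eqI)
    show "left_comp A \<circ> slot_comp i A \<in> Op" "slot_comp i A \<circ> left_comp A \<in> Op" using Op_comp(1) left_comp_Op[OF A] slot_comp_Op[OF A i] by blast+
    show "(left_comp A \<circ> slot_comp i A) P vs = (slot_comp i A \<circ> left_comp A) P vs" if "P \<in> W" "length vs = j" for P vs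
      using that OpD(1)[OF left_comp_Op[OF A]] OpD(1)[OF slot_comp_Op[OF A i]] by (simp add: left_comp_apply slot_comp_apply)
  qed
  have TT: "slot_comp i A \<circ> slot_comp k A = slot_comp k A \<circ> slot_comp i A" if i: "i < j" "k < j" for i k
  proof (cases "i = k")
    case False
    show ?thesis
    proof (rule Op_eqI)
      show "slot_comp i A \<circ> slot_comp k A \<in> Op" "slot_comp k A \<circ> slot_comp i A \<in> Op" using Op_comp(1) slot_comp_Op[OF A] i by blast+
      show "(slot_comp i A \<circ> slot_comp k A) P vs = (slot_comp k A \<circ> slot_comp i A) P vs" if "P \<in> W" "length vs = j" for P vs
        using that False OpD(1)[OF slot_comp_Op[OF A i(1)]] OpD(1)[OF slot_comp_Op[OF A i(2)]] by (simp add: slot_comp_apply list_update_swap)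
    qed
  qed simp
  show ?thesis using assms LT TT by (auto simp: gens_def)
qed

interpretation c: comm_algebra "bicomm (gens A)" "(\<circ>)" "occ 1" occ obd
  by (rule bicomm_comm_algebra(1)[OF gens_Op gens_comm])

lemma gens_bicomm: "gens A \<subseteq> bicomm (gens A)"
  by (rule bicomm_comm_algebra(2)[OF gens_Op gens_comm])

lemma left_comp_res:
  assumes "Res A \<mu>"
  shows "\<exists>y\<in>bicomm (gens A). y \<circ> (left_comp A - occ \<mu>) = occ 1"
proof -
  obtain K Q where Q: "dec K Q" "\<And>u. Q (quad A \<mu> u) = u" "\<And>u. quad A \<mu> (Q u) = u"
    using assms unfolding Res_def by blast
  note LW = OpD(1)[OF left_comp_Op[OF A]] and QW = OpD(1)[OF left_comp_Op[OF Q(1)]]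
  have eq: "left_comp A (left_comp A P) - (\<lambda>vs. (2 * Re \<mu>) *\<^sub>R (left_comp A P vs)) + (\<lambda>vs. (cmod \<mu>)\<^sup>2 *\<^sub>R (P vs))
      = (\<lambda>vs. (quad A \<mu> (fst (P vs)), quad A \<mu> (snd (P vs))))" if "P \<in> W" for P
    using that LW[OF that] by (simp add: fun_eq_iff left_comp_apply quad_def scaleR_prod_def)
  have XW: "left_comp A (left_comp A P) - (\<lambda>vs. (2 * Re \<mu>) *\<^sub>R (left_comp A P vs)) + (\<lambda>vs. (cmod \<mu>)\<^sup>2 *\<^sub>R (P vs)) \<in> W" if "P \<in> W" for P
    by (intro W_add W_diff W_scale LW that)
  show ?thesis
  proof (rule resolvent_in_bicomm[OF gens_Op gens_comm _ left_comp_Op[OF Q(1)]])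
    fix P assume P: "P \<in> W"
    show "left_comp A (left_comp A (left_comp Q P)) - (\<lambda>vs. (2 * Re \<mu>) *\<^sub>R (left_comp A (left_comp Q P) vs)) + (\<lambda>vs. (cmod \<mu>)\<^sup>2 *\<^sub>R (left_comp Q P vs)) = P"
      unfolding eq[OF QW[OF P]] using P by (simp add: left_comp_apply Q(3))
    show "left_comp Q (left_comp A (left_comp A P) - (\<lambda>vs. (2 * Re \<mu>) *\<^sub>R (left_comp A P vs)) + (\<lambda>vs. (cmod \<mu>)\<^sup>2 *\<^sub>R (P vs))) = P"
      using XW[OF P] P unfolding eq[OF P] by (simp add: fun_eq_iff left_comp_apply Q(2))
  qed (auto simp: gens_def)
qed

text \<open>Linearity in slot \<open>i\<close> turns the quadratic in \<open>slot_comp i A\<close>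
  into substitution of \<open>quad A \<mu>\<close> into that slot, which substitution of
  \<open>Q\<close> undoes.\<close>

lemma slot_comp_res:
  assumes "Res A \<mu>" and i: "i < j"
  shows "\<exists>y\<in>bicomm (gens A). y \<circ> (slot_comp i A - occ \<mu>) = occ 1"
proof -
  obtain K Q where Q: "dec K Q" "\<And>u. Q (quad A \<mu> u) = u" "\<And>u. quad A \<mu> (Q u) = u"
    using assms unfolding Res_def by blast
  note LW = OpD(1)[OF slot_comp_Op[OF A i]] and QW = OpD(1)[OF slot_comp_Op[OF Q(1) i]]
  have eq: "(slot_comp i A (slot_comp i A P) - (\<lambda>vs. (2 * Re \<mu>) *\<^sub>R (slot_comp i A P vs)) + (\<lambda>vs. (cmod \<mu>)\<^sup>2 *\<^sub>R (P vs))) vs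
      = P (vs[i := quad A \<mu> (vs ! i)])" if P: "P \<in> W" and vs: "length vs = j" for P vs
  proof -
    note l = linear_add[OF W_slot[OF P vs i]] linear_diff[OF W_slot[OF P vs i]] linear_scale[OF W_slot[OF P vs i]]
    have "P (vs[i := quad A \<mu> (vs ! i)]) = P (vs[i := A (A (vs ! i))]) - (2 * Re \<mu>) *\<^sub>R P (vs[i := A (vs ! i)]) + (cmod \<mu>)\<^sup>2 *\<^sub>R P (vs[i := vs ! i])"
      unfolding quad_def by (simp only: l)
    then show ?thesis using P vs i LW[OF P] by (simp add: slot_comp_apply)
  qed
  have XW: "slot_comp i A (slot_comp i A P) - (\<lambda>vs. (2 * Re \<mu>) *\<^sub>R (slot_comp i A P vs)) + (\<lambda>vs. (cmod \<mu>)\<^sup>2 *\<^sub>R (P vs)) \<in> W" if "P \<in> W" for P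
    by (intro W_add W_diff W_scale LW that)
  show ?thesis
  proof (rule resolvent_in_bicomm[OF gens_Op gens_comm _ slot_comp_Op[OF Q(1) i]])
    fix P assume P: "P \<in> W"
    show "slot_comp i A (slot_comp i A (slot_comp i Q P)) - (\<lambda>vs. (2 * Re \<mu>) *\<^sub>R (slot_comp i A (slot_comp i Q P) vs)) + (\<lambda>vs. (cmod \<mu>)\<^sup>2 *\<^sub>R (slot_comp i Q P vs)) = P"
    proof (rule W_eqI[OF XW[OF QW[OF P]] P])
      fix vs :: "'a list" assume vs: "length vs = j"
      show "(slot_comp i A (slot_comp i A (slot_comp i Q P)) - (\<lambda>vs. (2 * Re \<mu>) *\<^sub>R (slot_comp i A (slot_comp i Q P) vs)) + (\<lambda>vs. (cmod \<mu>)\<^sup>2 *\<^sub>R (slot_comp i Q P vs))) vs = P vs"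
        unfolding eq[OF QW[OF P] vs] using P vs i by (simp add: slot_comp_apply Q(2))
    qed
    show "slot_comp i Q (slot_comp i A (slot_comp i A P) - (\<lambda>vs. (2 * Re \<mu>) *\<^sub>R (slot_comp i A P vs)) + (\<lambda>vs. (cmod \<mu>)\<^sup>2 *\<^sub>R (P vs))) = P"
    proof (rule W_eqI[OF QW[OF XW[OF P]] P])
      fix vs :: "'a list" assume vs: "length vs = j"
      show "slot_comp i Q (slot_comp i A (slot_comp i A P) - (\<lambda>vs. (2 * Re \<mu>) *\<^sub>R (slot_comp i A P vs)) + (\<lambda>vs. (cmod \<mu>)\<^sup>2 *\<^sub>R (P vs))) vs = P vs"
        unfolding slot_comp_apply[OF XW[OF P] vs] using eq[OF P, of "vs[i := Q (vs ! i)]"] vs i by (simp add: Q(3))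
    qed
  qed (use i in \<open>auto simp: gens_def\<close>)
qed

lemma list_product_TB:
  assumes "set ks \<subseteq> {..<j}"
  shows "P \<in> W \<Longrightarrow> length vs = j \<Longrightarrow> c.list_product (map (\<lambda>i. slot_comp i A) ks) P vs = P (fold (\<lambda>i vs. vs[i := A (vs ! i)]) ks vs)"
  using assms
proof (induction ks arbitrary: vs)
  case Nil
  then show ?case by (simp only: list.map(1) c.list_product.simps(1) fold_simps) (simp add: occ_def)
next
  case (Cons i ks)
  have i: "i < j" using Cons.prems by simp
  have "set (map (\<lambda>i. slot_comp i A) ks) \<subseteq> bicomm (gens A)" using Cons.prems(3) gens_bicomm by (auto simp: gens_def)
  then have "c.list_product (map (\<lambda>i. slot_comp i A) ks) \<in> Op" using bicomm_comm_algebra(3)[OF gens_Op gens_comm] c.list_product_in by blast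
  then have mW: "c.list_product (map (\<lambda>i. slot_comp i A) ks) P \<in> W" using OpD(1) Cons.prems(1) by blast
  have "length (vs[i := A (vs ! i)]) = j" "set ks \<subseteq> {..<j}" using Cons.prems by auto
  note IH = Cons.IH[OF Cons.prems(1) this]
  have "c.list_product (map (\<lambda>i. slot_comp i A) (i # ks)) P = slot_comp i A (c.list_product (map (\<lambda>i. slot_comp i A) ks) P)"
    unfolding list.map(2) c.list_product.simps(2) by (rule o_apply)
  then show ?case by (simp only: slot_comp_apply[OF mW Cons.prems(2)] IH fold_simps)
qed

lemma fold_update_map: "k \<le> length vs \<Longrightarrow> fold (\<lambda>i vs. vs[i := A (vs ! i)]) [0..<k] vs = map A (take k vs) @ drop k vs"
proof (induction k)
  case (Suc k)
  have "drop k vs = vs ! k # drop (Suc k) vs" using Suc.prems by (simp add: Cons_nth_drop_Suc)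
  moreover have "take (Suc k) vs = take k vs @ [vs ! k]" using Suc.prems by (simp add: take_Suc_conv_app_nth)
  ultimately show ?case using Suc by (simp add: nth_append list_update_append)
qed simp

text \<open>The left side is \<open>left_comp A\<close> minus the product of all
  \<open>slot_comp i A\<close>, applied to \<open>H\<close>. Absence of resonances makes this
  difference invertible in the bicommutant of these operators.\<close>

theorem homological:
  assumes res: "\<And>z0 zs. length zs = j \<Longrightarrow> z0 = prod_list zs \<Longrightarrow> Res A z0 \<or> (\<exists>z\<in>set zs. Res A z)"
    and G: "multilinear_map j G" "MB j K G"
  shows "\<exists>H L. multilinear_map j H \<and> MB j L H \<and> (\<forall>vs. length vs = j \<longrightarrow> A (H vs) - H (map A vs) = G vs)"
proof -
  let ?xs = "map (\<lambda>i. slot_comp i A) [0..<j]"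
  have xs: "set ?xs \<subseteq> bicomm (gens A)" and x0: "left_comp A \<in> bicomm (gens A)" using gens_bicomm by (auto simp: gens_def)
  have "\<exists>y\<in>bicomm (gens A). y \<circ> (left_comp A - c.list_product ?xs) = occ 1"
  proof (rule c.product_invertible[OF x0 xs])
    fix z0 :: complex and zs assume zs: "length zs = length ?xs" "z0 = prod_list zs"
    then have l: "length zs = j" by simp
    from res[OF l zs(2)] show "(\<exists>y\<in>bicomm (gens A). y \<circ> (left_comp A - occ z0) = occ 1) \<or>
      (\<exists>i<length ?xs. \<exists>y\<in>bicomm (gens A). y \<circ> (?xs ! i - occ (zs ! i)) = occ 1)"
    proof
      assume "\<exists>z\<in>set zs. Res A z"
      then obtain i where "i < j" "Res A (zs ! i)" using l by (auto simp: in_set_conv_nth)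
      then show ?thesis using slot_comp_res by auto
    qed (use left_comp_res in blast)
  qed
  then obtain y where y: "y \<in> bicomm (gens A)" "y \<circ> (left_comp A - c.list_product ?xs) = occ 1" by blast
  have "c.list_product ?xs \<in> bicomm (gens A)" using xs by simp
  then have y': "(left_comp A - c.list_product ?xs) \<circ> y = occ 1" using y c.mul_comm[of y "left_comp A - c.list_product ?xs"] x0 by simp
  \<comment> \<open>The right side with imaginary part 0. Both \<open>left_comp A\<close> and
    substitution of \<open>A\<close> act on the two components separately, so the first component of
    the solution solves the real equation.\<close>
  define G' where "G' vs = (if length vs = j then (G vs, 0) else (0 :: 'a \<times> 'a))" for vs
  have "multilinear_map j G'"
    unfolding multilinear_map_def
  proof (intro allI impI)
    fix vs :: "'a list" and p assume vs: "length vs = j" "p < j"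
    then have l: "linear (\<lambda>w. G (vs[p := w]))" using G(1) by (simp add: multilinear_map_def)
    show "linear (\<lambda>w. G' (vs[p := w]))" by (rule linearI) (simp_all add: G'_def vs linear_add[OF l] linear_scale[OF l])
  qed
  moreover have "NB K G'" unfolding NB_def
  proof (intro exI conjI)
    show "MB j K (\<lambda>vs. fst (G' vs))" by (rule MB_cong[OF G(2)]) (simp add: G'_def)
    show "MB j 0 (\<lambda>vs. snd (G' vs))" by (rule MB_cong[OF MB_zero]) (simp_all add: G'_def)
  qed simp
  ultimately have G'W: "G' \<in> W" by (rule WI) (simp add: G'_def)
  define H where "H = y G'"
  have yO: "y \<in> Op" using y(1) bicomm_comm_algebra(3)[OF gens_Op gens_comm] by blast
  have HW: "H \<in> W" unfolding H_def by (rule OpD(1)[OF yO G'W])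
  obtain L where L: "NB L H" using W_NB[OF HW] by blast
  obtain K1 K2 where K12: "MB j K1 (\<lambda>vs. fst (H vs))" "MB j K2 (\<lambda>vs. snd (H vs))" using L unfolding NB_def by blast
  have "multilinear_map j (\<lambda>vs. fst (H vs))"
    using multilinear_compose_linear[OF linear_fst, of j H] HW by (simp add: W_def)
  moreover have "A (fst (H vs)) - fst (H (map A vs)) = G vs" if vs: "length vs = j" for vs
  proof -
    have "(left_comp A - c.list_product ?xs) H vs = occ 1 G' vs" using fun_cong[OF y', of G'] unfolding H_def by simp
    then have "left_comp A H vs - c.list_product ?xs H vs = G' vs" using G'W by (simp add: occ_def)
    moreover have "c.list_product ?xs H vs = H (map A vs)" using list_product_TB[OF _ HW vs, of "[0..<j]"] fold_update_map[of j vs] vs by (simp add: atLeast0LessThan)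
    ultimately have "fst (left_comp A H vs) - fst (H (map A vs)) = fst (G' vs)" by (metis fst_diff)
    then show ?thesis using HW vs by (simp add: left_comp_apply G'_def)
  qed
  ultimately show ?thesis using K12(1) by (intro exI[of _ "\<lambda>vs. fst (H vs)"]) blast
qed

lemma ideal_zero: "c.ideal {0}"
  using c.mul_zero by (auto simp: c.ideal_def)

lemma bq_zero: "c.bq {0} x K \<longleftrightarrow> obd x K"
  by (simp add: c.bq_def)

text \<open>With the ideal \<open>{0}\<close> the quotient is the algebra itself. For
  \<open>z \<noteq> 0\<close> the inverse of \<open>1 - z A\<close> comes from the resolvent at
  \<open>1 / z\<close>, whose modulus is at least \<open>\<rho>\<close>.\<close>

lemma spectral_radius_pw:
  assumes rho: "0 < \<rho>" and res: "\<And>\<mu>. \<rho> \<le> cmod \<mu> \<Longrightarrow> Res A \<mu>"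
  shows "\<exists>K. \<forall>n. obd (occ (of_real ((1 / \<rho>) ^ n)) \<circ> c.pw (left_comp A) n) K"
proof -
  have S: "left_comp A \<in> bicomm (gens A)" using gens_bicomm by (auto simp: gens_def)
  have "\<exists>y\<in>bicomm (gens A). ((occ 1 - (occ z \<circ> left_comp A)) \<circ> y) - occ 1 \<in> {0}" if z: "cmod z \<le> 1 / \<rho>" for z
  proof (cases "z = 0")
    case True
    have z0: "(0 :: ('a list \<Rightarrow> 'a \<times> 'a) \<Rightarrow> 'a list \<Rightarrow> 'a \<times> 'a) \<circ> left_comp A = 0" by (simp add: fun_eq_iff)
    have "((occ 1 - (occ z \<circ> left_comp A)) \<circ> occ 1) - occ 1 = 0" unfolding True c.cc_0 z0 by simp
    then show ?thesis by (intro bexI[of _ "occ 1"]) simp_all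
  next
    case False
    let ?w = "1 / z"
    have "\<rho> \<le> cmod ?w" using z False rho by (simp add: norm_divide field_simps)
    then obtain y where y: "y \<in> bicomm (gens A)" "y \<circ> (left_comp A - occ ?w) = occ 1" using left_comp_res[OF res] by blast
    have zw: "occ z \<circ> occ ?w = occ 1" using False by (simp flip: c.cc_mult)
    let ?y = "- (occ ?w \<circ> y)"
    have "(occ 1 - (occ z \<circ> left_comp A)) \<circ> ?y = ((occ z \<circ> occ ?w) \<circ> (y \<circ> left_comp A)) - (occ ?w \<circ> y)"
      using S y(1) by (simp add: c.ring_rules)
    also have "\<dots> = y \<circ> (left_comp A - occ ?w)" unfolding zw using S y(1) by (simp add: c.mul_diff c.mul_comm[of "occ ?w"])
    finally have "((occ 1 - (occ z \<circ> left_comp A)) \<circ> ?y) - occ 1 = 0" using y(2) by simp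
    then show ?thesis using y(1) by (intro bexI[of _ ?y]) simp_all
  qed
  note inv = this
  have "\<exists>K. \<forall>n. c.bq {0} (c.pw (occ (of_real (1 / \<rho>)) \<circ> left_comp A) n) K"
    by (rule c.spectral_radius[OF ideal_zero S _ inv]) (use rho in simp_all)
  then obtain K where "\<And>n. obd (c.pw (occ (of_real (1 / \<rho>)) \<circ> left_comp A) n) K" unfolding bq_zero by blast
  then show ?thesis using S by (simp add: c.pw_mul c.pw_cc) blast
qed

lemma spectrum_nonempty_pw:
  assumes "occ 1 \<noteq> 0"
  shows "\<exists>z. \<not> Res A z"
proof -
  have S: "left_comp A \<in> bicomm (gens A)" using gens_bicomm by (auto simp: gens_def)
  obtain z where "\<And>b. b \<in> bicomm (gens A) \<Longrightarrow> b \<circ> (left_comp A - occ z) \<noteq> occ 1"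
    using c.exists_character_value[OF ideal_zero S] assms by auto
  then show ?thesis using left_comp_res by blast
qed

lemma pw_LB: "P \<in> W \<Longrightarrow> c.pw (left_comp A) n P vs = ((A ^^ n) (fst (P vs)), (A ^^ n) (snd (P vs)))"
proof (induction n)
  case 0
  then show ?case by (simp only: c.pw.simps(1) funpow_0) (simp add: occ_def)
next
  case (Suc n)
  have "c.pw (left_comp A) n \<in> Op" using bicomm_comm_algebra(3)[OF gens_Op gens_comm] gens_bicomm c.pw_in by (auto simp: gens_def)
  then have pW: "c.pw (left_comp A) n P \<in> W" using OpD(1) Suc.prems by blast
  have "c.pw (left_comp A) (Suc n) P = left_comp A (c.pw (left_comp A) n P)" unfolding c.pw.simps(2) by (rule o_apply)
  then show ?case by (simp only: left_comp_apply[OF pW] Suc.IH[OF Suc.prems] fst_conv snd_conv) simp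
qed

text \<open>For \<open>j = 1\<close> the identity map, paired with imaginary part 0, lies in
  \<open>W\<close> with bound 1. Applying the operator to it turns a bound on operators back into a
  bound on the powers of \<open>A\<close>.\<close>

lemma dec_of_pw:
  assumes j: "j = 1" and b: "obd (occ (of_real c) \<circ> c.pw (left_comp A) n) K"
  shows "dec K (\<lambda>u. c *\<^sub>R (A ^^ n) u)"
proof -
  define P where "P vs = (if length vs = j then (hd vs, 0) else (0 :: 'a \<times> 'a))" for vs :: "'a list"
  have "multilinear_map j P"
    unfolding multilinear_map_def P_def using j by (auto simp: length_Suc_conv intro!: linearI)
  moreover have "NB 1 P" unfolding NB_def
  proof (intro exI conjI)
    have "MB j 1 (\<lambda>vs. hd vs)" using dec_MB[OF dec_id] j by simp
    then show "MB j 1 (\<lambda>vs. fst (P vs))" by (rule MB_cong) (simp add: P_def)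
    show "MB j 0 (\<lambda>vs. snd (P vs))" by (rule MB_cong[OF MB_zero]) (simp_all add: P_def)
  qed simp
  ultimately have P: "P \<in> W" "NB 1 P" by (auto intro!: WI simp: P_def)
  have "NB (K * 1) ((occ (of_real c) \<circ> c.pw (left_comp A) n) P)" by (rule obdD[OF b P])
  then obtain K1 K2 where K: "MB j K1 (\<lambda>vs. fst ((occ (of_real c) \<circ> c.pw (left_comp A) n) P vs))" "K1 + K2 \<le> K" "0 \<le> K2"
    unfolding NB_def using MB_nonneg by fastforce
  have "c.pw (left_comp A) n \<in> Op" using bicomm_comm_algebra(3)[OF gens_Op gens_comm] gens_bicomm c.pw_in by (auto simp: gens_def)
  then have pW: "c.pw (left_comp A) n P \<in> W" using OpD(1) P(1) by blast
  have lin: "linear (A ^^ n)" using dec_funpow[OF A] dec_linear by blast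
  have "MB 1 K1 (\<lambda>vs. c *\<^sub>R (A ^^ n) (hd vs))"
  proof -
    have "fst ((occ (of_real c) \<circ> c.pw (left_comp A) n) P vs) = c *\<^sub>R (A ^^ n) (hd vs)" if "length vs = j" for vs
      by (simp only: o_apply occ_def pW if_True pw_LB[OF P(1)] csc_of_real P_def that fst_conv fst_scaleR refl)
    from MB_cong[OF K(1) this] show ?thesis unfolding j .
  qed
  then have "dec K1 (\<lambda>u. c *\<^sub>R (A ^^ n) u)"
    using linear_compose_scale_right[OF lin] by (rule MB_imp_dec)
  then show ?thesis by (rule dec_mono) (use K(2,3) in simp)
qed

end

end

section \<open>Spectral radius and nonempty spectrum for maps with decay\<close>

context gauged
begin

theorem spectral_radius_dec:
  assumes A: "dec KA A" and rho: "0 < \<rho>" and res: "\<And>\<mu>. \<rho> \<le> cmod \<mu> \<Longrightarrow> Res A \<mu>"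
  shows "\<exists>K. \<forall>n. dec (K * \<rho> ^ n) (A ^^ n)"
proof -
  interpret w: decay_operators Fam 1 ..
  obtain K where K: "\<And>n. dec K (\<lambda>u. ((1 / \<rho>) ^ n) *\<^sub>R (A ^^ n) u)"
    using w.spectral_radius_pw[OF A rho res] w.dec_of_pw[OF A refl] by metis
  have "dec (K * \<rho> ^ n) (A ^^ n)" for n
  proof -
    have "(\<lambda>u. \<rho> ^ n *\<^sub>R ((1 / \<rho>) ^ n *\<^sub>R (A ^^ n) u)) = A ^^ n"
      using rho by (simp add: fun_eq_iff flip: power_mult_distrib)
    then show ?thesis using dec_scale[OF K[of n], of "\<rho> ^ n"] rho by (simp add: mult.commute)
  qed
  then show ?thesis by blast
qed

text \<open>The nonzero vector makes the algebra nontrivial, and a character value of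
  \<open>left_comp A\<close> is then a spectral value of \<open>A\<close>.\<close>

theorem spectrum_nonempty:
  assumes A: "dec KA A" and u: "(u :: 'a) \<noteq> 0"
  shows "\<exists>z. \<not> Res A z"
proof -
  interpret w: decay_operators Fam 1 ..
  define P where "P vs = (if length vs = 1 then (hd vs, 0) else (0 :: 'a \<times> 'a))" for vs :: "'a list"
  have "multilinear_map 1 P"
    unfolding multilinear_map_def P_def by (auto simp: length_Suc_conv intro!: linearI)
  moreover have "w.NB 1 P" unfolding w.NB_def
  proof (intro exI conjI)
    show "MB 1 1 (\<lambda>vs. fst (P vs))" by (rule MB_cong[OF dec_MB[OF dec_id]]) (simp add: P_def)
    show "MB 1 0 (\<lambda>vs. snd (P vs))" by (rule MB_cong[OF MB_zero]) (simp_all add: P_def)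
  qed simp
  ultimately have PW: "P \<in> w.W" by (rule w.WI) (simp add: P_def)
  have "w.occ 1 P [u] = P [u]" using PW by (simp only: w.occ_def if_True csc_1)
  moreover have "P [u] \<noteq> 0" using u by (simp add: P_def zero_prod_def)
  ultimately have "w.occ 1 \<noteq> 0" by (metis zero_fun_apply)
  from w.spectrum_nonempty_pw[OF A this] show ?thesis .
qed

end


section \<open>The adapted gauge\<close>

text \<open>The Lyapunov trick: weighting the whole orbit of \<open>u\<close> under \<open>A\<close> and \<open>A\<^sup>-\<^sup>1\<close> turns the asymptotic
  bounds \<open>\<parallel>A^k\<parallel> \<le> C b^k\<close> and \<open>\<parallel>A^-k\<parallel> \<le> C a^k\<close> into \<open>\<parallel>A\<parallel> \<le> b\<close> and \<open>\<parallel>A\<^sup>-\<^sup>1\<parallel> \<le> a\<close>.\<close>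

definition adapted ::
  "('o option \<Rightarrow> (('a::real_normed_vector \<Rightarrow> 'b::real_normed_vector) \<times> real) set) \<Rightarrow> ('a \<Rightarrow> 'a) \<Rightarrow> ('a \<Rightarrow> 'a) \<Rightarrow>
    real \<Rightarrow> real \<Rightarrow> 'o option \<Rightarrow> (('a \<Rightarrow> 'b) \<times> real) set" where
  "adapted Fam A Ai b a q = (\<Union>k::nat. (\<lambda>(T, c). (\<lambda>u. T ((A ^^ k) u), b ^ k * c)) ` Fam q \<union>
     (\<lambda>(T, c). (\<lambda>u. T ((Ai ^^ k) u), a ^ k * c)) ` Fam q)"

lemma gauge_adapted:
  "gauge (adapted Fam A Ai b a) q u K \<longleftrightarrow> 0 \<le> K \<and>
     (\<forall>k T c. (T, c) \<in> Fam q \<longrightarrow> norm (T ((A ^^ k) u)) \<le> K * (b ^ k * c) \<and> norm (T ((Ai ^^ k) u)) \<le> K * (a ^ k * c))"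
  unfolding gauge_def adapted_def by (auto; force)

text \<open>One constant \<open>M\<close> bounds all powers at every index, which compares the
  adapted gauge with the given one from above; the term \<open>k = 0\<close> of the orbit compares
  them from below.\<close>

locale adapted_gauge = gauged Fam
  for Fam :: "'o option \<Rightarrow> (('a::banach \<Rightarrow> 'b::real_normed_vector) \<times> real) set" +
  fixes A Ai :: "'a \<Rightarrow> 'a" and b a M :: real
  assumes A_dec: "\<And>k. dec (M * b ^ k) (A ^^ k)" and Ai_dec: "\<And>k. dec (M * a ^ k) (Ai ^^ k)"
    and inv: "\<And>x. A (Ai x) = x" "\<And>x. Ai (A x) = x" and ba: "0 < b" "0 < a" "1 \<le> a * b" and M: "1 \<le> M"
begin

abbreviation "Fam' \<equiv> adapted Fam A Ai b a"

lemma g'_iff: "gauge Fam' q u K \<longleftrightarrow> (\<forall>k. g q ((A ^^ k) u) (K * b ^ k) \<and> g q ((Ai ^^ k) u) (K * a ^ k))"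
proof
  assume "gauge Fam' q u K"
  then show "\<forall>k. g q ((A ^^ k) u) (K * b ^ k) \<and> g q ((Ai ^^ k) u) (K * a ^ k)"
    unfolding gauge_adapted unfolding gauge_def using ba by (simp add: mult.assoc)
next
  assume *: "\<forall>k. g q ((A ^^ k) u) (K * b ^ k) \<and> g q ((Ai ^^ k) u) (K * a ^ k)"
  have "0 \<le> K" using g_nonneg[of q u K] *[rule_format, of 0] by simp
  then show "gauge Fam' q u K"
    unfolding gauge_adapted using * unfolding gauge_def by (simp add: mult.assoc)
qed

lemma g'_g: "gauge Fam' q u K \<Longrightarrow> g q u K"
  unfolding g'_iff by (drule spec[of _ 0]) simp

lemma g_g': 
  assumes "g q u K"
  shows "gauge Fam' q u (M * K)"
  unfolding g'_iff
proof (intro allI conjI)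
  fix k
  show "g q ((A ^^ k) u) (M * K * b ^ k)" using decD[OF A_dec assms, of k] by (simp add: mult_ac)
  show "g q ((Ai ^^ k) u) (M * K * a ^ k)" using decD[OF Ai_dec assms, of k] by (simp add: mult_ac)
qed

lemma Fam'_cases:
  assumes "(T, c) \<in> Fam' q"
  shows "bounded_linear T \<and> 0 < c"
proof -
  obtain T0 c0 k where T: "(T0, c0) \<in> Fam q"
    "(T = (\<lambda>u. T0 ((A ^^ k) u)) \<and> c = b ^ k * c0) \<or> (T = (\<lambda>u. T0 ((Ai ^^ k) u)) \<and> c = a ^ k * c0)"
    using assms unfolding adapted_def by auto
  show ?thesis
    using T(2) bounded_linear_compose[OF Fam_linear[OF T(1)] dec_bounded_linear[OF A_dec]]
      bounded_linear_compose[OF Fam_linear[OF T(1)] dec_bounded_linear[OF Ai_dec]] Fam_pos[OF T(1)] ba by auto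
qed

sublocale g': gauged Fam'
proof (rule gauged.intro, goal_cases)
  case (1 T c q)
  then show ?case using Fam'_cases by blast
next
  case (2 T c q)
  then show ?case using Fam'_cases by blast
next
  case 3
  obtain C where C: "C \<ge> 1" "\<And>u. g None u (C * norm u)" using g_None_bounds by blast
  have "gauge Fam' None u ((M * C) * norm u)" for u using g_g'[OF C(2)[of u]] by (simp add: mult.assoc)
  then show ?case using C(1) M by (intro exI[of _ "M * C"]) auto
next
  case 4
  obtain C where C: "C \<ge> 1" "\<And>u K. g None u K \<Longrightarrow> norm u \<le> C * K" using g_None_bounds by blast
  then show ?case using g'_g by (intro exI[of _ C]) auto
qed

lemma good_good': "good ts \<Longrightarrow> g'.good (map (\<lambda>t. (fst t, M * fst (snd t), snd (snd t))) ts)"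
  by (induction ts) (auto simp: g_g')

lemma good'_good: "g'.good ts \<Longrightarrow> good ts"
  by (induction ts) (auto simp: g'_g)

lemma MB_MB':
  assumes "MB j K B"
  shows "g'.MB j (M * K) B"
proof (rule g'.MBI)
  show "0 \<le> M * K" using MB_nonneg[OF assms] M by simp
  fix ts q assume ts: "length ts = j" "g'.good ts" "adm q (map (\<lambda>t. snd (snd t)) ts)"
  show "gauge Fam' q (B (map fst ts)) (M * K * prod_list (map (\<lambda>t. fst (snd t)) ts))"
    using g_g'[OF MBD[OF assms ts(1) good'_good[OF ts(2)] ts(3)]] by (simp add: mult.assoc)
qed

lemma MB'_MB:
  assumes "g'.MB j K B"
  shows "MB j (K * M ^ j) B"
proof (rule MBI)
  show "0 \<le> K * M ^ j" using g'.MB_nonneg[OF assms] M by simp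
  fix ts q assume ts: "length ts = j" "good ts" "adm q (map (\<lambda>t. snd (snd t)) ts)"
  let ?ts = "map (\<lambda>t. (fst t, M * fst (snd t), snd (snd t))) ts"
  have "prod_list (map (\<lambda>t. M * fst (snd t)) ts) = M ^ length ts * prod_list (map (\<lambda>t. fst (snd t)) ts)"
    by (induction ts) auto
  then show "g q (B (map fst ts)) (K * M ^ j * prod_list (map (\<lambda>t. fst (snd t)) ts))"
    using g'_g[OF g'.MBD[OF assms _ good_good'[OF ts(2)], of q]] ts(1,3) by (simp add: o_def mult_ac)
qed

lemma dec'_A: "g'.dec b A"
  unfolding g'.dec_def
proof (intro conjI allI impI)
  show "linear A" using dec_linear[OF A_dec[of 1]] by simp
  fix q u k assume u: "gauge Fam' q u k"
  have k0: "0 \<le> k" using g'.g_nonneg[OF u] .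
  show "gauge Fam' q (A u) (b * k)"
    unfolding g'_iff
  proof (intro allI conjI)
    fix n
    have "g q ((A ^^ Suc n) u) (k * b ^ Suc n)" using u unfolding g'_iff by blast
    then show "g q ((A ^^ n) (A u)) (b * k * b ^ n)" by (simp only: funpow_Suc_right o_apply power_Suc mult_ac)
    show "g q ((Ai ^^ n) (A u)) (b * k * a ^ n)"
    proof (cases n)
      case 0
      have "g q ((A ^^ 1) u) (k * b ^ 1)" using u unfolding g'_iff by blast
      then show ?thesis using 0 by (simp add: mult.commute)
    next
      case (Suc m)
      have "g q ((Ai ^^ m) u) (k * a ^ m)" using u unfolding g'_iff by blast
      \<comment> \<open>\<open>A\<close> cancels one factor \<open>Ai\<close>, so the bound
        \<open>k * a ^ m\<close> must not exceed \<open>b * k * a ^ Suc m\<close>; this is the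
        condition \<open>1 \<le> a * b\<close>.\<close>
      moreover have "k * a ^ m * 1 \<le> k * a ^ m * (a * b)" using ba k0 by (intro mult_left_mono) auto
      ultimately have "g q ((Ai ^^ m) u) (b * k * a ^ n)" by (elim g_mono) (simp add: Suc mult_ac)
      then show ?thesis unfolding Suc funpow_Suc_right o_apply inv(2) .
    qed
  qed
qed (use ba in simp)

lemma dec'_Ai: "g'.dec a Ai"
  unfolding g'.dec_def
proof (intro conjI allI impI)
  show "linear Ai" using dec_linear[OF Ai_dec[of 1]] by simp
  fix q u k assume u: "gauge Fam' q u k"
  have k0: "0 \<le> k" using g'.g_nonneg[OF u] .
  show "gauge Fam' q (Ai u) (a * k)"
    unfolding g'_iff
  proof (intro allI conjI)
    fix n
    have "g q ((Ai ^^ Suc n) u) (k * a ^ Suc n)" using u unfolding g'_iff by blast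
    then show "g q ((Ai ^^ n) (Ai u)) (a * k * a ^ n)" by (simp only: funpow_Suc_right o_apply power_Suc mult_ac)
    show "g q ((A ^^ n) (Ai u)) (a * k * b ^ n)"
    proof (cases n)
      case 0
      have "g q ((Ai ^^ 1) u) (k * a ^ 1)" using u unfolding g'_iff by blast
      then show ?thesis using 0 by (simp add: mult.commute)
    next
      case (Suc m)
      have "g q ((A ^^ m) u) (k * b ^ m)" using u unfolding g'_iff by blast
      moreover have "k * b ^ m * 1 \<le> k * b ^ m * (a * b)" using ba k0 by (intro mult_left_mono) auto
      ultimately have "g q ((A ^^ m) u) (a * k * b ^ n)" by (elim g_mono) (simp add: Suc mult_ac)
      then show ?thesis unfolding Suc funpow_Suc_right o_apply inv(1) .
    qed
  qed
qed (use ba in simp)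

end

section \<open>Local linearization from spectral bounds\<close>

lemma exists_above_with_power_bound:
  fixes a b :: real
  assumes "0 < b" "b < 1" "a * b ^ q < 1"
  shows "\<exists>b'. b < b' \<and> b' < 1 \<and> a * b' ^ q < 1"
proof -
  have "((\<lambda>x. a * x ^ q) \<longlongrightarrow> a * b ^ q) (at_right b)" by (intro tendsto_intros)
  then have "\<forall>\<^sub>F x in at_right b. a * x ^ q < 1" by (rule order_tendstoD) (use assms in simp)
  moreover have "\<forall>\<^sub>F x in at_right b. b < x \<and> x < 1" using eventually_at_right_real[OF assms(2)] by (simp add: conj_commute)
  ultimately have "\<forall>\<^sub>F x in at_right b. b < x \<and> x < 1 \<and> a * x ^ q < 1" by eventually_elim auto
  then show ?thesis using eventually_happens trivial_limit_at_right_real by blast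
qed

context gauged
begin

text \<open>In the adapted norm the linear part contracts by \<open>b0\<close> at once rather than
  after many iterations, so on a small ball \<open>F\<close> contracts by some slightly larger
  \<open>b\<close>. The room in \<open>b0 ^ q < a0\<close> keeps \<open>a * b ^ q < 1\<close>.
  Bounds in the two norms differ by powers of \<open>M\<close> only.\<close>

theorem linearize_local:
  assumes A: "dec KA A" and Ai: "dec KAi Ai" and inv: "\<And>x. A (Ai x) = x" "\<And>x. Ai (A x) = x"
    and spec: "0 < a0" "a0 \<le> b0" "b0 < 1" "b0 ^ q < a0"
      "\<And>\<mu>. b0 \<le> cmod \<mu> \<Longrightarrow> Res A \<mu>" "\<And>\<mu>. cmod \<mu> \<le> a0 \<Longrightarrow> Res A \<mu>"
    and nonres: "\<And>j z0 zs. 2 \<le> j \<Longrightarrow> j < q \<Longrightarrow> length zs = j \<Longrightarrow> z0 = prod_list zs \<Longrightarrow> Res A z0 \<or> (\<exists>z\<in>set zs. Res A z)"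
    and q: "2 \<le> q" "q \<le> r"
    and F: "smooth r U F" and U: "0 \<in> U" and F0: "F 0 = 0" "\<And>h. nth_deriv F [h] 0 = A h"
    and FMB: "\<And>s. 1 \<le> s \<Longrightarrow> s \<le> r \<Longrightarrow> \<exists>K. \<forall>x\<in>U. MB s K (D_at F x)"
  shows "\<exists>V R. open V \<and> 0 \<in> V \<and> V \<subseteq> U \<and> smooth r V R \<and> R 0 = 0 \<and> (\<forall>h. nth_deriv R [h] 0 = h) \<and>
     (\<forall>s\<le>r. \<exists>K. \<forall>x\<in>V. MB s K (D_at R x)) \<and> (\<forall>x\<in>V. F x \<in> V \<and> R (F x) = A (R x))"
proof -
  have b0: "0 < b0" using spec by simp
  \<comment> \<open>\<open>a0 \<le> b0\<close> becomes \<open>1 \<le> a * b0\<close>, and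
    \<open>b0 ^ q < a0\<close> becomes \<open>a * b0 ^ q < 1\<close>.\<close>
  define a where "a = 1 / a0"
  have a: "0 < a" "1 \<le> a * b0" "a * b0 ^ q < 1" using spec by (auto simp: a_def field_simps)
  obtain M1 where M1: "\<And>n. dec (M1 * b0 ^ n) (A ^^ n)" using spectral_radius_dec[OF A b0 spec(5)] by blast
  have "Res Ai \<mu>" if m: "a \<le> cmod \<mu>" for \<mu>
  proof (rule Res_inverse[OF dec_linear[OF A] A inv dec_linear[OF Ai]])
    show "\<mu> \<noteq> 0" using m a(1) by auto
    have "0 < cmod \<mu>" using m a(1) by linarith
    then have "cmod (1 / \<mu>) \<le> a0" using m spec(1) by (simp add: norm_divide a_def field_simps)
    then show "Res A (1 / \<mu>)" by (rule spec(6))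
  qed
  then obtain M2 where M2: "\<And>n. dec (M2 * a ^ n) (Ai ^^ n)" using spectral_radius_dec[OF Ai a(1)] by blast
  define M where "M = max 1 (max M1 M2)"
  interpret adapted_gauge Fam A Ai b0 a M
  proof
    show "dec (M * b0 ^ k) (A ^^ k)" for k
      by (rule dec_mono[OF M1]) (use b0 in \<open>simp add: M_def mult_right_mono\<close>)
    show "dec (M * a ^ k) (Ai ^^ k)" for k
      by (rule dec_mono[OF M2]) (use a in \<open>simp add: M_def mult_right_mono\<close>)
  qed (use inv b0 a in \<open>auto simp: M_def\<close>)
  have "\<forall>s. \<exists>K. 1 \<le> s \<and> s \<le> r \<longrightarrow> (\<forall>x\<in>U. MB s K (D_at F x))" using FMB by blast
  then obtain K0 where K0: "\<And>s x. 1 \<le> s \<Longrightarrow> s \<le> r \<Longrightarrow> x \<in> U \<Longrightarrow> MB s (K0 s) (D_at F x)" by metis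
  have K0n: "0 \<le> K0 s" if "1 \<le> s" "s \<le> r" for s using MB_nonneg[OF K0[OF that U]] .
  define KF where "KF = 1 + M * (\<Sum>s=1..r. K0 s)"
  have F': "g'.MB s KF (D_at F x)" if "1 \<le> s" "s \<le> r" "x \<in> U" for s x
  proof (rule g'.MB_mono[OF MB_MB'[OF K0[OF that]]])
    have "K0 s \<le> (\<Sum>s=1..r. K0 s)" by (rule member_le_sum) (use that K0n in auto)
    then have "M * K0 s \<le> M * (\<Sum>s=1..r. K0 s)" using M by (intro mult_left_mono) auto
    then show "M * K0 s \<le> KF" by (simp add: KF_def)
  qed
  have KF: "0 < KF" unfolding KF_def using M K0n by (intro add_pos_nonneg mult_nonneg_nonneg sum_nonneg) auto
  obtain b where b: "b0 < b" "b < 1" "a * b ^ q < 1" using exists_above_with_power_bound[OF b0 spec(3) a(3)] by blast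
  obtain \<epsilon> where \<epsilon>: "0 < \<epsilon>" "ball 0 \<epsilon> \<subseteq> U" using smooth_open[OF F] U by (meson open_contains_ball)
  obtain C where C: "C \<ge> 1" "\<And>u K. gauge Fam' None u K \<Longrightarrow> norm u \<le> C * K" using g'.g_None_bounds by blast
  \<comment> \<open>The three conditions: gauge at most 1, ball inside \<open>U\<close>, and
    variation of the first derivative at most \<open>b - b0\<close>.\<close>
  define \<delta> where "\<delta> = min 1 (min (\<epsilon> / C) ((b - b0) / KF))"
  have d: "0 < \<delta>" "\<delta> \<le> 1" "C * \<delta> \<le> \<epsilon>" "KF * \<delta> \<le> b - b0"
  proof -
    show "0 < \<delta>" "\<delta> \<le> 1" using \<epsilon> C(1) b KF by (auto simp: \<delta>_def)
    have "\<delta> \<le> \<epsilon> / C" "\<delta> \<le> (b - b0) / KF" by (auto simp: \<delta>_def)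
    then show "C * \<delta> \<le> \<epsilon>" "KF * \<delta> \<le> b - b0" using C(1) KF by (auto simp: field_simps)
  qed
  let ?V = "g'.gball \<delta>"
  have VU: "?V \<subseteq> U"
  proof
    fix x assume "x \<in> ?V"
    then obtain \<rho> where \<rho>: "\<rho> < \<delta>" "gauge Fam' None x \<rho>" by (auto simp: g'.gball_def)
    have "norm x \<le> C * \<rho>" by (rule C(2)[OF \<rho>(2)])
    also have "\<dots> < C * \<delta>" using \<rho>(1) C(1) by simp
    finally show "x \<in> U" using d(3) \<epsilon>(2) by (auto simp: subset_iff)
  qed
  have FV: "smooth r ?V F" by (rule smooth_subset[OF F g'.open_gball VU])
  have F1: "g'.MB 1 b (D_at F x)" if x: "x \<in> ?V" for x
  proof -
    obtain \<rho> where \<rho>: "\<rho> < \<delta>" "gauge Fam' None x \<rho>" using x by (auto simp: g'.gball_def)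
    have 1: "g'.MB 1 (KF * \<rho> ^ Suc 0) (\<lambda>vs. D_at F x vs - D_at F 0 vs)"
      by (rule g'.MB_increment[OF FV _ g'.gball_star _ x \<rho>(2)]) (use q VU F' in auto)
    have 2: "g'.MB 1 (KF * \<rho> ^ Suc 0 + b0) (\<lambda>vs. (D_at F x vs - D_at F 0 vs) + A (hd vs))"
      by (rule g'.MB_add[OF 1 g'.dec_MB[OF dec'_A]])
    have 3: "g'.MB 1 (KF * \<rho> ^ Suc 0 + b0) (D_at F x)"
      by (rule g'.MB_cong[OF 2]) (auto simp: length_Suc_conv F0)
    have "KF * \<rho> \<le> KF * \<delta>" using \<rho>(1) KF by simp
    then show ?thesis using d(4) by (intro g'.MB_mono[OF 3]) simp
  qed
  have Fg: "gauge Fam' None (F x) (b * \<rho>)" if x: "x \<in> ?V" "gauge Fam' None x \<rho>" for x \<rho>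
  proof -
    have "g'.MB 0 (b * \<rho> ^ Suc 0) (\<lambda>vs. D_at F x vs - D_at F 0 vs)"
      by (rule g'.MB_increment[OF FV _ g'.gball_star _ x]) (use q F1 in auto)
    from g'.MBD[OF this, of "[]" None] show ?thesis by (simp add: F0)
  qed
  \<comment> \<open>The homological equation is solved with the original norms, to which the
    resolvent condition refers, and the solution is transferred.\<close>
  have hom: "\<exists>H L. multilinear_map j H \<and> g'.MB j L H \<and> (\<forall>vs. length vs = j \<longrightarrow> A (H vs) - H (map A vs) = G vs)"
    if j: "2 \<le> j" "j < q" and G: "multilinear_map j G" "g'.MB j K G" for j G K
  proof -
    interpret w: decay_operators Fam j ..
    obtain H L where "multilinear_map j H" "MB j L H" "\<forall>vs. length vs = j \<longrightarrow> A (H vs) - H (map A vs) = G vs"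
      using w.homological[OF A nonres[OF j] G(1) MB'_MB[OF G(2)]] by blast
    then show ?thesis using MB_MB' by blast
  qed
  have "\<exists>R. smooth r ?V R \<and> R 0 = 0 \<and> (\<forall>h. nth_deriv R [h] 0 = h) \<and>
     (\<forall>s\<le>r. \<exists>K. \<forall>x\<in>?V. g'.MB s K (D_at R x)) \<and> (\<forall>x\<in>?V. F x \<in> ?V \<and> R (F x) = A (R x))"
  proof (rule g'.linearize_gball[OF dec'_Ai inv dec'_A FV d(1,2) Fg _ b(2) F0(2) F1 _ hom q b(3)])
    show "0 < b" using b(1) b0 by simp
    show "g'.MB s KF (D_at F x)" if "2 \<le> s" "s \<le> r" "x \<in> ?V" for s x using F' VU that by auto
  qed
  then obtain R where R: "smooth r ?V R" "R 0 = 0" "\<And>h. nth_deriv R [h] 0 = h"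
    "\<And>s. s \<le> r \<Longrightarrow> \<exists>K. \<forall>x\<in>?V. g'.MB s K (D_at R x)" "\<And>x. x \<in> ?V \<Longrightarrow> F x \<in> ?V \<and> R (F x) = A (R x)" by blast
  have "\<exists>K. \<forall>x\<in>?V. MB s K (D_at R x)" if s: "s \<le> r" for s
  proof -
    obtain K where K: "\<forall>x\<in>?V. g'.MB s K (D_at R x)" using R(4)[OF s] ..
    have "\<forall>x\<in>?V. MB s (K * M ^ s) (D_at R x)" by (intro ballI MB'_MB) (use K in simp)
    then show ?thesis ..
  qed
  then show ?thesis using R(1,2,3,5) g'.open_gball g'.zero_in_gball[OF d(1)] VU
    by (intro exI[of _ ?V] exI[of _ R] conjI allI impI ballI) simp_all
qed

end


text \<open>The library has this instance for metric domains only, and \<open>int\<close> is no instance of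
  \<open>metric_space\<close>.\<close>

instance bcontfun :: (topological_space, complete_space) complete_space
proof
  fix u :: "nat \<Rightarrow> ('a, 'b) bcontfun"
  assume u: "Cauchy u"
  have "uniformly_Cauchy_on UNIV (\<lambda>n. apply_bcontfun (u n))"
  proof (rule uniformly_Cauchy_onI)
    fix e :: real assume "0 < e"
    then obtain M where M: "\<And>m n. m \<ge> M \<Longrightarrow> n \<ge> M \<Longrightarrow> dist (u m) (u n) < e"
      using metric_CauchyD[OF u] by blast
    have "dist (u m x) (u n x) < e" if "m \<ge> M" "n \<ge> M" for m n x
      using dist_bounded[of "u m" x "u n"] M[OF that] by simp
    then show "\<exists>M. \<forall>x\<in>UNIV. \<forall>m\<ge>M. \<forall>n\<ge>M. dist (u m x) (u n x) < e" by blast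
  qed
  then obtain f where "uniform_limit UNIV (\<lambda>n. apply_bcontfun (u n)) f sequentially"
    using Cauchy_uniformly_convergent uniformly_convergent_on_def by blast
  then obtain l where "u \<longlonglongrightarrow> l" by (rule uniform_limit_bcontfunE) simp_all
  then show "convergent u" by (rule convergentI)
qed

instance bcontfun :: (topological_space, banach) banach ..

section \<open>The decay gauge on bounded families\<close>

definition lgauge ::
  "(int ^ 'm \<Rightarrow> real) \<Rightarrow> (int ^ 'm) option \<Rightarrow> ((('m::finite, 'e::real_normed_vector) linf \<Rightarrow> 'e) \<times> real) set" where
  "lgauge \<Gamma> q = range (\<lambda>i. (\<lambda>u. apply_bcontfun u i, case q of None \<Rightarrow> 1 | Some l \<Rightarrow> \<Gamma> (i - l)))"

lemma lgauge_None: "gauge (lgauge \<Gamma>) None u K \<longleftrightarrow> norm u \<le> K"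
proof
  assume "gauge (lgauge \<Gamma>) None u K"
  then have "norm (apply_bcontfun u i) \<le> K * 1" for i unfolding gauge_def lgauge_def by fastforce
  then show "norm u \<le> K" by (intro norm_bound) simp
next
  assume K: "norm u \<le> K"
  then have "norm (apply_bcontfun u i) \<le> K" for i using norm_bounded[of u i] by simp
  moreover have "0 \<le> K" using K norm_ge_zero order_trans by blast
  ultimately show "gauge (lgauge \<Gamma>) None u K" by (auto simp: gauge_def lgauge_def)
qed

lemma lgauge_Some: "gauge (lgauge \<Gamma>) (Some l) u K \<longleftrightarrow> 0 \<le> K \<and> (\<forall>i. norm (apply_bcontfun u i) \<le> K * \<Gamma> (i - l))"
  by (auto simp: gauge_def lgauge_def)

lemma bounded_linear_apply_bcontfun: "bounded_linear (\<lambda>u. apply_bcontfun u i)"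
  by (rule bounded_linear_intro[where K = 1]) (simp_all add: norm_bounded)

lemma apply_bcontfun_of_bounded:
  "bounded (range f) \<Longrightarrow> apply_bcontfun (Bcontfun f) i = f (i :: int ^ 'm::finite)"
  by (simp add: Bcontfun_inverse bcontfun_eq_bounded)

definition single :: "int ^ 'm::finite \<Rightarrow> 'e::real_normed_vector \<Rightarrow> ('m, 'e) linf" where
  "single k v = Bcontfun (\<lambda>i. if i = k then v else 0)"

lemma single_apply: "apply_bcontfun (single k v) i = (if i = k then v else 0)"
proof -
  have "range (\<lambda>i. if i = k then v else 0) \<subseteq> {v, 0}" by auto
  then have "bounded (range (\<lambda>i. if i = k then v else 0))" by (rule finite_imp_bounded[OF finite_subset]) simp
  then show ?thesis unfolding single_def by (simp add: apply_bcontfun_of_bounded)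
qed

lemma norm_single_le: "norm (single k v) \<le> norm v"
  by (rule norm_bound) (simp add: single_apply)

lemma apply_bcontfun_sum: "apply_bcontfun (\<Sum>k\<in>S. f k) i = (\<Sum>k\<in>S. apply_bcontfun (f k) i)"
  by (induction S rule: infinite_finite_induct) auto

locale lattice =
  fixes \<Gamma> :: "int ^ 'm::finite \<Rightarrow> real"
  assumes decay: "decay_function \<Gamma>"
begin

lemma pos: "0 < \<Gamma> k" using decay by (simp add: decay_function_def)

lemma sum_le_1: "finite S \<Longrightarrow> (\<Sum>k\<in>S. \<Gamma> k) \<le> 1"
  using decay finite_sum_le_infsum[of \<Gamma> UNIV S] pos unfolding decay_function_def
  by (meson less_imp_le order_trans subset_UNIV)

lemma convolution_le: "finite S \<Longrightarrow> (\<Sum>k\<in>S. \<Gamma> (i - k) * \<Gamma> (k - l)) \<le> \<Gamma> (i - l)"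
  using decay finite_sum_le_infsum[of "\<lambda>k. \<Gamma> (i - k) * \<Gamma> (k - l)" UNIV S] pos unfolding decay_function_def
  by (meson less_imp_le mult_pos_pos order_trans subset_UNIV)

text \<open>\<open>\<Gamma>\<close> tends to 0 at infinity. Hence a family bounded by a multiple of
  \<open>\<Gamma> (k - l)\<close> is a limit of finitely supported ones in the supremum norm, which
  bounded families in general are not.\<close>

lemma finite_large: "0 < e \<Longrightarrow> finite {k. e \<le> \<Gamma> (k - l)}"
proof (rule ccontr)
  assume e: "0 < e" and inf: "infinite {k. e \<le> \<Gamma> (k - l)}"
  obtain n :: nat where n: "1 / e < real n" using reals_Archimedean2 by blast
  obtain S where S: "S \<subseteq> {k. e \<le> \<Gamma> (k - l)}" "finite S" "card S = n"
    using infinite_arbitrarily_large[OF inf] by blast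
  have "real n * e = (\<Sum>k\<in>S. e)" using S by simp
  also have "\<dots> \<le> (\<Sum>k\<in>S. \<Gamma> (k - l))" using S(1) by (intro sum_mono) auto
  also have "\<dots> = (\<Sum>k\<in>(\<lambda>k. k - l) ` S. \<Gamma> k)" by (subst sum.reindex) (auto simp: inj_on_def)
  also have "\<dots> \<le> 1" using S(2) by (intro sum_le_1) simp
  finally show False using n e by (simp add: field_simps)
qed

sublocale gauged "lgauge \<Gamma> :: (int ^ 'm) option \<Rightarrow> ((('m, 'e::banach) linf \<Rightarrow> 'e) \<times> real) set"
proof (rule gauged.intro, goal_cases)
  case (1 T c q)
  then show ?case by (auto simp: lgauge_def bounded_linear_apply_bcontfun)
next
  case (2 T c q)
  then show ?case using pos by (auto simp: lgauge_def split: option.split)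
next
  case 3
  then show ?case by (intro exI[of _ 1]) (simp add: lgauge_None)
next
  case 4
  then show ?case by (intro exI[of _ 1]) (simp add: lgauge_None)
qed

text \<open>A bound on families supported at one site extends to the weighted gauges, by the
  convolution property of \<open>\<Gamma>\<close>.\<close>

lemma gauge_of_localized:
  fixes T :: "('m, 'e::banach) linf \<Rightarrow> ('m, 'f::banach) linf"
  assumes T: "linear T" "\<And>u. norm (T u) \<le> D * norm u"
    and loc: "\<And>k w i. (\<And>j. j \<noteq> k \<Longrightarrow> apply_bcontfun w j = 0) \<Longrightarrow> norm (apply_bcontfun (T w) i) \<le> K * norm w * \<Gamma> (i - k)"
    and K: "0 \<le> K" and u: "gauge (lgauge \<Gamma>) (Some l) u c"
  shows "gauge (lgauge \<Gamma>) (Some l) (T u) (K * c)"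
  unfolding lgauge_Some
proof (intro conjI allI)
  have c: "0 \<le> c" and uk: "\<And>k. norm (apply_bcontfun u k) \<le> c * \<Gamma> (k - l)" using u by (auto simp: lgauge_Some)
  show "0 \<le> K * c" using K c by simp
  fix i
  show "norm (apply_bcontfun (T u) i) \<le> K * c * \<Gamma> (i - l)"
  proof (rule field_le_epsilon)
    fix e :: real assume e: "0 < e"
    \<comment> \<open>Chosen so that the part of \<open>u\<close> outside the finite set contributes
      at most \<open>e\<close> after applying \<open>T\<close>.\<close>
    define \<epsilon> where "\<epsilon> = e / (\<bar>D\<bar> * c + 1)"
    have pd: "0 < \<bar>D\<bar> * c + 1" using c by (simp add: add_nonneg_pos)
    have eps: "0 < \<epsilon>" using e pd by (simp add: \<epsilon>_def)
    define S where "S = {k. \<epsilon> \<le> \<Gamma> (k - l)}"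
    have S: "finite S" unfolding S_def by (rule finite_large[OF eps])
    define v where "v = u - (\<Sum>k\<in>S. single k (apply_bcontfun u k))"
    have "norm v \<le> c * \<epsilon>"
    proof (rule norm_bound)
      fix k
      have "apply_bcontfun v k = (if k \<in> S then 0 else apply_bcontfun u k)"
        using S by (simp add: v_def apply_bcontfun_sum single_apply)
      moreover have "norm (apply_bcontfun u k) \<le> c * \<epsilon>" if "k \<notin> S"
        by (rule order_trans[OF uk]) (use that c in \<open>simp add: S_def mult_left_mono\<close>)
      ultimately show "norm (apply_bcontfun v k) \<le> c * \<epsilon>" using c eps by simp
    qed
    then have "\<bar>D\<bar> * norm v \<le> \<bar>D\<bar> * (c * \<epsilon>)" by (rule mult_left_mono) simp
    moreover have "norm (T v) \<le> \<bar>D\<bar> * norm v" by (rule order_trans[OF T(2)]) (simp add: mult_right_mono)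
    ultimately have nv: "norm (apply_bcontfun (T v) i) \<le> \<bar>D\<bar> * c * \<epsilon>" using norm_bounded[of "T v" i] by (simp add: mult.assoc)
    have "u = (\<Sum>k\<in>S. single k (apply_bcontfun u k)) + v" by (simp add: v_def)
    then have "T u = (\<Sum>k\<in>S. T (single k (apply_bcontfun u k))) + T v"
      by (metis linear_add[OF T(1)] linear_sum[OF T(1)])
    then have "norm (apply_bcontfun (T u) i) \<le> (\<Sum>k\<in>S. norm (apply_bcontfun (T (single k (apply_bcontfun u k))) i)) + \<bar>D\<bar> * c * \<epsilon>"
      using norm_triangle_mono[OF norm_sum nv] by (simp add: apply_bcontfun_sum)
    also have "(\<Sum>k\<in>S. norm (apply_bcontfun (T (single k (apply_bcontfun u k))) i)) \<le> (\<Sum>k\<in>S. K * c * (\<Gamma> (i - k) * \<Gamma> (k - l)))"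
    proof (rule sum_mono)
      fix k
      have "norm (apply_bcontfun (T (single k (apply_bcontfun u k))) i) \<le> K * norm (single k (apply_bcontfun u k)) * \<Gamma> (i - k)"
        by (rule loc) (simp add: single_apply)
      also have "\<dots> \<le> K * (c * \<Gamma> (k - l)) * \<Gamma> (i - k)"
        using order_trans[OF norm_single_le uk] K pos[of "i - k"] by (intro mult_right_mono mult_left_mono) auto
      finally show "norm (apply_bcontfun (T (single k (apply_bcontfun u k))) i) \<le> K * c * (\<Gamma> (i - k) * \<Gamma> (k - l))" by (simp add: mult_ac)
    qed
    also have "\<dots> = K * c * (\<Sum>k\<in>S. \<Gamma> (i - k) * \<Gamma> (k - l))" by (simp add: sum_distrib_left)
    also have "\<dots> \<le> K * c * \<Gamma> (i - l)" using convolution_le[OF S] K c by (intro mult_left_mono) auto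
    also have "\<bar>D\<bar> * c * \<epsilon> \<le> e"
    proof -
      have "\<bar>D\<bar> * c * \<epsilon> \<le> (\<bar>D\<bar> * c + 1) * \<epsilon>" using eps by (intro mult_right_mono) auto
      then show ?thesis using pd by (simp add: \<epsilon>_def)
    qed
    finally show "norm (apply_bcontfun (T u) i) \<le> K * c * \<Gamma> (i - l) + e" by simp
  qed
qed

text \<open>At its own site the weight is \<open>\<Gamma> 0\<close>, whence the division. This is
  the origin of \<open>min 1 (\<Gamma> 0)\<close> in \<open>mult_decay_norm_of_MB\<close>.\<close>

lemma localized_gauge:
  assumes "\<And>j. j \<noteq> k \<Longrightarrow> apply_bcontfun w j = 0" "norm w \<le> c"
  shows "gauge (lgauge \<Gamma>) (Some k) w (c / \<Gamma> 0)"
  unfolding lgauge_Some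
proof (intro conjI allI)
  have c: "0 \<le> c" using assms(2) norm_ge_zero order_trans by blast
  then show "0 \<le> c / \<Gamma> 0" using pos[of 0] by simp
  show "norm (apply_bcontfun w i) \<le> c / \<Gamma> 0 * \<Gamma> (i - k)" for i
  proof (cases "i = k")
    case True
    then show ?thesis using norm_bounded[of w i] assms(2) pos[of 0] by simp
  next
    case False
    then show ?thesis using assms(1) c pos[of 0] pos[of "i - k"] by simp
  qed
qed

end


section \<open>Comparison with the norms of the statement\<close>

text \<open>Of a norm of the statement only its comparison with the standard norm is kept. The
  locale serves for the real norm and, in the description of the spectrum, for the complex
  one.\<close>

locale lattice_norm = lattice \<Gamma> for \<Gamma> :: "int ^ 'm::finite \<Rightarrow> real" +
  fixes N :: "'e::euclidean_space \<Rightarrow> real" and c C :: real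
  assumes c: "0 < c" and C: "0 < C" and N_lower: "c * norm v \<le> N v" and N_upper: "N v \<le> C * norm v"
begin

lemma linf_bounds:
  fixes x :: "('m, 'e) linf"
  shows "c * norm x \<le> linf_norm N x" "linf_norm N x \<le> C * norm x" "N (apply_bcontfun x i) \<le> linf_norm N x"
proof -
  have le: "N (apply_bcontfun x i) \<le> C * norm x" for i
    using order_trans[OF N_upper mult_left_mono[OF norm_bounded less_imp_le[OF C]]] .
  show "linf_norm N x \<le> C * norm x" unfolding linf_norm_def by (intro cSUP_least le) simp
  have "bdd_above (range (\<lambda>i. N (apply_bcontfun x i)))" using le by (intro bdd_aboveI2)
  then show n: "N (apply_bcontfun x i) \<le> linf_norm N x" for i
    unfolding linf_norm_def by (intro cSUP_upper) auto
  have "norm x \<le> linf_norm N x / c"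
    using order_trans[OF N_lower n] c by (intro norm_bound) (simp add: field_simps)
  then show "c * norm x \<le> linf_norm N x" using c by (simp add: field_simps)
qed

lemma linf_le_1: "linf_norm N (x :: ('m, 'e) linf) \<le> 1 \<Longrightarrow> norm x \<le> 1 / c"
  using linf_bounds(1)[of x] c by (simp add: field_simps)

lemma prod_list_norm_le:
  fixes vs :: "('m, 'e) linf list"
  assumes "\<forall>v\<in>set vs. linf_norm N v \<le> 1"
  shows "prod_list (map norm vs) \<le> (1 / c) ^ length vs"
  using assms
proof (induction vs)
  case (Cons v vs)
  then have "norm v * prod_list (map norm vs) \<le> (1 / c) * (1 / c) ^ length vs"
    using linf_le_1[of v] c prod_list_norm_nonneg[of vs] by (intro mult_mono) auto
  then show ?case by simp
qed simp

lemma mult_norm_le: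
  assumes "\<And>vs. length vs = j \<Longrightarrow> norm (B vs :: ('m, 'e) linf) \<le> e * prod_list (map norm vs)" "0 \<le> e"
  shows "mult_norm N j B \<le> ennreal (C * (e * (1 / c) ^ j))"
  unfolding mult_norm_def
proof (rule SUP_least)
  fix vs :: "('m, 'e) linf list"
  assume "vs \<in> {vs. length vs = j \<and> (\<forall>v\<in>set vs. linf_norm N v \<le> 1)}"
  then have vs: "length vs = j" "\<forall>v\<in>set vs. linf_norm N v \<le> 1" by auto
  have "linf_norm N (B vs) \<le> C * norm (B vs)" by (rule linf_bounds(2))
  also have "\<dots> \<le> C * (e * prod_list (map norm vs))" using assms(1)[OF vs(1)] C by (intro mult_left_mono) auto
  also have "\<dots> \<le> C * (e * (1 / c) ^ j)" using prod_list_norm_le[OF vs(2)] vs(1) assms(2) C by (intro mult_left_mono) auto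
  finally show "ennreal (linf_norm N (B vs)) \<le> ennreal (C * (e * (1 / c) ^ j))" by (rule ennreal_leI)
qed

text \<open>Scaling to norm at most 1 in the sense of the statement. Division by 0 yields 0, so the
  zero vector is covered.\<close>

definition nrml :: "('m, 'e) linf \<Rightarrow> ('m, 'e) linf" where
  "nrml v = (1 / (C * norm v)) *\<^sub>R v"

lemma nrml_apply: "apply_bcontfun v k = 0 \<Longrightarrow> apply_bcontfun (nrml v) k = 0"
  by (simp add: nrml_def)

lemma nrml_le: "linf_norm N (nrml v) \<le> 1"
proof (cases "v = 0")
  case True
  then show ?thesis using linf_bounds(2)[of "nrml v"] by (simp add: nrml_def)
next
  case False
  then have "norm (nrml v) = 1 / C" using C by (simp add: nrml_def)
  then show ?thesis using linf_bounds(2)[of "nrml v"] C by simp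
qed

text \<open>\<open>s\<close> is abstract because the homogeneity argument is used for the norm of a
  value and for the norm of its entry at one site.\<close>

lemma multilinear_nrml:
  fixes B :: "('m, 'e) linf list \<Rightarrow> 'f::real_vector"
  assumes B: "multilinear_map j B" "length vs = j"
    and b: "0 \<notin> set vs \<Longrightarrow> s (B (map nrml vs)) \<le> b" and s: "\<And>r x. 0 \<le> r \<Longrightarrow> s (r *\<^sub>R x) = r * s x" and b0: "0 \<le> b" "s 0 = (0::real)"
  shows "s (B vs) \<le> b * C ^ j * prod_list (map norm vs)"
proof (cases "0 \<in> set vs")
  case True
  then show ?thesis using multilinear_map_zero[OF B True] b0 C prod_list_norm_nonneg[of vs] by simp
next
  case False
  have p: "prod_list (map (\<lambda>v. 1 / (C * norm v)) vs) * (C ^ j * prod_list (map norm vs)) = 1"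
    using False unfolding B(2)[symmetric]
  proof (induction vs)
    case (Cons v vs)
    have "prod_list (map (\<lambda>v. 1 / (C * norm v)) (v # vs)) * (C ^ length (v # vs) * prod_list (map norm (v # vs)))
       = (1 / (C * norm v) * (C * norm v)) * (prod_list (map (\<lambda>v. 1 / (C * norm v)) vs) * (C ^ length vs * prod_list (map norm vs)))"
      by (simp add: mult_ac)
    also have "\<dots> = 1" using Cons C by simp
    finally show ?case .
  qed simp
  have pp: "0 \<le> C ^ j * prod_list (map norm vs)" using C prod_list_norm_nonneg[of vs] by simp
  have "B (map nrml vs) = prod_list (map (\<lambda>v. 1 / (C * norm v)) vs) *\<^sub>R B vs"
    unfolding nrml_def by (rule multilinear_map_scale[OF B])
  then have "(C ^ j * prod_list (map norm vs)) *\<^sub>R B (map nrml vs) = B vs"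
    using p by (simp add: mult.commute)
  then have "s (B vs) = (C ^ j * prod_list (map norm vs)) * s (B (map nrml vs))" using s[OF pp] by metis
  also have "\<dots> \<le> (C ^ j * prod_list (map norm vs)) * b" using b[OF False] pp by (rule mult_left_mono)
  finally show ?thesis by (simp add: mult_ac)
qed

lemma mult_norm_le_imp:
  fixes B :: "('m, 'e) linf list \<Rightarrow> ('m, 'e) linf"
  assumes B: "multilinear_map j B" "mult_norm N j B \<le> ennreal e" "0 \<le> e" and vs: "length vs = j"
  shows "norm (B vs) \<le> e / c * C ^ j * prod_list (map norm vs)"
proof (rule multilinear_nrml[OF B(1) vs])
  have "ennreal (linf_norm N (B (map nrml vs))) \<le> mult_norm N j B"
    unfolding mult_norm_def using vs nrml_le by (intro SUP_upper) auto
  then have "ennreal (linf_norm N (B (map nrml vs))) \<le> ennreal e" using B(2) by (rule order_trans)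
  then have "linf_norm N (B (map nrml vs)) \<le> e" using B(3) by simp
  then show "norm (B (map nrml vs)) \<le> e / c" using linf_bounds(1)[of "B (map nrml vs)"] c by (simp add: field_simps)
qed (use B(3) c in auto)

text \<open>This direction rests on the convolution inequality. With all but the marked argument
  frozen, the form is a linear map bounded on families at one site, and
  \<open>gauge_of_localized\<close> extends the estimate to arbitrary arguments measured with
  weights.\<close>

lemma MB_of_mult_decay_norm:
  fixes B :: "('m, 'e) linf list \<Rightarrow> ('m, 'e) linf"
  assumes B: "multilinear_map j B" and K: "mult_decay_norm N \<Gamma> j B \<le> ennreal K" "0 \<le> K"
  shows "MB j (K / c * C ^ j) B"
proof (rule MBI)
  let ?K = "K / c * C ^ j"
  show K0: "0 \<le> ?K" using K(2) c C by simp
  have n1: "norm (B vs) \<le> ?K * prod_list (map norm vs)" if "length vs = j" for vs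
    using mult_norm_le_imp[OF B _ K(2) that] K(1) by (simp add: mult_decay_norm_def)
  have n2: "norm (apply_bcontfun (B vs) i) \<le> (K / c * \<Gamma> (i - l)) * C ^ j * prod_list (map norm vs)"
    if vs: "length vs = j" "p < j" "\<And>k. k \<noteq> l \<Longrightarrow> apply_bcontfun (vs ! p) k = 0" for vs p l i
  proof (rule multilinear_nrml[OF B vs(1), where s = "\<lambda>x. norm (apply_bcontfun x i)"])
    let ?ws = "map nrml vs"
    let ?vs = "take p ?ws @ drop (Suc p) ?ws"
    have eq: "take p ?vs @ (?ws ! p) # drop p ?vs = ?ws" using vs(1,2) id_take_nth_drop[of p ?ws] by simp
    have mem: "(?vs, ?ws ! p) \<in> {(vs, w). length vs = j - 1 \<and> (\<forall>v\<in>set vs. linf_norm N v \<le> 1) \<and>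
                      linf_norm N w \<le> 1 \<and> (\<forall>j. j \<noteq> l \<longrightarrow> apply_bcontfun w j = 0)}"
      using vs nrml_le by (auto simp: zero_bcontfun_def nrml_apply dest!: in_set_takeD in_set_dropD)
    have "ennreal (N (apply_bcontfun (B ?ws) i) / \<Gamma> (i - l)) \<le> mult_decay_coeff N \<Gamma> j B"
      unfolding mult_decay_coeff_def
      by (rule SUP_upper2[of p], use vs in simp, rule SUP_upper2[of i], simp, rule SUP_upper2[of l], simp,
          rule SUP_upper2[OF mem]) (simp only: eq prod.case order_refl)
    also have "\<dots> \<le> ennreal K" using K(1) by (simp add: mult_decay_norm_def)
    finally have "N (apply_bcontfun (B ?ws) i) / \<Gamma> (i - l) \<le> K" using K(2) by simp
    then have "N (apply_bcontfun (B ?ws) i) \<le> K * \<Gamma> (i - l)" using pos[of "i - l"] by (simp add: field_simps)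
    then show "norm (apply_bcontfun (B ?ws) i) \<le> K / c * \<Gamma> (i - l)"
      using order_trans[OF N_lower] c by (simp add: field_simps)
  qed (use K(2) c pos[of "i - l"] in auto)
  fix ts :: "(('m, 'e) linf \<times> real \<times> (int ^ 'm) option) list" and q
  assume ts: "length ts = j" "good ts" "adm q (map tm ts)"
  let ?p = "prod_list (map tk ts)"
  have pk: "(\<forall>t\<in>set ts. norm (tv t) \<le> tk t) \<Longrightarrow> prod_list (map norm (map tv ts)) \<le> prod_list (map tk ts)" for ts :: "(('m, 'e) linf \<times> real \<times> (int ^ 'm) option) list"
  proof (induction ts)
    case (Cons t ts)
    then have t: "norm (tv t) \<le> tk t" "prod_list (map norm (map tv ts)) \<le> prod_list (map tk ts)" by simp_all
    have "norm (tv t) * prod_list (map norm (map tv ts)) \<le> tk t * prod_list (map tk ts)"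
      by (rule mult_mono[OF t order_trans[OF norm_ge_zero t(1)] prod_list_norm_nonneg])
    then show ?case by simp
  qed simp
  show "g q (B (map tv ts)) (?K * ?p)"
  proof (cases q)
    case None
    then have "\<forall>t\<in>set ts. norm (tv t) \<le> tk t"
      using ts(2,3) by (fastforce simp: good_def adm_None lgauge_None)
    then have "?K * prod_list (map norm (map tv ts)) \<le> ?K * ?p" using pk K0 by (intro mult_left_mono) auto
    then show ?thesis using n1[of "map tv ts"] ts(1) None by (simp add: lgauge_None)
  next
    case (Some l)
    have "\<exists>xs t ys. ts = xs @ t # ys \<and> tm t = Some l \<and> (\<forall>s\<in>set xs \<union> set ys. tm s = None)"
      using ts(3) unfolding Some
    proof (induction ts)
      case (Cons s ts)
      show ?case
      proof (cases "tm s")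
        case None
        then obtain xs t ys where "ts = xs @ t # ys \<and> tm t = Some l \<and> (\<forall>s\<in>set xs \<union> set ys. tm s = None)"
          using Cons by auto
        then show ?thesis using None by (intro exI[of _ "s # xs"] exI[of _ t] exI[of _ ys]) auto
      next
        case (Some a)
        then show ?thesis using Cons.prems by (intro exI[of _ "[]"] exI[of _ s] exI[of _ ts]) (auto simp: adm_None)
      qed
    qed simp
    then obtain xs t ys where t: "ts = xs @ t # ys" "tm t = Some l" "\<And>s. s \<in> set xs \<union> set ys \<Longrightarrow> tm s = None" by blast
    have gt: "g (Some l) (tv t) (tk t)" using ts(2) t by (metis good_def in_set_conv_decomp prod.collapse)
    have gs: "\<forall>s\<in>set (xs @ ys). norm (tv s) \<le> tk s"
    proof
      fix s assume s: "s \<in> set (xs @ ys)"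
      then have "g (tm s) (tv s) (tk s)" using ts(2) unfolding good_def t(1) by (metis Un_iff list.set_intros(2) prod.collapse set_append)
      then show "norm (tv s) \<le> tk s" using t(3)[of s] s by (simp add: lgauge_None)
    qed
    define P where "P = prod_list (map norm (map tv (xs @ ys)))"
    have P: "0 \<le> P" unfolding P_def by (rule prod_list_norm_nonneg)
    let ?T = "\<lambda>w. B (map tv xs @ w # map tv ys)"
    let ?lx = "length xs"
    have lin: "linear ?T"
    proof -
      have "linear (\<lambda>w. B ((map tv xs @ 0 # map tv ys)[?lx := w]))"
        using B ts(1) t(1) unfolding multilinear_map_def by (elim allE[of _ "map tv xs @ 0 # map tv ys"] allE[of _ ?lx]) simp
      then show ?thesis by (simp add: list_update_append)
    qed
    have "gauge (lgauge \<Gamma>) (Some l) (?T (tv t)) ((?K * P) * tk t)"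
    proof (rule gauge_of_localized[OF lin _ _ _ gt])
      show "norm (?T u) \<le> (?K * P) * norm u" for u
        using n1[of "map tv xs @ u # map tv ys"] ts(1) t(1) by (simp add: P_def mult_ac)
      show "norm (apply_bcontfun (?T w) i) \<le> ?K * P * norm w * \<Gamma> (i - k)"
        if w: "\<And>j. j \<noteq> k \<Longrightarrow> apply_bcontfun w j = 0" for k w i
        using n2[of "map tv xs @ w # map tv ys" ?lx k i] w ts(1) t(1) by (simp add: P_def mult_ac nth_append)
      show "0 \<le> ?K * P" by (rule mult_nonneg_nonneg[OF K0 P])
    qed
    moreover have "(?K * P) * tk t \<le> ?K * ?p"
    proof -
      have "P \<le> prod_list (map tk (xs @ ys))" unfolding P_def by (rule pk[OF gs])
      then have "?K * (P * tk t) \<le> ?K * (prod_list (map tk (xs @ ys)) * tk t)"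
        using K0 g_nonneg[OF gt] by (intro mult_left_mono mult_right_mono) auto
      then show ?thesis by (simp add: t(1) mult_ac)
    qed
    ultimately show ?thesis using g_mono t(1) Some by (simp add: t(1)) blast
  qed
qed

text \<open>The converse is direct: an argument supported at \<open>l\<close> has a finite bound in
  the norm with index \<open>Some l\<close>, and with all other arguments at index
  \<open>None\<close> the \<open>MB\<close> bound is the decay condition.\<close>

lemma mult_decay_norm_of_MB:
  fixes B :: "('m, 'e) linf list \<Rightarrow> ('m, 'e) linf"
  assumes B: "MB j K B" and j: "1 \<le> j"
  shows "mult_decay_norm N \<Gamma> j B \<le> ennreal (C * (K * (1 / c) ^ j / min 1 (\<Gamma> 0)))"
proof -
  let ?m = "min 1 (\<Gamma> 0)"
  have m: "0 < ?m" "?m \<le> 1" using pos[of 0] by auto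
  have K: "0 \<le> K" by (rule MB_nonneg[OF B])
  have K1: "K * (1 / c) ^ j \<le> K * (1 / c) ^ j / ?m"
    using K c m by (simp add: field_simps mult_left_le)
  have n: "norm (B vs) \<le> K * prod_list (map norm vs)" if "length vs = j" for vs
    using MBD[OF B, of "map (\<lambda>v. (v, norm v, None)) vs" None] that
    by (fastforce simp: good_def lgauge_None adm_None o_def)
  have "mult_norm N j B \<le> ennreal (C * (K * (1 / c) ^ j))" by (rule mult_norm_le[OF n K])
  also have "\<dots> \<le> ennreal (C * (K * (1 / c) ^ j / ?m))" using K1 C by (intro ennreal_leI mult_left_mono) auto
  finally have 1: "mult_norm N j B \<le> ennreal (C * (K * (1 / c) ^ j / ?m))" .
  have 2: "mult_decay_coeff N \<Gamma> j B \<le> ennreal (C * (K * (1 / c) ^ j / ?m))"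
    unfolding mult_decay_coeff_def
  proof (intro SUP_least, goal_cases)
    case (1 p i l x)
    then obtain vs w where x: "x = (vs, w)" and p: "p \<in> {..<j}" and vs: "length vs = j - 1" "\<forall>v\<in>set vs. linf_norm N v \<le> 1"
      and w: "linf_norm N w \<le> 1" "\<forall>j. j \<noteq> l \<longrightarrow> apply_bcontfun w j = 0" by auto
    let ?ts = "map (\<lambda>v. (v, 1 / c, None)) (take p vs) @ (w, (1 / c) / \<Gamma> 0, Some l) # map (\<lambda>v. (v, 1 / c, None)) (drop p vs)"
    have "good ?ts"
    proof -
      have "g (Some l) w ((1 / c) / \<Gamma> 0)" using w linf_le_1 by (intro localized_gauge) auto
      then show ?thesis using vs(2) linf_le_1 by (auto simp: good_def lgauge_None dest!: in_set_takeD in_set_dropD)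
    qed
    moreover have "adm (Some l) (map tm ?ts)"
    proof -
      have "adm (Some l) (map (\<lambda>_. None) xs @ Some l # map (\<lambda>_. None) ys)" for xs ys :: "('m, 'e) linf list"
        by (induction xs) (auto simp: adm_None)
      then show ?thesis by (simp add: o_def)
    qed
    moreover have "length ?ts = j" using p vs(1) by auto
    moreover have "map tv ?ts = take p vs @ w # drop p vs" by (simp add: o_def)
    moreover have "prod_list (map tk ?ts) = (1 / c) ^ j / \<Gamma> 0"
    proof -
      have "prod_list (map tk ?ts) = (1 / c) ^ p * ((1 / c) / \<Gamma> 0) * (1 / c) ^ (j - 1 - p)"
        using p vs(1) by (simp add: o_def map_replicate_const prod_list_replicate min_absorb2)
      also have "\<dots> = (1 / c) ^ (p + 1 + (j - 1 - p)) / \<Gamma> 0" by (simp add: power_add)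
      also have "p + 1 + (j - 1 - p) = j" using p by auto
      finally show ?thesis .
    qed
    ultimately have "g (Some l) (B (take p vs @ w # drop p vs)) (K * ((1 / c) ^ j / \<Gamma> 0))"
      using MBD[OF B, of ?ts "Some l"] by simp
    then have "norm (apply_bcontfun (B (take p vs @ w # drop p vs)) i) \<le> K * ((1 / c) ^ j / \<Gamma> 0) * \<Gamma> (i - l)"
      by (simp add: lgauge_Some)
    also have "\<dots> \<le> (K * (1 / c) ^ j / ?m) * \<Gamma> (i - l)"
    proof -
      have "K * (1 / c) ^ j / \<Gamma> 0 \<le> K * (1 / c) ^ j / ?m" using K c m pos[of 0] by (intro divide_left_mono) auto
      then show ?thesis using mult_right_mono[OF _ less_imp_le[OF pos[of "i - l"]]] by fastforce
    qed
    finally have "N (apply_bcontfun (B (take p vs @ w # drop p vs)) i) \<le> C * ((K * (1 / c) ^ j / ?m) * \<Gamma> (i - l))"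
      by (rule order_trans[OF N_upper mult_left_mono[OF _ less_imp_le[OF C]]])
    then have "N (apply_bcontfun (B (take p vs @ w # drop p vs)) i) / \<Gamma> (i - l) \<le> C * (K * (1 / c) ^ j / ?m)"
      using pos[of "i - l"] by (simp add: pos_divide_le_eq mult.assoc)
    then show ?case unfolding x prod.case by (rule ennreal_leI)
  qed
  from 1 2 show ?thesis by (simp add: mult_decay_norm_def)
qed

lemma C_class_of_smooth:
  fixes F :: "('m, 'e) linf \<Rightarrow> ('m, 'e) linf"
  assumes F: "smooth r V F"
  shows "C_class N r V F"
  unfolding C_class_def
proof (intro conjI ballI allI impI)
  fix x j assume x: "x \<in> V" and j: "j \<le> r"
  obtain d where d: "mbounded j (D_at F x) d" using smooth_bounded[OF F x j] by blast
  have "mult_norm N j (D_at F x) \<le> ennreal (C * (d * (1 / c) ^ j))"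
    using d by (intro mult_norm_le) (auto simp: mbounded_def)
  then have "mult_norm N j (D_at F x) < \<infinity>" by (simp add: le_less_trans)
  then show "D_at F x \<in> bounded_multilinear N j" using smooth_multilinear[OF F x j] by (simp add: bounded_multilinear_def)
next
  fix x j and \<epsilon> :: real assume x: "x \<in> V" and j: "j < r" and e: "0 < \<epsilon>"
  define e' where "e' = \<epsilon> * c * c ^ j / C"
  have e': "0 < e'" using e c C by (simp add: e'_def)
  obtain d where d: "0 < d" "\<And>y zs. dist y x < d \<Longrightarrow> length zs = j \<Longrightarrow>
      norm (D_at F y zs - D_at F x zs - D_at F x ((y - x) # zs)) \<le> e' * norm (y - x) * prod_list (map norm zs)"
    using smooth_famdiff[OF F x j] e' unfolding famdiff_def eventually_nhds_metric by blast
  show "\<exists>\<delta>>0. \<forall>y\<in>V. linf_norm N (y - x) < \<delta> \<longrightarrow>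
        mult_norm N j (\<lambda>vs. D_at F y vs - D_at F x vs - D_at F x ((y - x) # vs)) \<le> ennreal (\<epsilon> * linf_norm N (y - x))"
  proof (intro exI[of _ "c * d"] conjI ballI impI)
    show "0 < c * d" using c d(1) by simp
    fix y assume "linf_norm N (y - x) < c * d"
    then have "c * norm (y - x) < c * d" using linf_bounds(1)[of "y - x"] by simp
    then have y: "dist y x < d" using c by (simp add: dist_norm)
    have "mult_norm N j (\<lambda>vs. D_at F y vs - D_at F x vs - D_at F x ((y - x) # vs)) \<le> ennreal (C * (e' * norm (y - x) * (1 / c) ^ j))"
      using d(2)[OF y] e' by (intro mult_norm_le) auto
    also have "C * (e' * norm (y - x) * (1 / c) ^ j) = \<epsilon> * (c * norm (y - x))"
      using c C by (simp add: e'_def power_divide)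
    also have "ennreal \<dots> \<le> ennreal (\<epsilon> * linf_norm N (y - x))"
      using e linf_bounds(1)[of "y - x"] by (intro ennreal_leI mult_left_mono) auto
    finally show "mult_norm N j (\<lambda>vs. D_at F y vs - D_at F x vs - D_at F x ((y - x) # vs)) \<le> ennreal (\<epsilon> * linf_norm N (y - x))" .
  qed
next
  fix x and \<epsilon> :: real assume x: "x \<in> V" and e: "0 < \<epsilon>"
  define e' where "e' = \<epsilon> * c ^ r / C"
  have e': "0 < e'" using e c C by (simp add: e'_def)
  obtain d where d: "0 < d" "\<And>y zs. dist y x < d \<Longrightarrow> length zs = r \<Longrightarrow> norm (D_at F y zs - D_at F x zs) \<le> e' * prod_list (map norm zs)"
    using smooth_eventually[OF F x order_refl e'] unfolding eventually_nhds_metric by blast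
  show "\<exists>\<delta>>0. \<forall>y\<in>V. linf_norm N (y - x) < \<delta> \<longrightarrow> mult_norm N r (\<lambda>vs. D_at F y vs - D_at F x vs) \<le> ennreal \<epsilon>"
  proof (intro exI[of _ "c * d"] conjI ballI impI)
    show "0 < c * d" using c d(1) by simp
    fix y assume "linf_norm N (y - x) < c * d"
    then have "c * norm (y - x) < c * d" using linf_bounds(1)[of "y - x"] by simp
    then have y: "dist y x < d" using c by (simp add: dist_norm)
    have "mult_norm N r (\<lambda>vs. D_at F y vs - D_at F x vs) \<le> ennreal (C * (e' * (1 / c) ^ r))"
      using d(2)[OF y] e' by (intro mult_norm_le) auto
    also have "C * (e' * (1 / c) ^ r) = \<epsilon>" using c C by (simp add: e'_def power_divide)
    finally show "mult_norm N r (\<lambda>vs. D_at F y vs - D_at F x vs) \<le> ennreal \<epsilon>" .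
  qed
qed

lemma smooth_of_C_class:
  fixes F :: "('m, 'e) linf \<Rightarrow> ('m, 'e) linf"
  assumes F: "C_class N r V F" and V: "open V"
  shows "smooth r V F"
proof -
  have ml: "multilinear_map j (D_at F x)" and mn: "mult_norm N j (D_at F x) < \<infinity>" if "x \<in> V" "j \<le> r" for x j
    using F[unfolded C_class_def, THEN conjunct1, rule_format, OF that] by (simp_all add: bounded_multilinear_def)
  have mb: "\<exists>d. mbounded j (D_at F x) d" if x: "x \<in> V" "j \<le> r" for x j
  proof -
    define K where "K = enn2real (mult_norm N j (D_at F x))"
    have "mult_norm N j (D_at F x) \<le> ennreal K" "0 \<le> K" using mn[OF x] by (simp_all add: K_def)
    then have "mbounded j (D_at F x) (K / c * C ^ j)"
      using mult_norm_le_imp[OF ml[OF x]] c C unfolding mbounded_def by simp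
    then show ?thesis by blast
  qed
  have ml2: "multilinear_map j (\<lambda>vs. D_at F y vs - D_at F x vs - D_at F x ((y - x) # vs))" if "x \<in> V" "y \<in> V" "j < r" for x y j
    using that by (intro multilinear_diff ml multilinear_tail) auto
  have fam: "\<forall>\<^sub>F y in nhds x. y \<in> V \<and> (\<forall>zs. length zs = j \<longrightarrow>
       norm (D_at F y zs - D_at F x zs - D_at F x ((y - x) # zs)) \<le> e * norm (y - x) * prod_list (map norm zs))"
    if x: "x \<in> V" and j: "j < r" and e: "e > 0" for x j e
  proof -
    \<comment> \<open>One \<open>C\<close> pays for replacing \<open>linf_norm N (y - x)\<close> by
      the standard norm; \<open>C ^ j\<close> and \<open>c\<close> pay for the conversion of the
      multilinear norm.\<close>
    define e' where "e' = e * c / (C * C ^ j)"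
    have e': "0 < e'" using e c C by (simp add: e'_def)
    obtain d where d: "0 < d" "\<And>y. y \<in> V \<Longrightarrow> linf_norm N (y - x) < d \<Longrightarrow>
        mult_norm N j (\<lambda>vs. D_at F y vs - D_at F x vs - D_at F x ((y - x) # vs)) \<le> ennreal (e' * linf_norm N (y - x))"
      using F[unfolded C_class_def, THEN conjunct2, THEN conjunct1, rule_format, OF x j e'] by blast
    have "\<forall>\<^sub>F y in nhds x. dist y x < d / C" unfolding eventually_nhds_metric using d(1) C by (intro exI[of _ "d / C"]) auto
    then show ?thesis using eventually_nhds_in_open[OF V x]
    proof eventually_elim
      case (elim y)
      have l: "linf_norm N (y - x) < d" using linf_bounds(2)[of "y - x"] elim(1) C by (simp add: dist_norm field_simps)
      have "norm (D_at F y zs - D_at F x zs - D_at F x ((y - x) # zs)) \<le> e * norm (y - x) * prod_list (map norm zs)" if zs: "length zs = j" for zs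
      proof -
        have l0: "0 \<le> linf_norm N (y - x)" using linf_bounds(1)[of "y - x"] c by (meson mult_nonneg_nonneg less_imp_le norm_ge_zero order_trans)
        have "norm (D_at F y zs - D_at F x zs - D_at F x ((y - x) # zs)) \<le> e' * linf_norm N (y - x) / c * C ^ j * prod_list (map norm zs)"
          by (rule mult_norm_le_imp[OF ml2[OF x elim(2) j] d(2)[OF elim(2) l] _ zs]) (use e' l0 in simp)
        also have "\<dots> \<le> e' * (C * norm (y - x)) / c * C ^ j * prod_list (map norm zs)"
          using linf_bounds(2)[of "y - x"] e' c C prod_list_norm_nonneg
          by (intro mult_right_mono divide_right_mono mult_left_mono) auto
        also have "\<dots> = e * norm (y - x) * prod_list (map norm zs)" using c C by (simp add: e'_def field_simps)
        finally show ?thesis .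
      qed
      then show ?case using elim(2) by blast
    qed
  qed
  have "nth_deriv F vs differentiable (at x)" if x: "x \<in> V" and vs: "length vs < r" for x vs
  proof -
    have mlS: "multilinear_map (Suc (length vs)) (D_at F x)" using ml[OF x] vs by simp
    obtain d where d: "mbounded (Suc (length vs)) (D_at F x) d" using mb[OF x, of "Suc (length vs)"] vs by auto
    have lin: "linear (\<lambda>h. D_at F x (h # vs))" by (rule multilinear_head[OF mlS refl])
    have bl: "bounded_linear (\<lambda>h. D_at F x (h # vs))"
    proof (rule bounded_linear_intro[where K = "d * prod_list (map norm vs)"])
      show "norm (D_at F x (h # vs)) \<le> norm h * (d * prod_list (map norm vs))" for h
        using mboundedD[OF d, of "h # vs"] by (simp add: mult_ac)
    qed (use linear_add[OF lin] linear_scale[OF lin] in simp_all)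
    have "\<exists>\<delta>>0. \<forall>y. norm (y - x) < \<delta> \<longrightarrow> norm (nth_deriv F vs y - nth_deriv F vs x - D_at F x ((y - x) # vs)) \<le> e * norm (y - x)"
      if e: "e > 0" for e
    proof -
      define e' where "e' = e / (prod_list (map norm vs) + 1)"
      have p: "0 \<le> prod_list (map norm vs)" by (rule prod_list_norm_nonneg)
      have e': "0 < e'" "e' * prod_list (map norm vs) \<le> e" using e p by (auto simp: e'_def field_simps)
      obtain \<delta> where \<delta>: "0 < \<delta>" "\<And>y. dist y x < \<delta> \<Longrightarrow> norm (D_at F y vs - D_at F x vs - D_at F x ((y - x) # vs)) \<le> e' * norm (y - x) * prod_list (map norm vs)"
        using fam[OF x vs e'(1)] unfolding eventually_nhds_metric by blast
      have "norm (nth_deriv F vs y - nth_deriv F vs x - D_at F x ((y - x) # vs)) \<le> e * norm (y - x)" if "norm (y - x) < \<delta>" for y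
      proof -
        have "e' * norm (y - x) * prod_list (map norm vs) = (e' * prod_list (map norm vs)) * norm (y - x)" by simp
        also have "\<dots> \<le> e * norm (y - x)" using e'(2) by (intro mult_right_mono) auto
        finally show ?thesis using \<delta>(2)[of y] that by (simp add: dist_norm)
      qed
      then show ?thesis using \<delta>(1) by blast
    qed
    then have "(nth_deriv F vs has_derivative (\<lambda>h. D_at F x (h # vs))) (at x)"
      unfolding has_derivative_at_alt using bl by blast
    then show ?thesis by (auto simp: differentiable_def)
  qed
  moreover have "eqc j (D_at F) x" if x: "x \<in> V" and j: "j \<le> r" for x j
  proof (rule eqcI_eventually)
    fix e :: real assume e: "0 < e"
    show "\<forall>\<^sub>F y in nhds x. \<forall>vs. length vs = j \<longrightarrow> norm (D_at F y vs - D_at F x vs) \<le> e * prod_list (map norm vs)"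
    proof (cases "j = r")
      case True
      define e' where "e' = e * c / C ^ r"
      have e': "0 < e'" using e c C by (simp add: e'_def)
      obtain d where d: "0 < d" "\<And>y. y \<in> V \<Longrightarrow> linf_norm N (y - x) < d \<Longrightarrow> mult_norm N r (\<lambda>vs. D_at F y vs - D_at F x vs) \<le> ennreal e'"
        using F[unfolded C_class_def, THEN conjunct2, THEN conjunct2, rule_format, OF x e'] by blast
      have "\<forall>\<^sub>F y in nhds x. dist y x < d / C" unfolding eventually_nhds_metric using d(1) C by (intro exI[of _ "d / C"]) auto
      then show ?thesis using eventually_nhds_in_open[OF V x]
      proof eventually_elim
        case (elim y)
        have l: "linf_norm N (y - x) < d" using linf_bounds(2)[of "y - x"] elim(1) C by (simp add: dist_norm field_simps)
        have m: "multilinear_map r (\<lambda>vs. D_at F y vs - D_at F x vs)" using x elim(2) by (intro multilinear_diff ml) auto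
        show ?case using mult_norm_le_imp[OF m d(2)[OF elim(2) l]] e' c C True by (simp add: e'_def)
      qed
    next
      case False
      \<comment> \<open>Below the top order, continuity is derived from differentiability, with
        \<open>d0 + 1\<close> as local Lipschitz constant at \<open>x\<close>.\<close>
      then have jr: "j < r" using j by simp
      obtain d0 where d0: "mbounded (Suc j) (D_at F x) d0" using mb[OF x, of "Suc j"] jr by auto
      then have "0 \<le> d0" by (simp add: mbounded_def)
      moreover have "norm (D_at F x (h # vs)) \<le> d0 * (norm h * prod_list (map norm vs))" if "length vs = j" for h vs
        using mboundedD[OF d0, of "h # vs"] that by simp
      ultimately have d: "0 \<le> d0" "\<And>h vs. length vs = j \<Longrightarrow> norm (D_at F x (h # vs)) \<le> d0 * (norm h * prod_list (map norm vs))"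
        by blast+
      have "\<forall>\<^sub>F y in nhds x. dist y x < e / (d0 + 1)" unfolding eventually_nhds_metric using e d(1) by (intro exI[of _ "e / (d0 + 1)"]) auto
      then show ?thesis using fam[OF x jr zero_less_one]
      proof eventually_elim
        case (elim y)
        show ?case
        proof (intro allI impI)
          fix vs :: "('m, 'e) linf list" assume vs: "length vs = j"
          let ?p = "prod_list (map norm vs)"
          have p: "0 \<le> ?p" by (rule prod_list_norm_nonneg)
          have "norm (D_at F y vs - D_at F x vs) = norm ((D_at F y vs - D_at F x vs - D_at F x ((y - x) # vs)) + D_at F x ((y - x) # vs))" by simp
          also have "\<dots> \<le> 1 * norm (y - x) * ?p + d0 * (norm (y - x) * ?p)"
            using elim(2) vs d(2) by (intro norm_triangle_mono) blast+
          also have "\<dots> = (d0 + 1) * norm (y - x) * ?p" by (simp add: algebra_simps)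
          also have "\<dots> \<le> e * ?p"
            using elim(1) d(1) p by (intro mult_right_mono) (auto simp: dist_norm field_simps)
          finally show "norm (D_at F y vs - D_at F x vs) \<le> e * ?p" .
        qed
      qed
    qed
  qed
  ultimately show ?thesis using V mb unfolding smooth_def by blast
qed

lemma C_decay_imp:
  fixes F :: "('m, 'e) linf \<Rightarrow> ('m, 'e) linf"
  assumes F: "F \<in> C_decay N \<Gamma> r V" and V: "open V"
  shows "smooth r V F" and "\<And>s. 1 \<le> s \<Longrightarrow> s \<le> r \<Longrightarrow> \<exists>K. \<forall>x\<in>V. MB s K (D_at F x)"
proof -
  show sm: "smooth r V F" using F V by (intro smooth_of_C_class) (auto simp: C_decay_def)
  fix s assume s: "1 \<le> s" "s \<le> r"
  define S where "S = (SUP x\<in>V. mult_decay_norm N \<Gamma> s (D_at F x))"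
  have S: "S < \<infinity>" using F s by (auto simp: C_decay_def S_def)
  have "mult_decay_norm N \<Gamma> s (D_at F x) \<le> ennreal (enn2real S)" if "x \<in> V" for x
  proof -
    have "mult_decay_norm N \<Gamma> s (D_at F x) \<le> S" unfolding S_def using that by (rule SUP_upper)
    then show ?thesis using S by simp
  qed
  then have "MB s (enn2real S / c * C ^ s) (D_at F x)" if "x \<in> V" for x
    using that s by (intro MB_of_mult_decay_norm smooth_multilinear[OF sm]) auto
  then show "\<exists>K. \<forall>x\<in>V. MB s K (D_at F x)" by blast
qed

lemma C_decayI:
  fixes F :: "('m, 'e) linf \<Rightarrow> ('m, 'e) linf"
  assumes F: "smooth r V F" and b: "\<And>s. s \<le> r \<Longrightarrow> \<exists>K. \<forall>x\<in>V. MB s K (D_at F x)"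
  shows "F \<in> C_decay N \<Gamma> r V"
  unfolding C_decay_def
proof (intro CollectI conjI ballI)
  show "C_class N r V F" by (rule C_class_of_smooth[OF F])
  obtain K where K: "\<And>x. x \<in> V \<Longrightarrow> MB 0 K (D_at F x)" using b[of 0] by auto
  have "linf_norm N (F x) \<le> C * K" if "x \<in> V" for x
  proof -
    have "norm (F x) \<le> K" using MBD[OF K[OF that], of "[]" None] by (simp add: lgauge_None)
    then show ?thesis using linf_bounds(2)[of "F x"] C by (meson less_imp_le mult_left_mono order_trans)
  qed
  then have "(SUP x\<in>V. ennreal (linf_norm N (F x))) \<le> ennreal (C * K)" by (intro SUP_least ennreal_leI)
  then show "(SUP x\<in>V. ennreal (linf_norm N (F x))) < \<infinity>" by (simp add: le_less_trans)
  fix j assume j: "j \<in> {1..r}"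
  obtain K where K: "\<And>x. x \<in> V \<Longrightarrow> MB j K (D_at F x)" using b[of j] j by auto
  have le: "mult_decay_norm N \<Gamma> j (D_at F x) \<le> ennreal (C * (K * (1 / c) ^ j / min 1 (\<Gamma> 0)))" if "x \<in> V" for x
    using mult_decay_norm_of_MB[OF K[OF that]] j by simp
  then have "(SUP x\<in>V. mult_decay_norm N \<Gamma> j (D_at F x)) \<le> ennreal (C * (K * (1 / c) ^ j / min 1 (\<Gamma> 0)))" by (intro SUP_least)
  then show "(SUP x\<in>V. mult_decay_norm N \<Gamma> j (D_at F x)) < \<infinity>" by (simp add: le_less_trans)
  fix x assume x: "x \<in> V"
  have "mult_decay_norm N \<Gamma> j (D_at F x) < \<infinity>" using le[OF x] by (simp add: le_less_trans)
  moreover have "D_at F x \<in> bounded_multilinear N j"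
    using \<open>C_class N r V F\<close> x j unfolding C_class_def by auto
  ultimately show "D_at F x \<in> L_decay N \<Gamma> j" by (simp add: L_decay_def)
qed

end


section \<open>The resolvent set\<close>

context gauged
begin

lemma neumann:
  assumes B: "dec \<theta> B" and th: "\<theta> < 1"
  shows "\<exists>T. dec (1 / (1 - \<theta>)) T \<and> (\<forall>u. T (u - B u) = u) \<and> (\<forall>u. T u - B (T u) = u)"
proof -
  have th0: "0 \<le> \<theta>" by (rule dec_nonneg[OF B])
  have lin: "linear (B ^^ n)" for n by (rule dec_linear[OF dec_funpow[OF B]])
  obtain C where C: "\<And>u. g None u (C * norm u)" "\<And>u K. g None u K \<Longrightarrow> norm u \<le> C * K" using g_None_bounds by blast
  have n: "norm ((B ^^ n) u) \<le> C * (C * norm u) * \<theta> ^ n" for n u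
    using C(2)[OF decD[OF dec_funpow[OF B] C(1)]] by (simp add: mult_ac)
  have sm: "summable (\<lambda>n. (B ^^ n) u)" for u
    by (rule summable_comparison_test'[OF summable_mult[OF summable_geometric] n]) (use th th0 in simp)
  define T where "T u = (\<Sum>n. (B ^^ n) u)" for u
  have T: "(\<lambda>n. \<Sum>i<n. (B ^^ i) u) \<longlonglongrightarrow> T u" for u
    using summable_LIMSEQ[OF sm] by (simp add: T_def)
  have tel: "(\<lambda>n. (B ^^ n) u - (B ^^ Suc n) u) sums u" for u
    using telescope_sums'[OF summable_LIMSEQ_zero[OF sm[of u]]] by simp
  have bl: "bounded_linear B" by (rule dec_bounded_linear[OF B])
  have "dec (1 / (1 - \<theta>)) T"
    unfolding dec_def
  proof (intro conjI allI impI)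
    show "linear T"
      using sm by (intro linearI)
        (simp_all add: T_def linear_add[OF lin] linear_scale[OF lin] suminf_add suminf_scaleR_right)
    show "0 \<le> 1 / (1 - \<theta>)" using th by simp
    fix q u k assume u: "g q u k"
    have part: "g q (\<Sum>i<n. (B ^^ i) u) (\<Sum>i<n. \<theta> ^ i * k)" for n
      by (induction n) (auto intro: g_zero g_add decD[OF dec_funpow[OF B] u])
    have "g q (\<Sum>i<n. (B ^^ i) u) (1 / (1 - \<theta>) * k)" for n
    proof (rule g_mono[OF part])
      have "(\<Sum>i<n. \<theta> ^ i) \<le> 1 / (1 - \<theta>)"
        using sum_le_suminf[of "\<lambda>i. \<theta> ^ i" "{..<n}"] th th0 by (simp add: suminf_geometric summable_geometric)
      then show "(\<Sum>i<n. \<theta> ^ i * k) \<le> 1 / (1 - \<theta>) * k"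
        unfolding sum_distrib_right[symmetric] by (rule mult_right_mono[OF _ g_nonneg[OF u]])
    qed
    then show "g q (T u) (1 / (1 - \<theta>) * k)" by (rule g_limit[OF T]) simp
  qed
  moreover have "T (u - B u) = u" for u
  proof -
    have "(\<lambda>n. (B ^^ n) (u - B u)) = (\<lambda>n. (B ^^ n) u - (B ^^ Suc n) u)"
      by (simp add: linear_diff[OF lin] funpow_swap1)
    then show ?thesis using sums_unique[OF tel[of u]] by (simp only: T_def)
  qed
  moreover have "T u - B (T u) = u" for u
  proof -
    have "B (T u) = (\<Sum>n. B ((B ^^ n) u))" unfolding T_def by (rule bounded_linear.suminf[OF bl sm])
    then have "T u - B (T u) = (\<Sum>n. (B ^^ n) u - (B ^^ Suc n) u)"
      using suminf_diff[OF sm bounded_linear.summable[OF bl sm]] by (simp add: T_def)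
    then show ?thesis using sums_unique[OF tel[of u]] by simp
  qed
  ultimately show ?thesis by blast
qed

text \<open>Changing \<open>\<mu>\<close> to \<open>z\<close> perturbs the quadratic by multiples of
  \<open>A\<close> and of the identity that tend to 0. Factoring out \<open>quad A \<mu>\<close>
  leaves the identity minus an operator bounded by \<open>\<theta> z\<close>, which a Neumann series
  inverts.\<close>

lemma open_Res:
  assumes A: "dec KA A"
  shows "open {\<mu>. Res A \<mu>}"
  unfolding open_dist
proof
  fix \<mu> assume "\<mu> \<in> {\<mu>. Res A \<mu>}"
  then obtain K Q where Q: "dec K Q" "\<And>u. Q (quad A \<mu> u) = u" "\<And>u. quad A \<mu> (Q u) = u" unfolding Res_def by blast
  note lA = dec_linear[OF A] and lQ = dec_linear[OF Q(1)]
  define \<theta> where "\<theta> z = K * (\<bar>2 * Re \<mu> - 2 * Re z\<bar> * KA + \<bar>(cmod z)\<^sup>2 - (cmod \<mu>)\<^sup>2\<bar> * 1)" for z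
  have "(\<theta> \<longlongrightarrow> \<theta> \<mu>) (nhds \<mu>)" unfolding \<theta>_def by (intro tendsto_intros filterlim_ident)
  then have "\<forall>\<^sub>F z in nhds \<mu>. \<theta> z < 1" by (rule order_tendstoD(2)) (simp add: \<theta>_def)
  moreover have "Res A z" if z: "\<theta> z < 1" for z
  proof -
    define D where "D u = (2 * Re \<mu> - 2 * Re z) *\<^sub>R A u + ((cmod z)\<^sup>2 - (cmod \<mu>)\<^sup>2) *\<^sub>R u" for u
    define B where "B u = - 1 *\<^sub>R Q (D u)" for u
    have "dec (\<bar>- 1\<bar> * \<theta> z) B"
      unfolding B_def[abs_def] \<theta>_def D_def by (rule dec_scale[OF dec_compose[OF Q(1) dec_add[OF dec_scale[OF A] dec_scale[OF dec_id]]]])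
    then have "dec (\<theta> z) B" by simp
    from neumann[OF this z] obtain T where T: "dec (1 / (1 - \<theta> z)) T" "\<And>u. T (u - B u) = u" "\<And>u. T u - B (T u) = u" by blast
    have q: "quad A z u = quad A \<mu> (u - B u)" for u
    proof -
      have "quad A \<mu> (u + Q (D u)) = quad A \<mu> u + quad A \<mu> (Q (D u))"
        by (simp add: quad_def linear_add[OF lA] algebra_simps)
      then have "quad A \<mu> (u - B u) = quad A \<mu> u + D u" by (simp add: B_def Q(3))
      then show ?thesis by (simp add: quad_def D_def algebra_simps)
    qed
    show ?thesis unfolding Res_def
      by (intro exI[of _ "1 / (1 - \<theta> z) * K"] exI[of _ "\<lambda>u. T (Q u)"] conjI allI dec_compose[OF T(1) Q(1)])
         (simp_all add: q Q T)
  qed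
  ultimately show "\<exists>e>0. \<forall>y. dist y \<mu> < e \<longrightarrow> y \<in> {\<mu>. Res A \<mu>}"
    unfolding eventually_nhds_metric by blast
qed

end


section \<open>The spectrum of the complexification\<close>

lemma Re_Im_apply:
  "apply_bcontfun (linf_Re z) i $ k = Re (apply_bcontfun z i $ k)"
  "apply_bcontfun (linf_Im z) i $ k = Im (apply_bcontfun z i $ k)"
  "apply_bcontfun (linf_scale c z) i $ k = c * (apply_bcontfun z i $ k)"
  "apply_bcontfun (linf_of_real x) i $ k = complex_of_real (apply_bcontfun x i $ k)"
  by (transfer, simp)+

lemma linf_complex_eqI: "linf_Re z = linf_Re w \<Longrightarrow> linf_Im z = linf_Im w \<Longrightarrow> z = w"
  by (rule bcontfun_eqI) (simp add: vec_eq_iff complex_eq_iff flip: Re_Im_apply)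

lemma linf_Re_simps [simp]:
  "linf_Re (z + w) = linf_Re z + linf_Re w" "linf_Re (z - w) = linf_Re z - linf_Re w"
  "linf_Re (linf_scale c z) = Re c *\<^sub>R linf_Re z - Im c *\<^sub>R linf_Im z"
  "linf_Re (linf_of_real x) = x" "linf_Re (r *\<^sub>R z) = r *\<^sub>R linf_Re z"
  by (rule bcontfun_eqI, simp add: vec_eq_iff Re_Im_apply)+

lemma linf_Im_simps [simp]:
  "linf_Im (z + w) = linf_Im z + linf_Im w" "linf_Im (z - w) = linf_Im z - linf_Im w"
  "linf_Im (linf_scale c z) = Re c *\<^sub>R linf_Im z + Im c *\<^sub>R linf_Re z"
  "linf_Im (linf_of_real x) = 0" "linf_Im (r *\<^sub>R z) = r *\<^sub>R linf_Im z"
  by (rule bcontfun_eqI, simp add: vec_eq_iff Re_Im_apply)+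

lemma complexify_simps [simp]:
  "linf_Re (complexify A z) = A (linf_Re z)" "linf_Im (complexify A z) = A (linf_Im z)"
  by (simp_all add: complexify_def)

lemma linear_linf_of_real: "linear linf_of_real"
  by (rule linearI; rule linf_complex_eqI) simp_all

lemma norm_linf_apply:
  "norm (apply_bcontfun (linf_Re z) i) \<le> norm (apply_bcontfun z i)"
  "norm (apply_bcontfun (linf_Im z) i) \<le> norm (apply_bcontfun z i)"
  "norm (apply_bcontfun (linf_of_real x) i) = norm (apply_bcontfun x i)"
  "norm (apply_bcontfun (linf_scale c z) i) = cmod c * norm (apply_bcontfun z i)"
  by (auto simp: norm_vec_def Re_Im_apply norm_mult L2_set_right_distrib intro!: L2_set_mono abs_Re_le_cmod abs_Im_le_cmod)

lemma gauge_lgauge_mono: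
  assumes "gauge (lgauge \<Gamma>) q u K" "\<And>i. norm (apply_bcontfun v i) \<le> norm (apply_bcontfun u i)"
  shows "gauge (lgauge \<Gamma>) q v K"
  using assms(1) unfolding gauge_def lgauge_def by (auto intro: order_trans[OF assms(2)])

context lattice_norm
begin

lemma dec_of_decay_norm:
  fixes B :: "('m, 'e) linf \<Rightarrow> ('m, 'e) linf"
  assumes B: "linear B" and fin: "decay_norm N \<Gamma> B < \<infinity>"
  shows "\<exists>K. dec K B"
proof -
  define K where "K = enn2real (decay_norm N \<Gamma> B)"
  have K: "decay_norm N \<Gamma> B \<le> ennreal K" using fin by (simp add: K_def)
  have "mult_norm N 1 (\<lambda>vs. B (hd vs)) \<le> op_norm N B"
    unfolding mult_norm_def op_norm_def by (rule SUP_least, rule SUP_upper2) (auto simp: length_Suc_conv)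
  moreover have "mult_decay_coeff N \<Gamma> 1 (\<lambda>vs. B (hd vs)) \<le> decay_coeff N \<Gamma> B"
    unfolding mult_decay_coeff_def
  proof (intro SUP_least, goal_cases)
    case (1 p i l x)
    then obtain w where w: "x = ([], w)" "w \<in> {u. linf_norm N u \<le> 1 \<and> (\<forall>j. j \<noteq> l \<longrightarrow> apply_bcontfun u j = 0)}" by auto
    show ?case unfolding w(1) decay_coeff_def
      by (rule SUP_upper2[OF UNIV_I[of i]], rule SUP_upper2[OF UNIV_I[of l]], rule SUP_upper2[OF w(2)]) simp
  qed
  ultimately have "mult_decay_norm N \<Gamma> 1 (\<lambda>vs. B (hd vs)) \<le> ennreal K"
    using K unfolding mult_decay_norm_def decay_norm_def by (auto intro: order_trans)
  then have "MB 1 (K / c * C ^ 1) (\<lambda>vs. B (hd vs))"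
    using B by (intro MB_of_mult_decay_norm) (auto simp: K_def multilinear_map_def length_Suc_conv)
  then show ?thesis using MB_imp_dec B by blast
qed

lemma decay_norm_of_dec:
  fixes B :: "('m, 'e) linf \<Rightarrow> ('m, 'e) linf"
  assumes B: "dec K B"
  shows "decay_norm N \<Gamma> B < \<infinity>"
proof -
  let ?B = "\<lambda>vs. B (hd vs)"
  have "op_norm N B \<le> mult_norm N 1 ?B"
    unfolding mult_norm_def op_norm_def
  proof (rule SUP_least)
    fix u :: "('m, 'e) linf" assume "u \<in> {u. linf_norm N u \<le> 1}"
    then show "ennreal (linf_norm N (B u)) \<le> (SUP vs\<in>{vs. length vs = 1 \<and> (\<forall>v\<in>set vs. linf_norm N v \<le> 1)}. ennreal (linf_norm N (?B vs)))"
      by (intro SUP_upper2[of "[u]"]) auto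
  qed
  moreover have "decay_coeff N \<Gamma> B \<le> mult_decay_coeff N \<Gamma> 1 ?B"
    unfolding decay_coeff_def
  proof (intro SUP_least, goal_cases)
    case (1 i k u)
    then have u: "([], u) \<in> {(vs, w). length vs = 1 - 1 \<and> (\<forall>v\<in>set vs. linf_norm N v \<le> 1) \<and>
                      linf_norm N w \<le> 1 \<and> (\<forall>j. j \<noteq> k \<longrightarrow> apply_bcontfun w j = 0)}" by simp
    show ?case unfolding mult_decay_coeff_def
      by (rule SUP_upper2[of 0], simp, rule SUP_upper2[OF UNIV_I[of i]], rule SUP_upper2[OF UNIV_I[of k]], rule SUP_upper2[OF u]) simp
  qed
  ultimately have "decay_norm N \<Gamma> B \<le> mult_decay_norm N \<Gamma> 1 ?B"
    unfolding mult_decay_norm_def decay_norm_def by (rule max.mono)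
  also have "\<dots> < \<infinity>" using mult_decay_norm_of_MB[OF dec_MB[OF B]] by (simp add: le_less_trans)
  finally show ?thesis .
qed

end

text \<open>The resolvent at \<open>\<mu> = a + i b\<close> is \<open>(A - a + i b) Q\<close>, where
  \<open>Q\<close> inverts the quadratic. In one direction \<open>B\<close> is built from this
  formula; in the other \<open>Q\<close> is recovered from the action of \<open>B\<close> on real
  families. The right side refers to real families only, so the spectrum is the same for all complex
  norms.\<close>

lemma decay_spectrum_iff_not_Res:
  fixes A :: "('m::finite, real ^ 'n) linf \<Rightarrow> ('m, real ^ 'n) linf"
  assumes N: "lattice_norm \<Gamma> (N :: complex ^ 'n \<Rightarrow> real) c C" and A: "gauged.dec (lgauge \<Gamma>) KA A"
  shows "\<mu> \<in> decay_spectrum N \<Gamma> A \<longleftrightarrow> \<not> gauged.Res (lgauge \<Gamma>) A \<mu>"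
proof -
  interpret lattice_norm \<Gamma> N c C by (rule N)
  define a b where "a = Re \<mu>" and "b = Im \<mu>"
  note lA = dec_linear[OF A]
  note A_simps = linear_add[OF lA] linear_diff[OF lA] linear_scale[OF lA] linear_0[OF lA]
  have quad: "quad A \<mu> u = A (A u) - (a *\<^sub>R A u + a *\<^sub>R A u) + (a * a + b * b) *\<^sub>R u" for u
    unfolding quad_def a_def b_def cmod_power2 by (simp only: power2_eq_square mult_2 scaleR_left_distrib)
  have "Res A \<mu>" if mu: "\<mu> \<notin> decay_spectrum N \<Gamma> A"
  proof -
    obtain B where B0: "B \<in> L_decay_complex N \<Gamma>" and L: "\<forall>z. B (complexify A z - linf_scale \<mu> z) = z"
      and R: "\<forall>z. complexify A (B z) - linf_scale \<mu> (B z) = z"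
      using mu unfolding decay_spectrum_def by auto
    note L = spec[OF L] and R = spec[OF R]
    have B: "bounded_linear B" "\<And>c z. B (linf_scale c z) = linf_scale c (B z)" "decay_norm N \<Gamma> B < \<infinity>"
      using B0 unfolding L_decay_complex_def by simp_all
    note lB = bounded_linear.linear[OF B(1)]
    obtain K where K: "dec K B" using dec_of_decay_norm[OF lB B(3)] by blast
    define X Y where "X u = linf_Re (B (linf_of_real u))" and "Y u = linf_Im (B (linf_of_real u))" for u
    note lr = linear_add[OF linear_linf_of_real] linear_scale[OF linear_linf_of_real]
    have gr: "gauge (lgauge \<Gamma>) q (B (linf_of_real u)) (K * k)" if "gauge (lgauge \<Gamma>) q u k" for q and u :: "('m, real ^ 'n) linf" and k
      by (rule decD[OF K gauge_lgauge_mono[OF that]]) (simp add: norm_linf_apply)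
    have X: "dec K X" and Y: "dec K Y"
      unfolding dec_def using dec_nonneg[OF K]
      by (auto simp: X_def Y_def lr linear_add[OF lB] linear_scale[OF lB] norm_linf_apply intro!: linearI intro: gauge_lgauge_mono[OF gr])
    note lX = dec_linear[OF X] and lY = dec_linear[OF Y]
    have R1: "A (X u) - a *\<^sub>R X u + b *\<^sub>R Y u = u" and R2: "A (Y u) - a *\<^sub>R Y u - b *\<^sub>R X u = 0" for u
      using arg_cong[OF R[of "linf_of_real u"], of linf_Re] arg_cong[OF R[of "linf_of_real u"], of linf_Im]
      by (simp_all add: X_def Y_def a_def b_def algebra_simps)
    have eq: "complexify A (linf_of_real u) - linf_scale \<mu> (linf_of_real u) = linf_of_real (A u - a *\<^sub>R u) - linf_scale (\<i> * b) (linf_of_real u)" for u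
      by (rule linf_complex_eqI) (simp_all add: A_simps a_def b_def)
    have "B (linf_of_real (A u - a *\<^sub>R u)) - linf_scale (\<i> * b) (B (linf_of_real u)) = linf_of_real u" for u
      using L[of "linf_of_real u"] unfolding eq by (simp add: linear_diff[OF lB] B(2))
    from arg_cong[OF this, of linf_Re] arg_cong[OF this, of linf_Im]
    have L1: "X (A u - a *\<^sub>R u) + b *\<^sub>R Y u = u" and L2: "Y (A u - a *\<^sub>R u) - b *\<^sub>R X u = 0" for u
      by (simp_all add: X_def Y_def)
    have quad2: "quad A \<mu> u = (A (A u - a *\<^sub>R u) - a *\<^sub>R (A u - a *\<^sub>R u)) + (b * b) *\<^sub>R u" for u
      unfolding quad by (simp add: A_simps algebra_simps)
    show ?thesis
    proof (cases "b = 0")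
      case True
      have "X (X (quad A \<mu> u)) = u" "quad A \<mu> (X (X u)) = u" for u
        using L1 R1 True unfolding quad2 by simp_all
      then show ?thesis unfolding Res_def using dec_compose[OF X X] by blast
    next
      case False
      have YA: "Y (A u - a *\<^sub>R u) = b *\<^sub>R X u" and AY: "A (Y u) - a *\<^sub>R Y u = b *\<^sub>R X u" for u using L2 R2 by simp_all
      have "Y (quad A \<mu> u) = b *\<^sub>R u" for u
      proof -
        have "Y (quad A \<mu> u) = b *\<^sub>R (X (A u - a *\<^sub>R u) + b *\<^sub>R Y u)"
          unfolding quad2 by (simp add: linear_add[OF lY] linear_scale[OF lY] YA scaleR_add_right)
        then show ?thesis by (simp add: L1)
      qed
      moreover have "quad A \<mu> (Y u) = b *\<^sub>R u" for u
      proof -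
        have "quad A \<mu> (Y u) = b *\<^sub>R (A (X u) - a *\<^sub>R X u + b *\<^sub>R Y u)"
          unfolding quad2 AY by (simp add: A_simps algebra_simps)
        then show ?thesis by (simp add: R1)
      qed
      moreover have "quad A \<mu> (r *\<^sub>R u) = r *\<^sub>R quad A \<mu> u" for r u by (simp add: quad A_simps algebra_simps)
      ultimately show ?thesis unfolding Res_def using dec_scale[OF Y, of "1 / b"] False
        by (intro exI[of _ "\<bar>1 / b\<bar> * K"] exI[of _ "\<lambda>u. (1 / b) *\<^sub>R Y u"]) simp
    qed
  qed
  moreover have "\<mu> \<notin> decay_spectrum N \<Gamma> A" if mu: "Res A \<mu>"
  proof -
    obtain K Q where Q: "dec K Q" "\<And>u. Q (quad A \<mu> u) = u" "\<And>u. quad A \<mu> (Q u) = u"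
      using mu unfolding Res_def by blast
    note lQ = dec_linear[OF Q(1)]
    note Q_simps = linear_add[OF lQ] linear_diff[OF lQ] linear_scale[OF lQ] linear_0[OF lQ]
    have quadA: "quad A \<mu> (A u) = A (quad A \<mu> u)" for u by (simp add: quad A_simps)
    have QA: "Q (A u) = A (Q u)" for u
      using Q(2)[of "A (Q u)"] by (simp add: quadA Q(3))
    \<comment> \<open>Real and imaginary part of \<open>(A - cnj \<mu>) Q\<close>.\<close>
    define P S where "P u = A (Q u) + (- a) *\<^sub>R Q u" and "S u = b *\<^sub>R Q u" for u
    define B where "B z = complexify P z + linf_scale \<i> (complexify S z)" for z :: "('m, complex ^ 'n) linf"
    obtain KP KS where P: "dec KP P" and S: "dec KS S"
      unfolding P_def[abs_def] S_def[abs_def] using dec_add[OF dec_compose[OF A Q(1)] dec_scale[OF Q(1)]] dec_scale[OF Q(1)] by blast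
    note PS = linear_add[OF dec_linear[OF P]] linear_add[OF dec_linear[OF S]] linear_scale[OF dec_linear[OF P]] linear_scale[OF dec_linear[OF S]]
      linear_diff[OF dec_linear[OF P]] linear_diff[OF dec_linear[OF S]]
    have reim: "linf_Re (B z) = P (linf_Re z) - S (linf_Im z)" "linf_Im (B z) = P (linf_Im z) + S (linf_Re z)" for z
      by (simp_all add: B_def)
    have lin: "linear B" by (rule linearI; rule linf_complex_eqI) (simp_all add: reim PS algebra_simps)
    have cdec: "gauge (lgauge \<Gamma>) q (complexify T z) (K' * k + K' * k)"
      if T: "dec K' T" and z: "gauge (lgauge \<Gamma>) q z k" for T :: "('m, real ^ 'n) linf \<Rightarrow> ('m, real ^ 'n) linf" and K' q z k
    proof -
      have "gauge (lgauge \<Gamma>) q (linf_Re z) k" "gauge (lgauge \<Gamma>) q (linf_Im z) k"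
        by (rule gauge_lgauge_mono[OF z]; simp add: norm_linf_apply)+
      from this[THEN decD[OF T]] show ?thesis
        unfolding complexify_def by (intro g_add) (rule gauge_lgauge_mono, assumption, simp add: norm_linf_apply)+
    qed
    have "dec (2 * KP + 2 * KS) B"
      unfolding dec_def
    proof (intro conjI allI impI lin)
      show "0 \<le> 2 * KP + 2 * KS" using dec_nonneg[OF P] dec_nonneg[OF S] by simp
      fix q and z :: "('m, complex ^ 'n) linf" and k assume z: "gauge (lgauge \<Gamma>) q z k"
      have "gauge (lgauge \<Gamma>) q (linf_scale \<i> (complexify S z)) (KS * k + KS * k)"
        by (rule gauge_lgauge_mono[OF cdec[OF S z]]) (simp add: norm_linf_apply)
      from g_add[OF cdec[OF P z] this] show "gauge (lgauge \<Gamma>) q (B z) ((2 * KP + 2 * KS) * k)"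
        by (simp add: B_def algebra_simps)
    qed
    then have "decay_norm N \<Gamma> B < \<infinity>" "bounded_linear B" by (rule decay_norm_of_dec, rule dec_bounded_linear)
    moreover have "B (linf_scale c z) = linf_scale c (B z)" for c z
      by (rule linf_complex_eqI) (simp_all add: reim PS algebra_simps)
    moreover have *: "A (A (Q u)) = u + a *\<^sub>R A (Q u) + a *\<^sub>R A (Q u) - (a * a) *\<^sub>R Q u - (b * b) *\<^sub>R Q u" for u
      using Q(3)[of u] by (simp add: quad algebra_simps)
    have "B (complexify A z - linf_scale \<mu> z) = z" for z
      by (rule linf_complex_eqI)
         (simp_all add: reim P_def S_def A_simps Q_simps QA * algebra_simps a_def[symmetric] b_def[symmetric])
    moreover have "complexify A (B z) - linf_scale \<mu> (B z) = z" for z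
      by (rule linf_complex_eqI)
         (simp_all add: reim P_def S_def A_simps * algebra_simps a_def[symmetric] b_def[symmetric])
    ultimately show ?thesis unfolding decay_spectrum_def L_decay_complex_def by blast
  qed
  ultimately show ?thesis by blast
qed


section \<open>Smooth truncation\<close>

definition truncates :: "nat \<Rightarrow> (nat \<Rightarrow> real \<Rightarrow> real) \<Rightarrow> real \<Rightarrow> real \<Rightarrow> bool" where
  "truncates k \<phi> C \<delta> \<longleftrightarrow> 0 < \<delta> \<and> (\<forall>i<k. \<forall>t. (\<phi> i has_real_derivative \<phi> (Suc i) t) (at t)) \<and> continuous_on UNIV (\<phi> k) \<and>
     (\<forall>i\<le>k. \<forall>t. \<bar>\<phi> i t\<bar> \<le> C) \<and> (\<forall>t. \<bar>t\<bar> < \<delta> \<longrightarrow> \<phi> 0 t = t)"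

text \<open>Averaging over an interval of length \<open>2h\<close> gains one derivative and does not change the
  function where it is the identity on that interval.\<close>

lemma smooth_truncation: "\<exists>\<phi> C \<delta>. truncates k \<phi> C \<delta>"
proof (induction k)
  case 0
  show ?case
    unfolding truncates_def
    by (intro exI[of _ "\<lambda>_ t. max (- 1) (min 1 t)"] exI[of _ 1]) (auto intro!: continuous_intros)
next
  case (Suc k)
  then obtain \<phi> C \<delta> where tr: "truncates k \<phi> C \<delta>" by blast
  have d: "0 < \<delta>" and D: "i < k \<Longrightarrow> (\<phi> i has_real_derivative \<phi> (Suc i) t) (at t)"
    and c: "continuous_on UNIV (\<phi> k)" and C: "i \<le> k \<Longrightarrow> \<bar>\<phi> i t\<bar> \<le> C" and id: "\<bar>t\<bar> < \<delta> \<Longrightarrow> \<phi> 0 t = t" for i t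
    using tr by (simp_all add: truncates_def)
  have "isCont (\<phi> 0) t" for t
    using c D[of 0] by (cases "k = 0") (auto simp: continuous_on_eq_continuous_at intro: DERIV_isCont)
  then obtain G where G: "\<And>t. (G has_real_derivative \<phi> 0 t) (at t)"
    using einterval_antiderivative[of "- \<infinity>" "\<infinity>" "\<phi> 0"] by (auto simp: has_real_derivative_iff_has_vector_derivative)
  \<comment> \<open>For arguments of modulus below \<open>h\<close> the interval of averaging stays
    where \<open>\<phi> 0\<close> is the identity.\<close>
  define h where "h = \<delta> / 2"
  have h: "0 < h" using d by (simp add: h_def)
  have C0: "0 \<le> C" using C[of 0 0] abs_ge_zero order_trans by blast
  \<comment> \<open>The averages of \<open>\<phi> 0\<close> and of its derivatives are difference
    quotients of the sequence shifted by one, which begins with the antiderivative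
    \<open>G\<close>.\<close>
  define \<Phi> where "\<Phi> i = (case i of 0 \<Rightarrow> G | Suc j \<Rightarrow> \<phi> j)" for i
  define \<psi> where "\<psi> i t = (\<Phi> i (t + h) - \<Phi> i (t - h)) / (2 * h)" for i t
  have "(\<psi> i has_real_derivative \<psi> (Suc i) t) (at t)" if "i < Suc k" for i t
  proof -
    have \<Phi>: "(\<Phi> i has_real_derivative \<Phi> (Suc i) t) (at t)" for t
      using G D that by (auto simp: \<Phi>_def split: nat.split)
    show ?thesis unfolding \<psi>_def
      by (rule derivative_eq_intros DERIV_chain'[OF _ \<Phi>] refl)+ (use h in \<open>simp_all add: field_simps\<close>)
  qed
  moreover have "continuous_on UNIV (\<psi> (Suc k))"
    unfolding \<psi>_def \<Phi>_def using h by (auto intro!: continuous_intros continuous_on_compose2[OF c])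
  moreover have "\<bar>\<psi> i t\<bar> \<le> C + C / h" if "i \<le> Suc k" for i t
  proof (cases i)
    case 0
    have "norm (G (t + h) - G (t - h)) \<le> C * norm ((t + h) - (t - h))"
      by (rule field_differentiable_bound[of UNIV G "\<phi> 0"]) (use G C in auto)
    then have "\<bar>\<psi> i t\<bar> \<le> C" using h 0 by (simp add: \<psi>_def \<Phi>_def field_simps)
    then show ?thesis using C0 h by (simp add: add_increasing2)
  next
    case (Suc j)
    then have "\<bar>\<phi> j (t + h) - \<phi> j (t - h)\<bar> \<le> C + C"
      using C[of j "t + h"] C[of j "t - h"] that by simp
    then have "\<bar>\<psi> i t\<bar> \<le> C / h" using h Suc by (simp add: \<psi>_def \<Phi>_def field_simps)
    then show ?thesis using C0 by simp
  qed
  \<comment> \<open>There \<open>G\<close> differs from half the square by a constant, and the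
    difference quotient of half the square over an interval is the midpoint.\<close>
  moreover have "\<psi> 0 t = t" if t: "\<bar>t\<bar> < h" for t
  proof -
    have "norm ((G (t + h) - (t + h)\<^sup>2 / 2) - (G (t - h) - (t - h)\<^sup>2 / 2)) \<le> 0 * norm ((t + h) - (t - h))"
    proof (rule field_differentiable_bound[of "{t - h..t + h}" _ "\<lambda>u. \<phi> 0 u - u"])
      fix u assume u: "u \<in> {t - h..t + h}"
      show "((\<lambda>u. G u - u\<^sup>2 / 2) has_real_derivative \<phi> 0 u - u) (at u within {t - h..t + h})"
        by (auto intro!: derivative_eq_intros DERIV_subset[OF G])
      have "\<bar>u\<bar> < \<delta>" using u t unfolding h_def by auto
      then show "norm (\<phi> 0 u - u) \<le> 0" by (simp add: id)
    qed (use h in auto)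
    then have "G (t + h) - G (t - h) = ((t + h)\<^sup>2 - (t - h)\<^sup>2) / 2" by (simp add: field_simps)
    then show ?thesis using h by (simp add: \<psi>_def \<Phi>_def power2_eq_square field_simps)
  qed
  ultimately have "truncates (Suc k) \<psi> (C + C / h) h" using h by (simp only: truncates_def) simp
  then show ?case by blast
qed

text \<open>Rescaling to \<open>s * \<phi> 0 (t / s)\<close> with small \<open>s\<close> keeps the
  identity near 0 and shrinks the range. The derivatives acquire powers of \<open>1 / s\<close>,
  which the constant \<open>C\<close> absorbs.\<close>

lemma small_smooth_truncation:
  assumes "0 < \<rho>"
  obtains \<phi> :: "nat \<Rightarrow> real \<Rightarrow> real" and C \<delta> where "0 < \<delta>" "0 \<le> C"
    "\<And>i t. i < k \<Longrightarrow> (\<phi> i has_real_derivative \<phi> (Suc i) t) (at t)" "\<And>i t. i \<le> k \<Longrightarrow> \<bar>\<phi> i t\<bar> \<le> C"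
    "\<And>t. \<bar>\<phi> 0 t\<bar> \<le> \<rho>" "\<And>t. \<bar>t\<bar> < \<delta> \<Longrightarrow> \<phi> 0 t = t"
proof -
  obtain \<phi> C \<delta> where tr: "truncates k \<phi> C \<delta>" using smooth_truncation by blast
  have d: "0 < \<delta>" and D: "i < k \<Longrightarrow> (\<phi> i has_real_derivative \<phi> (Suc i) t) (at t)"
    and C: "i \<le> k \<Longrightarrow> \<bar>\<phi> i t\<bar> \<le> C" and id: "\<bar>t\<bar> < \<delta> \<Longrightarrow> \<phi> 0 t = t" for i t
    using tr by (simp_all add: truncates_def)
  have C0: "0 \<le> C" using C[of 0 0] abs_ge_zero order_trans by blast
  define s where "s = \<rho> / (C + 1)"
  have s: "0 < s" using assms C0 by (simp add: s_def)
  define \<psi> where "\<psi> i t = s * (1 / s) ^ i * \<phi> i (t / s)" for i t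
  show thesis
  proof (rule that[of "\<delta> * s" "(\<Sum>i\<le>k. s * (1 / s) ^ i) * C" \<psi>])
    show "0 < \<delta> * s" using d s by simp
    show "0 \<le> (\<Sum>i\<le>k. s * (1 / s) ^ i) * C" using s C0 by (simp add: sum_nonneg)
    show "(\<psi> i has_real_derivative \<psi> (Suc i) t) (at t)" if "i < k" for i t
    proof -
      have "((\<lambda>t. t / s) has_real_derivative 1 / s) (at t)" using s by (auto intro!: derivative_eq_intros)
      from DERIV_cmult[OF DERIV_chain'[OF this D[OF that]], of "s * (1 / s) ^ i"]
      show ?thesis using s by (simp add: \<psi>_def[abs_def] mult_ac)
    qed
    show "\<bar>\<psi> i t\<bar> \<le> (\<Sum>i\<le>k. s * (1 / s) ^ i) * C" if "i \<le> k" for i t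
    proof -
      have "s * (1 / s) ^ i \<le> (\<Sum>i\<le>k. s * (1 / s) ^ i)"
        by (rule member_le_sum[where f = "\<lambda>i. s * (1 / s) ^ i"]) (use that s in auto)
      from mult_mono[OF this C[OF that]] show ?thesis
        using s by (simp add: \<psi>_def abs_mult sum_nonneg)
    qed
    show "\<bar>\<psi> 0 t\<bar> \<le> \<rho>" for t
    proof -
      have "\<bar>\<psi> 0 t\<bar> \<le> s * C" using C[of 0 "t / s"] s by (simp add: \<psi>_def abs_mult)
      also have "\<dots> \<le> s * (C + 1)" using s by simp
      also have "\<dots> = \<rho>" using C0 by (simp add: s_def)
      finally show ?thesis .
    qed
    show "\<psi> 0 t = t" if "\<bar>t\<bar> < \<delta> * s" for t
      using id[of "t / s"] that s by (simp add: \<psi>_def field_simps)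
  qed
qed

section \<open>Superposition operators\<close>

definition superpose ::
  "(nat \<Rightarrow> real \<Rightarrow> real) \<Rightarrow> ('m::finite, real ^ 'n) linf list \<Rightarrow> ('m, real ^ 'n) linf \<Rightarrow> ('m, real ^ 'n) linf" where
  "superpose \<phi> vs x = Bcontfun (\<lambda>i. \<chi> c. \<phi> (length vs) (apply_bcontfun x i $ c) * prod_list (map (\<lambda>v. apply_bcontfun v i $ c) vs))"

lemma norm_vec_le: "(\<And>c. \<bar>x $ c\<bar> \<le> K) \<Longrightarrow> norm (x :: real ^ 'n) \<le> real CARD('n) * K"
  by (rule order_trans[OF norm_le_l1_cart sum_bounded_above]) simp

lemma abs_prod_list_le: "\<bar>prod_list (map (\<lambda>v. apply_bcontfun v i $ c) vs)\<bar> \<le> prod_list (map norm vs)"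
proof (induction vs)
  case (Cons v vs)
  have "\<bar>apply_bcontfun v i $ c\<bar> \<le> norm v" using component_le_norm_cart norm_bounded order_trans by blast
  from mult_mono[OF this Cons] show ?case by (simp add: abs_mult)
qed simp

text \<open>Bounds are required one order beyond the class \<open>r\<close>. They make the
  derivatives up to order \<open>r\<close> Lipschitz: infinitely many sites move at once, so the
  Taylor estimates must be uniform in the real argument.\<close>

locale truncation =
  fixes \<phi> :: "nat \<Rightarrow> real \<Rightarrow> real" and C :: real and r :: nat
  assumes C: "0 \<le> C" and deriv: "\<And>i t. i \<le> r \<Longrightarrow> (\<phi> i has_real_derivative \<phi> (Suc i) t) (at t)"
    and bound: "\<And>i t. i \<le> Suc r \<Longrightarrow> \<bar>\<phi> i t\<bar> \<le> C"
begin

lemma lipschitz: "i \<le> r \<Longrightarrow> \<bar>\<phi> i s - \<phi> i t\<bar> \<le> C * \<bar>s - t\<bar>"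
  using field_differentiable_bound[of UNIV "\<phi> i" "\<phi> (Suc i)" C s t] deriv bound by auto

lemma remainder:
  assumes "Suc i \<le> r"
  shows "\<bar>\<phi> i s - \<phi> i t - \<phi> (Suc i) t * (s - t)\<bar> \<le> C * \<bar>s - t\<bar> * \<bar>s - t\<bar>"
proof -
  let ?S = "{min s t..max s t}"
  have "norm ((\<phi> i s - \<phi> (Suc i) t * s) - (\<phi> i t - \<phi> (Suc i) t * t)) \<le> C * \<bar>s - t\<bar> * norm (s - t)"
  proof (rule field_differentiable_bound[of ?S "\<lambda>u. \<phi> i u - \<phi> (Suc i) t * u" "\<lambda>u. \<phi> (Suc i) u - \<phi> (Suc i) t"])
    fix u assume u: "u \<in> ?S"
    show "((\<lambda>u. \<phi> i u - \<phi> (Suc i) t * u) has_field_derivative \<phi> (Suc i) u - \<phi> (Suc i) t) (at u within ?S)"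
      by (rule derivative_eq_intros DERIV_subset[OF deriv] refl subset_UNIV)+ (use assms in simp_all)
    have "\<bar>\<phi> (Suc i) u - \<phi> (Suc i) t\<bar> \<le> C * \<bar>u - t\<bar>" by (rule lipschitz[OF assms])
    also have "\<dots> \<le> C * \<bar>s - t\<bar>" using u C by (intro mult_left_mono) auto
    finally show "norm (\<phi> (Suc i) u - \<phi> (Suc i) t) \<le> C * \<bar>s - t\<bar>" by simp
  qed auto
  then show ?thesis by (simp add: algebra_simps)
qed

lemma superpose_apply:
  fixes x :: "('m::finite, real ^ 'n) linf"
  assumes vs: "length vs \<le> Suc r"
  shows "apply_bcontfun (superpose \<phi> vs x) i $ c =
    \<phi> (length vs) (apply_bcontfun x i $ c) * prod_list (map (\<lambda>v. apply_bcontfun v i $ c) vs)"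
proof -
  have "norm (\<chi> c. \<phi> (length vs) (apply_bcontfun x i $ c) * prod_list (map (\<lambda>v. apply_bcontfun v i $ c) vs) :: real ^ 'n)
      \<le> real CARD('n) * (C * prod_list (map norm vs))" for i
    using C bound[OF vs] abs_prod_list_le by (intro norm_vec_le) (auto simp: abs_mult intro!: mult_mono)
  then show ?thesis
    unfolding superpose_def by (subst apply_bcontfun_of_bounded) (auto simp: bounded_iff)
qed

text \<open>Increments and Taylor remainders of a superposition share this form with its values: in
  each component a scalar times the product of the directions.\<close>

lemma norm_superpose_combination:
  fixes f :: "('m::finite, real ^ 'n) linf"
  assumes "\<And>i c. \<exists>a. apply_bcontfun f i $ c = a * prod_list (map (\<lambda>v. apply_bcontfun v i $ c) vs) \<and> \<bar>a\<bar> \<le> K"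
  shows "norm f \<le> real CARD('n) * (K * prod_list (map norm vs))"
proof (rule norm_bound, rule norm_vec_le)
  fix i c
  obtain a where a: "apply_bcontfun f i $ c = a * prod_list (map (\<lambda>v. apply_bcontfun v i $ c) vs)" "\<bar>a\<bar> \<le> K"
    using assms by blast
  show "\<bar>apply_bcontfun f i $ c\<bar> \<le> K * prod_list (map norm vs)"
    unfolding a(1) abs_mult using a(2) abs_prod_list_le by (intro mult_mono) auto
qed

lemma component_le: "\<bar>apply_bcontfun y i $ c - apply_bcontfun x i $ c\<bar> \<le> norm (y - x)"
  using order_trans[OF component_le_norm_cart norm_bounded, of "y - x" i c] by simp

lemma norm_superpose:
  fixes x :: "('m::finite, real ^ 'n) linf"
  shows "length vs \<le> Suc r \<Longrightarrow> norm (superpose \<phi> vs x) \<le> real CARD('n) * (C * prod_list (map norm vs))"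
  using superpose_apply bound by (intro norm_superpose_combination) blast

lemma superpose_has_derivative:
  fixes x :: "('m::finite, real ^ 'n) linf"
  assumes vs: "length vs < r"
  shows "(superpose \<phi> vs has_derivative (\<lambda>h. superpose \<phi> (h # vs) x)) (at x)"
  unfolding has_derivative_at_alt
proof (intro conjI allI impI)
  let ?P = "prod_list (map norm vs)"
  have P: "0 \<le> ?P" by (rule prod_list_norm_nonneg)
  show "bounded_linear (\<lambda>h. superpose \<phi> (h # vs) x)"
  proof (rule bounded_linear_intro[where K = "real CARD('n) * (C * ?P)"])
    show "norm (superpose \<phi> (h # vs) x) \<le> norm h * (real CARD('n) * (C * ?P))" for h
      using norm_superpose[of "h # vs" x] vs by (simp add: mult_ac)
  qed (rule bcontfun_eqI; use vs in \<open>simp add: vec_eq_iff superpose_apply algebra_simps\<close>)+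
  fix e :: real assume e: "0 < e"
  define K where "K = real CARD('n) * (C * ?P)"
  have K: "0 \<le> K" using C P by (simp add: K_def)
  show "\<exists>d>0. \<forall>y. norm (y - x) < d \<longrightarrow> norm (superpose \<phi> vs y - superpose \<phi> vs x - superpose \<phi> ((y - x) # vs) x) \<le> e * norm (y - x)"
  proof (intro exI[of _ "e / (K + 1)"] conjI allI impI)
    show "0 < e / (K + 1)" using e K by simp
    fix y :: "('m, real ^ 'n) linf" assume y: "norm (y - x) < e / (K + 1)"
    have "norm (superpose \<phi> vs y - superpose \<phi> vs x - superpose \<phi> ((y - x) # vs) x) \<le> real CARD('n) * ((C * norm (y - x) * norm (y - x)) * ?P)"
    proof (rule norm_superpose_combination)
      fix i c
      let ?s = "apply_bcontfun y i $ c" and ?t = "apply_bcontfun x i $ c"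
      have "\<bar>\<phi> (length vs) ?s - \<phi> (length vs) ?t - \<phi> (Suc (length vs)) ?t * (?s - ?t)\<bar> \<le> C * \<bar>?s - ?t\<bar> * \<bar>?s - ?t\<bar>"
        using vs by (intro remainder) simp
      also have "\<dots> \<le> C * norm (y - x) * norm (y - x)"
        using component_le[of y i c x] C by (intro mult_mono mult_left_mono) auto
      finally show "\<exists>a. apply_bcontfun (superpose \<phi> vs y - superpose \<phi> vs x - superpose \<phi> ((y - x) # vs) x) i $ c
          = a * prod_list (map (\<lambda>v. apply_bcontfun v i $ c) vs) \<and> \<bar>a\<bar> \<le> C * norm (y - x) * norm (y - x)"
        using vs by (intro exI[of _ "\<phi> (length vs) ?s - \<phi> (length vs) ?t - \<phi> (Suc (length vs)) ?t * (?s - ?t)"])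
          (simp add: superpose_apply algebra_simps)
    qed
    also have "\<dots> = K * norm (y - x) * norm (y - x)" by (simp add: K_def mult_ac)
    also have "\<dots> \<le> e * norm (y - x)"
    proof (rule mult_right_mono)
      have "K * norm (y - x) \<le> (K + 1) * norm (y - x)" by (simp add: mult_right_mono)
      also have "\<dots> \<le> e" using y K by (simp add: field_simps)
      finally show "K * norm (y - x) \<le> e" .
    qed simp
    finally show "norm (superpose \<phi> vs y - superpose \<phi> vs x - superpose \<phi> ((y - x) # vs) x) \<le> e * norm (y - x)" .
  qed
qed

lemma smooth_superpose:
  shows nth_deriv_superpose: "length vs \<le> r \<Longrightarrow> nth_deriv (superpose \<phi> []) vs x = superpose \<phi> vs (x :: ('m::finite, real ^ 'n) linf)"
    and "smooth r UNIV (superpose \<phi> [] :: ('m, real ^ 'n) linf \<Rightarrow> ('m, real ^ 'n) linf)"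
proof -
  show "length vs \<le> r \<Longrightarrow> nth_deriv (superpose \<phi> []) vs x = superpose \<phi> vs x" for vs and x :: "('m::finite, real ^ 'n) linf"
    by (rule smoothI_deriv[of UNIV "superpose \<phi>" _ r]) (auto intro: superpose_has_derivative)
  show "smooth r UNIV (superpose \<phi> [] :: ('m, real ^ 'n) linf \<Rightarrow> ('m, real ^ 'n) linf)"
  proof (rule smoothI(2)[of UNIV "superpose \<phi>"])
    fix x :: "('m, real ^ 'n) linf" and j assume j: "j \<le> r"
    show "\<exists>c. mbounded j (\<lambda>vs. superpose \<phi> vs x) c"
      using norm_superpose[of _ x] j C by (intro exI[of _ "real CARD('n) * C"]) (auto simp: mbounded_def mult.assoc)
    show "eqc j (\<lambda>x vs. superpose \<phi> vs x) x"
    proof (rule eqcI_eventually)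
      fix e :: real assume e: "0 < e"
      define K where "K = real CARD('n) * C"
      have K: "0 \<le> K" using C by (simp add: K_def)
      have "\<forall>\<^sub>F y in nhds x. dist y x < e / (K + 1)" unfolding eventually_nhds_metric using e K by (intro exI[of _ "e / (K + 1)"]) auto
      then show "\<forall>\<^sub>F y in nhds x. \<forall>vs. length vs = j \<longrightarrow> norm (superpose \<phi> vs y - superpose \<phi> vs x) \<le> e * prod_list (map norm vs)"
      proof eventually_elim
        case (elim y)
        show ?case
        proof (intro allI impI)
          fix vs :: "('m, real ^ 'n) linf list" assume vs: "length vs = j"
          have "norm (superpose \<phi> vs y - superpose \<phi> vs x) \<le> real CARD('n) * ((C * norm (y - x)) * prod_list (map norm vs))"
          proof (rule norm_superpose_combination)
            fix i c
            let ?s = "apply_bcontfun y i $ c" and ?t = "apply_bcontfun x i $ c"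
            have "\<bar>\<phi> j ?s - \<phi> j ?t\<bar> \<le> C * norm (y - x)"
              using order_trans[OF lipschitz[OF j] mult_left_mono[OF component_le C]] .
            then show "\<exists>a. apply_bcontfun (superpose \<phi> vs y - superpose \<phi> vs x) i $ c
                = a * prod_list (map (\<lambda>v. apply_bcontfun v i $ c) vs) \<and> \<bar>a\<bar> \<le> C * norm (y - x)"
              using vs j by (intro exI[of _ "\<phi> j ?s - \<phi> j ?t"]) (simp add: superpose_apply algebra_simps)
          qed
          also have "\<dots> = (K * norm (y - x)) * prod_list (map norm vs)" by (simp add: K_def mult_ac)
          also have "\<dots> \<le> e * prod_list (map norm vs)"
          proof (rule mult_right_mono[OF _ prod_list_norm_nonneg])
            have "K * norm (y - x) \<le> (K + 1) * norm (y - x)" by (simp add: mult_right_mono)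
            also have "\<dots> \<le> e" using elim K by (simp add: dist_norm field_simps)
            finally show "K * norm (y - x) \<le> e" .
          qed
          finally show "norm (superpose \<phi> vs y - superpose \<phi> vs x) \<le> e * prod_list (map norm vs)" .
        qed
      qed
    qed
  qed (auto intro: superpose_has_derivative)
qed

text \<open>The derivatives act at each site separately. In the product of the arguments at site
  \<open>i\<close> only a marked factor brings the weight \<open>\<Gamma> (i - l)\<close>, so the
  estimate holds for every index, with a constant independent of \<open>\<Gamma>\<close>.\<close>

lemma superpose_MB:
  fixes x :: "('m::finite, real ^ 'n) linf"
  assumes L: "lattice \<Gamma>" and j: "j \<le> r"
  shows "gauged.MB (lgauge \<Gamma>) j (real CARD('n) * C) (\<lambda>vs. superpose \<phi> vs x)"
proof -
  interpret lattice \<Gamma> by (rule L)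
  let ?w = "\<lambda>q i. case q of None \<Rightarrow> 1 | Some l \<Rightarrow> \<Gamma> (i - l)"
  have w: "0 < ?w q i" for q i using pos by (auto split: option.split)
  have gw: "\<bar>apply_bcontfun u i $ c\<bar> \<le> K * ?w q i" if "gauge (lgauge \<Gamma>) q u K" for q i c K and u :: "('m, real ^ 'n) linf"
    using that order_trans[OF component_le_norm_cart] unfolding gauge_def lgauge_def by fastforce
  have prod: "\<bar>prod_list (map (\<lambda>v. apply_bcontfun v i $ c) (map tv ts))\<bar> \<le> prod_list (map tk ts) * ?w q i"
    if "good ts" "adm q (map tm ts)" for q i c and ts :: "(('m, real ^ 'n) linf \<times> real \<times> (int ^ 'm) option) list"
    using that
  proof (induction ts arbitrary: q)
    case (Cons t ts)
    have gt: "gauge (lgauge \<Gamma>) (tm t) (tv t) (tk t)" and "good ts" using Cons.prems(1) by (cases t; auto simp: good_def)+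
    note IH = Cons.IH[OF \<open>good ts\<close>]
    \<comment> \<open>At most one argument is marked, so the weights of the arguments multiply to
      the weight of \<open>q\<close>; \<open>q'\<close> is what remains of it after the first
      argument.\<close>
    have "\<exists>q'. adm q' (map tm ts) \<and> ?w (tm t) i * ?w q' i = ?w q i"
      using Cons.prems(2) by (auto split: option.split)
    then obtain q' where q': "adm q' (map tm ts)" "?w (tm t) i * ?w q' i = ?w q i" by blast
    have "\<bar>apply_bcontfun (tv t) i $ c\<bar> * \<bar>prod_list (map (\<lambda>v. apply_bcontfun v i $ c) (map tv ts))\<bar>
        \<le> (tk t * ?w (tm t) i) * (prod_list (map tk ts) * ?w q' i)"
      using g_nonneg[OF gt] less_imp_le[OF w] by (intro mult_mono[OF gw[OF gt] IH[OF q'(1)]]) auto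
    also have "\<dots> = tk t * prod_list (map tk ts) * ?w q i" unfolding q'(2)[symmetric] by (simp only: mult_ac)
    finally show ?case by (simp add: abs_mult)
  qed simp
  show ?thesis
  proof (rule MBI)
    show "0 \<le> real CARD('n) * C" using C by simp
    fix ts :: "(('m, real ^ 'n) linf \<times> real \<times> (int ^ 'm) option) list" and q
    assume ts: "length ts = j" "good ts" "adm q (map tm ts)"
    have "0 \<le> prod_list (map tk ts)"
      by (rule prod_list_nonneg) (use ts(2) in \<open>force simp: good_def dest: g_nonneg\<close>)
    moreover have "norm (apply_bcontfun (superpose \<phi> (map tv ts) x) i) \<le> real CARD('n) * (C * (prod_list (map tk ts) * ?w q i))" for i
    proof (rule norm_vec_le)
      fix c
      show "\<bar>apply_bcontfun (superpose \<phi> (map tv ts) x) i $ c\<bar> \<le> C * (prod_list (map tk ts) * ?w q i)"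
        using mult_mono[OF bound[of j "apply_bcontfun x i $ c"] prod[OF ts(2,3), of i c]] ts(1) j C
        by (simp add: superpose_apply abs_mult)
    qed
    ultimately show "gauge (lgauge \<Gamma>) q (superpose \<phi> (map tv ts) x) (real CARD('n) * C * prod_list (map tk ts))"
      using C unfolding gauge_def lgauge_def by (auto simp: mult.assoc)
  qed
qed

end


section \<open>From the spectral hypotheses to the global conjugacy\<close>

theorem theorem2:
  fixes N :: "real ^ 'n \<Rightarrow> real"
    and N\<^sub>C :: "complex ^ 'n \<Rightarrow> real"
    and \<Gamma> :: "int ^ 'm::finite \<Rightarrow> real"
    and U :: "('m, real ^ 'n) linf set"
    and F A :: "('m, real ^ 'n) linf \<Rightarrow> ('m, real ^ 'n) linf"
    and r r\<^sub>0 :: nat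
    and \<alpha> \<beta> \<nu> :: real
  assumes "is_norm N" and "is_complex_norm N\<^sub>C"
    and "decay_function \<Gamma>"
    and "r \<ge> 1"
    and "open U" and "0 \<in> U"
    and "F \<in> C_decay N \<Gamma> r U" and "F 0 = 0"
    and "A = frechet_derivative F (at 0)"
    and "\<alpha> = (INF \<mu>\<in>decay_spectrum N\<^sub>C \<Gamma> A. cmod \<mu>)"
    and "\<beta> = (SUP \<mu>\<in>decay_spectrum N\<^sub>C \<Gamma> A. cmod \<mu>)"
    and "\<nu> = ln \<alpha> / ln \<beta>"
    and "r\<^sub>0 = nat \<lfloor>\<nu>\<rfloor> + 1"
    and H1: "0 \<notin> decay_spectrum N\<^sub>C \<Gamma> A" "decay_spectrum N\<^sub>C \<Gamma> A \<subseteq> ball 0 1"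
    and H2: "\<And>j. 2 \<le> j \<Longrightarrow> j \<le> r\<^sub>0 \<Longrightarrow>
               decay_spectrum N\<^sub>C \<Gamma> A \<inter> set_prods (decay_spectrum N\<^sub>C \<Gamma> A) j = {}"
    and "r \<ge> r\<^sub>0"
  shows "\<exists>R. R \<in> C_decay N \<Gamma> r UNIV \<and> R 0 = 0 \<and> (R has_derivative (\<lambda>v. v)) (at 0) \<and>
           (\<exists>U\<^sub>1. open U\<^sub>1 \<and> 0 \<in> U\<^sub>1 \<and> U\<^sub>1 \<subseteq> U \<and> (\<forall>x\<in>U\<^sub>1. R (F x) = A (R x)))"
proof -
  let ?S = "decay_spectrum N\<^sub>C \<Gamma> A"
  have lat: "lattice \<Gamma>" using assms(3) by (rule lattice.intro)
  obtain c C where cC: "0 < c" "0 < C" "\<forall>v. c * norm v \<le> N v \<and> N v \<le> C * norm v"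
    using is_norm_equivalent[OF assms(1)] by blast
  interpret lattice_norm \<Gamma> N c C
    using cC lat by (simp add: lattice_norm_def lattice_norm_axioms_def)
  have "is_norm N\<^sub>C" using assms(2) by (simp add: is_complex_norm_def)
  from is_norm_equivalent[OF this] obtain c' C' where "0 < c'" "0 < C'" "\<forall>v. c' * norm v \<le> N\<^sub>C v \<and> N\<^sub>C v \<le> C' * norm v"
    by blast
  then have NC: "lattice_norm \<Gamma> N\<^sub>C c' C'" using lat by (simp add: lattice_norm_def lattice_norm_axioms_def)
  note F = C_decay_imp[OF assms(7) assms(5)]
  have A_eq: "nth_deriv F [h] 0 = A h" for h by (simp add: nth_deriv.simps(2) assms(9))
  have "linear A"
    using has_derivative_linear[OF smooth_deriv0[OF F(1) assms(6,4)]] unfolding A_eq .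
  obtain KA where "MB 1 KA (D_at F 0)" using F(2)[of 1] assms(4,6) by auto
  then have "MB 1 KA (\<lambda>vs. A (hd vs))" by (rule MB_cong) (auto simp: length_Suc_conv A_eq)
  then have A: "dec KA A" using \<open>linear A\<close> by (rule MB_imp_dec)
  have S: "\<mu> \<in> ?S \<longleftrightarrow> \<not> Res A \<mu>" for \<mu> by (rule decay_spectrum_iff_not_Res[OF NC A])
  \<comment> \<open>\<open>quad A 0\<close> is the square of \<open>A\<close>, so \<open>Q\<close>
    inverts this square and \<open>A\<close> composed with \<open>Q\<close> is the inverse of
    \<open>A\<close>.\<close>
  obtain K Q where Q: "dec K Q" "\<And>u. Q (A (A u)) = u" "\<And>u. A (A (Q u)) = u"
  proof -
    have "Res A 0" using H1(1) S by blast
    then show thesis using that unfolding Res_def quad_def by auto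
  qed
  have QA: "Q (A u) = A (Q u)" for u using Q(2)[of "A (Q u)"] by (simp add: Q(3))
  have "compact ?S"
  proof -
    have "?S = - {\<mu>. Res A \<mu>}" using S by auto
    then have "closed ?S" using open_Res[OF A] by (simp add: closed_def)
    moreover have "bounded ?S" using H1(2) bounded_ball bounded_subset by blast
    ultimately show ?thesis by (simp add: compact_eq_bounded_closed)
  qed
  \<comment> \<open>The space is nonzero, so the spectrum is nonempty; being compact, it attains
    \<open>\<alpha>\<close> and \<open>\<beta>\<close>.\<close>
  have "single 0 1 \<noteq> (0 :: ('m, real ^ 'n) linf)"
  proof
    assume "single 0 1 = (0 :: ('m, real ^ 'n) linf)"
    then have "apply_bcontfun (single 0 1 :: ('m, real ^ 'n) linf) 0 = 0" by simp
    then show False by (simp add: single_apply)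
  qed
  from spectrum_nonempty[OF A this] have "?S \<noteq> {}" using S by blast
  have cont: "continuous_on ?S cmod" by (intro continuous_intros)
  obtain \<mu>\<^sub>0 where \<mu>\<^sub>0: "\<mu>\<^sub>0 \<in> ?S" "\<And>\<mu>. \<mu> \<in> ?S \<Longrightarrow> cmod \<mu>\<^sub>0 \<le> cmod \<mu>"
    using continuous_attains_inf[OF \<open>compact ?S\<close> \<open>?S \<noteq> {}\<close> cont] by blast
  obtain \<mu>\<^sub>1 where \<mu>\<^sub>1: "\<mu>\<^sub>1 \<in> ?S" "\<And>\<mu>. \<mu> \<in> ?S \<Longrightarrow> cmod \<mu> \<le> cmod \<mu>\<^sub>1"
    using continuous_attains_sup[OF \<open>compact ?S\<close> \<open>?S \<noteq> {}\<close> cont] by blast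
  have \<alpha>: "\<alpha> = cmod \<mu>\<^sub>0" unfolding assms(10) by (rule cInf_eq_minimum) (use \<mu>\<^sub>0 in auto)
  have \<beta>: "\<beta> = cmod \<mu>\<^sub>1" unfolding assms(11) by (rule cSup_eq_maximum) (use \<mu>\<^sub>1 in auto)
  have "0 < \<alpha>" using \<mu>\<^sub>0(1) H1(1) by (auto simp: \<alpha>)
  have "\<alpha> \<le> \<beta>" using \<mu>\<^sub>0(2)[OF \<mu>\<^sub>1(1)] by (simp add: \<alpha> \<beta>)
  have "\<beta> < 1" using \<mu>\<^sub>1(1) H1(2) by (auto simp: \<beta>)
  have ln: "ln \<alpha> \<le> ln \<beta>" "ln \<beta> < 0" using \<open>0 < \<alpha>\<close> \<open>\<alpha> \<le> \<beta>\<close> \<open>\<beta> < 1\<close> by auto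
  \<comment> \<open>Both logarithms are negative and \<open>ln \<alpha> \<le> ln \<beta>\<close>, so
    the quotient is at least 1 and its integer part plus one is at least 2.\<close>
  have "1 \<le> \<nu>" unfolding assms(12) using ln by (simp add: neg_le_divide_eq)
  then have r0: "2 \<le> r\<^sub>0" "\<nu> < real r\<^sub>0" unfolding assms(13) by linarith+
  have "\<beta> ^ r\<^sub>0 < \<alpha>"
  proof -
    have "real r\<^sub>0 * ln \<beta> < \<nu> * ln \<beta>" using r0(2) ln(2) by (rule mult_strict_right_mono_neg)
    also have "\<dots> = ln \<alpha>" using ln(2) by (simp add: assms(12))
    finally have "ln (\<beta> ^ r\<^sub>0) < ln \<alpha>" using \<open>0 < \<alpha>\<close> \<open>\<alpha> \<le> \<beta>\<close> by (simp add: ln_realpow)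
    then show ?thesis using \<open>0 < \<alpha>\<close> \<open>\<alpha> \<le> \<beta>\<close> by simp
  qed
  have "\<forall>\<^sub>F b in at_right \<beta>. b ^ r\<^sub>0 < \<alpha>"
    by (rule order_tendstoD(2)[OF _ \<open>\<beta> ^ r\<^sub>0 < \<alpha>\<close>]) (intro tendsto_intros)
  moreover have "\<forall>\<^sub>F b in at_right \<beta>. b \<in> {\<beta><..<1}" by (rule eventually_at_right_real[OF \<open>\<beta> < 1\<close>])
  ultimately have "\<forall>\<^sub>F b in at_right \<beta>. b ^ r\<^sub>0 < \<alpha> \<and> b \<in> {\<beta><..<1}" by (rule eventually_conj)
  then obtain b0 where b0: "b0 ^ r\<^sub>0 < \<alpha>" "\<beta> < b0" "b0 < 1"
    using eventually_happens[of _ "at_right \<beta>"] by (auto simp: trivial_limit_at_right_real)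
  \<comment> \<open>The strict inequality leaves room for \<open>b0\<close> above
    \<open>\<beta>\<close> and \<open>a0\<close> below \<open>\<alpha>\<close>. The spectrum then
    lies strictly between the circles of radius \<open>a0\<close> and \<open>b0\<close>, so the
    resolvent conditions hold on the closed regions.\<close>
  obtain a0 where a0: "b0 ^ r\<^sub>0 < a0" "a0 < \<alpha>" using dense[OF b0(1)] by blast
  have "0 < b0 ^ r\<^sub>0" using \<open>0 < \<alpha>\<close> \<open>\<alpha> \<le> \<beta>\<close> b0(2) by simp
  then have "0 < a0" using a0(1) by simp
  have "a0 \<le> b0" using a0(2) \<open>\<alpha> \<le> \<beta>\<close> b0(2) by simp
  have res1: "Res A \<mu>" if "b0 \<le> cmod \<mu>" for \<mu> using \<mu>\<^sub>1(2)[of \<mu>] that b0(2) S by (force simp: \<beta>)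
  have res2: "Res A \<mu>" if "cmod \<mu> \<le> a0" for \<mu> using \<mu>\<^sub>0(2)[of \<mu>] that a0(2) S by (force simp: \<alpha>)
  have nonres: "Res A z0 \<or> (\<exists>z\<in>set zs. Res A z)"
    if "2 \<le> j" "j < r\<^sub>0" "length zs = j" "z0 = prod_list zs" for j z0 zs
  proof (rule ccontr)
    assume "\<not> ?thesis"
    then have "z0 \<in> ?S" "set zs \<subseteq> ?S" using S by auto
    then have "z0 \<in> ?S \<inter> set_prods ?S j" using that(3,4) by (auto simp: set_prods_def)
    then show False using H2[of j] that(1,2) by simp
  qed
  have Ai: "dec (KA * K) (\<lambda>x. A (Q x))" by (rule dec_compose[OF A Q(1)])
  have AQA: "A (Q (A x)) = x" for x by (simp add: Q(3) QA)
  have "\<exists>V P. open V \<and> 0 \<in> V \<and> V \<subseteq> U \<and> smooth r V P \<and> P 0 = 0 \<and> (\<forall>h. nth_deriv P [h] 0 = h) \<and>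
     (\<forall>s\<le>r. \<exists>K. \<forall>x\<in>V. MB s K (D_at P x)) \<and> (\<forall>x\<in>V. F x \<in> V \<and> P (F x) = A (P x))"
    by (rule linearize_local[where KA = KA and KAi = "KA * K" and Ai = "\<lambda>x. A (Q x)" and q = r\<^sub>0, OF A Ai Q(3) AQA
          \<open>0 < a0\<close> \<open>a0 \<le> b0\<close> b0(3) a0(1) res1 res2 nonres r0(1) assms(17) F(1) assms(6,8) A_eq F(2)]; assumption)
  then obtain V P where V: "open V" "0 \<in> V" "V \<subseteq> U" and P: "smooth r V P" "P 0 = 0" "\<forall>h. nth_deriv P [h] 0 = h"
      "\<forall>s\<le>r. \<exists>K. \<forall>x\<in>V. MB s K (D_at P x)" and conj: "\<forall>x\<in>V. F x \<in> V \<and> P (F x) = A (P x)"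
    by blast
  obtain e where e: "0 < e" "ball 0 e \<subseteq> V" using V(1,2) open_contains_ball by blast
  \<comment> \<open>The norm on \<open>real ^ 'n\<close> is at most \<open>CARD('n)\<close> times
    the largest component, so truncating the components at \<open>\<rho>\<close> keeps the family in
    the ball of radius \<open>e\<close>.\<close>
  define \<rho> where "\<rho> = e / (2 * real CARD('n))"
  have "0 < \<rho>" using e(1) by (simp add: \<rho>_def)
  obtain \<phi> B \<delta> where \<delta>: "0 < \<delta>" and B: "0 \<le> B" and \<phi>: "\<And>i t. i < Suc r \<Longrightarrow> (\<phi> i has_real_derivative \<phi> (Suc i) t) (at t)"
    "\<And>i t. i \<le> Suc r \<Longrightarrow> \<bar>\<phi> i t\<bar> \<le> B" "\<And>t. \<bar>\<phi> 0 t\<bar> \<le> \<rho>" "\<And>t. \<bar>t\<bar> < \<delta> \<Longrightarrow> \<phi> 0 t = t"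
    by (rule small_smooth_truncation[OF \<open>0 < \<rho>\<close>, of "Suc r"]) (rule that; assumption)
  interpret t: truncation \<phi> B r by standard (use B \<phi> in auto)
  define cut :: "('m, real ^ 'n) linf \<Rightarrow> ('m, real ^ 'n) linf" where "cut = superpose \<phi> []"
  have cut_apply: "apply_bcontfun (cut x) i $ k = \<phi> 0 (apply_bcontfun x i $ k)" for x i k
    by (simp add: cut_def t.superpose_apply)
  have cut_V: "cut x \<in> V" for x
  proof -
    have "norm (cut x) \<le> real CARD('n) * \<rho>"
      by (rule norm_bound, rule norm_vec_le) (simp add: cut_apply \<phi>(3))
    also have "\<dots> = e / 2" by (simp add: \<rho>_def)
    finally show ?thesis using e by auto
  qed
  have cut_id: "cut x = x" if "norm x < \<delta>" for x
  proof (rule bcontfun_eqI, unfold vec_eq_iff, intro allI)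
    fix i k
    have "\<bar>apply_bcontfun x i $ k\<bar> \<le> norm x" using component_le_norm_cart norm_bounded order_trans by blast
    then show "apply_bcontfun (cut x) i $ k = apply_bcontfun x i $ k" using that by (simp add: cut_apply \<phi>(4))
  qed
  have cut: "smooth r UNIV cut" unfolding cut_def by (rule t.smooth_superpose(2))
  have cut_MB: "MB s (real CARD('n) * B) (D_at cut x)" if "s \<le> r" for s x
    by (rule MB_cong[OF t.superpose_MB[OF lat that]]) (use that in \<open>simp add: cut_def t.nth_deriv_superpose\<close>)
  have "\<forall>s. \<exists>K. s \<le> r \<longrightarrow> (\<forall>x\<in>V. MB s K (D_at P x))" using P(4) by blast
  then obtain KP where KP: "\<And>s x. s \<le> r \<Longrightarrow> x \<in> V \<Longrightarrow> MB s (KP s) (D_at P x)" by metis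
  \<comment> \<open>\<open>cut\<close> maps the whole space into \<open>V\<close> and is the
    identity near 0, so \<open>R\<close> is globally defined and has the germ of \<open>P\<close> at
    0.\<close>
  define R where "R x = P (cut x)" for x
  note comp = smooth_compose[OF P(1) cut cut_V]
  have "smooth r UNIV R" unfolding R_def[abs_def] by (rule comp(2))
  moreover have "\<exists>K. \<forall>x\<in>UNIV. MB s K (D_at R x)" if s: "s \<le> r" for s
  proof (intro exI ballI)
    fix x
    show "MB s (\<Sum>\<pi>\<leftarrow>parts [0..<s]. KP (length \<pi>) * prod_list (map (\<lambda>b. real CARD('n) * B) \<pi>)) (D_at R x)"
      by (rule MB_cong[OF MB_fdb[of s KP P cut x "\<lambda>_. real CARD('n) * B"]])
        (use s in \<open>auto simp: R_def[abs_def] comp(1) intro: KP cut_V cut_MB\<close>)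
  qed
  ultimately have "R \<in> C_decay N \<Gamma> r UNIV" by (rule C_decayI)
  moreover have "R 0 = 0" using cut_id[of 0] \<delta> P(2) by (simp add: R_def)
  moreover have "(R has_derivative (\<lambda>v. v)) (at 0)"
  proof (rule has_derivative_transform_within_open[of P _ _ _ "ball 0 \<delta>"])
    show "(P has_derivative (\<lambda>v. v)) (at 0)" using smooth_deriv0[OF P(1) V(2) assms(4)] by (simp add: P(3))
  qed (use \<delta> cut_id in \<open>auto simp: R_def\<close>)
  moreover have "\<exists>U\<^sub>1. open U\<^sub>1 \<and> 0 \<in> U\<^sub>1 \<and> U\<^sub>1 \<subseteq> U \<and> (\<forall>x\<in>U\<^sub>1. R (F x) = A (R x))"
  proof -
    have "(F \<longlongrightarrow> F 0) (nhds 0)"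
      using has_derivative_continuous[OF smooth_deriv0[OF F(1) assms(6,4)]] by (simp add: tendsto_at_iff_tendsto_nhds continuous_at)
    from order_tendstoD(2)[OF tendsto_norm[OF this], of \<delta>] obtain W where W: "open W" "0 \<in> W" "\<And>x. x \<in> W \<Longrightarrow> norm (F x) < \<delta>"
      using \<delta> by (auto simp: eventually_nhds assms(8))
    \<comment> \<open>The radius \<open>\<delta>\<close> is imposed on \<open>x\<close> and on
      \<open>F x\<close>, since \<open>R\<close> is evaluated at both and has to agree with
      \<open>P\<close> there.\<close>
    then show ?thesis
      using V \<delta> conj cut_id by (intro exI[of _ "W \<inter> V \<inter> ball 0 \<delta>"]) (auto simp: R_def)
  qed
  ultimately show ?thesis by blast
qed

end
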